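(* Let $\Omega\subset\mathbb{R}^n$ ($n\le 3$) be a bounded Lipschitz domain and let $d_1,d_2,d_3,a_1,a_3,b_1,b_2,c_2,c_3,F,G_1,G_2$ be positive constants. Let $\{S(t)\}_{t\ge0}$ be the Oregonator semiflow on $H_+$ generated by $$\frac{\partial u}{\partial t}=d_1\Delta u+a_1u+b_1v-Fu^2-G_1uv,\qquad \frac{\partial v}{\partial t}=d_2\Delta v-b_2v+c_2w-G_2uv,\qquad \frac{\partial w}{\partial t}=d_3\Delta w+a_3u-c_3w$$ on $\Omega$ with $u=v=w=0$ on $\partial\Omega$, and let $\mathscr{A}$ be its global attractor in $H_+$. Then $\mathscr{A}$ is an $(H_+,E_+)$ global attractor for $\{S(t)\}_{t\ge0}$.
   Context: Spaces: $H=[L^2(\Omega)]^3$ with norm $\|\cdot\|$, $E=[H_0^1(\Omega)]^3$ with norm $\|\varphi\|_E=\|\nabla\varphi\|$, $E^*=[H^{-1}(\Omega)]^3$, with $(\cdot,\cdot)$ the $(E^*,E)$ dual product. $H_+=\{\varphi\in H:\varphi_i\ge0 \text{ a.e. in }\Omega,\ i=1,2,3\}$ and $E_+=\{\varphi\in E:\varphi_i\ge0 \text{ a.e. in }\Omega,\ i=1,2,3\}$. Operators: $A=\mathrm{diag}(d_1\Delta,d_2\Delta,d_3\Delta)$ with Dirichlet conditions, regarded also as a bounded operator $E\to E^*$, and $f:E\to H$, $f(u,v,w)=(a_1u+b_1v-Fu^2-G_1uv,\,-b_2v+c_2w-G_2uv,\,a_3u-c_3w)$. The system is written as $\frac{dg}{dt}=Ag+f(g)$,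 $g(0)=g_0$, with $g=(u,v,w)$. Weak solution on $[0,\tau]$: a function $g\in L^2(0,\tau;E)\cap C_w([0,\tau];H)$ ($C_w$: weakly continuous) with $g(0)=g_0$ such that for every $\phi\in E$, $\frac{d}{dt}(g,\phi)=(Ag,\phi)+(f(g),\phi)$ for a.e. $t\in[0,\tau]$ (time derivative in the distributional sense). A global weak solution is a function on $[0,\infty)$ that is a weak solution on every $[0,\tau]$. Oregonator semiflow: for every $g_0\in H_+$ there is a unique global weak solution $g(t;g_0)$, and it stays in $H_+$; $S(t)g_0=g(t;g_0)$, $t\ge0$. Global attractor in $H_+$ for $\{S(t)\}_{t\ge0}$: a nonempty compact (in the $H$-norm) subset $\mathscr{A}\subset H_+$ with $S(t)\mathscr{A}=\mathscr{A}$ for all $t\ge0$, and such that for every bounded $B\subset H_+$, $\sup_{x\in B}\inf_{y\in\mathscr{A}}\|S(t)x-y\|\to0$ as $t\to\infty$. Such a set exists for the Oregonator semiflow and is unique. $(H_+,E_+)$ global attractor: a subset $\mathcal{A}\subset E_+$ such that (i) $\mathcal{A}$ is nonempty, compact in $E_+$ (in the $E$-norm) and invariant, i.e. $S(t)\mathcal{A}=\mathcal{A}$ for all $t\ge0$; (ii) $\mathcal{A}$ attracts every bounded set $B\subset H_+$ (bounded in the $H$-norm) with respect to the $E$-norm: there is a time $\tau=\tau(B)$ such that $S(t)B\subset E_+$ for $t>\tau$, and $\sup_{x\in B}\inf_{y\in\mathcal{A}}\|S(t)x-y\|_E\to0$ as $t\to\infty$. *)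

theory Defs
  imports "HOL-Analysis.Analysis"
begin

section \<open>The Hilbert space of square-integrable functions\<close>

definition square_integrable :: "('a::euclidean_space \<Rightarrow> real) \<Rightarrow> bool" where
  "square_integrable f \<longleftrightarrow>
     f \<in> borel_measurable lebesgue \<and> integrable lebesgue (\<lambda>x. (f x)\<^sup>2)"

definition l2_rel :: "('a::euclidean_space \<Rightarrow> real) \<Rightarrow> ('a \<Rightarrow> real) \<Rightarrow> bool" where
  "l2_rel f g \<longleftrightarrow> square_integrable f \<and> square_integrable g \<and> (AE x in lebesgue. f x = g x)"

lemma square_integrable_mult:
  assumes "square_integrable f" "square_integrable g"
  shows "integrable lebesgue (\<lambda>x. f x * g x)"
proof (rule Bochner_Integration.integrable_bound)
  show "integrable lebesgue (\<lambda>x. (f x)\<^sup>2 + (g x)\<^sup>2)"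
    using assms by (auto simp: square_integrable_def)
  show "(\<lambda>x. f x * g x) \<in> borel_measurable lebesgue"
    using assms by (auto simp: square_integrable_def)
  have "\<bar>a * b\<bar> \<le> a\<^sup>2 + b\<^sup>2" for a b :: real
    using sum_squares_bound[of "\<bar>a\<bar>" "\<bar>b\<bar>"] mult_nonneg_nonneg[of "\<bar>a\<bar>" "\<bar>b\<bar>"]
    unfolding abs_mult power2_abs by linarith
  then show "AE x in lebesgue. norm (f x * g x) \<le> norm ((f x)\<^sup>2 + (g x)\<^sup>2)"
    by auto
qed

lemma square_integrable_add:
  assumes "square_integrable f" "square_integrable g"
  shows "square_integrable (\<lambda>x. f x + g x)"
proof -
  have "(\<lambda>x. (f x + g x)\<^sup>2) = (\<lambda>x. (f x)\<^sup>2 + (g x)\<^sup>2 + 2 * (f x * g x))"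
    by (auto simp: power2_sum)
  then show ?thesis
    using assms square_integrable_mult[OF assms] by (auto simp: square_integrable_def)
qed

lemma square_integrable_cmult:
  "square_integrable f \<Longrightarrow> square_integrable (\<lambda>x. c * f x)"
  by (auto simp: square_integrable_def power_mult_distrib)

lemma square_integrable_diff:
  "square_integrable f \<Longrightarrow> square_integrable g \<Longrightarrow> square_integrable (\<lambda>x. f x - g x)"
  using square_integrable_add[of f "\<lambda>x. - 1 * g x"] square_integrable_cmult[of g "- 1"] by simp

lemma square_integrable_zero: "square_integrable (\<lambda>x. 0)"
  by (simp add: square_integrable_def)

quotient_type (overloaded) 'a l2 = "'a::euclidean_space \<Rightarrow> real" / partial: l2_rel
  morphisms l2_fun l2_abs
proof (rule part_equivpI)
  show "\<exists>f. l2_rel f f"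
    by (rule exI[of _ "\<lambda>x. 0"]) (simp add: l2_rel_def square_integrable_zero)
  show "symp (l2_rel :: ('a \<Rightarrow> real) \<Rightarrow> _)"
    by (auto simp: symp_def l2_rel_def)
  show "transp (l2_rel :: ('a \<Rightarrow> real) \<Rightarrow> _)"
    by (auto simp: transp_def l2_rel_def)
qed

lemma l2_rel_l2_fun: "l2_rel (l2_fun u) (l2_fun u)"
  by (rule Quotient3_rep_reflp[OF Quotient3_l2])

lemma l2_abs_l2_fun: "l2_abs (l2_fun u) = u"
  by (rule Quotient3_abs_rep[OF Quotient3_l2])

lemma square_integrable_l2_fun: "square_integrable (l2_fun u)"
  using l2_rel_l2_fun[of u] by (simp add: l2_rel_def)

lemma l2_fun_l2_abs:
  "square_integrable f \<Longrightarrow> AE x in lebesgue. l2_fun (l2_abs f) x = f x"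
  using rep_abs_rsp[OF Quotient3_l2, of f f] by (auto simp: l2_rel_def)

instantiation l2 :: (euclidean_space) real_inner
begin

lift_definition zero_l2 :: "'a l2" is "\<lambda>x. 0"
  by (simp add: l2_rel_def square_integrable_zero)

lift_definition plus_l2 :: "'a l2 \<Rightarrow> 'a l2 \<Rightarrow> 'a l2" is "\<lambda>f g x. f x + g x"
  by (auto simp: l2_rel_def square_integrable_add)

lift_definition uminus_l2 :: "'a l2 \<Rightarrow> 'a l2" is "\<lambda>f x. - f x"
  by (auto simp: l2_rel_def square_integrable_def)

lift_definition minus_l2 :: "'a l2 \<Rightarrow> 'a l2 \<Rightarrow> 'a l2" is "\<lambda>f g x. f x - g x"
  by (auto simp: l2_rel_def square_integrable_diff)

lift_definition scaleR_l2 :: "real \<Rightarrow> 'a l2 \<Rightarrow> 'a l2" is "\<lambda>c f x. c * f x"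
  by (auto simp: l2_rel_def square_integrable_cmult)

lift_definition inner_l2 :: "'a l2 \<Rightarrow> 'a l2 \<Rightarrow> real" is "\<lambda>f g. LINT x|lebesgue. f x * g x"
proof -
  fix f f' g g' :: "'a \<Rightarrow> real"
  assume "l2_rel f f'" "l2_rel g g'"
  then show "(LINT x|lebesgue. f x * g x) = (LINT x|lebesgue. f' x * g' x)"
    by (intro integral_cong_AE) (auto simp: l2_rel_def square_integrable_def)
qed

definition norm_l2 :: "'a l2 \<Rightarrow> real" where "norm u = sqrt (inner u u)" for u :: "'a l2"
definition sgn_l2 :: "'a l2 \<Rightarrow> 'a l2" where "sgn u = inverse (norm u) *\<^sub>R u" for u :: "'a l2"
definition dist_l2 :: "'a l2 \<Rightarrow> 'a l2 \<Rightarrow> real" where "dist u v = norm (u - v)" for u v :: "'a l2"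
definition uniformity_l2 :: "('a l2 \<times> 'a l2) filter" where
  "(uniformity :: ('a l2 \<times> 'a l2) filter) = (INF e\<in>{0<..}. principal {(u, v). dist u v < e})"
definition open_l2 :: "'a l2 set \<Rightarrow> bool" where
  "open U = (\<forall>u\<in>U. eventually (\<lambda>(u', v). u' = u \<longrightarrow> v \<in> U) uniformity)" for U :: "'a l2 set"

instance
proof
  fix u v w :: "'a l2" and a b :: real and U :: "'a l2 set"
  show "u + v + w = u + (v + w)"
    by transfer (auto simp: l2_rel_def square_integrable_add add.assoc)
  show "u + v = v + u"
    by transfer (auto simp: l2_rel_def square_integrable_add add.commute)
  show "0 + u = u"
    by transfer (auto simp: l2_rel_def)
  show "- u + u = 0"
    by transfer (auto simp: l2_rel_def square_integrable_zero)
  show "u - v = u + - v"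
    by transfer (auto simp: l2_rel_def square_integrable_diff)
  show "a *\<^sub>R (u + v) = a *\<^sub>R u + a *\<^sub>R v"
    by transfer (auto simp: l2_rel_def distrib_left
        intro!: square_integrable_add square_integrable_cmult)
  show "(a + b) *\<^sub>R u = a *\<^sub>R u + b *\<^sub>R u"
    by transfer (auto simp: l2_rel_def distrib_right
        intro!: square_integrable_add square_integrable_cmult)
  show "a *\<^sub>R b *\<^sub>R u = (a * b) *\<^sub>R u"
    by transfer (auto simp: l2_rel_def square_integrable_cmult mult.assoc[symmetric])
  show "1 *\<^sub>R u = u"
    by transfer (auto simp: l2_rel_def)
  show "sgn u = inverse (norm u) *\<^sub>R u"
    by (simp add: sgn_l2_def)
  show "dist u v = norm (u - v)"
    by (simp add: dist_l2_def)
  show "(uniformity :: ('a l2 \<times> 'a l2) filter) = (INF e\<in>{0<..}. principal {(x, y). dist x y < e})"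
    by (simp add: uniformity_l2_def)
  show "open U \<longleftrightarrow> (\<forall>x\<in>U. eventually (\<lambda>(x', y). x' = x \<longrightarrow> y \<in> U) uniformity)"
    by (simp add: open_l2_def)
  show "inner u v = inner v u"
    by transfer (simp add: mult.commute)
  show "inner (u + v) w = inner u w + inner v w"
    by transfer (auto simp: l2_rel_def distrib_right square_integrable_mult)
  show "inner (a *\<^sub>R u) v = a * inner u v"
    by transfer (simp add: mult.assoc)
  show "0 \<le> inner u u"
    by transfer simp
  show "inner u u = 0 \<longleftrightarrow> u = 0"
  proof transfer
    fix f :: "'a \<Rightarrow> real"
    assume "l2_rel f f"
    then have f: "square_integrable f"
      by (simp add: l2_rel_def)
    then have "(LINT x|lebesgue. (f x)\<^sup>2) = 0 \<longleftrightarrow> (AE x in lebesgue. (f x)\<^sup>2 = 0)"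
      by (intro integral_nonneg_eq_0_iff_AE) (auto simp: square_integrable_def)
    with f show "(LINT x|lebesgue. f x * f x) = 0 \<longleftrightarrow> l2_rel f (\<lambda>x. 0)"
      by (simp add: l2_rel_def square_integrable_zero power2_eq_square)
  qed
  show "norm u = sqrt (inner u u)"
    by (simp add: norm_l2_def)
qed

end

text \<open>The class of a function, with value 0 on functions that are not square-integrable.\<close>

definition l2_of :: "('a::euclidean_space \<Rightarrow> real) \<Rightarrow> 'a l2" where
  "l2_of f = (if square_integrable f then l2_abs f else 0)"

definition l2_mult :: "'a::euclidean_space l2 \<Rightarrow> 'a l2 \<Rightarrow> 'a l2" where
  "l2_mult u v = l2_of (\<lambda>x. l2_fun u x * l2_fun v x)"

text \<open>
  The space of square-integrable functions on \<open>\<Omega>\<close>, each identified with its extension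
  by zero to the whole space.
\<close>

definition L2_on :: "'a::euclidean_space set \<Rightarrow> 'a l2 set" where
  "L2_on \<Omega> = {u. AE x in lebesgue. x \<notin> \<Omega> \<longrightarrow> l2_fun u x = 0}"


section \<open>Test functions and weak derivatives\<close>

primrec Ck :: "nat \<Rightarrow> ('a::euclidean_space \<Rightarrow> real) \<Rightarrow> bool" where
  "Ck 0 f \<longleftrightarrow> continuous_on UNIV f"
| "Ck (Suc k) f \<longleftrightarrow> (\<forall>x. f differentiable (at x)) \<and>
     (\<forall>b\<in>Basis. Ck k (\<lambda>x. frechet_derivative f (at x) b))"

definition test_functions :: "'a::euclidean_space set \<Rightarrow> ('a \<Rightarrow> real) set" where
  "test_functions \<Omega> =
     {\<eta>. (\<forall>k. Ck k \<eta>) \<and> compact (closure {x. \<eta> x \<noteq> 0}) \<and> closure {x. \<eta> x \<noteq> 0} \<subseteq> \<Omega>}"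

definition locally_integrable_on :: "'a::euclidean_space set \<Rightarrow> ('a \<Rightarrow> real) \<Rightarrow> bool" where
  "locally_integrable_on \<Omega> h \<longleftrightarrow> (\<forall>K. compact K \<longrightarrow> K \<subseteq> \<Omega> \<longrightarrow> set_integrable lebesgue K h)"

text \<open>
  \<open>h'\<close> is the distributional derivative of \<open>h\<close> in direction \<open>b\<close> on the open set \<open>\<Omega>\<close>.
  It is used with \<open>b\<close> a coordinate direction in space and with \<open>b = 1\<close> on time intervals.
\<close>

definition weak_derivative ::
  "'a::euclidean_space set \<Rightarrow> 'a \<Rightarrow> ('a \<Rightarrow> real) \<Rightarrow> ('a \<Rightarrow> real) \<Rightarrow> bool" where
  "weak_derivative \<Omega> b h h' \<longleftrightarrow>
     locally_integrable_on \<Omega> h \<and> locally_integrable_on \<Omega> h' \<and>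
     (\<forall>\<eta>\<in>test_functions \<Omega>.
        (LINT x:\<Omega>|lebesgue. h x * frechet_derivative \<eta> (at x) b) =
        - (LINT x:\<Omega>|lebesgue. h' x * \<eta> x))"


section \<open>Sobolev spaces\<close>

definition is_weak_gradient ::
  "(real^'n) set \<Rightarrow> (real^'n) l2 \<Rightarrow> (real^'n) l2 ^ 'n \<Rightarrow> bool" where
  "is_weak_gradient \<Omega> u G \<longleftrightarrow>
     (\<forall>i. G $ i \<in> L2_on \<Omega> \<and> weak_derivative \<Omega> (axis i 1) (l2_fun u) (l2_fun (G $ i)))"

definition H1 :: "(real^'n) set \<Rightarrow> (real^'n) l2 set" where
  "H1 \<Omega> = {u \<in> L2_on \<Omega>. \<exists>G. is_weak_gradient \<Omega> u G}"

text \<open>The value 0 off \<open>H1 \<Omega>\<close> keeps the seminorm below symmetric on the whole type.\<close>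

definition grad :: "(real^'n) set \<Rightarrow> (real^'n) l2 \<Rightarrow> (real^'n) l2 ^ 'n" where
  "grad \<Omega> u = (if u \<in> H1 \<Omega> then THE G. is_weak_gradient \<Omega> u G else 0)"

definition H1_norm :: "(real^'n) set \<Rightarrow> (real^'n) l2 \<Rightarrow> real" where
  "H1_norm \<Omega> u = sqrt ((norm u)\<^sup>2 + (norm (grad \<Omega> u))\<^sup>2)"

text \<open>The closure of the test functions in the \<open>H1\<close>-norm.\<close>

definition H01 :: "(real^'n) set \<Rightarrow> (real^'n) l2 set" where
  "H01 \<Omega> = {u \<in> H1 \<Omega>. \<forall>\<epsilon>>0. \<exists>\<eta>\<in>test_functions \<Omega>. H1_norm \<Omega> (u - l2_of \<eta>) < \<epsilon>}"

definition lipschitz_domain :: "(real^'n) set \<Rightarrow> bool" where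
  "lipschitz_domain \<Omega> \<longleftrightarrow>
     open \<Omega> \<and> connected \<Omega> \<and> \<Omega> \<noteq> {} \<and>
     (\<forall>x\<in>frontier \<Omega>. \<exists>r>0. \<exists>e \<gamma> L.
        norm e = 1 \<and> L-lipschitz_on {y. y \<bullet> e = 0} \<gamma> \<and>
        \<Omega> \<inter> ball x r = {y \<in> ball x r. \<gamma> (y - (y \<bullet> e) *\<^sub>R e) < y \<bullet> e})"


section \<open>Phase spaces of the three-component system\<close>

text \<open>The norm of this type is the product norm of \<open>H\<close>.\<close>

type_synonym 'n state = "(real^'n) l2 ^ 3"

definition H_space :: "(real^'n) set \<Rightarrow> 'n state set" where
  "H_space \<Omega> = {g. \<forall>i. g $ i \<in> L2_on \<Omega>}"

definition E_space :: "(real^'n) set \<Rightarrow> 'n state set" where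
  "E_space \<Omega> = {g. \<forall>i. g $ i \<in> H01 \<Omega>}"

definition ae_nonneg :: "(real^'n) set \<Rightarrow> 'n state \<Rightarrow> bool" where
  "ae_nonneg \<Omega> g \<longleftrightarrow> (\<forall>i. AE x in lebesgue. x \<in> \<Omega> \<longrightarrow> 0 \<le> l2_fun (g $ i) x)"

definition H_plus :: "(real^'n) set \<Rightarrow> 'n state set" where
  "H_plus \<Omega> = {g \<in> H_space \<Omega>. ae_nonneg \<Omega> g}"

definition E_plus :: "(real^'n) set \<Rightarrow> 'n state set" where
  "E_plus \<Omega> = {g \<in> E_space \<Omega>. ae_nonneg \<Omega> g}"

definition E_norm :: "(real^'n) set \<Rightarrow> 'n state \<Rightarrow> real" where
  "E_norm \<Omega> g = norm (\<chi> i. grad \<Omega> (g $ i))"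

definition E_dist :: "(real^'n) set \<Rightarrow> 'n state \<Rightarrow> 'n state \<Rightarrow> real" where
  "E_dist \<Omega> g h = E_norm \<Omega> (g - h)"


section \<open>Weak solutions of reaction-diffusion systems\<close>

text \<open>
  The duality product \<open>(A g, \<phi>)\<close> for \<open>A = diag (d\<^sub>1 \<Delta>, d\<^sub>2 \<Delta>, d\<^sub>3 \<Delta>)\<close>, regarded as an
  operator from \<open>E\<close> to its dual.
\<close>

definition diffusion :: "(real^'n) set \<Rightarrow> real^3 \<Rightarrow> 'n state \<Rightarrow> 'n state \<Rightarrow> real" where
  "diffusion \<Omega> d g \<phi> = - (\<Sum>i\<in>UNIV. d $ i * (grad \<Omega> (g $ i) \<bullet> grad \<Omega> (\<phi> $ i)))"

text \<open>Square-integrability in the Bochner sense of an \<open>E\<close>-valued function on \<open>[0, \<tau>]\<close>.\<close>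

definition bochner_L2_E :: "(real^'n) set \<Rightarrow> real \<Rightarrow> (real \<Rightarrow> 'n state) \<Rightarrow> bool" where
  "bochner_L2_E \<Omega> \<tau> g \<longleftrightarrow>
     (AE t in lebesgue. t \<in> {0..\<tau>} \<longrightarrow> g t \<in> E_space \<Omega>) \<and>
     (\<exists>s. (\<forall>k::nat. simple_function (restrict_space lebesgue {0..\<tau>}) (s k) \<and>
                    s k ` {0..\<tau>} \<subseteq> E_space \<Omega>) \<and>
          (AE t in lebesgue. t \<in> {0..\<tau>} \<longrightarrow> (\<lambda>k. E_norm \<Omega> (s k t - g t)) \<longlonglongrightarrow> 0)) \<and>
     (\<integral>\<^sup>+ t\<in>{0..\<tau>}. ennreal ((E_norm \<Omega> (g t))\<^sup>2) \<partial>lebesgue) < \<infinity>"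

definition weakly_continuous_H :: "(real^'n) set \<Rightarrow> real \<Rightarrow> (real \<Rightarrow> 'n state) \<Rightarrow> bool" where
  "weakly_continuous_H \<Omega> \<tau> g \<longleftrightarrow>
     (\<forall>t\<in>{0..\<tau>}. g t \<in> H_space \<Omega>) \<and>
     (\<forall>\<phi>\<in>H_space \<Omega>. continuous_on {0..\<tau>} (\<lambda>t. g t \<bullet> \<phi>))"

definition weak_solution ::
  "(real^'n) set \<Rightarrow> real^3 \<Rightarrow> ('n state \<Rightarrow> 'n state) \<Rightarrow> 'n state \<Rightarrow> real \<Rightarrow>
   (real \<Rightarrow> 'n state) \<Rightarrow> bool" where
  "weak_solution \<Omega> d f g0 \<tau> g \<longleftrightarrow>
     bochner_L2_E \<Omega> \<tau> g \<and> weakly_continuous_H \<Omega> \<tau> g \<and> g 0 = g0 \<and>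
     (\<forall>\<phi>\<in>E_space \<Omega>.
        weak_derivative {0<..<\<tau>} 1 (\<lambda>t. g t \<bullet> \<phi>) (\<lambda>t. diffusion \<Omega> d (g t) \<phi> + f (g t) \<bullet> \<phi>))"

definition global_weak_solution ::
  "(real^'n) set \<Rightarrow> real^3 \<Rightarrow> ('n state \<Rightarrow> 'n state) \<Rightarrow> 'n state \<Rightarrow>
   (real \<Rightarrow> 'n state) \<Rightarrow> bool" where
  "global_weak_solution \<Omega> d f g0 g \<longleftrightarrow> (\<forall>\<tau>>0. weak_solution \<Omega> d f g0 \<tau> g)"

text \<open>
  \<open>S\<close> is the semiflow on \<open>H_plus \<Omega>\<close> of the system: \<open>S t g0\<close> is the value at time \<open>t\<close> of the
  unique global weak solution starting at \<open>g0\<close>. Values of functions at negative times are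
  irrelevant, so uniqueness refers to times \<open>t \<ge> 0\<close>.
\<close>

definition is_semiflow_of ::
  "(real^'n) set \<Rightarrow> real^3 \<Rightarrow> ('n state \<Rightarrow> 'n state) \<Rightarrow>
   (real \<Rightarrow> 'n state \<Rightarrow> 'n state) \<Rightarrow> bool" where
  "is_semiflow_of \<Omega> d f S \<longleftrightarrow>
     (\<forall>g0\<in>H_plus \<Omega>.
        global_weak_solution \<Omega> d f g0 (\<lambda>t. S t g0) \<and>
        (\<forall>g. global_weak_solution \<Omega> d f g0 g \<longrightarrow> (\<forall>t\<ge>0. g t = S t g0)) \<and>
        (\<forall>t\<ge>0. S t g0 \<in> H_plus \<Omega>))"

text \<open>
  On \<open>E\<close> the products are square-integrable when the dimension is at most 3, so the default
  value of \<open>l2_of\<close> plays no role there.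
\<close>

definition oregonator_reaction ::
  "real \<Rightarrow> real \<Rightarrow> real \<Rightarrow> real \<Rightarrow> real \<Rightarrow> real \<Rightarrow> real \<Rightarrow> real \<Rightarrow> real \<Rightarrow>
   'n::finite state \<Rightarrow> 'n state" where
  "oregonator_reaction a1 a3 b1 b2 c2 c3 F G1 G2 g =
     (let u = g $ 1; v = g $ 2; w = g $ 3 in
      vector
       [a1 *\<^sub>R u + b1 *\<^sub>R v - F *\<^sub>R l2_mult u u - G1 *\<^sub>R l2_mult u v,
        - (b2 *\<^sub>R v) + c2 *\<^sub>R w - G2 *\<^sub>R l2_mult u v,
        a3 *\<^sub>R u - c3 *\<^sub>R w])"


section \<open>Global attractors\<close>

text \<open>Taken in \<^typ>\<open>ennreal\<close>, so that the supremum makes sense for empty and unbounded sets.\<close>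

definition semidist :: "('a \<Rightarrow> 'a \<Rightarrow> real) \<Rightarrow> 'a set \<Rightarrow> 'a set \<Rightarrow> ennreal" where
  "semidist \<delta> X Y = (SUP x\<in>X. INF y\<in>Y. ennreal (\<delta> x y))"

definition global_attractor ::
  "(real^'n) set \<Rightarrow> (real \<Rightarrow> 'n state \<Rightarrow> 'n state) \<Rightarrow> 'n state set \<Rightarrow> bool" where
  "global_attractor \<Omega> S \<A> \<longleftrightarrow>
     \<A> \<subseteq> H_plus \<Omega> \<and> \<A> \<noteq> {} \<and> compact \<A> \<and> (\<forall>t\<ge>0. S t ` \<A> = \<A>) \<and>
     (\<forall>B \<subseteq> H_plus \<Omega>. bounded B \<longrightarrow> ((\<lambda>t. semidist dist (S t ` B) \<A>) \<longlongrightarrow> 0) at_top)"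

definition HE_global_attractor ::
  "(real^'n) set \<Rightarrow> (real \<Rightarrow> 'n state \<Rightarrow> 'n state) \<Rightarrow> 'n state set \<Rightarrow> bool" where
  "HE_global_attractor \<Omega> S \<A> \<longleftrightarrow>
     \<A> \<subseteq> E_plus \<Omega> \<and> \<A> \<noteq> {} \<and>
     compactin (Metric_space.mtopology (E_plus \<Omega>) (E_dist \<Omega>)) \<A> \<and>
     (\<forall>t\<ge>0. S t ` \<A> = \<A>) \<and>
     (\<forall>B \<subseteq> H_plus \<Omega>. bounded B \<longrightarrow>
        (\<exists>\<tau>\<ge>0. \<forall>t>\<tau>. S t ` B \<subseteq> E_plus \<Omega>) \<and>
        ((\<lambda>t. semidist (E_dist \<Omega>) (S t ` B) \<A>) \<longlongrightarrow> 0) at_top)"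

end

(*
  Once trajectories are bounded in H, closeness in H forces closeness in E after a fixed time,
  so compactness and attraction carry over from the H-norm to the E-norm.

  In dimension at most 3 the Ladyzhenskaya inequality bounds the L4-norm by
  eps |grad u| + C |u|, which controls the quadratic reaction terms: the difference of two bounded
  weak solutions satisfies an energy inequality. For the time increment g(t + h) - g(t) the
  equation itself bounds the squared L2(E)-norm over a time window by a power of h, and feeding this
  bound back improves its order until it is summable over dyadic scales. Comparing the mean of
  |grad g|^2 over [t, t + l / 2^k] on successive scales then bounds the gradient at every time t, and
  for a difference of two solutions the dyadic errors beyond scale k are geometrically small, while
  the scale-k mean is controlled by the H-distance at time t.
*)

theory Submission
  imports Defs "HOL-Computational_Algebra.Polynomial"
begin

section \<open>Smoothing for abstract parabolic problems\<close>

text \<open>Test functions are elements of E that do not depend on time, so neither -\<Delta> g nor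
  the time derivative of g can be used for testing. A value of the solution can, but at first it is
  known to lie in E only for almost every time. Hence every estimate is averaged over short windows,
  and a bound at a single time is recovered from weak continuity, which makes the H-norm lower but
  not upper semicontinuous. This is why the local estimate starts from a mean over an earlier window
  instead of an initial value. The order of the time increment has to exceed one: comparing means
  over windows of length h divides the squared L2(E)-bound by h, and a positive power must be left
  over. The crude bound has order 0, one round gives h, a second gives h^(3/2), so the gradient
  error at scale h is of order h^(1/4). All constants depend on a trajectory only through its
  H-bound. The attractor is its own image at every time, so its points are late values of uniformly
  bounded trajectories, and among them H-closeness already implies E-closeness.\<close>

lemma integral_mono_negligible:
  fixes F G :: "'a::euclidean_space \<Rightarrow> real"
  assumes "F integrable_on A" "G integrable_on A" "negligible N" "\<And>x. x \<in> A - N \<Longrightarrow> F x \<le> G x"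
  shows "integral A F \<le> integral A G"
proof -
  let ?F = "\<lambda>x. if x \<in> N then 0 else F x" and ?G = "\<lambda>x. if x \<in> N then 0 else G x"
  have "integral A F = integral A ?F" "integral A G = integral A ?G"
    by (rule integral_spike[OF assms(3)]; simp)+
  moreover have "?F integrable_on A" "?G integrable_on A"
    by (rule integrable_spike[OF _ assms(3)], use assms in auto)+
  moreover have "?F x \<le> ?G x" if "x \<in> A" for x
    using assms(4) that by auto
  ultimately show ?thesis
    using integral_le[of ?F A ?G] by simp
qed

lemma integrable_on_shift:
  fixes F :: "real \<Rightarrow> real"
  assumes "F integrable_on {a+h..b+h}"
  shows "(\<lambda>r. F (r + h)) integrable_on {a..b}"
  using integrable_shift_real_ivl[OF assms, of h] by simp

lemma integral_shift_eq:
  fixes F :: "real \<Rightarrow> real"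
  shows "integral {a..b} (\<lambda>r. F (r + h)) = integral {a+h..b+h} F"
  using integral_shift_real_ivl[of "a+h" h "b+h" F] by simp

text \<open>The two windows overlap in all but their end pieces, so an increment integrated in time
  telescopes to two integrals over length \<open>h\<close>. These replace values at single times,
  where the integrands may not be controlled.\<close>

lemma integral_shift_diff:
  fixes F :: "real \<Rightarrow> real"
  assumes "a \<le> b" "0 \<le> h" and F: "F integrable_on {a..b+h}"
  shows "integral {a..b} (\<lambda>r. F (r + h)) - integral {a..b} F =
         integral {b..b+h} F - integral {a..a+h} F"
  using Henstock_Kurzweil_Integration.integral_combine[of a "b" "b+h" F] Henstock_Kurzweil_Integration.integral_combine[of a "a+h" "b+h" F] assms
  by (simp add: integral_shift_eq)

lemma integral_le_const:
  fixes F :: "real \<Rightarrow> real"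
  assumes "a \<le> b" "F integrable_on {a..b}" "\<And>x. x \<in> {a..b} \<Longrightarrow> F x \<le> c"
  shows "integral {a..b} F \<le> (b - a) * c"
  using integral_le[of F "{a..b}" "\<lambda>_. c"] assms by (simp add: integrable_const_ivl)

lemma integral_ge_const:
  fixes F :: "real \<Rightarrow> real"
  assumes "a \<le> b" "F integrable_on {a..b}" "\<And>x. x \<in> {a..b} \<Longrightarrow> c \<le> F x"
  shows "(b - a) * c \<le> integral {a..b} F"
  using integral_le[of "\<lambda>_. c" "{a..b}" F] assms by (simp add: integrable_const_ivl)

lemma integral_mono_interval:
  fixes F :: "real \<Rightarrow> real"
  assumes "F integrable_on {a..b}" "\<And>x. x \<in> {a..b} \<Longrightarrow> 0 \<le> F x" "a \<le> c" "d \<le> b"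
  shows "integral {c..d} F \<le> integral {a..b} F"
  using assms by (intro integral_subset_le) (auto intro: integrable_subinterval_real)

lemma norm_add_sq_le: "(norm (x + y))\<^sup>2 \<le> 2 * (norm x)\<^sup>2 + 2 * (norm (y::'a::real_normed_vector))\<^sup>2"
proof -
  have "(norm (x + y))\<^sup>2 \<le> (norm x + norm y)\<^sup>2"
    by (intro power_mono norm_triangle_ineq norm_ge_zero)
  also have "\<dots> \<le> 2 * (norm x)\<^sup>2 + 2 * (norm y)\<^sup>2"
    using sum_squares_bound[of "norm x" "norm y"] by (simp add: power2_sum)
  finally show ?thesis .
qed

lemma norm_diff_sq_le: "(norm (x - y))\<^sup>2 \<le> 2 * (norm x)\<^sup>2 + 2 * (norm (y::'a::real_normed_vector))\<^sup>2"
  using norm_add_sq_le[of x "- y"] by simp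

lemma norm_add3_sq_le:
  "(norm (x + y + z))\<^sup>2 \<le> 3 * (norm x)\<^sup>2 + 3 * (norm y)\<^sup>2 + 3 * (norm (z::'a::real_normed_vector))\<^sup>2"
proof -
  have "norm (x + y + z) \<le> norm x + norm y + norm z"
    by (meson add_mono norm_triangle_ineq order_refl order_trans)
  then have "(norm (x + y + z))\<^sup>2 \<le> (norm x + norm y + norm z)\<^sup>2"
    by (intro power_mono) auto
  also have "\<dots> \<le> 3 * (norm x)\<^sup>2 + 3 * (norm y)\<^sup>2 + 3 * (norm z)\<^sup>2"
    using sum_squares_bound[of "norm x" "norm y"] sum_squares_bound[of "norm x" "norm z"]
      sum_squares_bound[of "norm y" "norm z"]
    by (simp add: power2_sum algebra_simps)
  finally show ?thesis .
qed

text \<open>An abstract parabolic problem: \<open>D\<close> is a gradient with domain \<open>E\<close>, and \<open>V\<close> plays the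
  role of the \<open>L\<^sup>4\<close>-norm.\<close>

locale parabolic =
  fixes Hs E :: "'h::real_inner set" and D :: "'h \<Rightarrow> 'k::real_inner"
    and f :: "'h \<Rightarrow> 'h" and V :: "'h \<Rightarrow> real"
  assumes subspace_Hs: "subspace Hs" and subspace_E: "subspace E" and E_subset: "E \<subseteq> Hs"
    and D_add: "x \<in> E \<Longrightarrow> y \<in> E \<Longrightarrow> D (x + y) = D x + D y"
    and D_scale: "x \<in> E \<Longrightarrow> D (c *\<^sub>R x) = c *\<^sub>R D x"
    and V_nonneg: "0 \<le> V x"
    and V_interp: "0 < \<epsilon> \<Longrightarrow> \<exists>C\<ge>0. \<forall>x\<in>E. (V x)\<^sup>2 \<le> \<epsilon> * (norm (D x))\<^sup>2 + C * (norm x)\<^sup>2"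
    and f_diff: "\<exists>C\<ge>0. \<forall>x\<in>E. \<forall>y\<in>E. \<forall>\<phi>\<in>E. norm x \<le> K \<longrightarrow> norm y \<le> K \<longrightarrow>
                   \<bar>(f x - f y) \<bullet> \<phi>\<bar> \<le> C * (V (x - y) * V \<phi>)"
    and f_zero: "f 0 = 0"
    and closed: "(\<And>k::nat. xs k \<in> E) \<Longrightarrow> xs \<longlonglongrightarrow> z \<Longrightarrow> (\<And>k. norm (D (xs k)) \<le> R) \<Longrightarrow>
                   z \<in> E \<and> norm (D z) \<le> R"
begin

lemma E_diff: "x \<in> E \<Longrightarrow> y \<in> E \<Longrightarrow> x - y \<in> E"
  using subspace_E by (rule subspace_diff)

lemma Hs_diff: "x \<in> Hs \<Longrightarrow> y \<in> Hs \<Longrightarrow> x - y \<in> Hs"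
  using subspace_Hs by (rule subspace_diff)

lemma E_zero: "0 \<in> E"
  using subspace_E by (rule subspace_0)

lemma Hs_zero: "0 \<in> Hs"
  using subspace_Hs by (rule subspace_0)

lemma D_zero: "D 0 = 0"
  using D_scale[OF E_zero, of 0] by simp

lemma D_diff: "x \<in> E \<Longrightarrow> y \<in> E \<Longrightarrow> D (x - y) = D x - D y"
  using D_add[of x "- 1 *\<^sub>R y"] D_scale[of y "-1"] subspace_scale[OF subspace_E, of y "-1"] by simp

text \<open>Bochner square-integrability on \<open>[0, T]\<close>, phrased with integrable majorants \<open>e\<close> so that no
  measurability of \<open>D \<circ> g\<close> has to be carried along.\<close>

definition approx :: "real \<Rightarrow> (real \<Rightarrow> 'h) \<Rightarrow> bool" where
  "approx T g \<longleftrightarrow> (\<forall>\<eta>>0. \<exists>c e N. (\<forall>t. c t \<in> E) \<and> continuous_on {0..T} (\<lambda>t. D (c t)) \<and>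
     (\<forall>t. 0 \<le> e t) \<and> e integrable_on {0..T} \<and> integral {0..T} e \<le> \<eta> \<and>
     negligible N \<and> (\<forall>t\<in>{0..T} - N. g t \<in> E \<and> (norm (D (g t - c t)))\<^sup>2 \<le> e t))"

lemma approxE:
  assumes "approx T g" "\<eta> > 0"
  obtains c e N where "\<And>t. c t \<in> E" "continuous_on {0..T} (\<lambda>t. D (c t))" "\<And>t. 0 \<le> (e t::real)"
    "e integrable_on {0..T}" "integral {0..T} e \<le> \<eta>" "negligible N"
    "\<And>t. t \<in> {0..T} \<Longrightarrow> t \<notin> N \<Longrightarrow> g t \<in> E"
    "\<And>t. t \<in> {0..T} \<Longrightarrow> t \<notin> N \<Longrightarrow> (norm (D (g t - c t)))\<^sup>2 \<le> e t"
  using assms unfolding approx_def by (metis Diff_iff)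

lemma approx_zero: "approx T (\<lambda>_. 0)"
  unfolding approx_def
  by (intro allI impI exI[of _ "\<lambda>_. 0"] exI[of _ "{}"]) (auto simp: E_zero D_zero)

lemma approx_diff:
  assumes g1: "approx T g1" and g2: "approx T g2"
  shows "approx T (\<lambda>t. g1 t - g2 t)"
  unfolding approx_def
proof (intro allI impI)
  fix \<eta> :: real assume "\<eta> > 0"
  then have \<eta>: "\<eta> / 4 > 0" by simp
  obtain c1 e1 N1 where 1: "\<And>t. c1 t \<in> E" "continuous_on {0..T} (\<lambda>t. D (c1 t))" "\<And>t. 0 \<le> (e1 t::real)"
    "e1 integrable_on {0..T}" "integral {0..T} e1 \<le> \<eta> / 4" "negligible N1"
    "\<And>t. t \<in> {0..T} \<Longrightarrow> t \<notin> N1 \<Longrightarrow> g1 t \<in> E"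
    "\<And>t. t \<in> {0..T} \<Longrightarrow> t \<notin> N1 \<Longrightarrow> (norm (D (g1 t - c1 t)))\<^sup>2 \<le> e1 t"
    using approxE[OF g1 \<eta>] by blast
  obtain c2 e2 N2 where 2: "\<And>t. c2 t \<in> E" "continuous_on {0..T} (\<lambda>t. D (c2 t))" "\<And>t. 0 \<le> (e2 t::real)"
    "e2 integrable_on {0..T}" "integral {0..T} e2 \<le> \<eta> / 4" "negligible N2"
    "\<And>t. t \<in> {0..T} \<Longrightarrow> t \<notin> N2 \<Longrightarrow> g2 t \<in> E"
    "\<And>t. t \<in> {0..T} \<Longrightarrow> t \<notin> N2 \<Longrightarrow> (norm (D (g2 t - c2 t)))\<^sup>2 \<le> e2 t"
    using approxE[OF g2 \<eta>] by blast
  show "\<exists>c e N. (\<forall>t. c t \<in> E) \<and> continuous_on {0..T} (\<lambda>t. D (c t)) \<and>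
     (\<forall>t. 0 \<le> e t) \<and> e integrable_on {0..T} \<and> integral {0..T} e \<le> \<eta> \<and>
     negligible N \<and> (\<forall>t\<in>{0..T} - N. g1 t - g2 t \<in> E \<and> (norm (D (g1 t - g2 t - c t)))\<^sup>2 \<le> e t)"
  proof (intro exI[of _ "\<lambda>t. c1 t - c2 t"] exI[of _ "\<lambda>t. 2 * e1 t + 2 * e2 t"] exI[of _ "N1 \<union> N2"] conjI ballI allI)
    show "continuous_on {0..T} (\<lambda>t. D (c1 t - c2 t))"
      using continuous_on_diff[OF 1(2) 2(2)] 1(1) 2(1) by (simp add: D_diff)
    show "(\<lambda>t. 2 * e1 t + 2 * e2 t) integrable_on {0..T}"
      using 1 2 by (intro integrable_add integrable_on_mult_right) auto
    have "integral {0..T} (\<lambda>t. 2 * e1 t + 2 * e2 t) = 2 * integral {0..T} e1 + 2 * integral {0..T} e2"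
      using 1 2 by (subst integral_add) (auto intro!: integrable_on_mult_right)
    then show "integral {0..T} (\<lambda>t. 2 * e1 t + 2 * e2 t) \<le> \<eta>"
      using 1 2 by simp
    fix t assume t: "t \<in> {0..T} - (N1 \<union> N2)"
    have "D (g1 t - g2 t - (c1 t - c2 t)) = D (g1 t - c1 t) - D (g2 t - c2 t)"
      using t 1 2 by (simp add: D_diff E_diff)
    then show "(norm (D (g1 t - g2 t - (c1 t - c2 t))))\<^sup>2 \<le> 2 * e1 t + 2 * e2 t"
      using norm_diff_sq_le[of "D (g1 t - c1 t)" "D (g2 t - c2 t)"] 1(8)[of t] 2(8)[of t] t by auto
  qed (use 1 2 in \<open>auto simp: E_diff add_nonneg_nonneg\<close>)
qed

lemma approx_shift:
  assumes g: "approx (T + h) g" and h: "0 \<le> h"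
  shows "approx T (\<lambda>t. g (t + h))"
  unfolding approx_def
proof (intro allI impI)
  fix \<eta> :: real assume "\<eta> > 0"
  obtain c e N where 1: "\<And>t. c t \<in> E" "continuous_on {0..T+h} (\<lambda>t. D (c t))" "\<And>t. 0 \<le> (e t::real)"
    "e integrable_on {0..T+h}" "integral {0..T+h} e \<le> \<eta>" "negligible N"
    "\<And>t. t \<in> {0..T+h} \<Longrightarrow> t \<notin> N \<Longrightarrow> g t \<in> E"
    "\<And>t. t \<in> {0..T+h} \<Longrightarrow> t \<notin> N \<Longrightarrow> (norm (D (g t - c t)))\<^sup>2 \<le> e t"
    using approxE[OF g \<open>\<eta> > 0\<close>] by blast
  show "\<exists>c e N. (\<forall>t. c t \<in> E) \<and> continuous_on {0..T} (\<lambda>t. D (c t)) \<and>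
     (\<forall>t. 0 \<le> e t) \<and> e integrable_on {0..T} \<and> integral {0..T} e \<le> \<eta> \<and>
     negligible N \<and> (\<forall>t\<in>{0..T} - N. g (t + h) \<in> E \<and> (norm (D (g (t + h) - c t)))\<^sup>2 \<le> e t)"
  proof (intro exI[of _ "\<lambda>t. c (t + h)"] exI[of _ "\<lambda>t. e (t + h)"] exI[of _ "(+) (- h) ` N"] conjI ballI allI)
    show "continuous_on {0..T} (\<lambda>t. D (c (t + h)))"
      by (rule continuous_on_compose2[OF 1(2)]) (use h in \<open>auto intro!: continuous_intros\<close>)
    show "(\<lambda>t. e (t + h)) integrable_on {0..T}"
      using integrable_subinterval_real[OF 1(4), of h "T + h"] h
      by (intro integrable_on_shift) auto
    have "integral {h..T+h} e \<le> integral {0..T+h} e"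
      using 1 h by (intro integral_mono_interval) auto
    then show "integral {0..T} (\<lambda>t. e (t + h)) \<le> \<eta>"
      using 1(5) by (simp add: integral_shift_eq)
    show "negligible ((+) (- h) ` N)"
      using 1(6) by (rule negligible_translation)
    fix t assume t: "t \<in> {0..T} - (+) (- h) ` N"
    then have "t + h \<notin> N" "t + h \<in> {0..T+h}"
      using h by (auto simp: image_iff)
    then show "g (t + h) \<in> E" "(norm (D (g (t + h) - c (t + h))))\<^sup>2 \<le> e (t + h)"
      using 1 by auto
  qed (use 1 in auto)
qed

end

lemma measurable_bounded_negligible_integrable:
  fixes F :: "'a::euclidean_space \<Rightarrow> real"
  assumes "F \<in> borel_measurable (lebesgue_on S)" "G integrable_on S" "S \<in> sets lebesgue"
    "negligible N" "\<And>x. x \<in> S - N \<Longrightarrow> \<bar>F x\<bar> \<le> G x"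
  shows "F integrable_on S"
proof (rule measurable_bounded_by_integrable_imp_integrable_real[OF assms(1)])
  show "(\<lambda>x. if x \<in> N then \<bar>F x\<bar> else G x) integrable_on S"
    by (rule integrable_spike[OF assms(2,4)]) auto
qed (use assms in auto)

lemma nonneg_integrable_on_lebesgue_on:
  fixes F :: "'a::euclidean_space \<Rightarrow> real"
  assumes "F integrable_on S" "\<And>x. 0 \<le> F x" "S \<in> sets lebesgue"
  shows "integrable (lebesgue_on S) F" "integral\<^sup>L (lebesgue_on S) F = integral S F"
proof -
  have "F absolutely_integrable_on S"
    by (rule nonnegative_absolutely_integrable_1) (use assms in auto)
  then show "integrable (lebesgue_on S) F"
    using assms(3) by (simp add: integrable_restrict_space set_integrable_def)
  then show "integral\<^sup>L (lebesgue_on S) F = integral S F"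
    by (rule lebesgue_integral_eq_integral) (use assms in auto)
qed

context parabolic
begin

text \<open>The majorants \<open>e k\<close> tend to zero in mean, hence almost everywhere along a
  subsequence. So \<open>norm (D (g t))\<close> is an almost everywhere limit of continuous
  functions, which gives measurability; the approximation with \<open>k = 0\<close> supplies an
  integrable bound.\<close>

lemma approx_gradient_integrable:
  assumes "approx T g"
  shows "(\<lambda>t. (norm (D (g t)))\<^sup>2) integrable_on {0..T}"
proof -
  have "\<forall>k::nat. \<exists>c e N. (\<forall>t. c t \<in> E) \<and> continuous_on {0..T} (\<lambda>t. D (c t)) \<and>
     (\<forall>t. 0 \<le> e t) \<and> e integrable_on {0..T} \<and> integral {0..T} e \<le> inverse (Suc k) \<and>
     negligible N \<and> (\<forall>t\<in>{0..T} - N. g t \<in> E \<and> (norm (D (g t - c t)))\<^sup>2 \<le> e t)"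
    using assms unfolding approx_def by (metis inverse_positive_iff_positive of_nat_0_less_iff zero_less_Suc)
  then obtain c e N where c: "\<And>k t. c k t \<in> E" "\<And>k. continuous_on {0..T} (\<lambda>t. D (c k t))"
    and e: "\<And>k t. 0 \<le> (e k t::real)" "\<And>k. e k integrable_on {0..T}"
      "\<And>k. integral {0..T} (e k) \<le> inverse (Suc k)"
    and N: "\<And>k::nat. negligible (N k)"
    and g: "\<And>k t. t \<in> {0..T} \<Longrightarrow> t \<notin> N k \<Longrightarrow> g t \<in> E"
      "\<And>k t. t \<in> {0..T} \<Longrightarrow> t \<notin> N k \<Longrightarrow> (norm (D (g t - c k t)))\<^sup>2 \<le> e k t"
    by (metis Diff_iff)
  have "(\<lambda>k. integral {0..T} (e k)) \<longlonglongrightarrow> 0"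
    by (rule tendsto_sandwich[OF _ _ tendsto_const LIMSEQ_inverse_real_of_nat])
      (use e in \<open>auto intro!: integral_nonneg always_eventually\<close>)
  then have "(\<lambda>k. \<integral>t. norm (e k t) \<partial>lebesgue_on {0..T}) \<longlonglongrightarrow> 0"
    using nonneg_integrable_on_lebesgue_on(2)[OF e(2) e(1)] e(1) by simp
  then obtain r where r: "strict_mono r" "AE t in lebesgue_on {0..T}. (\<lambda>k. e (r k) t) \<longlonglongrightarrow> 0"
    using tendsto_L1_AE_subseq[of "lebesgue_on {0..T}" e] nonneg_integrable_on_lebesgue_on(1)[OF e(2) e(1)]
    by auto
  then have "AE t in lebesgue. t \<in> {0..T} \<longrightarrow> (\<lambda>k. e (r k) t) \<longlonglongrightarrow> 0"
    by (subst (asm) AE_restrict_space_iff) auto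
  then obtain M where M: "negligible M" "\<And>t. t \<in> {0..T} \<Longrightarrow> t \<notin> M \<Longrightarrow> (\<lambda>k. e (r k) t) \<longlonglongrightarrow> 0"
    unfolding eventually_ae_filter_negligible by blast
  have "(\<lambda>t. norm (D (g t))) measurable_on {0..T}"
  proof (rule measurable_on_limit)
    show "(\<lambda>t. norm (D (c (r k) t))) measurable_on {0..T}" for k
      by (subst measurable_on_iff_borel_measurable)
        (auto intro!: continuous_imp_measurable_on_sets_lebesgue continuous_intros c)
    show "negligible (M \<union> (\<Union>k. N k))"
      using M(1) N by auto
    fix t assume t: "t \<in> {0..T} - (M \<union> (\<Union>k. N k))"
    have "norm (norm (D (c (r k) t)) - norm (D (g t))) \<le> sqrt (e (r k) t)" for k
    proof -
      have "norm (norm (D (c (r k) t)) - norm (D (g t))) \<le> norm (D (g t - c (r k) t))"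
        using norm_triangle_ineq3[of "D (c (r k) t)" "D (g t)"] g(1)[of t 0] c(1)[of "r k" t] t
        by (simp add: D_diff norm_minus_commute)
      also have "\<dots> \<le> sqrt (e (r k) t)"
        using g(2)[of t "r k"] t by (intro real_le_rsqrt) auto
      finally show ?thesis .
    qed
    moreover have "(\<lambda>k. sqrt (e (r k) t)) \<longlonglongrightarrow> 0"
      using tendsto_real_sqrt[OF M(2)[of t]] t by simp
    ultimately have "(\<lambda>k. norm (D (c (r k) t)) - norm (D (g t))) \<longlonglongrightarrow> 0"
      by (rule Lim_null_comparison[OF always_eventually[OF allI]])
    then show "(\<lambda>k. norm (D (c (r k) t))) \<longlonglongrightarrow> norm (D (g t))"
      by (simp add: LIM_zero_iff)
  qed
  then have meas: "(\<lambda>t. norm (D (g t))) \<in> borel_measurable (lebesgue_on {0..T})"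
    by (subst (asm) measurable_on_iff_borel_measurable) auto
  show ?thesis
  proof (rule measurable_bounded_negligible_integrable)
    show "(\<lambda>t. 2 * (norm (D (c 0 t)))\<^sup>2 + 2 * e 0 t) integrable_on {0..T}"
      by (intro integrable_add integrable_on_mult_right e(2) integrable_continuous_interval[where f="\<lambda>t. (norm (D (c 0 t)))\<^sup>2"]
        continuous_on_power continuous_on_norm c(2))
    fix t assume t: "t \<in> {0..T} - N 0"
    have "D (g t) = D (c 0 t) + D (g t - c 0 t)"
      using t g(1)[of t 0] c(1)[of 0 t] by (simp add: D_diff)
    then show "\<bar>(norm (D (g t)))\<^sup>2\<bar> \<le> 2 * (norm (D (c 0 t)))\<^sup>2 + 2 * e 0 t"
      using norm_add_sq_le[of "D (c 0 t)" "D (g t - c 0 t)"] g(2)[of t 0] t by auto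
  qed (use N meas in auto)
qed

section \<open>Weak continuity in time and the notion of solution\<close>

definition weakly_continuous :: "(real \<Rightarrow> 'h) \<Rightarrow> bool" where
  "weakly_continuous g \<longleftrightarrow> (\<forall>t\<ge>0. g t \<in> Hs) \<and> (\<forall>\<phi>\<in>Hs. continuous_on {0..} (\<lambda>t. g t \<bullet> \<phi>))"

lemma weakly_continuous_diff:
  "weakly_continuous g1 \<Longrightarrow> weakly_continuous g2 \<Longrightarrow> weakly_continuous (\<lambda>t. g1 t - g2 t)"
  unfolding weakly_continuous_def inner_diff_left by (intro conjI ballI allI impI Hs_diff continuous_on_diff) simp_all

text \<open>This is \<open>0 \<le> (norm (x - z))\<^sup>2\<close>: the square lies above its tangent
  at \<open>z\<close>. The tangent is affine in \<open>x\<close>, so it is continuous along weakly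
  continuous trajectories, which the norm need not be.\<close>

lemma norm_sq_ge_tangent: "2 * (x \<bullet> z) - (norm z)\<^sup>2 \<le> (norm (x::'h))\<^sup>2"
  using inner_ge_zero[of "x - z"] inner_commute[of x z] unfolding power2_norm_eq_inner
  by (simp only: inner_diff_left inner_diff_right)

text \<open>Weak continuity makes \<open>\<parallel>g t\<parallel>\<^sup>2\<close> lower semicontinuous.\<close>

lemma weakly_continuous_norm_integrable:
  assumes g: "weakly_continuous g" and K: "\<And>t. t \<ge> 0 \<Longrightarrow> norm (g t) \<le> K" and "0 \<le> a"
  shows "(\<lambda>t. (norm (g t))\<^sup>2) integrable_on {a..b}"
proof (rule measurable_bounded_by_integrable_imp_integrable_real)
  have "{t \<in> {a..b}. z < (norm (g t))\<^sup>2} \<in> sets (lebesgue_on {a..b})" for z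
  proof -
    let ?A = "{t \<in> {a..b}. z < (norm (g t))\<^sup>2}"
    let ?U = "\<lambda>s. {a..b} \<inter> (\<lambda>t. 2 * (g t \<bullet> g s) - (norm (g s))\<^sup>2) -` {z<..}"
    \<comment> \<open>A superlevel set of the squared norm is the union of superlevel sets of its
      tangents at \<open>g s\<close>. Each of these is relatively open by weak continuity, and the
      tangent with \<open>s = t\<close> attains the value at \<open>t\<close>.\<close>
    have "?A = (\<Union>s\<in>?A. ?U s)"
    proof (intro set_eqI iffI)
      fix t assume "t \<in> ?A"
      then show "t \<in> (\<Union>s\<in>?A. ?U s)"
        by (intro UN_I[of t]) (simp_all add: power2_norm_eq_inner)
    next
      fix t assume "t \<in> (\<Union>s\<in>?A. ?U s)"
      then obtain s where "t \<in> {a..b}" "z < 2 * (g t \<bullet> g s) - (norm (g s))\<^sup>2"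
        by auto
      then show "t \<in> ?A"
        using norm_sq_ge_tangent[of "g t" "g s"] by auto
    qed
    moreover have "openin (top_of_set {a..b}) (\<Union>s\<in>?A. ?U s)"
    proof (intro openin_Union ballI, clarify)
      fix s assume "s \<in> {a..b}"
      then have "continuous_on {0..} (\<lambda>t. g t \<bullet> g s)"
        using g \<open>0 \<le> a\<close> unfolding weakly_continuous_def by auto
      then have "continuous_on {a..b} (\<lambda>t. g t \<bullet> g s)"
        by (rule continuous_on_subset) (use \<open>0 \<le> a\<close> in auto)
      then show "openin (top_of_set {a..b}) (?U s)"
        by (intro continuous_openin_preimage_gen continuous_on_diff continuous_on_mult_left
            continuous_on_const) auto
    qed
    ultimately have "openin (top_of_set {a..b}) ?A"
      by simp
    then have "?A \<in> sets lebesgue"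
      by (rule lebesgue_openin) simp
    moreover have "?A \<subseteq> {a..b}"
      by blast
    ultimately show ?thesis
      using sets_restrict_space_iff[of "{a..b}" lebesgue ?A] by (metis sets.Int_space_eq2 lmeasurable_interval(1) fmeasurableD)
  qed
  note level = this
  have "space (lebesgue_on {a..b}) = {a..b}"
    by simp
  then have "{t \<in> space (lebesgue_on {a..b}). z < (norm (g t))\<^sup>2} \<in> sets (lebesgue_on {a..b})" for z
    using level[of z] by (simp only:)
  then show "(\<lambda>t. (norm (g t))\<^sup>2) \<in> borel_measurable (lebesgue_on {a..b})"
    by (rule borel_measurableI_greater)
  show "(\<lambda>_. K\<^sup>2) integrable_on {a..b}"
    by (rule integrable_const_ivl)
  show "\<bar>(norm (g t))\<^sup>2\<bar> \<le> K\<^sup>2" if "t \<in> {a..b}" for t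
    using power_mono[OF K[of t] norm_ge_zero, of 2] that assms(3) by simp
qed simp

text \<open>The distributional equation is kept in integrated form between any two times, for a
  fixed \<open>\<phi>\<close>. In the application the diffusion coefficients sit inside
  \<open>D\<close>, so the diffusion term is the plain product
  \<open>D (g r) \<bullet> D \<phi>\<close>.\<close>

definition solution :: "(real \<Rightarrow> 'h) \<Rightarrow> bool" where
  "solution g \<longleftrightarrow> (\<forall>T. approx T g) \<and> weakly_continuous g \<and>
     (\<forall>\<phi>\<in>E. \<forall>s t. 0 \<le> s \<longrightarrow> s \<le> t \<longrightarrow>
        ((\<lambda>r. f (g r) \<bullet> \<phi> - D (g r) \<bullet> D \<phi>) has_integral (g t - g s) \<bullet> \<phi>) {s..t})"

text \<open>Comparison with the zero solution turns every estimate for differences into one for a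
  single trajectory.\<close>

lemma solution_zero: "solution (\<lambda>_. 0)"
  unfolding solution_def weakly_continuous_def
  by (simp only: f_zero inner_zero_left D_zero diff_self) (simp add: approx_zero Hs_zero)

lemma solution_shift:
  assumes g: "solution g" and h: "0 \<le> h"
  shows "solution (\<lambda>t. g (t + h))"
  unfolding solution_def
proof (intro conjI allI ballI impI)
  show "approx T (\<lambda>t. g (t + h))" for T
    using g h by (intro approx_shift) (auto simp: solution_def)
  show "weakly_continuous (\<lambda>t. g (t + h))"
    unfolding weakly_continuous_def
  proof (intro conjI allI ballI impI)
    show "g (t + h) \<in> Hs" if "0 \<le> t" for t
      using g h that unfolding solution_def weakly_continuous_def by auto
    fix \<phi> assume "\<phi> \<in> Hs"
    then have "continuous_on {0..} (\<lambda>t. g t \<bullet> \<phi>)"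
      using g by (auto simp: solution_def weakly_continuous_def)
    then show "continuous_on {0..} (\<lambda>t. g (t + h) \<bullet> \<phi>)"
      by (rule continuous_on_compose2) (use h in \<open>auto intro!: continuous_intros\<close>)
  qed
  fix \<phi> s t assume "\<phi> \<in> E" "0 \<le> s" "s \<le> (t::real)"
  then have "((\<lambda>r. f (g r) \<bullet> \<phi> - D (g r) \<bullet> D \<phi>) has_integral (g (t + h) - g (s + h)) \<bullet> \<phi>) {s + h..t + h}"
    using g h by (auto simp: solution_def)
  from has_integral_shift_real_ivl[OF this, of h]
  show "((\<lambda>r. f (g (r + h)) \<bullet> \<phi> - D (g (r + h)) \<bullet> D \<phi>) has_integral (g (t + h) - g (s + h)) \<bullet> \<phi>) {s..t}"
    by simp
qed

text \<open>The product \<open>V (x - y) * V \<phi>\<close> is split evenly and each square is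
  interpolated. A quarter of each squared gradient is affordable: diffusion supplies a half of each,
  so another quarter survives for the energy inequality.\<close>

lemma reaction_bound:
  "\<exists>C>0. \<forall>x\<in>E. \<forall>y\<in>E. \<forall>\<phi>\<in>E. norm x \<le> K \<longrightarrow> norm y \<le> K \<longrightarrow>
     \<bar>(f x - f y) \<bullet> \<phi>\<bar> \<le> (norm (D (x - y)))\<^sup>2 / 4 + (norm (D \<phi>))\<^sup>2 / 4
       + C * ((norm (x - y))\<^sup>2 + (norm \<phi>)\<^sup>2)"
proof -
  obtain C where C: "C \<ge> 0" "\<And>x y \<phi>. x \<in> E \<Longrightarrow> y \<in> E \<Longrightarrow> \<phi> \<in> E \<Longrightarrow> norm x \<le> K \<Longrightarrow> norm y \<le> K \<Longrightarrow>
      \<bar>(f x - f y) \<bullet> \<phi>\<bar> \<le> C * (V (x - y) * V \<phi>)"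
    using f_diff[of K] by blast
  \<comment> \<open>Half of \<open>C + 1\<close> times this \<epsilon> is the quarter in the claim;
    \<open>C + 1\<close> instead of \<open>C\<close> avoids a division by zero.\<close>
  have "0 < 1 / (2 * (C + 1))"
    using C(1) by simp
  then obtain C' where C': "C' \<ge> 0" "\<And>x. x \<in> E \<Longrightarrow> (V x)\<^sup>2 \<le> 1 / (2 * (C + 1)) * (norm (D x))\<^sup>2 + C' * (norm x)\<^sup>2"
    using V_interp by blast
  show ?thesis
  proof (intro exI[of _ "(C + 1) * C' + 1"] conjI ballI impI)
    show "0 < (C + 1) * C' + 1"
      using C(1) C'(1) by (simp add: add_nonneg_pos)
    fix x y \<phi> assume xy: "x \<in> E" "y \<in> E" "\<phi> \<in> E" "norm x \<le> K" "norm y \<le> K"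
    have "\<bar>(f x - f y) \<bullet> \<phi>\<bar> \<le> C * (V (x - y) * V \<phi>)"
      using C(2) xy by blast
    also have "\<dots> \<le> (C + 1) * (V (x - y) * V \<phi>)"
      using V_nonneg by (intro mult_right_mono) (auto intro: mult_nonneg_nonneg)
    also have "\<dots> \<le> (C + 1) * (((V (x - y))\<^sup>2 + (V \<phi>)\<^sup>2) / 2)"
      using sum_squares_bound[of "V (x - y)" "V \<phi>"] C(1) by (intro mult_left_mono) auto
    also have "\<dots> \<le> (C + 1) * (((1 / (2 * (C + 1)) * (norm (D (x - y)))\<^sup>2 + C' * (norm (x - y))\<^sup>2)
        + (1 / (2 * (C + 1)) * (norm (D \<phi>))\<^sup>2 + C' * (norm \<phi>)\<^sup>2)) / 2)"
      using C'(2)[of "x - y"] C'(2)[of \<phi>] xy C(1) E_diff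
      by (intro mult_left_mono divide_right_mono add_mono) auto
    also have "\<dots> = (norm (D (x - y)))\<^sup>2 / 4 + (norm (D \<phi>))\<^sup>2 / 4
        + (C + 1) * C' / 2 * ((norm (x - y))\<^sup>2 + (norm \<phi>)\<^sup>2)"
    proof -
      have "(C + 1) * (((1 / (2 * (C + 1)) * p + C' * q) + (1 / (2 * (C + 1)) * p' + C' * q')) / 2)
        = p / 4 + p' / 4 + (C + 1) * C' / 2 * (q + q')" for p q p' q' :: real
        using C(1) by (simp add: divide_simps) (simp add: algebra_simps)
      then show ?thesis .
    qed
    also have "\<dots> \<le> (norm (D (x - y)))\<^sup>2 / 4 + (norm (D \<phi>))\<^sup>2 / 4
        + ((C + 1) * C' + 1) * ((norm (x - y))\<^sup>2 + (norm \<phi>)\<^sup>2)"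
    proof -
      have "0 \<le> (C + 1) * C'"
        using C(1) C'(1) by simp
      then show ?thesis
        by (intro add_left_mono mult_right_mono) (linarith, simp)
    qed
    finally show "\<bar>(f x - f y) \<bullet> \<phi>\<bar> \<le> (norm (D (x - y)))\<^sup>2 / 4 + (norm (D \<phi>))\<^sup>2 / 4
        + ((C + 1) * C' + 1) * ((norm (x - y))\<^sup>2 + (norm \<phi>)\<^sup>2)" .
  qed
qed

end

section \<open>The energy inequality for the difference of two bounded solutions\<close>

lemma le_of_le_add_mult:
  fixes A B M :: real
  assumes "\<And>\<nu>. 0 < \<nu> \<Longrightarrow> \<nu> \<le> 1 \<Longrightarrow> A \<le> B + M * \<nu>"
  shows "A \<le> B"
proof (rule ccontr)
  assume "\<not> A \<le> B"
  define m where "m = \<bar>M\<bar> + 1"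
  have m: "m > 0" "M \<le> m"
    by (auto simp: m_def)
  define \<nu> where "\<nu> = min 1 ((A - B) / (2 * m))"
  have \<nu>: "0 < \<nu>" "\<nu> \<le> 1" "\<nu> \<le> (A - B) / (2 * m)"
    using \<open>\<not> A \<le> B\<close> m by (auto simp: \<nu>_def)
  have "M * \<nu> \<le> m * \<nu>"
    using \<nu>(1) m by (intro mult_right_mono) auto
  also have "\<dots> \<le> m * ((A - B) / (2 * m))"
    using \<nu>(3) m by (intro mult_left_mono) auto
  also have "\<dots> = (A - B) / 2"
    using m by simp
  finally show False
    using assms[OF \<nu>(1,2)] \<open>\<not> A \<le> B\<close> by argo
qed

lemma continuous_on_interval_modulus:
  fixes P :: "real \<Rightarrow> 'a::metric_space"
  assumes "continuous_on {0..T} P" "0 < (\<nu>::real)"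
  obtains d where "d > 0" "\<And>x y. x \<in> {0..T} \<Longrightarrow> y \<in> {0..T} \<Longrightarrow> \<bar>x - y\<bar> \<le> d \<Longrightarrow> dist (P x) (P y) \<le> \<nu>"
proof -
  have "uniformly_continuous_on {0..T} P"
    using assms(1) by (intro compact_uniformly_continuous) auto
  then obtain d where "d > 0" "\<And>x y. x \<in> {0..T} \<Longrightarrow> y \<in> {0..T} \<Longrightarrow> dist y x < d \<Longrightarrow> dist (P y) (P x) < \<nu>"
    using \<open>0 < \<nu>\<close> unfolding uniformly_continuous_on_def by metis
  then show ?thesis
    using that[of "d / 2"] by (force simp: dist_real_def dist_commute intro: less_imp_le)
qed

lemma average_bounds:
  fixes F :: "real \<Rightarrow> real"
  assumes "0 \<le> h" "F integrable_on {p..p+h}" "\<And>x. x \<in> {p..p+h} \<Longrightarrow> dist (F x) (F p) \<le> \<nu>"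
  shows "integral {p..p+h} F \<le> h * (F p + \<nu>)" "h * (F p - \<nu>) \<le> integral {p..p+h} F"
proof -
  have "F x \<le> F p + \<nu>" "F p - \<nu> \<le> F x" if "x \<in> {p..p+h}" for x
    using assms(3)[OF that] unfolding dist_real_def by linarith+
  then show "integral {p..p+h} F \<le> h * (F p + \<nu>)" "h * (F p - \<nu>) \<le> integral {p..p+h} F"
    using integral_le_const[OF _ assms(2), of "F p + \<nu>"] integral_ge_const[OF _ assms(2), of "F p - \<nu>"]
      assms(1) by simp_all
qed

context parabolic
begin

context
  fixes g1 g2 :: "real \<Rightarrow> 'h" and K C :: real
  assumes g1: "solution g1" and g2: "solution g2"
    and K1: "\<And>t. 0 \<le> t \<Longrightarrow> norm (g1 t) \<le> K" and K2: "\<And>t. 0 \<le> t \<Longrightarrow> norm (g2 t) \<le> K"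
    and C_pos: "C > 0"
    and C: "\<And>x y \<phi>. x \<in> E \<Longrightarrow> y \<in> E \<Longrightarrow> \<phi> \<in> E \<Longrightarrow> norm x \<le> K \<Longrightarrow> norm y \<le> K \<Longrightarrow>
       \<bar>(f x - f y) \<bullet> \<phi>\<bar> \<le> (norm (D (x - y)))\<^sup>2 / 4 + (norm (D \<phi>))\<^sup>2 / 4
         + C * ((norm (x - y))\<^sup>2 + (norm \<phi>)\<^sup>2)"
begin

definition "\<delta> t = g1 t - g2 t"

lemma \<delta>_weakly_continuous: "weakly_continuous \<delta>"
  using g1 g2 unfolding \<delta>_def[abs_def] solution_def by (blast intro: weakly_continuous_diff)

lemma \<delta>_approx: "approx T \<delta>"
  using g1 g2 unfolding \<delta>_def[abs_def] solution_def by (blast intro: approx_diff)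

lemma \<delta>_bound: "0 \<le> t \<Longrightarrow> norm (\<delta> t) \<le> 2 * K"
  unfolding \<delta>_def using norm_triangle_ineq4[of "g1 t" "g2 t"] K1[of t] K2[of t] by linarith

lemma \<delta>_norm_integrable: "0 \<le> a \<Longrightarrow> (\<lambda>t. (norm (\<delta> t))\<^sup>2) integrable_on {a..b}"
  by (rule weakly_continuous_norm_integrable[OF \<delta>_weakly_continuous \<delta>_bound])

lemma \<delta>_gradient_integrable: "0 \<le> a \<Longrightarrow> (\<lambda>t. (norm (D (\<delta> t)))\<^sup>2) integrable_on {a..b}"
  by (rule integrable_subinterval_real[OF approx_gradient_integrable[OF \<delta>_approx, of b]]) auto

lemma \<delta>_increment:
  assumes "0 \<le> r" "r \<le> t" "\<phi> \<in> E"
  shows "((\<lambda>q. (f (g1 q) - f (g2 q)) \<bullet> \<phi> - (D (g1 q) - D (g2 q)) \<bullet> D \<phi>) has_integral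
           (\<delta> t - \<delta> r) \<bullet> \<phi>) {r..t}"
proof -
  have *: "((\<lambda>q. f (g q) \<bullet> \<phi> - D (g q) \<bullet> D \<phi>) has_integral (g t - g r) \<bullet> \<phi>) {r..t}"
    if "solution g" for g
    using that assms unfolding solution_def by blast
  show ?thesis
    using has_integral_diff[OF *[OF g1] *[OF g2]] by (simp add: \<delta>_def inner_diff_left algebra_simps)
qed

context
  fixes T \<eta> :: real and c e N
  assumes c: "\<And>t. c t \<in> E" "continuous_on {0..T} (\<lambda>t. D (c t))"
    and e: "\<And>t. 0 \<le> (e t::real)" "e integrable_on {0..T}" "integral {0..T} e \<le> \<eta>"
    and N: "negligible N"
    and gN: "\<And>t. t \<in> {0..T} \<Longrightarrow> t \<notin> N \<Longrightarrow> g1 t \<in> E" "\<And>t. t \<in> {0..T} \<Longrightarrow> t \<notin> N \<Longrightarrow> g2 t \<in> E"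
      "\<And>t. t \<in> {0..T} \<Longrightarrow> t \<notin> N \<Longrightarrow> (norm (D (\<delta> t - c t)))\<^sup>2 \<le> e t"
begin

text \<open>Testing the difference equation at time \<open>q\<close> with \<open>\<delta> t\<close>
  costs at most \<open>Q q + Q t\<close> plus a modulus term. The quarter is what remains of the
  half from diffusion after the reaction has taken its share; 3/2 is half the factor 3 from
  splitting \<open>D (\<delta> q) - D (\<delta> t)\<close> through the continuous approximation
  \<open>c\<close>.\<close>

definition "Q t = - (norm (D (\<delta> t)))\<^sup>2 / 4 + C * (norm (\<delta> t))\<^sup>2 + 3 / 2 * e t"

lemma Q_integrable: "0 \<le> a \<Longrightarrow> b \<le> T \<Longrightarrow> Q integrable_on {a..b}"
  unfolding Q_def[abs_def]
  using integrable_subinterval_real[OF e(2), of a b]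
  by (intro integrable_add integrable_on_mult_right integrable_on_divide
      integrable_neg \<delta>_norm_integrable \<delta>_gradient_integrable) auto

lemma energy_increment:
  assumes r: "0 \<le> r" "0 \<le> h" "r + h \<le> T" "r + h \<notin> N"
    and \<omega>: "\<And>q. q \<in> {r..r+h} \<Longrightarrow> norm (D (c q - c (r + h))) \<le> \<omega>"
  shows "(norm (\<delta> (r + h)))\<^sup>2 - (norm (\<delta> r))\<^sup>2 \<le>
         2 * integral {r..r+h} Q + 2 * h * Q (r + h) + 3 * h * \<omega>\<^sup>2"
proof -
  let ?t = "r + h"
  define \<phi> where "\<phi> = \<delta> ?t"
  have \<phi>: "\<phi> \<in> E" "(norm (D (\<phi> - c ?t)))\<^sup>2 \<le> e ?t"
    using gN[of ?t] r by (auto simp: \<phi>_def \<delta>_def E_diff)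
  note inc = \<delta>_increment[OF \<open>0 \<le> r\<close> _ \<phi>(1), of ?t]
  have "(\<delta> ?t - \<delta> r) \<bullet> \<phi> = integral {r..?t} (\<lambda>q. (f (g1 q) - f (g2 q)) \<bullet> \<phi> - (D (g1 q) - D (g2 q)) \<bullet> D \<phi>)"
    using integral_unique[OF inc] r by simp
  also have "\<dots> \<le> integral {r..?t} (\<lambda>q. Q q + (Q ?t + 3 / 2 * \<omega>\<^sup>2))"
  proof (rule integral_mono_negligible[OF _ _ N])
    show "(\<lambda>q. (f (g1 q) - f (g2 q)) \<bullet> \<phi> - (D (g1 q) - D (g2 q)) \<bullet> D \<phi>) integrable_on {r..?t}"
      using has_integral_integrable[OF inc] r by simp
    show "(\<lambda>q. Q q + (Q ?t + 3 / 2 * \<omega>\<^sup>2)) integrable_on {r..?t}"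
      using r by (intro integrable_add Q_integrable) (auto simp: integrable_const_ivl)
    fix q assume "q \<in> {r..?t} - N"
    then have q: "q \<in> {0..T}" "q \<notin> N" "q \<in> {r..?t}" "0 \<le> q"
      using r by auto
    note Eq = gN(1)[OF q(1,2)] gN(2)[OF q(1,2)]
    have \<delta>q: "\<delta> q \<in> E" "D (g1 q) - D (g2 q) = D (\<delta> q)"
      using Eq by (simp_all add: \<delta>_def E_diff D_diff)
    have "D (\<delta> q) - D \<phi> = D (\<delta> q - c q) + D (c q - c ?t) + D (c ?t - \<phi>)"
      using \<delta>q \<phi> c(1) by (simp add: D_diff)
    then have "(norm (D (\<delta> q) - D \<phi>))\<^sup>2 \<le>
        3 * (norm (D (\<delta> q - c q)))\<^sup>2 + 3 * (norm (D (c q - c ?t)))\<^sup>2 + 3 * (norm (D (c ?t - \<phi>)))\<^sup>2"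
      using norm_add3_sq_le by metis
    also have "\<dots> \<le> 3 * e q + 3 * \<omega>\<^sup>2 + 3 * e ?t"
    proof -
      have "norm (D (c ?t - \<phi>)) = norm (D (\<phi> - c ?t))"
        using \<phi> c(1) by (simp add: D_diff norm_minus_commute)
      then show ?thesis
        using gN(3)[OF q(1,2)] \<phi>(2) power_mono[OF \<omega>[OF q(3)] norm_ge_zero, of 2] by simp
    qed
    finally have 1: "(norm (D (\<delta> q) - D \<phi>))\<^sup>2 \<le> 3 * e q + 3 * \<omega>\<^sup>2 + 3 * e ?t" .
    have 2: "- (D (\<delta> q) \<bullet> D \<phi>) = ((norm (D (\<delta> q) - D \<phi>))\<^sup>2 - (norm (D (\<delta> q)))\<^sup>2 - (norm (D \<phi>))\<^sup>2) / 2"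
      using dot_norm_neg[of "D (\<delta> q)" "D \<phi>"] by simp
    have 3: "(f (g1 q) - f (g2 q)) \<bullet> \<phi> \<le> (norm (D (\<delta> q)))\<^sup>2 / 4 + (norm (D \<phi>))\<^sup>2 / 4
        + C * ((norm (\<delta> q))\<^sup>2 + (norm \<phi>)\<^sup>2)"
      using C[OF Eq \<phi>(1) K1[OF q(4)] K2[OF q(4)]] unfolding \<delta>_def[of q] by linarith
    show "(f (g1 q) - f (g2 q)) \<bullet> \<phi> - (D (g1 q) - D (g2 q)) \<bullet> D \<phi> \<le> Q q + (Q ?t + 3 / 2 * \<omega>\<^sup>2)"
      using 1 2 3 unfolding \<delta>q(2) Q_def \<phi>_def[symmetric] by (simp add: algebra_simps)
  qed
  also have "\<dots> = integral {r..?t} Q + h * (Q ?t + 3 / 2 * \<omega>\<^sup>2)"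
    using r by (subst integral_add) (auto simp: integrable_const_ivl intro!: Q_integrable)
  finally have "(\<delta> ?t - \<delta> r) \<bullet> \<phi> \<le> integral {r..?t} Q + h * (Q ?t + 3 / 2 * \<omega>\<^sup>2)" .
  moreover have "(norm (\<delta> ?t))\<^sup>2 - (norm (\<delta> r))\<^sup>2 \<le> 2 * ((\<delta> ?t - \<delta> r) \<bullet> \<phi>)"
    using norm_sq_ge_tangent[of "\<delta> r" "\<delta> ?t"]
    unfolding \<phi>_def inner_diff_left power2_norm_eq_inner[of "\<delta> ?t"] by argo
  ultimately show ?thesis
    by (simp add: algebra_simps)
qed

lemma energy_averages:
  assumes a: "0 \<le> a" "a \<le> b" "0 \<le> h" "b + h \<le> T"
    and \<omega>: "\<And>p q. p \<in> {0..T} \<Longrightarrow> q \<in> {0..T} \<Longrightarrow> \<bar>p - q\<bar> \<le> h \<Longrightarrow> norm (D (c p - c q)) \<le> \<omega>"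
  defines "P \<equiv> \<lambda>x. integral {0..x} Q" and "y \<equiv> \<lambda>t. (norm (\<delta> t))\<^sup>2"
  shows "integral {b..b+h} y - integral {a..a+h} y \<le>
         2 * (integral {b..b+h} P - integral {a..a+h} P) + 2 * h * (P (b + h) - P (a + h))
           + 3 * h * (b - a) * \<omega>\<^sup>2"
proof -
  have y: "y integrable_on {p..q}" if "0 \<le> p" for p q
    using \<delta>_norm_integrable[OF that] unfolding y_def .
  have P: "continuous_on {0..T} P"
    unfolding P_def by (intro indefinite_integral_continuous_1 Q_integrable) auto
  then have P': "P integrable_on {p..q}" if "0 \<le> p" "q \<le> T" for p q
    using that by (intro integrable_continuous_interval) (auto elim: continuous_on_subset)
  have ny: "(\<lambda>r. y (r + h) - y r) integrable_on {a..b}"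
    using a by (intro integrable_diff integrable_on_shift y) auto
  have nP: "(\<lambda>r. 2 * (P (r + h) - P r)) integrable_on {a..b}"
    using a by (intro integrable_on_mult_right integrable_diff integrable_on_shift P') auto
  have nQ: "(\<lambda>r. 2 * h * Q (r + h)) integrable_on {a..b}"
    using a by (intro integrable_on_mult_right integrable_on_shift Q_integrable) auto
  have "integral {b..b+h} y - integral {a..a+h} y = integral {a..b} (\<lambda>r. y (r + h) - y r)"
    using a integral_shift_diff[OF a(2,3) y] by (subst integral_diff) (auto intro!: integrable_on_shift y)
  also have "\<dots> \<le> integral {a..b} (\<lambda>r. 2 * (P (r + h) - P r) + (2 * h * Q (r + h) + 3 * h * \<omega>\<^sup>2))"
  proof (rule integral_mono_negligible)
    show "negligible ((+) (- h) ` N)"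
      using N by (rule negligible_translation)
    fix r assume r: "r \<in> {a..b} - (+) (- h) ` N"
    then have rN: "r + h \<notin> N"
      by (auto simp: image_iff)
    have "integral {r..r+h} Q = P (r + h) - P r"
      using Henstock_Kurzweil_Integration.integral_combine[of 0 r "r + h" Q] Q_integrable[of 0 "r + h"] a r
      unfolding P_def by auto
    then show "y (r + h) - y r \<le> 2 * (P (r + h) - P r) + (2 * h * Q (r + h) + 3 * h * \<omega>\<^sup>2)"
      using energy_increment[of r h \<omega>] rN a r \<omega> unfolding y_def by auto
  qed (use ny nP nQ in \<open>auto intro!: integrable_add simp: integrable_const_ivl\<close>)
  also have "\<dots> = integral {a..b} (\<lambda>r. 2 * (P (r + h) - P r))
      + (integral {a..b} (\<lambda>r. 2 * h * Q (r + h)) + integral {a..b} (\<lambda>_. 3 * h * \<omega>\<^sup>2))"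
    using nP nQ by (subst integral_add, (auto intro!: integrable_add simp: integrable_const_ivl)[2])+ simp
  also have "integral {a..b} (\<lambda>r. 2 * (P (r + h) - P r)) = 2 * (integral {b..b+h} P - integral {a..a+h} P)"
    using a integral_shift_diff[OF a(2,3) P'] by (simp only: integral_mult_right, subst integral_diff)
      (auto intro!: integrable_on_shift P')
  also have "integral {a..b} (\<lambda>r. 2 * h * Q (r + h)) = 2 * h * (P (b + h) - P (a + h))"
    using Henstock_Kurzweil_Integration.integral_combine[of 0 "a + h" "b + h" Q] Q_integrable[of 0 "b + h"] a
    by (simp only: integral_mult_right integral_shift_eq P_def) auto
  finally show ?thesis
    using a by (simp add: algebra_simps)
qed

text \<open>As \<open>h\<close> tends to zero, the average near \<open>b\<close> is bounded below by
  the value at \<open>b\<close>, by weak lower semicontinuity. Near the starting time no matching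
  upper bound is available, so the starting time is itself averaged over \<open>[s, t]\<close>;
  hence the factor \<open>t - s\<close> and the integral of the squared norm on the right. The
  constants are four times those of \<open>X\<close>, which gives the gradient integral coefficient
  one.\<close>

lemma energy_inequality_approx:
  assumes st: "0 \<le> s" "s \<le> t" "t \<le> b" "b + 1 \<le> T"
  shows "(t - s) * ((norm (\<delta> b))\<^sup>2 + integral {t..b} (\<lambda>r. (norm (D (\<delta> r)))\<^sup>2)) \<le>
    integral {s..t} (\<lambda>r. (norm (\<delta> r))\<^sup>2)
      + (t - s) * (4 * C * integral {s..b} (\<lambda>r. (norm (\<delta> r))\<^sup>2) + 6 * \<eta>)"
proof -
  define y where "y = (\<lambda>t. (norm (\<delta> t))\<^sup>2)"
  define n where "n = (\<lambda>t. (norm (D (\<delta> t)))\<^sup>2)"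
  define P where "P x = integral {0..x} Q" for x
  define Z where "Z x = integral {0..x} y" for x
  define X where "X = - integral {t..b} n / 4 + C * integral {s..b} y + 3 / 2 * \<eta>"
  have y_int: "y integrable_on {p..q}" if "0 \<le> p" for p q
    using \<delta>_norm_integrable[OF that] unfolding y_def .
  have n_int: "n integrable_on {p..q}" if "0 \<le> p" for p q
    using \<delta>_gradient_integrable[OF that] unfolding n_def .
  have P_cont: "continuous_on {0..T} P"
    unfolding P_def by (intro indefinite_integral_continuous_1 Q_integrable) auto
  have Z_cont: "continuous_on {0..T} Z"
    unfolding Z_def by (intro indefinite_integral_continuous_1 y_int) auto
  have P_int: "P integrable_on {p..q}" if "0 \<le> p" "q \<le> T" for p q
    using that P_cont by (intro integrable_continuous_interval) (auto elim: continuous_on_subset)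
  have Z_int: "Z integrable_on {p..q}" if "0 \<le> p" "q \<le> T" for p q
    using that Z_cont by (intro integrable_continuous_interval) (auto elim: continuous_on_subset)
  \<comment> \<open>Continuity of the tangent at \<open>\<delta> b\<close> yields the lower bound
    \<open>y b - 2 * \<nu>\<close> for the squared norm on \<open>[b, b + h]\<close>.\<close>
  have weak: "continuous_on {0..T} (\<lambda>q. \<delta> q \<bullet> \<delta> b)"
    using \<delta>_weakly_continuous st unfolding weakly_continuous_def
    by (meson atLeastAtMost_iff atLeast_iff continuous_on_subset order_trans subsetI)
  have PX: "P b - P a \<le> X" if a: "a \<in> {s..t}" for a
  proof -
    have "P b - P a = integral {a..b} Q"
      using Henstock_Kurzweil_Integration.integral_combine[of 0 a b Q] Q_integrable[of 0 b] a st
      unfolding P_def by auto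
    also have "\<dots> = - integral {a..b} n / 4 + C * integral {a..b} y + 3 / 2 * integral {a..b} e"
    proof -
      have "((\<lambda>r. - n r / 4 + C * y r + 3 / 2 * e r) has_integral
          (- integral {a..b} n / 4 + C * integral {a..b} y + 3 / 2 * integral {a..b} e)) {a..b}"
        using n_int[of a b] y_int[of a b] integrable_subinterval_real[OF e(2), of a b] a st
        by (intro has_integral_add has_integral_mult_right has_integral_divide has_integral_neg
            integrable_integral) auto
      from integral_unique[OF this] show ?thesis
        unfolding Q_def[abs_def] n_def y_def .
    qed
    also have "\<dots> \<le> X"
    proof -
      have "integral {t..b} n \<le> integral {a..b} n"
        using a st by (intro integral_mono_interval n_int) (auto simp: n_def)
      moreover have "integral {a..b} y \<le> integral {s..b} y"
        using a st by (intro integral_mono_interval y_int) (auto simp: y_def)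
      moreover have "integral {a..b} e \<le> integral {0..T} e"
        using a st e by (intro integral_mono_interval) auto
      ultimately show ?thesis
        using C_pos e(3) unfolding X_def by (intro add_mono mult_left_mono) auto
    qed
    finally show ?thesis .
  qed
  \<comment> \<open>The error budget: 8 from averaging and shifting \<open>P\<close>,
    \<open>3 * T\<close> from the modulus of \<open>D (c t)\<close>, 2 from the lower bound at
    \<open>b\<close>, and the separate 2 from the two averages of \<open>Z\<close>.\<close>
  have "(t - s) * y b \<le> (integral {s..t} y + (t - s) * (4 * X)) + (2 + (t - s) * (10 + 3 * T)) * \<nu>"
    if \<nu>: "0 < \<nu>" "\<nu> \<le> 1" for \<nu>
  proof -
    obtain d1 where d1: "d1 > 0" "\<And>p q. p \<in> {0..T} \<Longrightarrow> q \<in> {0..T} \<Longrightarrow> \<bar>p - q\<bar> \<le> d1 \<Longrightarrow> dist (P p) (P q) \<le> \<nu>"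
      using continuous_on_interval_modulus[OF P_cont \<nu>(1)] by blast
    obtain d2 where d2: "d2 > 0" "\<And>p q. p \<in> {0..T} \<Longrightarrow> q \<in> {0..T} \<Longrightarrow> \<bar>p - q\<bar> \<le> d2 \<Longrightarrow> dist (Z p) (Z q) \<le> \<nu>"
      using continuous_on_interval_modulus[OF Z_cont \<nu>(1)] by blast
    obtain d3 where d3: "d3 > 0" "\<And>p q. p \<in> {0..T} \<Longrightarrow> q \<in> {0..T} \<Longrightarrow> \<bar>p - q\<bar> \<le> d3 \<Longrightarrow> dist (D (c p)) (D (c q)) \<le> \<nu>"
      using continuous_on_interval_modulus[OF c(2) \<nu>(1)] by blast
    obtain d4 where d4: "d4 > 0" "\<And>p q. p \<in> {0..T} \<Longrightarrow> q \<in> {0..T} \<Longrightarrow> \<bar>p - q\<bar> \<le> d4 \<Longrightarrow> dist (\<delta> p \<bullet> \<delta> b) (\<delta> q \<bullet> \<delta> b) \<le> \<nu>"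
      using continuous_on_interval_modulus[OF weak \<nu>(1)] by blast
    \<comment> \<open>The bound 1 keeps the windows that start at \<open>b\<close> inside
      \<open>[0, T]\<close>, since \<open>b + 1 \<le> T\<close>.\<close>
    define h where "h = min 1 (min (min d1 d2) (min d3 d4))"
    have h: "0 < h" "h \<le> 1" "h \<le> d1" "h \<le> d2" "h \<le> d3" "h \<le> d4"
      using d1 d2 d3 d4 by (auto simp: h_def)
    have hT: "b + h \<le> T" "0 \<le> T"
      using h st by auto
    have c_mod: "norm (D (c p - c q)) \<le> \<nu>" if "p \<in> {0..T}" "q \<in> {0..T}" "\<bar>p - q\<bar> \<le> h" for p q
      using d3(2)[of p q] that h by (simp add: D_diff c(1) dist_norm)
    have avg_P: "integral {p..p+h} P \<le> h * (P p + \<nu>)" "h * (P p - \<nu>) \<le> integral {p..p+h} P"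
      if "0 \<le> p" "p + h \<le> T" for p
      by (rule average_bounds[OF _ P_int d1(2)]; use that h in auto)+
    have avg_Z: "integral {p..p+h} Z \<le> h * (Z p + \<nu>)" "h * (Z p - \<nu>) \<le> integral {p..p+h} Z"
      if "0 \<le> p" "p + h \<le> T" for p
      by (rule average_bounds[OF _ Z_int d2(2)]; use that h in auto)+
    have step: "integral {b..b+h} y \<le> (Z (a + h) - Z a) + h * (4 * X + (8 + 3 * T) * \<nu>)"
      if a: "a \<in> {s..t}" for a
    proof -
      have a': "0 \<le> a" "a \<le> b" "a + h \<le> T" "b - a \<le> T"
        using a st hT by auto
      have "integral {a..a+h} y = Z (a + h) - Z a"
        using Henstock_Kurzweil_Integration.integral_combine[of 0 a "a + h" y] y_int[of 0 "a + h"] a' h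
        unfolding Z_def by auto
      moreover have "integral {b..b+h} y - integral {a..a+h} y \<le>
         2 * (integral {b..b+h} P - integral {a..a+h} P) + 2 * h * (P (b + h) - P (a + h))
           + 3 * h * (b - a) * \<nu>\<^sup>2"
        using energy_averages[OF a'(1,2) _ hT(1) c_mod] h unfolding y_def P_def by auto
      moreover have "2 * (integral {b..b+h} P - integral {a..a+h} P) \<le> 2 * (h * (P b + \<nu>) - h * (P a - \<nu>))"
        using avg_P(1)[of b] avg_P(2)[of a] a' hT by (intro mult_left_mono diff_mono) auto
      moreover have "2 * h * (P (b + h) - P (a + h)) \<le> 2 * h * ((P b + \<nu>) - (P a - \<nu>))"
        using d1(2)[of "b + h" b] d1(2)[of "a + h" a] a' h hT
        by (intro mult_left_mono diff_mono) (auto simp: dist_real_def abs_le_iff)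
      moreover have "3 * h * (b - a) * \<nu>\<^sup>2 \<le> 3 * h * T * \<nu>"
      proof -
        have "\<nu>\<^sup>2 \<le> \<nu>"
          using \<nu> by (simp add: power2_eq_square mult_left_le)
        then show ?thesis
          using a' h hT by (intro mult_mono) auto
      qed
      moreover have "h * (4 * (P b - P a)) \<le> h * (4 * X)"
        using PX[OF a] h by (intro mult_left_mono) auto
      ultimately show ?thesis
        by (simp add: algebra_simps)
    qed
    have lower: "h * (y b - 2 * \<nu>) \<le> integral {b..b+h} y"
    proof -
      have "y b - 2 * \<nu> \<le> y q" if "q \<in> {b..b+h}" for q
      proof -
        have "\<bar>\<delta> q \<bullet> \<delta> b - \<delta> b \<bullet> \<delta> b\<bar> \<le> \<nu>"
          using d4(2)[of q b] that h hT st by (auto simp: dist_real_def)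
        then show ?thesis
          using norm_sq_ge_tangent[of "\<delta> q" "\<delta> b"]
          unfolding y_def power2_norm_eq_inner[of "\<delta> b"] by argo
      qed
      then show ?thesis
        using integral_ge_const[of b "b + h" y "y b - 2 * \<nu>"] y_int[of b "b + h"] st h by auto
    qed
    have Z_diff: "(\<lambda>a. Z (a + h) - Z a) integrable_on {s..t}"
      using integrable_diff[OF integrable_on_shift[OF Z_int[of "s + h" "t + h"]] Z_int[of s t]] st hT h
      by simp
    have "(t - s) * (h * (y b - 2 * \<nu>)) \<le> (t - s) * integral {b..b+h} y"
      using lower st by (intro mult_left_mono) auto
    \<comment> \<open>The average near \<open>b\<close> does not depend on the starting time
      \<open>a\<close>, so integrating over \<open>a\<close> only reproduces the factor
      \<open>t - s\<close>.\<close>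
    also have "\<dots> = integral {s..t} (\<lambda>a. integral {b..b+h} y)"
      using st by simp
    also have "\<dots> \<le> integral {s..t} (\<lambda>a. (Z (a + h) - Z a) + h * (4 * X + (8 + 3 * T) * \<nu>))"
    proof (rule integral_le)
      show "(\<lambda>a. (Z (a + h) - Z a) + h * (4 * X + (8 + 3 * T) * \<nu>)) integrable_on {s..t}"
        by (intro integrable_add[OF Z_diff] integrable_const_ivl)
    qed (use step in \<open>auto simp: integrable_const_ivl\<close>)
    also have "\<dots> = integral {s..t} (\<lambda>a. Z (a + h) - Z a) + (t - s) * (h * (4 * X + (8 + 3 * T) * \<nu>))"
      using st Z_diff by (subst integral_add) (simp_all add: integrable_const_ivl)
    also have "integral {s..t} (\<lambda>a. Z (a + h) - Z a) = integral {t..t+h} Z - integral {s..s+h} Z"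
      using st hT h integral_shift_diff[of s t h Z] Z_int[of s "t + h"]
        integral_diff[OF integrable_on_shift[OF Z_int[of "s + h" "t + h"]] Z_int[of s t]]
      by simp
    also have "\<dots> \<le> h * (Z t + \<nu>) - h * (Z s - \<nu>)"
      using avg_Z(1)[of t] avg_Z(2)[of s] st hT by (intro diff_mono) auto
    also have "h * (Z t + \<nu>) - h * (Z s - \<nu>) + (t - s) * (h * (4 * X + (8 + 3 * T) * \<nu>)) =
        h * (Z t - Z s + (t - s) * (4 * X) + (2 + (t - s) * (8 + 3 * T)) * \<nu>)"
      by (simp add: algebra_simps)
    finally have "h * ((t - s) * (y b - 2 * \<nu>)) \<le>
        h * (Z t - Z s + (t - s) * (4 * X) + (2 + (t - s) * (8 + 3 * T)) * \<nu>)"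
      by (simp add: algebra_simps)
    then have "(t - s) * (y b - 2 * \<nu>) \<le> Z t - Z s + (t - s) * (4 * X) + (2 + (t - s) * (8 + 3 * T)) * \<nu>"
      using h by simp
    moreover have "Z t - Z s = integral {s..t} y"
      using Henstock_Kurzweil_Integration.integral_combine[of 0 s t y] y_int[of 0 t] st
      unfolding Z_def by auto
    ultimately show ?thesis
      by (simp add: algebra_simps)
  qed
  then have "(t - s) * y b \<le> integral {s..t} y + (t - s) * (4 * X)"
    by (rule le_of_le_add_mult)
  then have "(t - s) * (y b + integral {t..b} n) \<le>
      integral {s..t} y + (t - s) * (4 * C * integral {s..b} y + 6 * \<eta>)"
    unfolding X_def by (simp add: algebra_simps)
  then show ?thesis
    unfolding n_def y_def .
qed

end

text \<open>The approximation error \<open>\<eta>\<close> tends to zero. The approximating functions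
  live on \<open>[0, b + 1]\<close>, one unit beyond the last time of interest, to leave room for
  the windows.\<close>

lemma energy_inequality_difference:
  assumes st: "0 \<le> s" "s \<le> t" "t \<le> b"
  shows "(t - s) * ((norm (\<delta> b))\<^sup>2 + integral {t..b} (\<lambda>r. (norm (D (\<delta> r)))\<^sup>2)) \<le>
    integral {s..t} (\<lambda>r. (norm (\<delta> r))\<^sup>2)
      + (t - s) * (4 * C * integral {s..b} (\<lambda>r. (norm (\<delta> r))\<^sup>2))"
proof (rule le_of_le_add_mult)
  fix \<eta> :: real assume \<eta>: "0 < \<eta>"
  obtain c e N where 1: "\<And>t. c t \<in> E" "continuous_on {0..b+1} (\<lambda>t. D (c t))" "\<And>t. 0 \<le> (e t::real)"
    "e integrable_on {0..b+1}" "integral {0..b+1} e \<le> \<eta>" "negligible N"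
    "\<And>t. t \<in> {0..b+1} \<Longrightarrow> t \<notin> N \<Longrightarrow> \<delta> t \<in> E"
    "\<And>t. t \<in> {0..b+1} \<Longrightarrow> t \<notin> N \<Longrightarrow> (norm (D (\<delta> t - c t)))\<^sup>2 \<le> e t"
    using approxE[OF \<delta>_approx \<eta>, of "b+1"] by blast
  have "approx (b+1) g1" "approx (b+1) g2"
    using g1 g2 by (auto simp: solution_def)
  then obtain N1 N2 where 2: "negligible N1" "\<And>t. t \<in> {0..b+1} \<Longrightarrow> t \<notin> N1 \<Longrightarrow> g1 t \<in> E"
    "negligible N2" "\<And>t. t \<in> {0..b+1} \<Longrightarrow> t \<notin> N2 \<Longrightarrow> g2 t \<in> E"
    using approxE[OF _ \<eta>] by metis
  have "negligible (N \<union> N1 \<union> N2)"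
    using 1 2 by auto
  from energy_inequality_approx[OF 1(1-5) this _ _ _ st order_refl] 1(8) 2(2,4)
  show "(t - s) * ((norm (\<delta> b))\<^sup>2 + integral {t..b} (\<lambda>r. (norm (D (\<delta> r)))\<^sup>2)) \<le>
    integral {s..t} (\<lambda>r. (norm (\<delta> r))\<^sup>2)
      + (t - s) * (4 * C * integral {s..b} (\<lambda>r. (norm (\<delta> r))\<^sup>2)) + 6 * (t - s) * \<eta>"
    by (simp add: algebra_simps)
qed

lemmas energy_inequality = energy_inequality_difference[unfolded \<delta>_def]

end

end

section \<open>Local control of a difference by its mean over an earlier window\<close>

context parabolic
begin

definition bounded_solution :: "real \<Rightarrow> (real \<Rightarrow> 'h) \<Rightarrow> bool" where
  "bounded_solution K g \<longleftrightarrow> solution g \<and> (\<forall>t\<ge>0. norm (g t) \<le> K)"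

lemma bounded_solution_zero: "0 \<le> K \<Longrightarrow> bounded_solution K (\<lambda>_. 0)"
  by (simp add: bounded_solution_def solution_zero)

lemma bounded_solution_shift: "bounded_solution K g \<Longrightarrow> 0 \<le> h \<Longrightarrow> bounded_solution K (\<lambda>t. g (t + h))"
  by (simp add: bounded_solution_def solution_shift)

lemma solution_norm_integrable:
  assumes "bounded_solution K g1" "bounded_solution K g2" "0 \<le> a"
  shows "(\<lambda>r. (norm (g1 r - g2 r))\<^sup>2) integrable_on {a..b}"
proof (rule weakly_continuous_norm_integrable[OF weakly_continuous_diff _ \<open>0 \<le> a\<close>])
  show "norm (g1 t - g2 t) \<le> K + K" if "0 \<le> t" for t
    using assms that norm_triangle_ineq4[of "g1 t" "g2 t"] unfolding bounded_solution_def
    by (meson add_mono order_trans)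
qed (use assms in \<open>auto simp: bounded_solution_def solution_def\<close>)

lemma solution_gradient_integrable:
  assumes "bounded_solution K g1" "bounded_solution K g2" "0 \<le> a"
  shows "(\<lambda>r. (norm (D (g1 r - g2 r)))\<^sup>2) integrable_on {a..b}"
proof -
  have "approx b (\<lambda>r. g1 r - g2 r)"
    using assms by (auto simp: bounded_solution_def solution_def intro: approx_diff)
  from approx_gradient_integrable[OF this] show ?thesis
    by (rule integrable_subinterval_real) (use assms in auto)
qed

text \<open>The hypothesis is a mean over an earlier window because the energy inequality does not
  start from the value at a single time. The same \<open>l\<close> bounds the earlier window and
  measures the controlled one, so that consecutive windows fit together.\<close>

definition locally_controlled :: "real \<Rightarrow> real \<Rightarrow> bool" where
  "locally_controlled K l \<longleftrightarrow> (\<forall>g1 g2 s t A. bounded_solution K g1 \<longrightarrow> bounded_solution K g2 \<longrightarrow>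
     0 \<le> s \<longrightarrow> s < t \<longrightarrow> t - s \<le> l \<longrightarrow> 0 \<le> A \<longrightarrow> integral {s..t} (\<lambda>r. (norm (g1 r - g2 r))\<^sup>2) \<le> (t - s) * A \<longrightarrow>
     (\<forall>b\<in>{t..t+l}. (norm (g1 b - g2 b))\<^sup>2 \<le> 3 * A) \<and>
     integral {t..t+l} (\<lambda>r. (norm (D (g1 r - g2 r)))\<^sup>2) \<le> 3 * A)"

text \<open>The loss of \<open>4 C \<integral> \<parallel>\<delta>\<parallel>\<^sup>2\<close> in the energy inequality is absorbed on time intervals of length
  \<open>l \<le> 1 / (8 C)\<close>.\<close>

lemma local_estimate:
  "\<exists>l>0. l \<le> 1 \<and> locally_controlled K l"
proof -
  obtain C where C: "C > 0" "\<And>x y \<phi>. x \<in> E \<Longrightarrow> y \<in> E \<Longrightarrow> \<phi> \<in> E \<Longrightarrow> norm x \<le> K \<Longrightarrow> norm y \<le> K \<Longrightarrow>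
       \<bar>(f x - f y) \<bullet> \<phi>\<bar> \<le> (norm (D (x - y)))\<^sup>2 / 4 + (norm (D \<phi>))\<^sup>2 / 4
         + C * ((norm (x - y))\<^sup>2 + (norm \<phi>)\<^sup>2)"
    using reaction_bound[of K] by blast
  define l where "l = min 1 (1 / (8 * C))"
  have l: "0 < l" "l \<le> 1" "8 * C * l \<le> 1"
  proof -
    have "8 * C * l \<le> 8 * C * (1 / (8 * C))"
      using C(1) unfolding l_def by (intro mult_left_mono) auto
    then show "8 * C * l \<le> 1"
      using C(1) by simp
  qed (use C(1) in \<open>auto simp: l_def\<close>)
  show ?thesis
    unfolding locally_controlled_def
  proof (intro exI[of _ l] conjI l allI impI)
    fix g1 g2 :: "real \<Rightarrow> 'h" and s t A :: real
    assume g: "bounded_solution K g1" "bounded_solution K g2" and st: "0 \<le> s" "s < t" "t - s \<le> l"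
      and A: "0 \<le> A" "integral {s..t} (\<lambda>r. (norm (g1 r - g2 r))\<^sup>2) \<le> (t - s) * A"
    define y where "y r = (norm (g1 r - g2 r))\<^sup>2" for r
    define n where "n r = (norm (D (g1 r - g2 r)))\<^sup>2" for r
    have y_int: "y integrable_on {p..q}" if "0 \<le> p" for p q
      using solution_norm_integrable[OF g that] unfolding y_def .
    have n_int: "n integrable_on {p..q}" if "0 \<le> p" for p q
      using solution_gradient_integrable[OF g that] unfolding n_def .
    have y_le: "y r \<le> (2 * K)\<^sup>2" if "0 \<le> r" for r
    proof -
      have "norm (g1 r - g2 r) \<le> 2 * K"
        using g that norm_triangle_ineq4[of "g1 r" "g2 r"] unfolding bounded_solution_def by force
      then show ?thesis
        unfolding y_def by (intro power_mono) auto
    qed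
    \<comment> \<open>The supremum over the window is finite because both solutions are bounded.
      Therefore the term \<open>Y / 2\<close> in \<open>main\<close> can be absorbed, which leaves
      \<open>Y \<le> 3 * A\<close>.\<close>
    define Y where "Y = Sup (y ` {t..t+l})"
    have bdd: "bdd_above (y ` {t..t+l})"
      using y_le st by (intro bdd_aboveI2[where M="(2 * K)\<^sup>2"]) auto
    have yY: "y b \<le> Y" if "b \<in> {t..t+l}" for b
      unfolding Y_def using that bdd by (rule cSUP_upper)
    have main: "y b + integral {t..b} n \<le> 3 / 2 * A + Y / 2" if b: "b \<in> {t..t+l}" for b
    proof -
      have "(t - s) * (y b + integral {t..b} n) \<le> integral {s..t} y + (t - s) * (4 * C * integral {s..b} y)"
        using energy_inequality[of g1 g2 K C s t b] g C st b
        unfolding bounded_solution_def y_def n_def by simp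
      also have "\<dots> \<le> (t - s) * A + (t - s) * (4 * C * integral {s..b} y)"
        using A(2) unfolding y_def by simp
      also have "\<dots> = (t - s) * (A + 4 * C * integral {s..b} y)"
        by (simp add: algebra_simps)
      finally have "y b + integral {t..b} n \<le> A + 4 * C * integral {s..b} y"
        using st by simp
      also have "integral {s..b} y \<le> l * A + l * Y"
      proof -
        have "integral {s..b} y = integral {s..t} y + integral {t..b} y"
          using Henstock_Kurzweil_Integration.integral_combine[of s t b y] y_int[of s b] st b by auto
        also have "integral {s..t} y \<le> l * A"
          using A st mult_right_mono[of "t - s" l A] unfolding y_def by linarith
        also have "integral {t..b} y \<le> (b - t) * Y"
          using yY b st by (intro integral_le_const y_int) auto
        also have "(b - t) * Y \<le> l * Y"
        proof (rule mult_right_mono)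
          have "0 \<le> y t"
            by (simp add: y_def)
          then show "0 \<le> Y"
            using yY[of t] l(1) by simp
        qed (use b in auto)
        finally show ?thesis
          by simp
      qed
      also have "4 * C * (l * A + l * Y) = (8 * C * l) * ((A + Y) / 2)"
        by (simp add: algebra_simps)
      also have "\<dots> \<le> 1 * ((A + Y) / 2)"
      proof (rule mult_right_mono[OF l(3)])
        have "0 \<le> y t"
          by (simp add: y_def)
        then show "0 \<le> (A + Y) / 2"
          using yY[of t] l(1) A(1) by simp
      qed
      finally show ?thesis
        using C(1) by (simp add: mult_left_mono field_simps)
    qed
    have "y b \<le> 3 / 2 * A + Y / 2" if "b \<in> {t..t+l}" for b
      using main[OF that] integral_nonneg[OF n_int, of t b] st by (simp add: n_def)
    then have "Y \<le> 3 / 2 * A + Y / 2"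
      unfolding Y_def using l(1) by (intro cSUP_least) auto
    then have Y: "Y \<le> 3 * A"
      by simp
    show "\<forall>b\<in>{t..t+l}. (norm (g1 b - g2 b))\<^sup>2 \<le> 3 * A"
      using yY Y unfolding y_def by force
    have "integral {t..t+l} n \<le> 3 / 2 * A + Y / 2"
    proof -
      have "0 \<le> y (t + l)"
        by (simp add: y_def)
      then show ?thesis
        using main[of "t + l"] l(1) by simp
    qed
    then show "integral {t..t+l} (\<lambda>r. (norm (D (g1 r - g2 r)))\<^sup>2) \<le> 3 * A"
      using Y unfolding n_def by simp
  qed
qed

end

text \<open>A weighted Young inequality with ratio \<open>c / b\<close> is sharp when the two root
  integrals are \<open>b\<close> and \<open>c\<close>. Adding \<open>\<nu>\<close> keeps both
  positive, and \<open>\<nu>\<close> tends to zero at the end.\<close>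

lemma integral_minkowski:
  fixes F G H :: "real \<Rightarrow> real"
  assumes int: "(\<lambda>r. (F r)\<^sup>2) integrable_on S" "(\<lambda>r. (G r)\<^sup>2) integrable_on S" "(\<lambda>r. (H r)\<^sup>2) integrable_on S"
    and N: "negligible N" "\<And>r. r \<in> S - N \<Longrightarrow> 0 \<le> F r \<and> F r \<le> G r + H r"
  shows "sqrt (integral S (\<lambda>r. (F r)\<^sup>2)) \<le> sqrt (integral S (\<lambda>r. (G r)\<^sup>2)) + sqrt (integral S (\<lambda>r. (H r)\<^sup>2))"
proof (rule le_of_le_add_mult)
  fix \<nu> :: real assume "0 < \<nu>"
  let ?B = "integral S (\<lambda>r. (G r)\<^sup>2)" and ?C = "integral S (\<lambda>r. (H r)\<^sup>2)"
  define b where "b = sqrt ?B + \<nu>"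
  define c where "c = sqrt ?C + \<nu>"
  have BC: "0 \<le> ?B" "0 \<le> ?C"
    using int by (auto intro: integral_nonneg)
  have b: "0 < b" "?B \<le> b\<^sup>2" and c: "0 < c" "?C \<le> c\<^sup>2"
    using BC \<open>0 < \<nu>\<close> by (auto simp: b_def c_def add_nonneg_pos power2_sum)
  have young: "(x + y)\<^sup>2 \<le> (1 + c / b) * x\<^sup>2 + (1 + b / c) * y\<^sup>2" for x y :: real
  proof -
    have "0 \<le> (c * x - b * y)\<^sup>2 / (b * c)"
      using b c by simp
    also have "(c * x - b * y)\<^sup>2 / (b * c) = c / b * x\<^sup>2 + b / c * y\<^sup>2 - 2 * x * y"
      using b(1) c(1) by (simp add: power2_eq_square field_simps)
    finally show ?thesis
      by (simp add: power2_sum algebra_simps)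
  qed
  have "integral S (\<lambda>r. (F r)\<^sup>2) \<le> integral S (\<lambda>r. (1 + c / b) * (G r)\<^sup>2 + (1 + b / c) * (H r)\<^sup>2)"
  proof (rule integral_mono_negligible[OF int(1) _ N(1)])
    show "(\<lambda>r. (1 + c / b) * (G r)\<^sup>2 + (1 + b / c) * (H r)\<^sup>2) integrable_on S"
      using int by (intro integrable_add integrable_on_mult_right)
    show "(F r)\<^sup>2 \<le> (1 + c / b) * (G r)\<^sup>2 + (1 + b / c) * (H r)\<^sup>2" if "r \<in> S - N" for r
    proof -
      have "(F r)\<^sup>2 \<le> (G r + H r)\<^sup>2"
        using N(2)[OF that] by (intro power_mono) auto
      then show ?thesis
        using young by (rule order_trans)
    qed
  qed
  also have "\<dots> = (1 + c / b) * ?B + (1 + b / c) * ?C"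
    using int by (subst integral_add) (auto intro!: integrable_on_mult_right)
  also have "\<dots> \<le> (1 + c / b) * b\<^sup>2 + (1 + b / c) * c\<^sup>2"
    using b c by (intro add_mono mult_left_mono) auto
  also have "\<dots> = (b + c)\<^sup>2"
    using b(1) c(1) by (simp add: power2_eq_square field_simps)
  finally have "sqrt (integral S (\<lambda>r. (F r)\<^sup>2)) \<le> b + c"
    using b(1) c(1) by (intro real_le_lsqrt) auto
  then show "sqrt (integral S (\<lambda>r. (F r)\<^sup>2)) \<le> sqrt ?B + sqrt ?C + 2 * \<nu>"
    by (simp add: b_def c_def)
qed

section \<open>Time increments of bounded solutions and gradient bounds at single times\<close>

context parabolic
begin

text \<open>The increment is tested with itself. The weight in Young's inequality trades the
  gradient of the trajectory, at a cost proportional to \<open>p\<close>, against the gradient of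
  the increment, at a cost \<open>h / p\<close>; the parameter \<open>p\<close> stays free so that
  the two can be balanced later.\<close>

lemma solution_increment_bound:
  "\<exists>B\<ge>0. \<forall>g s h p. bounded_solution K g \<longrightarrow> 0 \<le> s \<longrightarrow> 0 < h \<longrightarrow> h \<le> p \<longrightarrow> g s \<in> E \<longrightarrow> g (s + h) \<in> E \<longrightarrow>
     (norm (g (s + h) - g s))\<^sup>2 \<le> B * p * integral {s..s+h} (\<lambda>r. (norm (D (g r)))\<^sup>2 + 1)
       + 2 * (h / p) * (norm (D (g (s + h) - g s)))\<^sup>2"
proof -
  obtain C where C: "C \<ge> 0" "\<And>x y \<phi>. x \<in> E \<Longrightarrow> y \<in> E \<Longrightarrow> \<phi> \<in> E \<Longrightarrow> norm x \<le> K \<Longrightarrow> norm y \<le> K \<Longrightarrow>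
      \<bar>(f x - f y) \<bullet> \<phi>\<bar> \<le> C * (V (x - y) * V \<phi>)"
    using f_diff[of K] by blast
  obtain C' where C': "C' \<ge> 0" "\<And>x. x \<in> E \<Longrightarrow> (V x)\<^sup>2 \<le> (norm (D x))\<^sup>2 + C' * (norm x)\<^sup>2"
    using V_interp[of 1] by auto
  define B where "B = C\<^sup>2 + 1 + C\<^sup>2 * C' * K\<^sup>2"
  have B: "0 \<le> B"
    using C' by (simp add: B_def)
  show ?thesis
  proof (intro exI[of _ "B * (C' + 1)"] conjI allI impI)
    show "0 \<le> B * (C' + 1)"
      using B C' by simp
    fix g s h p
    assume g: "bounded_solution K g" and s: "0 \<le> s" and hp: "0 < h" "h \<le> (p::real)"
      and gE: "g s \<in> E" "g (s + h) \<in> E"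
    define \<phi> where "\<phi> = g (s + h) - g s"
    have \<phi>: "\<phi> \<in> E"
      using gE by (simp add: \<phi>_def E_diff)
    define z where "z = (norm \<phi>)\<^sup>2"
    define n where "n = (norm (D \<phi>))\<^sup>2"
    \<comment> \<open>The factor \<open>C' + 1\<close> together with \<open>h \<le> p\<close> makes
      \<open>h * \<mu> * C'\<close> at most one, so that half of \<open>z\<close> can be absorbed on
      the left.\<close>
    define \<mu> where "\<mu> = 1 / ((C' + 1) * p)"
    have \<mu>: "0 < \<mu>" "h * \<mu> * C' \<le> 1" "1 / \<mu> = (C' + 1) * p" "h * \<mu> \<le> h / p"
    proof -
      have p: "0 < p"
        using hp by simp
      show "0 < \<mu>" "1 / \<mu> = (C' + 1) * p"
        using p C' by (auto simp: \<mu>_def)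
      have "h * \<mu> * C' = (h / p) * (C' / (C' + 1))"
        using p C' by (simp add: \<mu>_def)
      also have "\<dots> \<le> 1 * 1"
        using hp p C' by (intro mult_mono) (auto simp: divide_simps)
      finally show "h * \<mu> * C' \<le> 1"
        by simp
      have "1 / (C' + 1) \<le> 1"
        using C' by simp
      then have "(h / p) * (1 / (C' + 1)) \<le> (h / p) * 1"
        using hp p by (intro mult_left_mono) auto
      then show "h * \<mu> \<le> h / p"
        using p C' by (simp add: \<mu>_def mult.commute)
    qed
    have K: "norm (g r) \<le> K" if "0 \<le> r" for r
      using g that by (auto simp: bounded_solution_def)
    have K0: "0 \<le> K"
      using K[of 0] norm_ge_zero[of "g 0"] by linarith
    let ?N = "\<lambda>r. (norm (D (g r)))\<^sup>2 + 1"
    have N_int: "?N integrable_on {s..s+h}"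
      using solution_gradient_integrable[OF g bounded_solution_zero[OF K0] s, of "s + h"]
      by (intro integrable_add) (auto simp: integrable_const_ivl)
    have "approx (s + h) g"
      using g by (auto simp: bounded_solution_def solution_def)
    then obtain N where N: "negligible N" "\<And>r. r \<in> {0..s+h} \<Longrightarrow> r \<notin> N \<Longrightarrow> g r \<in> E"
      using approxE[of "s + h" g 1] by (metis zero_less_one)
    have inc: "((\<lambda>r. f (g r) \<bullet> \<phi> - D (g r) \<bullet> D \<phi>) has_integral z) {s..s+h}"
      using g s hp \<phi> by (auto simp: bounded_solution_def solution_def z_def \<phi>_def power2_norm_eq_inner)
    have "z = integral {s..s+h} (\<lambda>r. f (g r) \<bullet> \<phi> - D (g r) \<bullet> D \<phi>)"
      using integral_unique[OF inc] by simp
    also have "\<dots> \<le> integral {s..s+h} (\<lambda>r. B / (2 * \<mu>) * ?N r + (\<mu> * n + \<mu> * C' / 2 * z))"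
    proof (rule integral_mono_negligible[OF has_integral_integrable[OF inc] _ N(1)])
      show "(\<lambda>r. B / (2 * \<mu>) * ?N r + (\<mu> * n + \<mu> * C' / 2 * z)) integrable_on {s..s+h}"
        using N_int by (intro integrable_add[OF integrable_on_mult_right]) (auto simp: integrable_const_ivl)
      fix r assume "r \<in> {s..s+h} - N"
      then have r: "g r \<in> E" "0 \<le> r"
        using N(2)[of r] s by auto
      have young: "a * b \<le> a\<^sup>2 / (2 * \<mu>) + \<mu> / 2 * b\<^sup>2" for a b :: real
      proof -
        have "0 \<le> (a - \<mu> * b)\<^sup>2 / (2 * \<mu>)"
          using \<mu> by simp
        also have "\<dots> = a\<^sup>2 / (2 * \<mu>) + \<mu> / 2 * b\<^sup>2 - a * b"
          using \<mu>(1) by (simp add: power2_eq_square field_simps)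
        finally show ?thesis by simp
      qed
      \<comment> \<open>The bound on differences with second argument zero, where \<open>f\<close>
        vanishes.\<close>
      have "f (g r) \<bullet> \<phi> \<le> (C * V (g r)) * V \<phi>"
        using C(2)[OF r(1) E_zero \<phi> K[OF r(2)]] K0 by (simp add: f_zero mult.assoc)
      also have "\<dots> \<le> (C * V (g r))\<^sup>2 / (2 * \<mu>) + \<mu> / 2 * (V \<phi>)\<^sup>2"
        by (rule young)
      also have "\<dots> \<le> C\<^sup>2 * ((norm (D (g r)))\<^sup>2 + C' * K\<^sup>2) / (2 * \<mu>) + \<mu> / 2 * (n + C' * z)"
      proof (intro add_mono divide_right_mono mult_left_mono)
        have "(V (g r))\<^sup>2 \<le> (norm (D (g r)))\<^sup>2 + C' * K\<^sup>2"
          using C'(2)[OF r(1)] mult_left_mono[OF power_mono[OF K[OF r(2)] norm_ge_zero, of 2] C'(1)] by simp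
        then show "(C * V (g r))\<^sup>2 \<le> C\<^sup>2 * ((norm (D (g r)))\<^sup>2 + C' * K\<^sup>2)"
          by (simp add: power_mult_distrib mult_left_mono)
        show "(V \<phi>)\<^sup>2 \<le> n + C' * z"
          using C'(2)[OF \<phi>] by (simp add: n_def z_def)
      qed (use \<mu> in auto)
      finally have 1: "f (g r) \<bullet> \<phi> \<le> C\<^sup>2 * ((norm (D (g r)))\<^sup>2 + C' * K\<^sup>2) / (2 * \<mu>) + \<mu> / 2 * (n + C' * z)" .
      have "- (D (g r) \<bullet> D \<phi>) \<le> norm (D (g r)) * norm (D \<phi>)"
        using Cauchy_Schwarz_ineq2[of "D (g r)" "D \<phi>"] by linarith
      also have "\<dots> \<le> (norm (D (g r)))\<^sup>2 / (2 * \<mu>) + \<mu> / 2 * n"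
        unfolding n_def by (rule young)
      finally have "f (g r) \<bullet> \<phi> - D (g r) \<bullet> D \<phi> \<le>
          C\<^sup>2 * ((norm (D (g r)))\<^sup>2 + C' * K\<^sup>2) / (2 * \<mu>) + \<mu> / 2 * (n + C' * z)
          + ((norm (D (g r)))\<^sup>2 / (2 * \<mu>) + \<mu> / 2 * n)"
        using 1 by simp
      also have "\<dots> = (C\<^sup>2 * ((norm (D (g r)))\<^sup>2 + C' * K\<^sup>2) + (norm (D (g r)))\<^sup>2) / (2 * \<mu>)
          + (\<mu> * n + \<mu> * C' / 2 * z)"
        by (simp add: add_divide_distrib algebra_simps)
      also have "\<dots> \<le> (B * ?N r) / (2 * \<mu>) + (\<mu> * n + \<mu> * C' / 2 * z)"
        using C'(1) \<mu>(1) by (intro add_right_mono divide_right_mono) (auto simp: B_def algebra_simps)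
      finally show "f (g r) \<bullet> \<phi> - D (g r) \<bullet> D \<phi> \<le> B / (2 * \<mu>) * ?N r + (\<mu> * n + \<mu> * C' / 2 * z)"
        by simp
    qed
    also have "\<dots> = B / (2 * \<mu>) * integral {s..s+h} ?N + h * (\<mu> * n + \<mu> * C' / 2 * z)"
    proof -
      have "((\<lambda>r. B / (2 * \<mu>) * ?N r + (\<mu> * n + \<mu> * C' / 2 * z)) has_integral
          (B / (2 * \<mu>) * integral {s..s+h} ?N + (s + h - s) *\<^sub>R (\<mu> * n + \<mu> * C' / 2 * z))) {s..s+h}"
        using N_int hp by (intro has_integral_add has_integral_mult_right integrable_integral has_integral_const_real)
          (auto intro: has_integral_const_real[THEN has_integral_eq_rhs])
      from integral_unique[OF this] show ?thesis
        by simp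
    qed
    also have "\<dots> = (1 / \<mu>) * B * integral {s..s+h} ?N / 2 + (h * \<mu>) * n + (h * \<mu> * C') * z / 2"
      by (simp add: algebra_simps)
    finally have "z \<le> (1 / \<mu>) * B * integral {s..s+h} ?N / 2 + (h * \<mu>) * n + (h * \<mu> * C') * z / 2" .
    moreover have "(h * \<mu> * C') * z \<le> 1 * z"
      using \<mu>(2) by (rule mult_right_mono) (simp add: z_def)
    moreover have "(h * \<mu>) * n \<le> h / p * n"
      using \<mu>(4) by (rule mult_right_mono) (simp add: n_def)
    ultimately have "z \<le> (1 / \<mu>) * B * integral {s..s+h} ?N + 2 * (h / p) * n"
      by argo
    then show "(norm (g (s + h) - g s))\<^sup>2 \<le> B * (C' + 1) * p * integral {s..s+h} ?N
        + 2 * (h / p) * (norm (D (g (s + h) - g s)))\<^sup>2"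
      unfolding \<mu>(3) z_def n_def \<phi>_def by (simp add: mult_ac)
  qed
qed

context
  fixes K l :: real
  assumes K: "0 \<le> K" and l: "0 < l" "l \<le> 1"
    and locally_controlled: "locally_controlled K l"
begin

lemmas local = locally_controlled[unfolded locally_controlled_def, rule_format]

lemma bounded_solution_diff_le:
  assumes "bounded_solution K g1" "bounded_solution K g2" "0 \<le> t"
  shows "norm (g1 t - g2 t) \<le> 2 * K" "(norm (g1 t - g2 t))\<^sup>2 \<le> 4 * K\<^sup>2"
proof -
  show "norm (g1 t - g2 t) \<le> 2 * K"
    using assms norm_triangle_ineq4[of "g1 t" "g2 t"] unfolding bounded_solution_def by force
  from power_mono[OF this, of 2] show "(norm (g1 t - g2 t))\<^sup>2 \<le> 4 * K\<^sup>2"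
    by (simp add: power_mult_distrib)
qed

text \<open>On the earlier window \<open>[t - l, t]\<close> the mean is at most
  \<open>4 * K\<^sup>2\<close>, from twice the H-bound, and the local estimate multiplies this by
  three.\<close>

lemma gradient_difference_bound:
  assumes g: "bounded_solution K g1" "bounded_solution K g2" and t: "l \<le> t"
  shows "integral {t..t+l} (\<lambda>r. (norm (D (g1 r - g2 r)))\<^sup>2) \<le> 12 * K\<^sup>2"
proof -
  have "integral {t-l..t} (\<lambda>r. (norm (g1 r - g2 r))\<^sup>2) \<le> (t - (t - l)) * (4 * K\<^sup>2)"
    using t l bounded_solution_diff_le(2)[OF g]
    by (intro integral_le_const solution_norm_integrable[OF g]) auto
  then show ?thesis
    using local[OF g, of "t - l" t "4 * K\<^sup>2"] t l by auto
qed

lemma gradient_bound: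
  assumes g: "bounded_solution K g" and t: "l \<le> t"
  shows "integral {t..t+l} (\<lambda>r. (norm (D (g r)))\<^sup>2) \<le> 12 * K\<^sup>2"
  using gradient_difference_bound[OF g bounded_solution_zero[OF K] t] by simp

lemma solution_gradient_sq_integrable:
  assumes "bounded_solution K g" "0 \<le> a"
  shows "(\<lambda>r. (norm (D (g r)))\<^sup>2) integrable_on {a..b}"
  using solution_gradient_integrable[OF assms(1) bounded_solution_zero[OF K] assms(2)] by simp

lemma solution_in_E_ae:
  assumes "bounded_solution K g"
  obtains N where "negligible N" "\<And>r. 0 \<le> r \<Longrightarrow> r \<le> T \<Longrightarrow> r \<notin> N \<Longrightarrow> g r \<in> E"
proof -
  have "approx T g"
    using assms by (auto simp: bounded_solution_def solution_def)
  then show ?thesis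
    using approxE[of T g 1] that by (metis atLeastAtMost_iff zero_less_one)
qed

text \<open>Feeding an integral bound on the gradient of a time increment back into the equation
  improves its order; this is used twice, with \<open>p = 1\<close> and \<open>p = \<surd>h\<close>.\<close>

lemma increment_improvement:
  "\<exists>M\<ge>0. \<forall>g h p a \<tau> t. bounded_solution K g \<longrightarrow> 0 < h \<longrightarrow> h \<le> p \<longrightarrow> h \<le> l \<longrightarrow> l \<le> \<tau> \<longrightarrow> 0 \<le> a \<longrightarrow>
     (\<forall>t\<ge>\<tau>. integral {t..t+l} (\<lambda>r. (norm (D (g (r + h) - g r)))\<^sup>2) \<le> a) \<longrightarrow> \<tau> + l \<le> t \<longrightarrow>
     (norm (g (t + h) - g t))\<^sup>2 \<le> M * (p * h + h / p * a) \<and>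
     integral {t..t+l} (\<lambda>r. (norm (D (g (r + h) - g r)))\<^sup>2) \<le> M * (p * h + h / p * a)"
proof -
  obtain B where B: "B \<ge> 0" "\<And>g s h p. bounded_solution K g \<Longrightarrow> 0 \<le> s \<Longrightarrow> 0 < h \<Longrightarrow> h \<le> p \<Longrightarrow> g s \<in> E \<Longrightarrow> g (s + h) \<in> E \<Longrightarrow>
     (norm (g (s + h) - g s))\<^sup>2 \<le> B * p * integral {s..s+h} (\<lambda>r. (norm (D (g r)))\<^sup>2 + 1)
       + 2 * (h / p) * (norm (D (g (s + h) - g s)))\<^sup>2"
    using solution_increment_bound[of K] by blast
  \<comment> \<open>Two windows of length \<open>l\<close>, each contributing at most
    \<open>12 * K\<^sup>2 + 1\<close>.\<close>
  define J where "J = 24 * K\<^sup>2 + 2"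
  \<comment> \<open>The factor \<open>1 / l\<close> turns the integral over
    \<open>[t - l, t]\<close> into a mean, and 3 comes from the local estimate. Using that earlier
    window moves the threshold from \<open>\<tau>\<close> to \<open>\<tau> + l\<close>.\<close>
  define M where "M = 3 / l * (B * J + 2)"
  have J: "0 \<le> J"
    by (simp add: J_def)
  show ?thesis
  proof (intro exI[of _ M] conjI allI impI)
    show "0 \<le> M"
      using l B(1) J by (simp add: M_def)
    fix g h p a \<tau> t
    assume g: "bounded_solution K g" and h: "0 < h" "h \<le> (p::real)" "h \<le> l" and \<tau>: "l \<le> \<tau>" and a: "0 \<le> a"
      and H: "\<forall>t\<ge>\<tau>. integral {t..t+l} (\<lambda>r. (norm (D (g (r + h) - g r)))\<^sup>2) \<le> a" and t: "\<tau> + l \<le> t"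
    have gh: "bounded_solution K (\<lambda>r. g (r + h))"
      using g h by (intro bounded_solution_shift) auto
    let ?n = "\<lambda>r. (norm (D (g (r + h) - g r)))\<^sup>2"
    let ?z = "\<lambda>r. (norm (g (r + h) - g r))\<^sup>2"
    let ?N = "\<lambda>r. (norm (D (g r)))\<^sup>2 + 1"
    \<comment> \<open>With this primitive the integrals over \<open>[r, r + h]\<close> become
      increments, whose integral over the window telescopes to at most \<open>h * J\<close>. This
      gains a factor \<open>h\<close> that no bound at a single \<open>r\<close> provides.\<close>
    define P where "P x = integral {0..x} ?N" for x
    have N_int: "?N integrable_on {u..v}" if "0 \<le> u" for u v
      using solution_gradient_sq_integrable[OF g that, of v] by (intro integrable_add) (auto simp: integrable_const_ivl)
    have P_diff: "integral {u..v} ?N = P v - P u" if "0 \<le> u" "u \<le> v" for u v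
      using Henstock_Kurzweil_Integration.integral_combine[of 0 u v ?N] N_int[of 0 v] that
      unfolding P_def by auto
    have P_mono: "P u \<le> P v" if "0 \<le> u" "u \<le> v" for u v
      using P_diff[OF that] integral_nonneg[OF N_int[OF that(1)], of v] by simp
    have P_int: "P integrable_on {u..v}" if "0 \<le> u" for u v
      unfolding P_def using that
      by (intro integrable_continuous_interval continuous_on_subset[OF indefinite_integral_continuous_1[OF N_int, of 0 v]]) auto
    let ?u = "t - l"
    have u: "0 \<le> ?u" "l \<le> ?u" "\<tau> \<le> ?u"
      using t \<tau> l by auto
    have "P (t + h) - P ?u \<le> J"
    proof -
      have "P (t + h) - P ?u \<le> P (t + l) - P ?u"
        using P_mono[of "t + h" "t + l"] h u l by auto
      also have "\<dots> = integral {?u..?u+l} ?N + integral {t..t+l} ?N"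
        using P_diff[of ?u t] P_diff[of t "t + l"] u l by auto
      also have "integral {v..v+l} ?N \<le> 12 * K\<^sup>2 + 1" if "l \<le> v" for v
      proof -
        have "integral {v..v+l} ?N = integral {v..v+l} (\<lambda>r. (norm (D (g r)))\<^sup>2) + l"
          using that l solution_gradient_sq_integrable[OF g, of v "v + l"]
          by (subst integral_add) (auto simp: integrable_const_ivl)
        then show ?thesis
          using gradient_bound[OF g that] l by simp
      qed
      then have "integral {?u..?u+l} ?N + integral {t..t+l} ?N \<le> J"
        using u l unfolding J_def by (smt (verit, best))
      finally show ?thesis .
    qed
    note PJ = this
    have "integral {?u..t} (\<lambda>r. P (r + h) - P r) = integral {t..t+h} P - integral {?u..?u+h} P"
      using integral_shift_diff[of ?u t h P] P_int[of ?u "t + h"] u l h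
        integral_diff[OF integrable_on_shift[OF P_int[of "?u + h" "t + h"]] P_int[of ?u t]] by simp
    also have "\<dots> \<le> h * P (t + h) - h * P ?u"
      using integral_le_const[of t "t + h" P "P (t + h)"] integral_ge_const[of ?u "?u + h" P "P ?u"]
        P_int[of t "t + h"] P_int[of ?u "?u + h"] P_mono u h l by (intro diff_mono) auto
    also have "\<dots> \<le> h * J"
      using PJ h by (simp add: right_diff_distrib[symmetric])
    finally have P_avg: "integral {?u..t} (\<lambda>r. P (r + h) - P r) \<le> h * J" .
    have n_int: "?n integrable_on {?u..t}"
      using solution_gradient_integrable[OF gh g u(1)] .
    have Pd_int: "(\<lambda>r. P (r + h) - P r) integrable_on {?u..t}"
      using integrable_diff[OF integrable_on_shift[OF P_int[of "?u + h" "t + h"]] P_int[of ?u t]] u h by simp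
    obtain N1 where N1: "negligible N1" "\<And>r. 0 \<le> r \<Longrightarrow> r \<le> t \<Longrightarrow> r \<notin> N1 \<Longrightarrow> g r \<in> E"
      using solution_in_E_ae[OF g] by metis
    obtain N2 where N2: "negligible N2" "\<And>r. 0 \<le> r \<Longrightarrow> r \<le> t \<Longrightarrow> r \<notin> N2 \<Longrightarrow> g (r + h) \<in> E"
      using solution_in_E_ae[OF gh] by metis
    have "integral {?u..t} ?z \<le> integral {?u..t} (\<lambda>r. B * p * (P (r + h) - P r) + 2 * (h / p) * ?n r)"
    proof (rule integral_mono_negligible)
      show "negligible (N1 \<union> N2)"
        using N1 N2 by simp
      show "?z integrable_on {?u..t}"
        using solution_norm_integrable[OF gh g u(1)] .
      show "(\<lambda>r. B * p * (P (r + h) - P r) + 2 * (h / p) * ?n r) integrable_on {?u..t}"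
        by (intro integrable_add integrable_on_mult_right n_int Pd_int)
      fix r assume r: "r \<in> {?u..t} - (N1 \<union> N2)"
      then have "0 \<le> r" "r \<le> t" "g r \<in> E" "g (r + h) \<in> E"
        using u N1(2)[of r] N2(2)[of r] by auto
      then show "?z r \<le> B * p * (P (r + h) - P r) + 2 * (h / p) * ?n r"
        using B(2)[OF g _ h(1,2), of r] P_diff[of r "r + h"] h by simp
    qed
    also have "\<dots> = B * p * integral {?u..t} (\<lambda>r. P (r + h) - P r) + 2 * (h / p) * integral {?u..t} ?n"
      using integral_add[OF integrable_on_mult_right[OF Pd_int, of "B * p"] integrable_on_mult_right[OF n_int, of "2 * (h / p)"]]
      by simp
    also have "\<dots> \<le> B * p * (h * J) + 2 * (h / p) * a"
      using P_avg H u B(1) h by (intro add_mono mult_left_mono) (auto dest!: spec[of _ ?u])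
    also have "\<dots> \<le> (B * J + 2) * (p * h + h / p * a)"
    proof -
      have "0 \<le> B * J * (h / p * a)" "0 \<le> 2 * (p * h)"
        using B(1) J h a by auto
      then show ?thesis
        by (simp add: algebra_simps)
    qed
    finally have z: "integral {?u..t} ?z \<le> (t - ?u) * (1 / l * (B * J + 2) * (p * h + h / p * a))"
      using l by simp
    have A: "0 \<le> 1 / l * (B * J + 2) * (p * h + h / p * a)"
      using l B(1) J h a by auto
    have "M * (p * h + h / p * a) = 3 * (1 / l * (B * J + 2) * (p * h + h / p * a))"
      by (simp add: M_def mult.assoc)
    then show "?z t \<le> M * (p * h + h / p * a)" "integral {t..t+l} ?n \<le> M * (p * h + h / p * a)"
      using local[OF gh g u(1) _ _ A z] l by simp_all
  qed
qed

text \<open>The trivial bound \<open>12 * K\<^sup>2\<close> with \<open>p = 1\<close> yields order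
  \<open>h\<close>. With that as input the two terms are of order \<open>p * h\<close> and
  \<open>h\<^sup>2 / p\<close>, which balance at \<open>p = sqrt h\<close> and yield
  \<open>h * sqrt h\<close>. Each round costs one window, hence the thresholds \<open>2 * l\<close>
  and \<open>3 * l\<close>.\<close>

lemma increment_order:
  "\<exists>M\<ge>0. \<forall>g h t. bounded_solution K g \<longrightarrow> 0 < h \<longrightarrow> h \<le> l \<longrightarrow>
     (2 * l \<le> t \<longrightarrow> (norm (g (t + h) - g t))\<^sup>2 \<le> M * h) \<and>
     (3 * l \<le> t \<longrightarrow> integral {t..t+l} (\<lambda>r. (norm (D (g (r + h) - g r)))\<^sup>2) \<le> M * (h * sqrt h))"
proof -
  obtain M where M: "M \<ge> 0" "\<And>g h p a \<tau> t. bounded_solution K g \<Longrightarrow> 0 < h \<Longrightarrow> h \<le> p \<Longrightarrow> h \<le> l \<Longrightarrow> l \<le> \<tau> \<Longrightarrow> 0 \<le> a \<Longrightarrow>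
     (\<And>t. \<tau> \<le> t \<Longrightarrow> integral {t..t+l} (\<lambda>r. (norm (D (g (r + h) - g r)))\<^sup>2) \<le> a) \<Longrightarrow> \<tau> + l \<le> t \<Longrightarrow>
     (norm (g (t + h) - g t))\<^sup>2 \<le> M * (p * h + h / p * a) \<and>
     integral {t..t+l} (\<lambda>r. (norm (D (g (r + h) - g r)))\<^sup>2) \<le> M * (p * h + h / p * a)"
    using increment_improvement by blast
  define M1 where "M1 = M * (1 + 12 * K\<^sup>2)"
  define M2 where "M2 = M * (1 + M1)"
  have M12: "0 \<le> M1" "0 \<le> M2"
    using M(1) by (auto simp: M1_def M2_def)
  show ?thesis
  proof (intro exI[of _ "M1 + M2"] conjI allI impI)
    show "0 \<le> M1 + M2"
      using M12 by simp
    fix g h t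
    assume g: "bounded_solution K g" and h: "0 < h" "h \<le> l"
    have gh: "bounded_solution K (\<lambda>r. g (r + h))"
      using g h by (intro bounded_solution_shift) auto
    have 1: "(norm (g (t + h) - g t))\<^sup>2 \<le> M1 * h \<and>
       integral {t..t+l} (\<lambda>r. (norm (D (g (r + h) - g r)))\<^sup>2) \<le> M1 * h" if "2 * l \<le> t" for t
    proof -
      have "M * (1 * h + h / 1 * (12 * K\<^sup>2)) = M1 * h"
        by (simp add: M1_def algebra_simps)
      then show ?thesis
        using M(2)[OF g h(1) _ h(2) order_refl _ gradient_difference_bound[OF gh g], of 1 t] that h l by auto
    qed
    then show "2 * l \<le> t \<Longrightarrow> (norm (g (t + h) - g t))\<^sup>2 \<le> (M1 + M2) * h"
      using M12 h by (smt (verit) mult_right_mono)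
    assume t: "3 * l \<le> t"
    have sq: "h / sqrt h = sqrt h" "h \<le> sqrt h"
      using h l by (auto simp: real_div_sqrt intro: real_le_rsqrt simp: power2_eq_square mult_left_le)
    have "integral {t..t+l} (\<lambda>r. (norm (D (g (r + h) - g r)))\<^sup>2) \<le> M * (sqrt h * h + h / sqrt h * (M1 * h))"
      using M(2)[OF g h(1) sq(2) h(2), of "2 * l" "M1 * h" t] 1 M12 h l t by auto
    also have "\<dots> = M2 * (h * sqrt h)"
      unfolding sq(1) by (simp add: M2_def algebra_simps)
    also have "\<dots> \<le> (M1 + M2) * (h * sqrt h)"
      using M12 h by (intro mult_right_mono) auto
    finally show "integral {t..t+l} (\<lambda>r. (norm (D (g (r + h) - g r)))\<^sup>2) \<le> (M1 + M2) * (h * sqrt h)" .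
  qed
qed

text \<open>Squared increments of order \<open>h\<close> make both trajectories Hoelder continuous
  in H with exponent 1/2. The mean of the squared difference over a short window before
  \<open>t\<close> therefore tends to its value at \<open>t\<close>, and the local estimate applies
  with that value.\<close>

lemma gradient_window:
  assumes g: "bounded_solution K g1" "bounded_solution K g2" and t: "3 * l \<le> t"
  shows "integral {t..t+l} (\<lambda>r. (norm (D (g1 r - g2 r)))\<^sup>2) \<le> 3 * (norm (g1 t - g2 t))\<^sup>2"
proof -
  obtain M where M: "M \<ge> 0" "\<And>g h t. bounded_solution K g \<Longrightarrow> 0 < h \<Longrightarrow> h \<le> l \<Longrightarrow> 2 * l \<le> t \<Longrightarrow>
      (norm (g (t + h) - g t))\<^sup>2 \<le> M * h"
    using increment_order by blast
  define w where "w r = g1 r - g2 r" for r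
  let ?c = "3 * (8 * K * sqrt (M * l) + 4 * (M * l))"
  have "integral {t..t+l} (\<lambda>r. (norm (D (w r)))\<^sup>2) \<le> 3 * (norm (w t))\<^sup>2 + ?c * \<nu>" if \<nu>: "0 < \<nu>" "\<nu> \<le> 1" for \<nu>
  proof -
    \<comment> \<open>Quadratic in \<open>\<nu>\<close>, since increments over a time \<sigma> have
      norm of order sqrt \<sigma>.\<close>
    define \<sigma> where "\<sigma> = l * \<nu>\<^sup>2"
    have \<sigma>: "0 < \<sigma>" "\<sigma> \<le> l"
      using l \<nu> by (auto simp: \<sigma>_def mult_left_le power_le_one)
    define \<rho> where "\<rho> = sqrt (M * l) * \<nu>"
    have \<rho>: "0 \<le> \<rho>" "sqrt (M * \<sigma>) = \<rho>" "\<rho>\<^sup>2 \<le> M * l * \<nu>"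
    proof -
      show "0 \<le> \<rho>" "sqrt (M * \<sigma>) = \<rho>"
        using M(1) l \<nu> by (auto simp: \<rho>_def \<sigma>_def real_sqrt_mult)
      have "\<rho>\<^sup>2 = M * l * \<nu>\<^sup>2"
        using M(1) l by (simp add: \<rho>_def power_mult_distrib)
      also have "\<dots> \<le> M * l * \<nu>"
        using M(1) l \<nu> by (intro mult_left_mono) (auto simp: power2_eq_square mult_left_le)
      finally show "\<rho>\<^sup>2 \<le> M * l * \<nu>" .
    qed
    have inc: "norm (g t - g r) \<le> \<rho>" if "bounded_solution K g" "r \<in> {t-\<sigma>..t}" for g r
    proof (cases "r = t")
      case False
      then have "(norm (g (r + (t - r)) - g r))\<^sup>2 \<le> M * (t - r)"
        using that t l \<sigma> by (intro M(2)) auto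
      also have "\<dots> \<le> M * \<sigma>"
        using that M(1) by (intro mult_left_mono) auto
      finally have "norm (g t - g r) \<le> sqrt (M * \<sigma>)"
        by (intro real_le_rsqrt) simp
      then show ?thesis
        using \<rho> by simp
    qed (use \<rho> in simp)
    define A where "A = (norm (w t))\<^sup>2 + ?c / 3 * \<nu>"
    have "(norm (w r))\<^sup>2 \<le> A" if r: "r \<in> {t-\<sigma>..t}" for r
    proof -
      have "norm (w r) = norm (w t - (g1 t - g1 r) + (g2 t - g2 r))"
        by (simp add: w_def)
      then have "norm (w r) \<le> norm (w t) + norm (g1 t - g1 r) + norm (g2 t - g2 r)"
        using norm_triangle_ineq[of "w t - (g1 t - g1 r)" "g2 t - g2 r"] norm_triangle_ineq4[of "w t" "g1 t - g1 r"]
        by linarith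
      also have "\<dots> \<le> norm (w t) + 2 * \<rho>"
        using inc[OF g(1) r] inc[OF g(2) r] by simp
      finally have "(norm (w r))\<^sup>2 \<le> (norm (w t) + 2 * \<rho>)\<^sup>2"
        by (intro power_mono) auto
      also have "\<dots> = (norm (w t))\<^sup>2 + 4 * (norm (w t) * \<rho>) + 4 * \<rho>\<^sup>2"
        by (simp add: power2_eq_square algebra_simps)
      also have "\<dots> \<le> (norm (w t))\<^sup>2 + 4 * (2 * K * \<rho>) + 4 * (M * l * \<nu>)"
        using \<rho> bounded_solution_diff_le(1)[OF g, of t] t l unfolding w_def
        by (intro add_mono mult_left_mono mult_right_mono) auto
      also have "\<dots> = A"
        by (simp add: A_def \<rho>_def algebra_simps)
      finally show ?thesis .
    qed
    then have "integral {t-\<sigma>..t} (\<lambda>r. (norm (w r))\<^sup>2) \<le> (t - (t - \<sigma>)) * A"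
      using t l \<sigma> solution_norm_integrable[OF g, of "t - \<sigma>" t] unfolding w_def
      by (intro integral_le_const) auto
    moreover have "0 \<le> A"
      using M(1) l K \<nu> by (auto simp: A_def)
    ultimately have "integral {t..t+l} (\<lambda>r. (norm (D (w r)))\<^sup>2) \<le> 3 * A"
      using local[OF g, of "t - \<sigma>" t A] t l \<sigma> unfolding w_def by auto
    then show ?thesis
      by (simp add: A_def)
  qed
  then show ?thesis
    unfolding w_def by (rule le_of_le_add_mult)
qed

text \<open>With \<open>q k\<close> the root mean square of \<open>\<parallel>D w\<parallel>\<close> over \<open>[t, t + l / 2 ^ k]\<close>, comparing the two halves
  of an interval gives \<open>q (k + 1) \<le> q k + C \<theta> ^ k\<close>. Hence \<open>q\<close> stays bounded and \<open>w t \<in> E\<close>.\<close>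

lemma pointwise_gradient:
  "\<exists>M\<ge>0. \<forall>g1 g2 t k. bounded_solution K g1 \<longrightarrow> bounded_solution K g2 \<longrightarrow> 3 * l \<le> t \<longrightarrow>
     g1 t - g2 t \<in> E \<and>
     norm (D (g1 t - g2 t)) \<le> sqrt (3 * 2 ^ k / l) * norm (g1 t - g2 t) + M * sqrt (sqrt (1 / 2)) ^ k"
proof -
  obtain M where M: "M \<ge> 0" "\<And>g h t. bounded_solution K g \<Longrightarrow> 0 < h \<Longrightarrow> h \<le> l \<Longrightarrow> 2 * l \<le> t \<Longrightarrow>
      (norm (g (t + h) - g t))\<^sup>2 \<le> M * h"
    "\<And>g h t. bounded_solution K g \<Longrightarrow> 0 < h \<Longrightarrow> h \<le> l \<Longrightarrow> 3 * l \<le> t \<Longrightarrow>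
      integral {t..t+l} (\<lambda>r. (norm (D (g (r + h) - g r)))\<^sup>2) \<le> M * (h * sqrt h)"
    using increment_order by blast
  \<comment> \<open>The error between consecutive scales is of order h^(1/4) for windows of length
    h, so halving the window multiplies it by the fourth root of 1/2.\<close>
  define \<theta> :: real where "\<theta> = sqrt (sqrt (1 / 2))"
  have \<theta>: "0 < \<theta>" "\<theta> < 1"
    by (auto simp: \<theta>_def)
  define R where "R = sqrt M / (1 - \<theta>)"
  have R: "0 \<le> R"
    using M(1) \<theta> by (simp add: R_def)
  show ?thesis
  proof (intro exI[of _ R] conjI allI impI)
    show "0 \<le> R"
      using R .
    fix g1 g2 t k
    assume g: "bounded_solution K g1" "bounded_solution K g2" and t: "3 * l \<le> t"
    define w where "w r = g1 r - g2 r" for r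
    let ?n = "\<lambda>r. norm (D (w r))"
    define L where "L j = l / 2 ^ j" for j :: nat
    have L: "0 < L j" "L j \<le> l" "L (Suc j) * 2 = L j" for j
      using l by (auto simp: L_def divide_simps)
    define A where "A j = integral {t..t + L j} (\<lambda>r. (?n r)\<^sup>2)" for j
    define q where "q j = sqrt (A j / L j)" for j
    have n_int: "(\<lambda>r. (?n r)\<^sup>2) integrable_on {u..v}" if "0 \<le> u" for u v
      using solution_gradient_integrable[OF g that] unfolding w_def .
    have t0: "0 \<le> t"
      using t l by simp
    have A0: "0 \<le> A j" for j
      unfolding A_def using n_int[OF t0] by (rule integral_nonneg) simp
    obtain N1 where N1: "negligible N1" "\<And>r. 0 \<le> r \<Longrightarrow> r \<le> t + l \<Longrightarrow> r \<notin> N1 \<Longrightarrow> g1 r \<in> E"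
      using solution_in_E_ae[OF g(1)] by metis
    obtain N2 where N2: "negligible N2" "\<And>r. 0 \<le> r \<Longrightarrow> r \<le> t + l \<Longrightarrow> r \<notin> N2 \<Longrightarrow> g2 r \<in> E"
      using solution_in_E_ae[OF g(2)] by metis
    have step: "q (Suc j) \<le> q j + sqrt M * \<theta> ^ Suc j" for j
    proof -
      define h where "h = L (Suc j)"
      have h: "0 < h" "h \<le> l" "L j = 2 * h"
        using L[of "Suc j"] L(3)[of j] by (auto simp: h_def)
      have h2: "2 * h \<le> l"
        using L(2)[of j] h by simp
      have gh: "bounded_solution K (\<lambda>r. g1 (r + h))" "bounded_solution K (\<lambda>r. g2 (r + h))"
        using g h by (auto intro: bounded_solution_shift)
      let ?d = "\<lambda>r. norm (D (w (r + h) - w r))"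
      let ?N = "N1 \<union> N2 \<union> (+) (- h) ` (N1 \<union> N2)"
      have N: "negligible ?N"
        using N1(1) N2(1) by (intro negligible_Un negligible_translation) auto
      have wE: "w r \<in> E" "w (r + h) \<in> E" "g1 r \<in> E" "g1 (r + h) \<in> E" "g2 r \<in> E" "g2 (r + h) \<in> E"
        if "r \<in> {t..t + h} - ?N" for r
      proof -
        have "r + h \<notin> N1 \<union> N2"
        proof
          assume "r + h \<in> N1 \<union> N2"
          then have "- h + (r + h) \<in> (+) (- h) ` (N1 \<union> N2)"
            by (rule imageI)
          then show False
            using that by simp
        qed
        then show *: "g1 r \<in> E" "g1 (r + h) \<in> E" "g2 r \<in> E" "g2 (r + h) \<in> E"
          using that N1(2)[of r] N1(2)[of "r + h"] N2(2)[of r] N2(2)[of "r + h"] h h2 t0 by auto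
        show "w r \<in> E" "w (r + h) \<in> E"
          unfolding w_def using * by (auto intro: E_diff)
      qed
      have d1_int: "(\<lambda>r. (norm (D (g1 (r + h) - g1 r)))\<^sup>2) integrable_on {t..v}" for v
        using solution_gradient_integrable[OF gh(1) g(1) t0] .
      have d2_int: "(\<lambda>r. (norm (D (g2 (r + h) - g2 r)))\<^sup>2) integrable_on {t..v}" for v
        using solution_gradient_integrable[OF gh(2) g(2) t0] .
      have d_int: "(\<lambda>r. (?d r)\<^sup>2) integrable_on {t..t+h}"
      proof -
        have "approx (t + h) (\<lambda>r. (g1 (r + h) - g2 (r + h)) - (g1 r - g2 r))"
          using g gh by (intro approx_diff) (auto simp: bounded_solution_def solution_def)
        from approx_gradient_integrable[OF this] show ?thesis
          unfolding w_def by (rule integrable_subinterval_real) (use t0 in auto)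
      qed
      have ns_int: "(\<lambda>r. (?n (r + h))\<^sup>2) integrable_on {t..t+h}"
        using integrable_on_shift[OF n_int[of "t + h" "t + h + h"]] t0 h by simp
      \<comment> \<open>The increment estimate concerns single trajectories, so the increment of
        \<open>w\<close> is split into those of \<open>g1\<close> and \<open>g2\<close>. Of the
        window of length \<open>l\<close> only \<open>[t, t + h]\<close> is kept.\<close>
      have "integral {t..t+h} (\<lambda>r. (?d r)\<^sup>2) \<le>
          integral {t..t+h} (\<lambda>r. 2 * (norm (D (g1 (r + h) - g1 r)))\<^sup>2 + 2 * (norm (D (g2 (r + h) - g2 r)))\<^sup>2)"
      proof (rule integral_mono_negligible[OF d_int _ N])
        show "(\<lambda>r. 2 * (norm (D (g1 (r + h) - g1 r)))\<^sup>2 + 2 * (norm (D (g2 (r + h) - g2 r)))\<^sup>2) integrable_on {t..t+h}"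
          by (intro integrable_add integrable_on_mult_right d1_int d2_int)
        fix r assume r: "r \<in> {t..t+h} - ?N"
        have "D (w (r + h) - w r) = D (g1 (r + h) - g1 r) - D (g2 (r + h) - g2 r)"
          using wE[OF r] by (simp add: w_def D_diff E_diff)
        then show "(?d r)\<^sup>2 \<le> 2 * (norm (D (g1 (r + h) - g1 r)))\<^sup>2 + 2 * (norm (D (g2 (r + h) - g2 r)))\<^sup>2"
          using norm_diff_sq_le by metis
      qed
      also have "\<dots> = 2 * integral {t..t+h} (\<lambda>r. (norm (D (g1 (r + h) - g1 r)))\<^sup>2)
          + 2 * integral {t..t+h} (\<lambda>r. (norm (D (g2 (r + h) - g2 r)))\<^sup>2)"
        using integral_add[OF integrable_on_mult_right[OF d1_int, of 2] integrable_on_mult_right[OF d2_int, of 2]]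
        by simp
      also have "\<dots> \<le> 2 * (M * (h * sqrt h)) + 2 * (M * (h * sqrt h))"
      proof -
        have "integral {t..t+h} (\<lambda>r. (norm (D (g1 (r + h) - g1 r)))\<^sup>2) \<le> M * (h * sqrt h)"
          using integral_mono_interval[OF d1_int[of "t + l"], of t "t + h"] M(3)[OF g(1) h(1,2) t] h by simp
        moreover have "integral {t..t+h} (\<lambda>r. (norm (D (g2 (r + h) - g2 r)))\<^sup>2) \<le> M * (h * sqrt h)"
          using integral_mono_interval[OF d2_int[of "t + l"], of t "t + h"] M(3)[OF g(2) h(1,2) t] h by simp
        ultimately show ?thesis
          by simp
      qed
      finally have d_bound: "integral {t..t+h} (\<lambda>r. (?d r)\<^sup>2) \<le> 4 * M * h * sqrt h"
        by simp
      define B where "B = integral {t+h..t+h+h} (\<lambda>r. (?n r)\<^sup>2)"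
      have B0: "0 \<le> B"
        unfolding B_def using n_int[of "t + h"] t0 h by (intro integral_nonneg) auto
      have AB: "A j = A (Suc j) + B"
        using Henstock_Kurzweil_Integration.integral_combine[of t "t + h" "t + h + h" "\<lambda>r. (?n r)\<^sup>2"] n_int[OF t0] h
        unfolding A_def B_def h_def[symmetric] by (simp add: algebra_simps)
      have "sqrt (A (Suc j)) \<le> sqrt (integral {t..t+h} (\<lambda>r. (?n (r + h))\<^sup>2)) + sqrt (integral {t..t+h} (\<lambda>r. (?d r)\<^sup>2))"
        unfolding A_def h_def[symmetric]
      proof (rule integral_minkowski[OF n_int[OF t0] ns_int d_int N])
        fix r assume r: "r \<in> {t..t+h} - ?N"
        have "D (w r) = D (w (r + h)) - D (w (r + h) - w r)"
          using wE[OF r] by (simp add: D_diff)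
        then show "0 \<le> ?n r \<and> ?n r \<le> ?n (r + h) + ?d r"
          using norm_triangle_ineq4 by (metis norm_ge_zero)
      qed
      also have "integral {t..t+h} (\<lambda>r. (?n (r + h))\<^sup>2) = B"
        unfolding B_def using integral_shift_eq[of t "t + h" "\<lambda>r. (?n r)\<^sup>2" h] .
      also have "sqrt (integral {t..t+h} (\<lambda>r. (?d r)\<^sup>2)) \<le> sqrt (4 * M * h * sqrt h)"
        using d_bound by simp
      finally have ab: "sqrt (A (Suc j)) \<le> sqrt B + sqrt (4 * M * h * sqrt h)"
        by simp
      \<comment> \<open>Added to \<open>ab\<close>, this eliminates the second half \<open>B\<close>
        of the window. Division by \<open>2 * sqrt h\<close> then converts root integrals to root
        mean squares, as \<open>L j = 2 * h\<close>.\<close>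
      have sum: "sqrt (A (Suc j)) + sqrt B \<le> sqrt (2 * A j)"
      proof (rule real_le_rsqrt)
        have "(sqrt (A (Suc j)) + sqrt B)\<^sup>2 \<le> 2 * (sqrt (A (Suc j)))\<^sup>2 + 2 * (sqrt B)\<^sup>2"
          using sum_squares_bound[of "sqrt (A (Suc j))" "sqrt B"] by (simp add: power2_sum)
        then show "(sqrt (A (Suc j)) + sqrt B)\<^sup>2 \<le> 2 * A j"
          using AB A0 B0 by simp
      qed
      have "2 * sqrt (A (Suc j)) / (2 * sqrt h) \<le> (sqrt (2 * A j) + sqrt (4 * M * h * sqrt h)) / (2 * sqrt h)"
        using ab sum h by (intro divide_right_mono) auto
      also have "\<dots> = q j + sqrt M * sqrt (sqrt h)"
      proof -
        have "2 * sqrt h = sqrt (4 * h)"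
          by (simp add: real_sqrt_mult)
        then have "sqrt (2 * A j) / (2 * sqrt h) = sqrt (2 * A j / (4 * h))"
          by (simp only: real_sqrt_divide)
        also have "\<dots> = q j"
          by (simp add: q_def h(3))
        finally have "sqrt (2 * A j) / (2 * sqrt h) = q j" .
        moreover have "sqrt (4 * M * h * sqrt h) = 2 * sqrt h * (sqrt M * sqrt (sqrt h))"
          by (simp add: real_sqrt_mult)
        ultimately show ?thesis
          using h by (simp add: add_divide_distrib)
      qed
      also have "2 * sqrt (A (Suc j)) / (2 * sqrt h) = q (Suc j)"
        unfolding q_def h_def[symmetric] by (simp add: real_sqrt_divide)
      also have "sqrt (sqrt h) \<le> \<theta> ^ Suc j"
      proof -
        have "h \<le> (1 / 2) ^ Suc j"
          using l by (simp add: h_def L_def power_divide divide_right_mono)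
        then have "sqrt (sqrt h) \<le> sqrt (sqrt ((1 / 2) ^ Suc j))"
          by (simp only: real_sqrt_le_iff)
        also have "\<dots> = \<theta> ^ Suc j"
          unfolding \<theta>_def by (simp only: real_sqrt_power)
        finally show ?thesis .
      qed
      finally show ?thesis
        using M(1) by (simp add: mult_left_mono)
    qed
    have q_bound: "q (k + j) \<le> q k + R * \<theta> ^ k" for j
    proof -
      \<comment> \<open>The induction carries the exact partial geometric sum; the factor
        \<open>1 - \<theta> ^ j\<close> is dropped only afterwards.\<close>
      have "q (k + j) \<le> q k + R * \<theta> ^ k * (1 - \<theta> ^ j)"
      proof (induction j)
        case (Suc j)
        have "sqrt M * \<theta> ^ Suc (k + j) \<le> sqrt M * \<theta> ^ (k + j)"
          using \<theta> M(1) by (intro mult_left_mono power_decreasing) auto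
        also have "sqrt M * \<theta> ^ (k + j) = (R * (1 - \<theta>)) * \<theta> ^ (k + j)"
          using \<theta> by (simp add: R_def)
        finally have "sqrt M * \<theta> ^ Suc (k + j) \<le> R * \<theta> ^ k * (\<theta> ^ j - \<theta> ^ Suc j)"
          by (simp add: power_add algebra_simps)
        then show ?case
          using step[of "k + j"] Suc.IH by (simp add: algebra_simps)
      qed simp
      also have "R * \<theta> ^ k * (1 - \<theta> ^ j) \<le> R * \<theta> ^ k * 1"
        using R \<theta> by (intro mult_left_mono) auto
      finally show ?thesis
        by simp
    qed
    define Z where "Z = q k + R * \<theta> ^ k"
    have q0: "0 \<le> q j" for j
      using A0[of j] L(1)[of j] by (simp add: q_def)
    have Z0: "0 \<le> Z"
      using q0[of k] R \<theta> by (simp add: Z_def)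
    \<comment> \<open>If \<open>?n\<close> exceeded \<open>Z + \<nu>\<close> almost everywhere on a
      window, so would its root mean square, against \<open>q_bound\<close>. Shrinking the windows
      forces the good times towards \<open>t\<close>.\<close>
    have good: "\<exists>r. r \<in> {t..t + L (k + j)} \<and> w r \<in> E \<and> ?n r \<le> Z + \<nu>" if "0 < \<nu>" for j \<nu>
    proof (rule ccontr)
      assume "\<not> ?thesis"
      then have *: "\<And>r. r \<in> {t..t + L (k + j)} \<Longrightarrow> w r \<in> E \<Longrightarrow> Z + \<nu> < ?n r"
        by (force simp: not_le)
      have "integral {t..t + L (k + j)} (\<lambda>_. (Z + \<nu>)\<^sup>2) \<le> A (k + j)"
        unfolding A_def
      proof (rule integral_mono_negligible[OF _ n_int[OF t0]])
        show "negligible (N1 \<union> N2)"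
          using N1 N2 by simp
        fix r assume r: "r \<in> {t..t + L (k + j)} - (N1 \<union> N2)"
        then have "w r \<in> E"
          unfolding w_def using N1(2)[of r] N2(2)[of r] t0 L(2)[of "k + j"] by (intro E_diff) auto
        then show "(Z + \<nu>)\<^sup>2 \<le> (?n r)\<^sup>2"
          using *[of r] r Z0 \<open>0 < \<nu>\<close> by (intro power_mono) auto
      qed (simp add: integrable_const_ivl)
      then have "(Z + \<nu>)\<^sup>2 \<le> A (k + j) / L (k + j)"
        using L(1)[of "k + j"] by (simp add: field_simps)
      then have "Z + \<nu> \<le> q (k + j)"
        unfolding q_def by (rule real_le_rsqrt)
      then show False
        using q_bound[of j] \<open>0 < \<nu>\<close> unfolding Z_def by simp
    qed
    have w_E: "w t \<in> E \<and> ?n t \<le> Z + \<nu>" if \<nu>: "0 < \<nu>" for \<nu>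
    proof -
      obtain r where r: "\<And>j. r j \<in> {t..t + L (k + j)}" "\<And>j. w (r j) \<in> E" "\<And>j. ?n (r j) \<le> Z + \<nu>"
        using good[OF \<nu>] by metis
      have "(\<lambda>j. w (r j)) \<longlonglongrightarrow> w t"
      proof -
        have inc: "norm (g (r j) - g t) \<le> sqrt (M * L j)" if g: "bounded_solution K g" for g j
        proof (cases "r j = t")
          case False
          have "L (k + j) \<le> L j"
            using l by (simp add: L_def divide_left_mono power_increasing)
          then have rj: "0 < r j - t" "r j - t \<le> L j"
            using r(1)[of j] False by auto
          then have "(norm (g (t + (r j - t)) - g t))\<^sup>2 \<le> M * (r j - t)"
            using t l L(2)[of j] by (intro M(2)[OF g]) auto
          also have "\<dots> \<le> M * L j"
            using rj M(1) by (intro mult_left_mono) auto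
          finally show ?thesis
            by (intro real_le_rsqrt) simp
        qed (use M(1) L(1)[of j] in simp)
        have "norm (w (r j) - w t) \<le> 2 * sqrt (M * L j)" for j
        proof -
          have "w (r j) - w t = (g1 (r j) - g1 t) - (g2 (r j) - g2 t)"
            by (simp add: w_def)
          then show ?thesis
            using norm_triangle_ineq4[of "g1 (r j) - g1 t" "g2 (r j) - g2 t"] inc[OF g(1)] inc[OF g(2)]
            by (smt (verit, best))
        qed
        moreover have "(\<lambda>j. 2 * sqrt (M * L j)) \<longlonglongrightarrow> 2 * sqrt (M * (l * 0))"
        proof -
          have "(\<lambda>j. l * (1 / 2) ^ j) \<longlonglongrightarrow> l * 0"
            by (intro tendsto_mult_left LIMSEQ_power_zero) simp
          then show ?thesis
            unfolding L_def by (intro tendsto_intros) (simp add: power_divide)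
        qed
        then have "(\<lambda>j. 2 * sqrt (M * L j)) \<longlonglongrightarrow> 0"
          by simp
        ultimately have "(\<lambda>j. w (r j) - w t) \<longlonglongrightarrow> 0"
          by (rule Lim_null_comparison[OF always_eventually[OF allI]])
        then show ?thesis
          by (simp add: LIM_zero_iff)
      qed
      \<comment> \<open>Closedness of \<open>D\<close> carries membership in \<open>E\<close> and
        the bound along the good times to \<open>w t\<close>; this is where almost every time
        becomes every time.\<close>
      with r show ?thesis
        by (intro closed[of "\<lambda>j. w (r j)"])
    qed
    show "g1 t - g2 t \<in> E"
      using w_E[of 1] by (simp add: w_def)
    have "?n t \<le> Z + 1 * \<nu>" if "0 < \<nu>" for \<nu>
      using w_E[OF that] by simp
    then have "?n t \<le> Z"
      by (rule le_of_le_add_mult)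
    \<comment> \<open>The window of scale \<open>k\<close> is enlarged to length \<open>l\<close>,
      where \<open>gradient_window\<close> applies; the mean is still taken over the shorter length,
      which costs the factor \<open>2 ^ k / l\<close>.\<close>
    also have "q k \<le> sqrt (3 * 2 ^ k / l) * norm (w t)"
    proof -
      have "A k \<le> integral {t..t+l} (\<lambda>r. (?n r)\<^sup>2)"
        unfolding A_def using n_int[OF t0] L[of k] by (intro integral_mono_interval) auto
      also have "\<dots> \<le> 3 * (norm (w t))\<^sup>2"
        using gradient_window[OF g t] unfolding w_def .
      finally have "A k / L k \<le> 3 * (norm (w t))\<^sup>2 / L k"
        using L(1)[of k] by (intro divide_right_mono) auto
      also have "\<dots> = 3 * 2 ^ k / l * (norm (w t))\<^sup>2"
        using l by (simp add: L_def)
      finally have "q k \<le> sqrt (3 * 2 ^ k / l * (norm (w t))\<^sup>2)"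
        unfolding q_def by (simp only: real_sqrt_le_iff)
      then show ?thesis
        by (simp only: real_sqrt_mult real_sqrt_abs abs_norm_cancel)
    qed
    then have "Z \<le> sqrt (3 * 2 ^ k / l) * norm (w t) + R * \<theta> ^ k"
      by (simp add: Z_def)
    finally show "norm (D (g1 t - g2 t)) \<le> sqrt (3 * 2 ^ k / l) * norm (g1 t - g2 t) + R * sqrt (sqrt (1 / 2)) ^ k"
      unfolding w_def \<theta>_def .
  qed
qed

end

text \<open>The scale \<open>k\<close> is chosen first, so that the dyadic error is below
  \<open>\<epsilon> / 2\<close>; for that fixed scale the factor in front of the H-distance is a
  constant. Both the time \<open>3 * l\<close> and \<open>\<eta>\<close> depend on the solutions
  only through \<open>K\<close>.\<close>

theorem smoothing:
  assumes K: "0 \<le> K"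
  shows "\<exists>\<tau>\<ge>0. (\<forall>g t. bounded_solution K g \<longrightarrow> \<tau> \<le> t \<longrightarrow> g t \<in> E) \<and>
    (\<forall>\<epsilon>>0. \<exists>\<eta>>0. \<forall>g1 g2 t. bounded_solution K g1 \<longrightarrow> bounded_solution K g2 \<longrightarrow> \<tau> \<le> t \<longrightarrow>
       norm (g1 t - g2 t) < \<eta> \<longrightarrow> norm (D (g1 t - g2 t)) < \<epsilon>)"
proof -
  obtain l where l: "0 < l" "l \<le> 1" "locally_controlled K l"
    using local_estimate[of K] by blast
  obtain M where M: "M \<ge> 0" "\<And>g1 g2 t k. bounded_solution K g1 \<Longrightarrow> bounded_solution K g2 \<Longrightarrow> 3 * l \<le> t \<Longrightarrow>
     g1 t - g2 t \<in> E \<and>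
     norm (D (g1 t - g2 t)) \<le> sqrt (3 * 2 ^ k / l) * norm (g1 t - g2 t) + M * sqrt (sqrt (1 / 2)) ^ k"
    using pointwise_gradient[OF K l] by blast
  show ?thesis
  proof (rule exI[of _ "3 * l"], intro conjI allI impI)
    show "g t \<in> E" if "bounded_solution K g" "3 * l \<le> t" for g t
      using M(2)[OF that(1) bounded_solution_zero[OF K] that(2)] by simp
    fix \<epsilon> :: real assume "0 < \<epsilon>"
    have "(\<lambda>k. M * sqrt (sqrt (1 / 2)) ^ k) \<longlonglongrightarrow> M * 0"
      by (intro tendsto_mult_left LIMSEQ_power_zero) simp
    then have "\<forall>\<^sub>F k in sequentially. M * sqrt (sqrt (1 / 2)) ^ k < \<epsilon> / 2"
      by (rule order_tendstoD) (use \<open>0 < \<epsilon>\<close> in simp)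
    then obtain k where k: "M * sqrt (sqrt (1 / 2)) ^ k < \<epsilon> / 2"
      by (auto simp: eventually_sequentially)
    define c where "c = sqrt (3 * 2 ^ k / l)"
    have c: "0 < c"
      using l by (simp add: c_def)
    show "\<exists>\<eta>>0. \<forall>g1 g2 t. bounded_solution K g1 \<longrightarrow> bounded_solution K g2 \<longrightarrow> 3 * l \<le> t \<longrightarrow>
       norm (g1 t - g2 t) < \<eta> \<longrightarrow> norm (D (g1 t - g2 t)) < \<epsilon>"
    proof (intro exI[of _ "\<epsilon> / (2 * c)"] conjI allI impI)
      show "0 < \<epsilon> / (2 * c)"
        using c \<open>0 < \<epsilon>\<close> by simp
      fix g1 g2 t assume g: "bounded_solution K g1" "bounded_solution K g2" "3 * l \<le> t"
        and small: "norm (g1 t - g2 t) < \<epsilon> / (2 * c)"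
      have "c * norm (g1 t - g2 t) < \<epsilon> / 2"
        using small c by (simp add: field_simps)
      then show "norm (D (g1 t - g2 t)) < \<epsilon>"
        using M(2)[OF g, of k] k unfolding c_def by linarith
    qed
  qed (use l in simp)
qed

end

section \<open>Continuous approximation of Bochner square-integrable functions\<close>

lemma borel_measurable_lebesgue_on_limit:
  fixes F :: "nat \<Rightarrow> real \<Rightarrow> real"
  assumes "\<And>k. F k \<in> borel_measurable (lebesgue_on S)" "S \<in> sets lebesgue"
    "AE t in lebesgue. t \<in> S \<longrightarrow> (\<lambda>k. F k t) \<longlonglongrightarrow> G t"
  shows "G \<in> borel_measurable (lebesgue_on S)"
proof -
  obtain N where N: "negligible N" "\<And>t. t \<in> S \<Longrightarrow> t \<notin> N \<Longrightarrow> (\<lambda>k. F k t) \<longlonglongrightarrow> G t"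
    using assms(3) unfolding eventually_ae_filter_negligible by blast
  have "G measurable_on S"
  proof (rule measurable_on_limit[OF _ N(1)])
    show "F k measurable_on S" for k
      using assms(1,2) by (simp add: measurable_on_iff_borel_measurable)
  qed (use N(2) in auto)
  then show ?thesis
    using assms(2) by (simp add: measurable_on_iff_borel_measurable)
qed

text \<open>Continuous functions converging almost everywhere to the indicator are clamped to
  \<open>[0, 1]\<close>, after which dominated convergence applies.\<close>

lemma indicator_approx_continuous:
  fixes A :: "real set"
  assumes A: "A \<in> sets lebesgue" and "0 < (\<eta>::real)"
  obtains \<xi> :: "real \<Rightarrow> real" where "continuous_on UNIV \<xi>" "\<And>t. 0 \<le> \<xi> t \<and> \<xi> t \<le> 1"
    "(\<lambda>t. \<bar>indicator A t - \<xi> t\<bar>) integrable_on {0..T}" "integral {0..T} (\<lambda>t. \<bar>indicator A t - \<xi> t\<bar>) \<le> \<eta>"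
proof -
  have Am: "indicat_real A \<in> borel_measurable lebesgue"
    using A by (rule borel_measurable_indicator)
  then have "indicat_real A measurable_on UNIV"
    by (simp add: measurable_on_iff_borel_measurable)
  then obtain N g where N: "negligible N" "\<And>n. continuous_on UNIV (g n)"
    "\<And>x. x \<notin> N \<Longrightarrow> (\<lambda>n. g n x) \<longlonglongrightarrow> indicat_real A x"
    unfolding measurable_on_def by auto
  define \<xi> where "\<xi> n t = max 0 (min 1 (g n t))" for n t
  have cont: "continuous_on UNIV (\<xi> n)" for n
    unfolding \<xi>_def by (intro continuous_intros N(2))
  have range: "0 \<le> \<xi> n t \<and> \<xi> n t \<le> 1" for n t
    by (auto simp: \<xi>_def)
  let ?e = "\<lambda>n t. \<bar>indicator A t - \<xi> n t\<bar>"
  have conv: "(\<lambda>n. ?e n t) \<longlonglongrightarrow> 0" if "t \<notin> N" for t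
  proof -
    have "(\<lambda>n. \<bar>indicator A t - max 0 (min 1 (g n t))\<bar>) \<longlonglongrightarrow> \<bar>indicator A t - max 0 (min 1 (indicat_real A t))\<bar>"
      by (intro tendsto_intros N(3) that)
    moreover have "max 0 (min 1 (indicat_real A t)) = indicator A t"
      by (auto simp: indicator_def)
    ultimately show ?thesis
      by (simp add: \<xi>_def)
  qed
  have int: "?e n integrable_on {0..T}" for n
  proof (rule measurable_bounded_by_integrable_imp_integrable_real)
    have "\<xi> n \<in> borel_measurable lebesgue"
      using borel_measurable_continuous_onI[OF cont] by (simp add: measurable_completion)
    then have "?e n \<in> borel_measurable lebesgue"
      using Am by measurable
    then show "?e n \<in> borel_measurable (lebesgue_on {0..T})"
      by (rule measurable_restrict_space1)
    show "(\<lambda>_. 1) integrable_on {0..T}"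
      by (rule integrable_const_ivl)
    show "\<bar>?e n t\<bar> \<le> 1" for t
      using range[of n t] by (auto simp: indicator_def)
  qed simp
  have "(\<lambda>n. \<integral>t. ?e n t \<partial>lebesgue_on {0..T}) \<longlonglongrightarrow> (\<integral>t. 0 \<partial>lebesgue_on {0..T})"
  proof (rule integral_dominated_convergence)
    show "integrable (lebesgue_on {0..T}) (\<lambda>_. 1 :: real)"
      using nonneg_integrable_on_lebesgue_on(1)[of "\<lambda>_. 1" "{0..T}"] by (simp add: integrable_const_ivl)
    show "?e n \<in> borel_measurable (lebesgue_on {0..T})" for n
      using nonneg_integrable_on_lebesgue_on(1)[OF int] by (auto dest: borel_measurable_integrable)
    show "AE t in lebesgue_on {0..T}. (\<lambda>n. ?e n t) \<longlonglongrightarrow> 0"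
      using conv N(1) by (subst AE_restrict_space_iff) (auto simp: eventually_ae_filter_negligible)
    show "AE t in lebesgue_on {0..T}. norm (?e n t) \<le> 1" for n
    proof (rule AE_I2)
      show "norm (?e n t) \<le> 1" for t
        using range[of n t] by (auto simp: indicator_def)
    qed
  qed simp
  then have "(\<lambda>n. integral {0..T} (?e n)) \<longlonglongrightarrow> 0"
    using nonneg_integrable_on_lebesgue_on(2)[OF int] by simp
  then have "\<forall>\<^sub>F n in sequentially. integral {0..T} (?e n) < \<eta>"
    using \<open>0 < \<eta>\<close> by (rule order_tendstoD)
  then obtain n where "integral {0..T} (?e n) < \<eta>"
    by (auto simp: eventually_sequentially)
  then show ?thesis
    using that[OF cont range int] by (meson less_imp_le)
qed

context parabolic
begin

lemma E_sum: "finite I \<Longrightarrow> (\<And>i. i \<in> I \<Longrightarrow> v i \<in> E) \<Longrightarrow> (\<Sum>i\<in>I. a i *\<^sub>R v i) \<in> E"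
  by (intro subspace_sum[OF subspace_E] subspace_scale[OF subspace_E])

lemma D_sum: "finite I \<Longrightarrow> (\<And>i. i \<in> I \<Longrightarrow> v i \<in> E) \<Longrightarrow> D (\<Sum>i\<in>I. a i *\<^sub>R v i) = (\<Sum>i\<in>I. a i *\<^sub>R D (v i))"
proof (induction I rule: finite_induct)
  case (insert i I)
  then have "D (a i *\<^sub>R v i + (\<Sum>i\<in>I. a i *\<^sub>R v i)) = D (a i *\<^sub>R v i) + D (\<Sum>i\<in>I. a i *\<^sub>R v i)"
    by (intro D_add E_sum subspace_scale[OF subspace_E]) auto
  then show ?case
    using insert by (simp add: D_scale)
qed (simp add: D_zero)

text \<open>The indicator of each level set is replaced by a continuous cutoff. The gradient error
  is at most \<open>a\<close>, and \<open>a t \<le> B\<close> gives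
  \<open>(a t)\<^sup>2 \<le> B * a t\<close>, so cutoffs that are good in mean suffice for an
  estimate in mean square.\<close>

lemma simple_function_approx_continuous:
  fixes T \<eta> :: real
  assumes s: "simple_function (lebesgue_on {0..T}) s" "s ` {0..T} \<subseteq> E" and "0 < \<eta>"
  shows "\<exists>c e. (\<forall>t. c t \<in> E) \<and> continuous_on {0..T} (\<lambda>t. D (c t)) \<and> (\<forall>t. 0 \<le> e t) \<and>
    e integrable_on {0..T} \<and> integral {0..T} e \<le> \<eta> \<and> (\<forall>t\<in>{0..T}. (norm (D (s t - c t)))\<^sup>2 \<le> (e t :: real))"
proof -
  define R where "R = s ` {0..T}"
  have R: "finite R" "\<And>v. v \<in> R \<Longrightarrow> v \<in> E"
    using s by (auto simp: R_def dest: simple_functionD(1))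
  define A where "A v = {t \<in> {0..T}. s t = v}" for v
  have A: "A v \<in> sets lebesgue" for v
  proof -
    have "s -` {v} \<inter> space (lebesgue_on {0..T}) \<in> sets (lebesgue_on {0..T})"
      using s(1) by (rule simple_functionD(2))
    moreover have "s -` {v} \<inter> space (lebesgue_on {0..T}) = A v"
      by (auto simp: A_def)
    ultimately show ?thesis
      using sets_restrict_space_iff[of "{0..T}" lebesgue "A v"] by simp
  qed
  define B where "B = (\<Sum>v\<in>R. norm (D v))"
  have B: "0 \<le> B"
    unfolding B_def by (intro sum_nonneg) auto
  define \<nu> where "\<nu> = \<eta> / (B\<^sup>2 + 1)"
  have \<nu>: "0 < \<nu>" "B * (\<nu> * B) \<le> \<eta>"
  proof -
    show "0 < \<nu>"
      unfolding \<nu>_def using \<open>0 < \<eta>\<close> by (intro divide_pos_pos) (auto simp: add_nonneg_pos)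
    have "B * (\<nu> * B) = \<eta> * (B\<^sup>2 / (B\<^sup>2 + 1))"
      by (simp add: \<nu>_def power2_eq_square)
    also have "\<dots> \<le> \<eta> * 1"
      using \<open>0 < \<eta>\<close> by (intro mult_left_mono) (auto simp: add_nonneg_pos divide_le_eq_1_pos)
    finally show "B * (\<nu> * B) \<le> \<eta>"
      by simp
  qed
  have "\<forall>v. \<exists>\<xi>. continuous_on UNIV \<xi> \<and> (\<forall>t. 0 \<le> \<xi> t \<and> \<xi> t \<le> 1) \<and>
    (\<lambda>t. \<bar>indicator (A v) t - \<xi> t\<bar>) integrable_on {0..T} \<and>
    integral {0..T} (\<lambda>t. \<bar>indicator (A v) t - \<xi> t\<bar>) \<le> \<nu>"
  proof
    fix v
    show "\<exists>\<xi>. continuous_on UNIV \<xi> \<and> (\<forall>t. 0 \<le> \<xi> t \<and> \<xi> t \<le> 1) \<and>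
      (\<lambda>t. \<bar>indicator (A v) t - \<xi> t\<bar>) integrable_on {0..T} \<and>
      integral {0..T} (\<lambda>t. \<bar>indicator (A v) t - \<xi> t\<bar>) \<le> \<nu>"
      by (rule indicator_approx_continuous[OF A[of v] \<nu>(1), of T]) blast
  qed
  then obtain \<xi> where \<xi>: "\<And>v. continuous_on UNIV (\<xi> v)" "\<And>v t. 0 \<le> \<xi> v t" "\<And>v t. \<xi> v t \<le> (1::real)"
    "\<And>v. (\<lambda>t. \<bar>indicator (A v) t - \<xi> v t\<bar>) integrable_on {0..T}"
    "\<And>v. integral {0..T} (\<lambda>t. \<bar>indicator (A v) t - \<xi> v t\<bar>) \<le> \<nu>"
    by metis
  define c where "c t = (\<Sum>v\<in>R. \<xi> v t *\<^sub>R v)" for t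
  define a where "a t = (\<Sum>v\<in>R. \<bar>indicator (A v) t - \<xi> v t\<bar> * norm (D v))" for t
  have a_le: "0 \<le> a t" "a t \<le> B" for t
  proof -
    show "0 \<le> a t"
      unfolding a_def by (intro sum_nonneg) auto
    have "\<bar>indicator (A v) t - \<xi> v t\<bar> \<le> 1" for v
      using \<xi>(2,3)[of v t] by (auto simp: indicator_def)
    then show "a t \<le> B"
      unfolding a_def B_def by (intro sum_mono) (simp add: mult_left_le_one_le)
  qed
  show ?thesis
  proof (intro exI[of _ c] exI[of _ "\<lambda>t. B * a t"] conjI allI ballI)
    show cE: "c t \<in> E" for t
      unfolding c_def using R by (intro E_sum) auto
    have "D (c t) = (\<Sum>v\<in>R. \<xi> v t *\<^sub>R D v)" for t
      unfolding c_def using R by (intro D_sum) auto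
    then show "continuous_on {0..T} (\<lambda>t. D (c t))"
      using continuous_on_subset[OF \<xi>(1)] by (simp, intro continuous_on_sum continuous_on_scaleR continuous_on_const) auto
    show "0 \<le> B * a t" for t
      using B a_le by simp
    have a_int: "(a has_integral (\<Sum>v\<in>R. integral {0..T} (\<lambda>t. \<bar>indicator (A v) t - \<xi> v t\<bar>) * norm (D v))) {0..T}"
      unfolding a_def using R(1) \<xi>(4)
      by (intro has_integral_sum has_integral_mult_left integrable_integral) auto
    then show "(\<lambda>t. B * a t) integrable_on {0..T}"
      by (intro integrable_on_mult_right) auto
    have "integral {0..T} a \<le> (\<Sum>v\<in>R. \<nu> * norm (D v))"
      unfolding integral_unique[OF a_int] by (intro sum_mono mult_right_mono \<xi>(5)) auto
    also have "\<dots> = \<nu> * B"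
      by (simp add: B_def sum_distrib_left)
    finally have "B * integral {0..T} a \<le> B * (\<nu> * B)"
      using B by (rule mult_left_mono)
    then show "integral {0..T} (\<lambda>t. B * a t) \<le> \<eta>"
      using \<nu>(2) by simp
    fix t assume t: "t \<in> {0..T}"
    have "s t = (\<Sum>v\<in>R. indicat_real (A v) t *\<^sub>R v)"
    proof -
      have "(\<Sum>v\<in>R. indicat_real (A v) t *\<^sub>R v) = (\<Sum>v\<in>{s t}. indicat_real (A v) t *\<^sub>R v)"
        using R(1) t by (intro sum.mono_neutral_right) (auto simp: R_def A_def indicator_def)
      also have "\<dots> = indicat_real (A (s t)) t *\<^sub>R s t"
        by (subst sum.insert) simp_all
      also have "\<dots> = s t"
        using t by (simp add: A_def)
      finally show ?thesis
        by (rule sym)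
    qed
    then have "s t - c t = (\<Sum>v\<in>R. (indicat_real (A v) t - \<xi> v t) *\<^sub>R v)"
      unfolding c_def scaleR_diff_left sum_subtractf by (rule arg_cong)
    then have "D (s t - c t) = (\<Sum>v\<in>R. (indicat_real (A v) t - \<xi> v t) *\<^sub>R D v)"
      using D_sum[OF R] by (simp only:)
    then have "norm (D (s t - c t)) \<le> a t"
      unfolding a_def by (simp only:) (intro order_trans[OF norm_sum] sum_mono, simp)
    then have "(norm (D (s t - c t)))\<^sup>2 \<le> (a t)\<^sup>2"
      by (intro power_mono) auto
    also have "\<dots> \<le> B * a t"
      using a_le[of t] by (simp add: power2_eq_square mult_right_mono)
    finally show "(norm (D (s t - c t)))\<^sup>2 \<le> B * a t" .
  qed
qed

text \<open>Truncating the simple functions where they exceed \<open>2 \<parallel>D g\<parallel>\<close> makes the convergence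
  dominated.\<close>

lemma approx_if_simple_limit:
  assumes gE: "AE t in lebesgue. t \<in> {0..T} \<longrightarrow> g t \<in> E"
    and s: "\<And>k. simple_function (lebesgue_on {0..T}) (s k)" "\<And>k. s k ` {0..T} \<subseteq> E"
    and lim: "AE t in lebesgue. t \<in> {0..T} \<longrightarrow> (\<lambda>k. norm (D (s k t - g t))) \<longlonglongrightarrow> 0"
    and fin: "(\<integral>\<^sup>+t\<in>{0..T}. ennreal ((norm (D (g t)))\<^sup>2) \<partial>lebesgue) < \<infinity>"
  shows "approx T g"
  unfolding approx_def
proof (intro allI impI)
  fix \<eta> :: real assume "0 < \<eta>"
  let ?M = "lebesgue_on {0..T}"
  have space: "space ?M = {0..T}"
    by simp
  have sE: "s k t \<in> E" if "t \<in> {0..T}" for k t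
    using s(2) that by blast
  obtain N where N: "negligible N" "\<And>t. t \<in> {0..T} \<Longrightarrow> t \<notin> N \<Longrightarrow> g t \<in> E"
    "\<And>t. t \<in> {0..T} \<Longrightarrow> t \<notin> N \<Longrightarrow> (\<lambda>k. norm (D (s k t - g t))) \<longlonglongrightarrow> 0"
  proof -
    have "AE t in lebesgue. t \<in> {0..T} \<longrightarrow> g t \<in> E \<and> (\<lambda>k. norm (D (s k t - g t))) \<longlonglongrightarrow> 0"
      using gE lim by eventually_elim auto
    then show ?thesis
      using that unfolding eventually_ae_filter_negligible by blast
  qed
  have aeI: "AE t in lebesgue. t \<in> {0..T} \<longrightarrow> P t" if "\<And>t. t \<in> {0..T} \<Longrightarrow> t \<notin> N \<Longrightarrow> P t" for P
    using that N(1) unfolding eventually_ae_filter_negligible by blast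
  \<comment> \<open>The fixed \<open>v\<close> is 0 for the measurability of the gradient of
    \<open>g\<close> and \<open>r k t\<close> for that of the truncation error.\<close>
  have Ds: "(\<lambda>k. D (v - s k t)) \<longlonglongrightarrow> D (v - g t)" if t: "t \<in> {0..T}" "t \<notin> N" and v: "v \<in> E" for v t
  proof -
    have "(\<lambda>k. D (s k t - g t)) \<longlonglongrightarrow> 0"
      using N(3)[OF t] by (rule tendsto_norm_zero_cancel)
    from tendsto_diff[OF tendsto_const[of "D (v - g t)"] this]
    show ?thesis
      using N(2)[OF t] sE[OF t(1)] v by (simp add: D_diff)
  qed
  have Ng_meas: "(\<lambda>t. norm (D (g t))) \<in> borel_measurable ?M"
  proof (rule borel_measurable_lebesgue_on_limit)
    show "(\<lambda>t. norm (D (0 - s k t))) \<in> borel_measurable ?M" for k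
      by (rule borel_measurable_simple_function, rule simple_function_compose1[OF s(1)])
    show "AE t in lebesgue. t \<in> {0..T} \<longrightarrow> (\<lambda>k. norm (D (0 - s k t))) \<longlonglongrightarrow> norm (D (g t))"
    proof (rule aeI)
      fix t assume t: "t \<in> {0..T}" "t \<notin> N"
      show "(\<lambda>k. norm (D (0 - s k t))) \<longlonglongrightarrow> norm (D (g t))"
      proof -
        have "D (0 - g t) = - D (g t)"
          using D_diff[OF E_zero N(2)[OF t]] by (simp only: D_zero diff_0)
        then show ?thesis
          using tendsto_norm[OF Ds[OF t E_zero]] by (simp only: norm_minus_cancel)
      qed
    qed
  qed simp
  have Ng_int: "integrable ?M (\<lambda>t. (norm (D (g t)))\<^sup>2)"
  proof (rule integrableI_bounded)
    have "(\<integral>\<^sup>+t. ennreal ((norm (D (g t)))\<^sup>2) \<partial>?M) = (\<integral>\<^sup>+t\<in>{0..T}. ennreal ((norm (D (g t)))\<^sup>2) \<partial>lebesgue)"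
      by (intro nn_integral_restrict_space) simp
    then show "(\<integral>\<^sup>+t. ennreal (norm ((norm (D (g t)))\<^sup>2)) \<partial>?M) < \<infinity>"
      using fin by simp
  qed (use Ng_meas in measurable)
  \<comment> \<open>The bound by twice the gradient of \<open>g\<close> makes the squared error at
    most \<open>9 * (norm (D (g t)))\<^sup>2\<close>. The functions stay simple because the
    truncation set is measurable.\<close>
  define r where "r k t = (if norm (D (s k t)) \<le> 2 * norm (D (g t)) then s k t else 0)" for k t
  have r_simple: "simple_function ?M (r k)" for k
  proof -
    have "simple_function ?M (\<lambda>t. if t \<in> {t \<in> space ?M. norm (D (s k t)) \<le> 2 * norm (D (g t))} then s k t else 0)"
    proof (rule simple_function_If_set)
      have "(\<lambda>t. norm (D (s k t))) \<in> borel_measurable ?M"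
        by (rule borel_measurable_simple_function, rule simple_function_compose1[OF s(1)])
      then have "{t \<in> space ?M. norm (D (s k t)) \<le> 2 * norm (D (g t))} \<in> sets ?M"
        using Ng_meas by measurable
      then show "{t \<in> space ?M. norm (D (s k t)) \<le> 2 * norm (D (g t))} \<inter> space ?M \<in> sets ?M"
        by (rule sets.Int) (rule sets.top)
    qed (use s(1) in auto)
    then show ?thesis
      by (rule simple_function_cong[THEN iffD1, rotated]) (auto simp: r_def)
  qed
  have rE: "r k t \<in> E" if "t \<in> {0..T}" for k t
    using sE[OF that] E_zero by (simp add: r_def)
  define e where "e k t = (norm (D (r k t - g t)))\<^sup>2" for k t
  have e_meas: "e k \<in> borel_measurable ?M" for k
  proof (rule borel_measurable_lebesgue_on_limit)
    show "(\<lambda>t. (norm (D (r k t - s j t)))\<^sup>2) \<in> borel_measurable ?M" for j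
      by (rule borel_measurable_simple_function, rule simple_function_compose2[OF r_simple s(1)])
    show "AE t in lebesgue. t \<in> {0..T} \<longrightarrow> (\<lambda>j. (norm (D (r k t - s j t)))\<^sup>2) \<longlonglongrightarrow> e k t"
      unfolding e_def by (intro aeI tendsto_power tendsto_norm Ds rE)
  qed simp
  have e_le: "e k t \<le> 9 * (norm (D (g t)))\<^sup>2" if t: "t \<in> {0..T}" "t \<notin> N" for k t
  proof -
    have "norm (D (r k t)) \<le> 2 * norm (D (g t))"
      by (simp add: r_def D_zero)
    then have "norm (D (r k t - g t)) \<le> 3 * norm (D (g t))"
      using norm_triangle_ineq4[of "D (r k t)" "D (g t)"] N(2)[OF t] rE[OF t(1)] by (simp add: D_diff)
    then have "(norm (D (r k t - g t)))\<^sup>2 \<le> (3 * norm (D (g t)))\<^sup>2"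
      by (intro power_mono) auto
    then show ?thesis
      by (simp add: e_def power_mult_distrib)
  qed
  have e_lim: "(\<lambda>k. e k t) \<longlonglongrightarrow> 0" if t: "t \<in> {0..T}" "t \<notin> N" for t
  proof (cases "D (g t) = 0")
    \<comment> \<open>Where the gradient of \<open>g t\<close> vanishes the truncation may stay
      active for all \<open>k\<close>, but the dominating function is already zero there.\<close>
    case True
    then have "e k t \<le> 0" for k
      using e_le[OF t, of k] by simp
    then have "e k t = 0" for k
      by (simp add: e_def antisym)
    then show ?thesis
      by simp
  next
    case False
    have "(\<lambda>k. norm (D (s k t))) \<longlonglongrightarrow> norm (D (g t))"
    proof -
      have "(\<lambda>k. norm (D (0 - s k t))) \<longlonglongrightarrow> norm (D (0 - g t))"
        by (intro tendsto_norm Ds t E_zero)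
      then show ?thesis
        unfolding D_diff[OF E_zero N(2)[OF t]] D_diff[OF E_zero sE[OF t(1)]] D_zero by simp
    qed
    then have "\<forall>\<^sub>F k in sequentially. norm (D (s k t)) < 2 * norm (D (g t))"
      using False by (intro order_tendstoD(2)) auto
    then have ev: "\<forall>\<^sub>F k in sequentially. (norm (D (s k t - g t)))\<^sup>2 = e k t"
      by eventually_elim (simp add: e_def r_def)
    have "(\<lambda>k. (norm (D (s k t - g t)))\<^sup>2) \<longlonglongrightarrow> 0\<^sup>2"
      by (intro tendsto_power N(3) t)
    then show ?thesis
      using Lim_transform_eventually[OF _ ev] by simp
  qed
  have "(\<lambda>k. \<integral>t. e k t \<partial>?M) \<longlonglongrightarrow> (\<integral>t. 0 \<partial>?M)"
  proof (rule integral_dominated_convergence)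
    show "integrable ?M (\<lambda>t. 9 * (norm (D (g t)))\<^sup>2)"
      using Ng_int by simp
    show "AE t in ?M. (\<lambda>k. e k t) \<longlonglongrightarrow> 0"
      using aeI[OF e_lim] by (subst AE_restrict_space_iff) auto
    show "AE t in ?M. norm (e k t) \<le> 9 * (norm (D (g t)))\<^sup>2" for k
    proof -
      have "norm (e k t) \<le> 9 * (norm (D (g t)))\<^sup>2" if "t \<in> {0..T}" "t \<notin> N" for t
        using e_le[OF that] by (simp add: e_def)
      from aeI[OF this] show ?thesis
        by (subst AE_restrict_space_iff) auto
    qed
  qed (use e_meas in auto)
  then have "(\<lambda>k. \<integral>t. e k t \<partial>?M) \<longlonglongrightarrow> 0"
    by simp
  then have "\<forall>\<^sub>F k in sequentially. (\<integral>t. e k t \<partial>?M) < \<eta> / 4"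
    using \<open>0 < \<eta>\<close> by (intro order_tendstoD(2)) auto
  then obtain k where k: "(\<integral>t. e k t \<partial>?M) < \<eta> / 4"
    by (auto simp: eventually_sequentially)
  have ek_int: "integrable ?M (e k)"
  proof (rule Bochner_Integration.integrable_bound)
    show "integrable ?M (\<lambda>t. 9 * (norm (D (g t)))\<^sup>2)"
      using Ng_int by simp
    have "norm (e k t) \<le> norm (9 * (norm (D (g t)))\<^sup>2)" if "t \<in> {0..T}" "t \<notin> N" for t
      using e_le[OF that] by (simp add: e_def)
    from aeI[OF this] show "AE t in ?M. norm (e k t) \<le> norm (9 * (norm (D (g t)))\<^sup>2)"
      by (subst AE_restrict_space_iff) auto
  qed (rule e_meas)
  have ek: "e k integrable_on {0..T}" "integral {0..T} (e k) \<le> \<eta> / 4"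
  proof -
    show "e k integrable_on {0..T}"
      by (rule integrable_on_lebesgue_on[OF ek_int]) simp
    show "integral {0..T} (e k) \<le> \<eta> / 4"
      using k by (subst lebesgue_integral_eq_integral[OF ek_int, symmetric]) auto
  qed
  have "0 < \<eta> / 4"
    using \<open>0 < \<eta>\<close> by simp
  have "r k ` {0..T} \<subseteq> E"
    using rE by (rule image_subsetI)
  from simple_function_approx_continuous[OF r_simple this \<open>0 < \<eta> / 4\<close>]
  obtain c e' where c: "\<And>t. c t \<in> E" "continuous_on {0..T} (\<lambda>t. D (c t))" "\<And>t. 0 \<le> e' t"
    "e' integrable_on {0..T}" "integral {0..T} e' \<le> \<eta> / 4" "\<And>t. t \<in> {0..T} \<Longrightarrow> (norm (D (r k t - c t)))\<^sup>2 \<le> e' t"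
    by - (elim exE conjE, rule that, (assumption | (erule allE, assumption) | (erule bspec, assumption))+)
  show "\<exists>c e N. (\<forall>t. c t \<in> E) \<and> continuous_on {0..T} (\<lambda>t. D (c t)) \<and>
     (\<forall>t. 0 \<le> e t) \<and> e integrable_on {0..T} \<and> integral {0..T} e \<le> \<eta> \<and>
     negligible N \<and> (\<forall>t\<in>{0..T} - N. g t \<in> E \<and> (norm (D (g t - c t)))\<^sup>2 \<le> e t)"
  proof (intro exI[of _ c] exI[of _ "\<lambda>t. 2 * e k t + 2 * e' t"] exI[of _ N] conjI allI ballI)
    show "(\<lambda>t. 2 * e k t + 2 * e' t) integrable_on {0..T}"
      by (intro integrable_add integrable_on_mult_right ek c)
    have "integral {0..T} (\<lambda>t. 2 * e k t + 2 * e' t) = 2 * integral {0..T} (e k) + 2 * integral {0..T} e'"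
      using integral_add[OF integrable_on_mult_right[OF ek(1), of 2] integrable_on_mult_right[OF c(4), of 2]] by simp
    then show "integral {0..T} (\<lambda>t. 2 * e k t + 2 * e' t) \<le> \<eta>"
      using ek(2) c(5) by simp
    show "0 \<le> 2 * e k t + 2 * e' t" for t
      using c(3)[of t] by (simp add: e_def)
    fix t assume t: "t \<in> {0..T} - N"
    then have E: "g t \<in> E" "r k t \<in> E" "c t \<in> E"
      using N(2) rE c(1) by auto
    then show "g t \<in> E"
      by simp
    have "D (g t - c t) = D (r k t - c t) - D (r k t - g t)"
      using E by (simp add: D_diff)
    then have "(norm (D (g t - c t)))\<^sup>2 \<le> 2 * (norm (D (r k t - c t)))\<^sup>2 + 2 * (norm (D (r k t - g t)))\<^sup>2"
      by (simp only: norm_diff_sq_le)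
    then show "(norm (D (g t - c t)))\<^sup>2 \<le> 2 * e k t + 2 * e' t"
      using c(6)[of t] t by (simp add: e_def)
  qed (use c N in auto)
qed

end

section \<open>Smooth functions and test functions\<close>

lemma Ck_SucD: "Ck (Suc k) f \<Longrightarrow> Ck k f"
proof (induction k arbitrary: f)
  case 0
  then show ?case
    by (auto intro!: continuous_at_imp_continuous_on differentiable_imp_continuous_within)
qed auto

lemma frechet_derivative_eq: "(f has_derivative f') (at x) \<Longrightarrow> frechet_derivative f (at x) = f'"
  using frechet_derivative_at by metis

lemma Ck_SucI:
  assumes "\<And>x. (f has_derivative f' x) (at x)" "\<And>b. b \<in> Basis \<Longrightarrow> Ck k (\<lambda>x. f' x b)"
  shows "Ck (Suc k) f"
  using assms by (auto simp: frechet_derivative_eq[OF assms(1)] differentiable_def)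

lemma Ck_SucE:
  assumes "Ck (Suc k) f"
  shows "(f has_derivative frechet_derivative f (at x)) (at x)"
    "b \<in> Basis \<Longrightarrow> Ck k (\<lambda>x. frechet_derivative f (at x) b)"
  using assms by (auto simp: frechet_derivative_works)

lemma Ck_const: "Ck k (\<lambda>x. c)"
proof (induction k arbitrary: c)
  case (Suc k)
  show ?case
    by (rule Ck_SucI[OF has_derivative_const]) (use Suc in auto)
qed auto

lemma Ck_add: "Ck k f \<Longrightarrow> Ck k g \<Longrightarrow> Ck k (\<lambda>x. f x + g x)"
proof (induction k arbitrary: f g)
  case (Suc k)
  show ?case
    by (rule Ck_SucI[OF has_derivative_add[OF Ck_SucE(1)[OF Suc.prems(1)] Ck_SucE(1)[OF Suc.prems(2)]]])
      (use Suc.IH Ck_SucE(2) Suc.prems in blast)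
qed (auto intro: continuous_on_add)

lemma Ck_mult: "Ck k f \<Longrightarrow> Ck k g \<Longrightarrow> Ck k (\<lambda>x. f x * g x)"
proof (induction k arbitrary: f g)
  case (Suc k)
  show ?case
  proof (rule Ck_SucI[OF has_derivative_mult[OF Ck_SucE(1)[OF Suc.prems(1)] Ck_SucE(1)[OF Suc.prems(2)]]])
    fix b :: 'a assume b: "b \<in> Basis"
    show "Ck k (\<lambda>x. f x * frechet_derivative g (at x) b + frechet_derivative f (at x) b * g x)"
      using Suc.prems Suc.IH Ck_SucE(2)[OF Suc.prems(1) b] Ck_SucE(2)[OF Suc.prems(2) b]
      by (intro Ck_add Suc.IH) (auto dest!: Ck_SucD simp del: Ck.simps(2))
  qed
qed (auto intro: continuous_on_mult)

lemma Ck_cmult: "Ck k f \<Longrightarrow> Ck k (\<lambda>x. c * f x)"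
  by (rule Ck_mult[OF Ck_const])

lemma Ck_prod: "finite I \<Longrightarrow> (\<And>i. i \<in> I \<Longrightarrow> Ck k (f i)) \<Longrightarrow> Ck k (\<lambda>x. \<Prod>i\<in>I. f i x)"
  by (induction I rule: finite_induct) (auto intro: Ck_const Ck_mult)

lemma Ck_Suc_realI:
  fixes f :: "real \<Rightarrow> real"
  assumes "\<And>x. (f has_real_derivative f' x) (at x)" "Ck k f'"
  shows "Ck (Suc k) f"
  by (rule Ck_SucI[of f "\<lambda>x h. f' x * h"]) (use assms in \<open>auto simp: has_field_derivative_def\<close>)

lemma Ck_Suc_realE:
  fixes f :: "real \<Rightarrow> real"
  assumes "Ck (Suc k) f"
  shows "(f has_real_derivative frechet_derivative f (at x) 1) (at x)"
    "Ck k (\<lambda>x. frechet_derivative f (at x) 1)"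
proof -
  have "(f has_derivative frechet_derivative f (at x)) (at x)"
    using assms by (rule Ck_SucE)
  moreover from this obtain c where "frechet_derivative f (at x) = (\<lambda>h. h * c)"
    using has_derivative_linear real_linearD by (metis mult.commute)
  then have "frechet_derivative f (at x) = (*) (frechet_derivative f (at x) 1)"
    by (auto simp: mult.commute)
  ultimately show "(f has_real_derivative frechet_derivative f (at x) 1) (at x)"
    unfolding has_field_derivative_def by simp
qed (use assms in auto)

lemma Ck_affine:
  fixes \<phi> :: "real \<Rightarrow> real"
  assumes "Ck k \<phi>"
  shows "Ck k (\<lambda>x::'a::euclidean_space. \<phi> (x \<bullet> c + d))"
  using assms
proof (induction k arbitrary: \<phi>)
  case 0
  then show ?case
    by (auto intro!: continuous_on_compose2[of UNIV \<phi>] continuous_intros)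
next
  case (Suc k)
  show ?case
  proof (rule Ck_SucI)
    show "((\<lambda>x. \<phi> (x \<bullet> c + d)) has_derivative
        (\<lambda>h. frechet_derivative \<phi> (at (x \<bullet> c + d)) 1 * (h \<bullet> c))) (at x)" for x :: 'a
      using Ck_Suc_realE(1)[OF Suc.prems, of "x \<bullet> c + d"]
      unfolding has_field_derivative_def
      by (rule has_derivative_compose[rotated]) (auto intro!: derivative_eq_intros)
    show "Ck k (\<lambda>x. frechet_derivative \<phi> (at (x \<bullet> c + d)) 1 * (b \<bullet> c))" for b :: 'a
      by (rule Ck_mult[OF Suc.IH[OF Ck_Suc_realE(2)[OF Suc.prems]] Ck_const])
  qed
qed

section \<open>Smooth cutoffs on the line and on boxes\<close>

definition flat :: "real poly \<Rightarrow> real \<Rightarrow> real" where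
  "flat p x = (if 0 < x then poly p (1 / x) * exp (- (1 / x)) else 0)"

lemma poly_div_exp_tendsto_0: "((\<lambda>y::real. poly p y / exp y) \<longlongrightarrow> 0) at_top"
proof (induction p)
  case (pCons a p)
  have "y * poly p y / exp y = (\<Sum>i\<le>degree p. coeff p i * (y ^ Suc i / exp y))" for y
    by (simp add: poly_altdef sum_distrib_left sum_divide_distrib mult_ac)
  moreover have "((\<lambda>y. \<Sum>i\<le>degree p. coeff p i * (y ^ Suc i / exp y)) \<longlongrightarrow> (\<Sum>i\<le>degree p. coeff p i * 0)) at_top"
    by (intro tendsto_sum tendsto_mult_left tendsto_power_div_exp_0)
  ultimately have "((\<lambda>y. y * poly p y / exp y) \<longlongrightarrow> 0) at_top"
    by simp
  moreover have "((\<lambda>y. a * (y ^ 0 / exp y)) \<longlongrightarrow> a * 0) at_top"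
    by (intro tendsto_mult_left tendsto_power_div_exp_0)
  ultimately show ?case
    using tendsto_add[of "\<lambda>y. a * (y ^ 0 / exp y)" 0 at_top "\<lambda>y. y * poly p y / exp y" 0]
    by (simp add: add_divide_distrib)
qed simp

text \<open>With \<open>y = 1 / x\<close>, differentiating p(y) exp(-y) in x gives y^2 (p - p')(y)
  exp(-y). The family is thus closed under differentiation, which is why \<open>flat\<close> carries
  a polynomial. At 0 the difference quotient is \<open>y * poly p y / exp y\<close>, which tends to
  zero as \<open>y\<close> grows.\<close>

lemma flat_derivative: "(flat p has_real_derivative flat (monom 1 2 * (p - pderiv p)) x) (at x)"
proof -
  consider "x > 0" | "x = 0" | "x < 0" by linarith
  then show ?thesis
  proof cases
    case 1
    have "((\<lambda>x. poly p (1 / x) * exp (- (1 / x))) has_real_derivative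
        flat (monom 1 2 * (p - pderiv p)) x) (at x)"
      using 1 unfolding flat_def
      by (auto intro!: derivative_eq_intros poly_DERIV[THEN DERIV_chain2] simp: poly_monom field_simps power2_eq_square)
    moreover have "\<forall>\<^sub>F y in nhds x. flat p y = poly p (1 / y) * exp (- (1 / y))"
      using 1 eventually_nhds_in_open[of "{0<..}" x] by (auto elim!: eventually_mono simp: flat_def)
    ultimately show ?thesis
      by (subst DERIV_cong_ev[OF refl _ refl])
  next
    case 3
    have "((\<lambda>x. 0) has_real_derivative flat (monom 1 2 * (p - pderiv p)) x) (at x)"
      using 3 by (simp add: flat_def)
    moreover have "\<forall>\<^sub>F y in nhds x. flat p y = 0"
      using 3 eventually_nhds_in_open[of "{..<0}" x] by (auto elim!: eventually_mono simp: flat_def)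
    ultimately show ?thesis
      by (subst DERIV_cong_ev[OF refl _ refl])
  next
    case 2
    have "((\<lambda>h. poly (pCons 0 p) (inverse h) / exp (inverse h)) \<longlongrightarrow> 0) (at_right 0)"
      by (rule filterlim_compose[OF poly_div_exp_tendsto_0 filterlim_inverse_at_top_right])
    then have "((\<lambda>h. (flat p (0 + h) - flat p 0) / h) \<longlongrightarrow> 0) (at_right 0)"
      by (rule Lim_transform_eventually)
        (auto simp: eventually_at_filter flat_def field_simps exp_minus)
    moreover have "((\<lambda>h. (flat p (0 + h) - flat p 0) / h) \<longlongrightarrow> 0) (at_left 0)"
      by (rule Lim_transform_eventually[OF tendsto_const]) (auto simp: eventually_at_filter flat_def)
    ultimately have "((\<lambda>h. (flat p (0 + h) - flat p 0) / h) \<longlongrightarrow> 0) (at 0)"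
      by (simp add: filterlim_at_split)
    then show ?thesis
      using 2 by (simp add: DERIV_def flat_def)
  qed
qed

lemma Ck_flat: "Ck k (flat p)"
proof (induction k arbitrary: p)
  case 0
  have "isCont (flat p) x" for x
    using flat_derivative by (rule DERIV_isCont)
  then show ?case
    by (simp add: continuous_at_imp_continuous_on)
qed (rule Ck_Suc_realI[OF flat_derivative])

definition bump :: "real \<Rightarrow> real" where
  "bump x = flat 1 x * flat 1 (1 - x)"

lemma Ck_bump: "Ck k bump"
proof -
  have "Ck k (\<lambda>x::real. flat 1 (x \<bullet> (-1) + 1))"
    by (intro Ck_affine Ck_flat)
  then show ?thesis
    unfolding bump_def[abs_def] by (intro Ck_mult Ck_flat) (simp add: inner_real_def algebra_simps)
qed

lemma bump_nonneg: "0 \<le> bump x"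
  by (simp add: bump_def flat_def)

lemma bump_pos: "0 < x \<Longrightarrow> x < 1 \<Longrightarrow> 0 < bump x"
  by (simp add: bump_def flat_def)

lemma bump_zero: "x \<le> 0 \<or> 1 \<le> x \<Longrightarrow> bump x = 0"
  by (auto simp: bump_def flat_def)

lemma continuous_on_bump: "continuous_on A bump"
  using Ck_bump[of 0] by (auto intro: continuous_on_subset)

text \<open>The integral starts at -1 rather than at 0, where the support of \<open>bump\<close>
  begins, so that every nonnegative point is interior to the interval used and the fundamental
  theorem gives a two-sided derivative.\<close>

definition smooth_step :: "real \<Rightarrow> real" where
  "smooth_step x = integral {-1..x} bump / integral {0..1} bump"

lemma bump_integrable: "bump integrable_on {a..b}"
  by (intro integrable_continuous_interval continuous_on_bump)

lemma bump_integral_pos: "0 < integral {0..1} bump"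
proof -
  have "integral {0..1} bump \<noteq> 0"
    using integral_eq_0_iff[of 0 1 bump] bump_nonneg bump_pos[of "1/2"] continuous_on_bump by force
  then show ?thesis
    using integral_nonneg[OF bump_integrable[of 0 1]] bump_nonneg by (simp add: order_less_le)
qed

lemma bump_integral_zero: "(\<And>y. y \<in> {a..b} \<Longrightarrow> y \<le> 0 \<or> 1 \<le> y) \<Longrightarrow> integral {a..b} bump = 0"
  using integral_cong[of "{a..b}" bump "\<lambda>_. 0"] bump_zero by simp

lemma smooth_step_0: "x \<le> 0 \<Longrightarrow> smooth_step x = 0"
  using bump_integral_zero[of "-1" x] by (simp add: smooth_step_def)

lemma smooth_step_1: "1 \<le> x \<Longrightarrow> smooth_step x = 1"
proof -
  assume "1 \<le> x"
  then have "integral {-1..x} bump = integral {-1..0} bump + (integral {0..1} bump + integral {1..x} bump)"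
    using Henstock_Kurzweil_Integration.integral_combine[of "-1" 0 x bump] bump_integrable
      Henstock_Kurzweil_Integration.integral_combine[of 0 1 x bump] by simp
  moreover have "integral {-1..0} bump = 0" "integral {1..x} bump = 0"
    by (auto intro: bump_integral_zero)
  ultimately show ?thesis
    using bump_integral_pos by (simp add: smooth_step_def)
qed

lemma smooth_step_derivative:
  "(smooth_step has_real_derivative bump x / integral {0..1} bump) (at x)"
proof (cases "x < 0")
  case True
  have "((\<lambda>x. 0) has_real_derivative bump x / integral {0..1} bump) (at x)"
    using True by (simp add: bump_zero)
  moreover have "\<forall>\<^sub>F y in nhds x. smooth_step y = 0"
    using True eventually_nhds_in_open[of "{..<0}" x] by (auto elim!: eventually_mono simp: smooth_step_0)
  ultimately show ?thesis
    by (subst DERIV_cong_ev[OF refl _ refl])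
next
  case False
  then have "((\<lambda>x. integral {-1..x} bump) has_real_derivative bump x) (at x within {-1..x+1})"
    by (intro integral_has_real_derivative continuous_on_bump) auto
  moreover have "at x within {-1..x+1} = at x"
    using False by (intro at_within_interior) auto
  ultimately show ?thesis
    unfolding smooth_step_def[abs_def] by (auto intro: DERIV_cdivide)
qed

lemma Ck_smooth_step: "Ck k smooth_step"
proof -
  have "Ck (Suc k) smooth_step"
  proof (rule Ck_Suc_realI[OF smooth_step_derivative])
    show "Ck k (\<lambda>x. bump x / integral {0..1} bump)"
      using Ck_cmult[OF Ck_bump, of k "1 / integral {0..1} bump"] by simp
  qed
  then show ?thesis
    by (rule Ck_SucD)
qed

lemma smooth_step_mono: "x \<le> y \<Longrightarrow> smooth_step x \<le> smooth_step y"
  using DERIV_nonneg_imp_nondecreasing[of x y smooth_step] smooth_step_derivative bump_nonneg bump_integral_pos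
  by (meson divide_nonneg_pos)

lemma smooth_step_range: "0 \<le> smooth_step x" "smooth_step x \<le> 1"
proof -
  show "0 \<le> smooth_step x"
    using smooth_step_mono[of "min x 0" x] smooth_step_0[of "min x 0"] by simp
  show "smooth_step x \<le> 1"
    using smooth_step_mono[of x "max x 1"] smooth_step_1[of "max x 1"] by simp
qed

text \<open>A cutoff that approximates the open box from inside, with transition layers of width
  \<open>1 / n\<close> along the faces.\<close>

definition smooth_box :: "nat \<Rightarrow> 'a::euclidean_space \<Rightarrow> 'a \<Rightarrow> 'a \<Rightarrow> real" where
  "smooth_box n a b x =
     (\<Prod>i\<in>Basis. smooth_step (real n * (x \<bullet> i - a \<bullet> i)) * smooth_step (real n * (b \<bullet> i - x \<bullet> i)))"

lemma smooth_box_range: "0 \<le> smooth_box n a b x" "smooth_box n a b x \<le> 1"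
  unfolding smooth_box_def
  by (auto intro!: prod_nonneg prod_le_1 mult_nonneg_nonneg mult_le_one smooth_step_range)

lemma smooth_box_outside: "x \<notin> box a b \<Longrightarrow> smooth_box n a b x = 0"
  unfolding smooth_box_def
proof (rule prod_zero)
  assume "x \<notin> box a b"
  then obtain i where i: "i \<in> Basis" "x \<bullet> i \<le> a \<bullet> i \<or> b \<bullet> i \<le> x \<bullet> i"
    by (force simp: mem_box not_less)
  then have "real n * (x \<bullet> i - a \<bullet> i) \<le> 0 \<or> real n * (b \<bullet> i - x \<bullet> i) \<le> 0"
    by (auto simp: mult_le_0_iff)
  then show "\<exists>i\<in>Basis. smooth_step (real n * (x \<bullet> i - a \<bullet> i)) * smooth_step (real n * (b \<bullet> i - x \<bullet> i)) = 0"
    using i(1) smooth_step_0 by (intro bexI[of _ i]) auto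
qed simp

lemma smooth_step_scaled_tendsto: "0 < y \<Longrightarrow> (\<lambda>n. smooth_step (real n * y)) \<longlonglongrightarrow> 1"
proof (rule tendsto_eventually)
  assume "0 < y"
  obtain N :: nat where N: "1 / y < N"
    using reals_Archimedean2 by blast
  have "smooth_step (real n * y) = 1" if "N \<le> n" for n
  proof (rule smooth_step_1)
    have "1 / y < n"
      using N that by (meson of_nat_le_iff order_less_le_trans)
    then show "1 \<le> real n * y"
      using \<open>0 < y\<close> by (simp add: field_simps)
  qed
  then show "\<forall>\<^sub>F n in sequentially. smooth_step (real n * y) = 1"
    by (auto simp: eventually_sequentially)
qed

lemma smooth_box_tendsto: "(\<lambda>n. smooth_box n a b x) \<longlonglongrightarrow> indicator (box a b) x"
proof (cases "x \<in> box a b")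
  case True
  have "(\<lambda>n. smooth_box n a b x) \<longlonglongrightarrow> (\<Prod>i\<in>(Basis::'a set). 1 * 1)"
    unfolding smooth_box_def using True
    by (intro tendsto_prod tendsto_mult smooth_step_scaled_tendsto) (auto simp: mem_box)
  then show ?thesis
    using True by simp
qed (simp add: smooth_box_outside)

lemma Ck_smooth_box: "Ck k (smooth_box n a b)"
proof -
  have "Ck k (\<lambda>x. smooth_step (x \<bullet> (real n *\<^sub>R i) + (- real n * (a \<bullet> i)))
      * smooth_step (x \<bullet> (- real n *\<^sub>R i) + real n * (b \<bullet> i)))" for i
    by (intro Ck_mult Ck_affine Ck_smooth_step)
  then have "Ck k (\<lambda>x. smooth_step (real n * (x \<bullet> i - a \<bullet> i)) * smooth_step (real n * (b \<bullet> i - x \<bullet> i)))" for i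
    by (simp add: algebra_simps)
  then show ?thesis
    unfolding smooth_box_def[abs_def] by (intro Ck_prod) auto
qed

lemma smooth_box_test_function:
  assumes "cbox a b \<subseteq> \<Omega>"
  shows "smooth_box n a b \<in> test_functions \<Omega>"
proof -
  have "{x. smooth_box n a b x \<noteq> 0} \<subseteq> cbox a b"
    using smooth_box_outside box_subset_cbox by blast
  then have "closure {x. smooth_box n a b x \<noteq> 0} \<subseteq> cbox a b"
    by (rule closure_minimal[OF _ closed_cbox])
  moreover from this have "compact (closure {x. smooth_box n a b x \<noteq> 0})"
    by (meson bounded_cbox bounded_subset closed_closure compact_eq_bounded_closed)
  ultimately show ?thesis
    using assms Ck_smooth_box by (auto simp: test_functions_def)
qed

section \<open>Compactly supported functions and integration by parts\<close>

abbreviation partial_deriv :: "'a::euclidean_space \<Rightarrow> ('a \<Rightarrow> real) \<Rightarrow> 'a \<Rightarrow> real" where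
  "partial_deriv b \<eta> x \<equiv> frechet_derivative \<eta> (at x) b"

definition compactly_supported :: "('a::euclidean_space \<Rightarrow> real) \<Rightarrow> bool" where
  "compactly_supported g \<longleftrightarrow> continuous_on UNIV g \<and> (\<exists>K. compact K \<and> (\<forall>x. x \<notin> K \<longrightarrow> g x = 0))"

lemma compactly_supported_integrable:
  assumes "compactly_supported g"
  shows "integrable lborel g"
proof -
  obtain K where K: "compact K" "\<And>x. x \<notin> K \<Longrightarrow> g x = 0" and g: "continuous_on UNIV g"
    using assms by (auto simp: compactly_supported_def)
  have "integrable lborel (\<lambda>x. indicator K x *\<^sub>R g x)"
    using g K(1) by (intro borel_integrable_compact) (auto intro: continuous_on_subset)
  moreover have "(\<lambda>x. indicator K x *\<^sub>R g x) = g"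
  proof (rule ext)
    show "indicator K x *\<^sub>R g x = g x" for x
      using K(2)[of x] by (cases "x \<in> K") auto
  qed
  ultimately show ?thesis
    by simp
qed

lemma compactly_supported_borel: "compactly_supported g \<Longrightarrow> g \<in> borel_measurable borel"
  by (auto simp: compactly_supported_def intro: borel_measurable_continuous_onI)

lemma compactly_supported_lebesgue:
  assumes "compactly_supported g"
  shows "g \<in> borel_measurable lebesgue" "integrable lebesgue g"
    "(LINT x|lebesgue. g x) = (LINT x|lborel. g x)"
  using compactly_supported_borel[OF assms] compactly_supported_integrable[OF assms]
  by (auto simp: measurable_completion integrable_completion integral_completion)

lemma compactly_supported_mult:
  assumes "compactly_supported f" "continuous_on UNIV g"
  shows "compactly_supported (\<lambda>x. f x * g x)"
  using assms unfolding compactly_supported_def by (auto intro: continuous_on_mult)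

lemma compactly_supported_power:
  assumes "compactly_supported f" "0 < n"
  shows "compactly_supported (\<lambda>x. f x ^ n)"
  using assms unfolding compactly_supported_def by (auto intro: continuous_on_power simp: zero_power)

lemma compactly_supported_square_integrable: "compactly_supported g \<Longrightarrow> square_integrable g"
  using compactly_supported_lebesgue(1)[of g] compactly_supported_lebesgue(2)[of "\<lambda>x. (g x)\<^sup>2"]
    compactly_supported_power[of g 2] by (simp add: square_integrable_def)

lemma compactly_supported_bounded:
  assumes "compactly_supported g"
  obtains M where "0 \<le> M" "\<And>x. \<bar>g x\<bar> \<le> M"
proof -
  obtain K where K: "compact K" "\<And>x. x \<notin> K \<Longrightarrow> g x = 0" and g: "continuous_on UNIV g"
    using assms by (auto simp: compactly_supported_def)
  have "bounded (g ` K)"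
    using compact_continuous_image[OF continuous_on_subset[OF g] K(1)] compact_imp_bounded by auto
  then obtain M where "\<And>x. x \<in> K \<Longrightarrow> \<bar>g x\<bar> \<le> M"
    by (auto simp: bounded_iff)
  then have "\<bar>g x\<bar> \<le> max M 0" for x
    using K(2)[of x] by (cases "x \<in> K") (auto simp: max.coboundedI1)
  then show ?thesis
    by (intro that[of "max M 0"]) auto
qed

lemma partial_deriv_outside:
  assumes "closed K" "\<And>x. x \<notin> K \<Longrightarrow> \<eta> x = 0" "x \<notin> K"
  shows "partial_deriv b \<eta> x = 0"
proof -
  have "\<forall>\<^sub>F y in nhds x. 0 = \<eta> y"
    using eventually_nhds_in_open[OF open_Compl[OF assms(1)], of x] assms by (auto elim!: eventually_mono)
  then have "(\<eta> has_derivative (\<lambda>_. 0)) (at x)"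
    by (intro has_derivative_transform_eventually[OF has_derivative_const[of 0]])
      (use assms in \<open>auto simp: eventually_at_filter elim!: eventually_mono\<close>)
  then show ?thesis
    by (simp add: frechet_derivative_eq)
qed

definition C1_compact :: "('a::euclidean_space \<Rightarrow> real) \<Rightarrow> bool" where
  "C1_compact \<eta> \<longleftrightarrow> Ck 1 \<eta> \<and> compactly_supported \<eta>"

lemma C1_compactD:
  assumes "C1_compact \<eta>"
  shows "(\<eta> has_derivative frechet_derivative \<eta> (at x)) (at x)"
    "b \<in> Basis \<Longrightarrow> compactly_supported (partial_deriv b \<eta>)"
proof -
  have C1: "Ck (Suc 0) \<eta>"
    using assms by (simp add: C1_compact_def)
  show "(\<eta> has_derivative frechet_derivative \<eta> (at x)) (at x)"
    by (rule Ck_SucE(1)[OF C1])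
  obtain K where K: "compact K" "\<And>x. x \<notin> K \<Longrightarrow> \<eta> x = 0"
    using assms by (auto simp: C1_compact_def compactly_supported_def)
  show "compactly_supported (partial_deriv b \<eta>)" if "b \<in> Basis"
    using Ck_SucE(2)[OF C1 that] K partial_deriv_outside[OF compact_imp_closed[OF K(1)] K(2)]
    by (auto simp: compactly_supported_def)
qed

lemma C1_compact_line_derivative:
  assumes "C1_compact \<eta>"
  shows "((\<lambda>t. \<eta> (x + t *\<^sub>R b)) has_real_derivative partial_deriv b \<eta> (x + t *\<^sub>R b)) (at t)"
proof -
  note * = C1_compactD(1)[OF assms, of "x + t *\<^sub>R b"]
  have "((\<lambda>t. x + t *\<^sub>R b) has_derivative (\<lambda>h. h *\<^sub>R b)) (at t)"
    by (auto intro!: derivative_eq_intros)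
  from has_derivative_compose[OF this *]
  have "((\<lambda>t. \<eta> (x + t *\<^sub>R b)) has_derivative (\<lambda>h. partial_deriv b \<eta> (x + t *\<^sub>R b) * h)) (at t)"
    using linear_cmul[OF has_derivative_linear[OF *]] by (simp add: mult.commute)
  then show ?thesis
    by (simp add: has_field_derivative_def)
qed

text \<open>By translation invariance the integral of a difference quotient vanishes.\<close>

lemma integral_partial_deriv_zero:
  assumes F: "C1_compact F" and b: "b \<in> Basis"
  shows "(LINT x|lborel. partial_deriv b F x) = 0"
proof -
  obtain K where K: "compact K" "\<And>x. x \<notin> K \<Longrightarrow> F x = 0" and cs: "compactly_supported F"
    using F by (auto simp: C1_compact_def compactly_supported_def)
  obtain R where R: "\<And>x. x \<in> K \<Longrightarrow> norm x \<le> R"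
    using compact_imp_bounded[OF K(1)] by (auto simp: bounded_iff)
  obtain M where M: "0 \<le> M" "\<And>x. \<bar>partial_deriv b F x\<bar> \<le> M"
    using compactly_supported_bounded[OF C1_compactD(2)[OF F b]] by blast
  define h where "h n = inverse (real (Suc n))" for n
  have h: "0 < h n" "h n \<le> 1" for n
    by (auto simp: h_def inverse_le_1_iff)
  define s where "s n x = (F (h n *\<^sub>R b + x) - F x) / h n" for n x
  have F_int: "integrable lborel F"
    by (rule compactly_supported_integrable[OF cs])
  have Fm: "F \<in> borel_measurable borel"
    by (rule compactly_supported_borel[OF cs])
  have shift: "integrable lborel (\<lambda>x. F (c + x))" "(LINT x|lborel. F (c + x)) = (LINT x|lborel. F x)" for c
  proof -
    have "(LINT x|lborel. F x) = (LINT x|distr lborel borel ((+) c). F x)"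
      by (simp add: lborel_distr_plus)
    also have "\<dots> = (LINT x|lborel. F (c + x))"
      using Fm by (intro integral_distr) auto
    finally show "(LINT x|lborel. F (c + x)) = (LINT x|lborel. F x)"
      by simp
    have "integrable (distr lborel borel ((+) c)) F"
      using F_int by (simp add: lborel_distr_plus)
    then show "integrable lborel (\<lambda>x. F (c + x))"
      by (rule integrable_distr[rotated]) auto
  qed
  have s0: "(LINT x|lborel. s n x) = 0" for n
    unfolding s_def using shift[of "h n *\<^sub>R b"] F_int by simp
  have "(\<lambda>n. LINT x|lborel. s n x) \<longlonglongrightarrow> (LINT x|lborel. partial_deriv b F x)"
  proof (rule integral_dominated_convergence)
    show "partial_deriv b F \<in> borel_measurable lborel"
      using compactly_supported_borel[OF C1_compactD(2)[OF F b]] by simp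
    have "continuous_on UNIV F"
      using cs by (simp add: compactly_supported_def)
    then have "continuous_on UNIV (\<lambda>x. s n x)" for n
      unfolding s_def using h(1)[of n]
      by (auto intro!: continuous_intros intro: continuous_on_compose2[of UNIV F])
    then show "s n \<in> borel_measurable lborel" for n
      by (simp add: borel_measurable_continuous_onI)
    \<comment> \<open>By the mean value theorem the difference quotients are bounded by
      \<open>M\<close>; they vanish outside the ball enlarged by \<open>norm b\<close>, because
      \<open>h n \<le> 1\<close>.\<close>
    show "integrable lborel (\<lambda>x. M * indicator (cball 0 (R + norm b)) x :: real)"
      by (intro integrable_mult_right integrable_real_indicator emeasure_bounded_finite[THEN order.strict_trans2]) auto
    show "AE x in lborel. (\<lambda>n. s n x) \<longlonglongrightarrow> partial_deriv b F x"
    proof (rule AE_I2)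
      fix x
      have "((\<lambda>t. F (x + t *\<^sub>R b)) has_real_derivative partial_deriv b F x) (at 0)"
        using C1_compact_line_derivative[OF F, of x b 0] by simp
      then have "((\<lambda>t. (F (x + t *\<^sub>R b) - F x) / t) \<longlongrightarrow> partial_deriv b F x) (at 0)"
        by (simp add: DERIV_def)
      moreover have "filterlim h (at 0) sequentially"
      proof -
        have "h \<longlonglongrightarrow> 0"
          unfolding h_def[abs_def] by (rule LIMSEQ_inverse_real_of_nat)
        moreover have "h n \<noteq> 0" for n
          using h(1)[of n] by simp
        ultimately show ?thesis
          by (simp add: filterlim_at)
      qed
      ultimately have "(\<lambda>n. (F (x + h n *\<^sub>R b) - F x) / h n) \<longlonglongrightarrow> partial_deriv b F x"
        by (rule filterlim_compose)
      then show "(\<lambda>n. s n x) \<longlonglongrightarrow> partial_deriv b F x"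
        by (simp add: s_def add.commute)
    qed
    show "AE x in lborel. norm (s n x) \<le> M * indicator (cball 0 (R + norm b)) x" for n
    proof (rule AE_I2)
      fix x
      show "norm (s n x) \<le> M * indicator (cball 0 (R + norm b)) x"
      proof (cases "x \<in> cball 0 (R + norm b)")
        case True
        obtain t where "F (x + h n *\<^sub>R b) - F (x + 0 *\<^sub>R b) = (h n - 0) * partial_deriv b F (x + t *\<^sub>R b)"
          using MVT2[OF h(1)[of n], of "\<lambda>t. F (x + t *\<^sub>R b)" "\<lambda>t. partial_deriv b F (x + t *\<^sub>R b)"]
            C1_compact_line_derivative[OF F, of x b] by blast
        then have "s n x = partial_deriv b F (x + t *\<^sub>R b)"
          using h(1)[of n] by (simp add: s_def add.commute)
        then show ?thesis
          using True M(2) by simp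
      next
        case False
        then have "R + norm b < norm x"
          by simp
        moreover have "norm (h n *\<^sub>R b) \<le> norm b"
          using h[of n] by (simp add: mult_left_le_one_le)
        moreover have "norm x \<le> norm (h n *\<^sub>R b + x) + norm (h n *\<^sub>R b)"
          by (metis add.commute add_diff_cancel_left' norm_triangle_ineq4)
        ultimately have "R < norm x" "R < norm (h n *\<^sub>R b + x)"
          using norm_ge_zero[of b] by linarith+
        then have "x \<notin> K" "h n *\<^sub>R b + x \<notin> K"
          using R by (auto simp: not_le[symmetric])
        then show ?thesis
          using K(2) False by (simp add: s_def)
      qed
    qed
  qed
  then show ?thesis
    using LIMSEQ_unique[OF _ tendsto_const[of 0]] by (simp add: s0)
qed

text \<open>The product of the two functions is again C1 with compact support, so the integral of
  its derivative vanishes.\<close>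

lemma integral_by_parts_compact:
  assumes "C1_compact \<eta>" "C1_compact \<psi>" "b \<in> Basis"
  shows "(LINT x|lborel. \<eta> x * partial_deriv b \<psi> x) = - (LINT x|lborel. partial_deriv b \<eta> x * \<psi> x)"
proof -
  have C1: "Ck (Suc 0) \<eta>" "Ck (Suc 0) \<psi>" and cs: "compactly_supported \<eta>" "compactly_supported \<psi>"
    using assms by (auto simp: C1_compact_def)
  have cont: "continuous_on UNIV \<eta>" "continuous_on UNIV \<psi>"
    using cs by (auto simp: compactly_supported_def)
  have "C1_compact (\<lambda>x. \<eta> x * \<psi> x)"
    using C1 cs cont by (auto simp: C1_compact_def intro: compactly_supported_mult Ck_mult simp del: Ck.simps)
  from integral_partial_deriv_zero[OF this assms(3)]
  have "(LINT x|lborel. \<eta> x * partial_deriv b \<psi> x + partial_deriv b \<eta> x * \<psi> x) = 0"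
    using frechet_derivative_eq[OF has_derivative_mult[OF C1_compactD(1)[OF assms(1)] C1_compactD(1)[OF assms(2)]]]
    by simp
  moreover have "integrable lborel (\<lambda>x. \<eta> x * partial_deriv b \<psi> x)"
    using C1_compactD(2)[OF assms(2,3)] cs
    by (intro compactly_supported_integrable compactly_supported_mult) (auto simp: compactly_supported_def)
  moreover have "integrable lborel (\<lambda>x. partial_deriv b \<eta> x * \<psi> x)"
    using C1_compactD(2)[OF assms(1,3)] cont
    by (intro compactly_supported_integrable compactly_supported_mult)
  ultimately show ?thesis
    by simp
qed

lemma test_function_support:
  assumes "\<eta> \<in> test_functions \<Omega>"
  obtains K where "compact K" "K \<subseteq> \<Omega>" "\<And>x. x \<notin> K \<Longrightarrow> \<eta> x = 0" "\<And>x. x \<notin> K \<Longrightarrow> partial_deriv b \<eta> x = 0"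
proof -
  let ?K = "closure {x. \<eta> x \<noteq> 0}"
  have 0: "\<eta> x = 0" if "x \<notin> ?K" for x
    using that closure_subset[of "{x. \<eta> x \<noteq> 0}"] by auto
  have K: "compact ?K" "?K \<subseteq> \<Omega>"
    using assms unfolding test_functions_def by blast+
  show ?thesis
  proof (rule that[OF K])
    show "\<eta> x = 0" if "x \<notin> ?K" for x
      using that by (rule 0)
    show "partial_deriv b \<eta> x = 0" if "x \<notin> ?K" for x
      by (rule partial_deriv_outside[OF closed_closure _ that]) (rule 0)
  qed
qed

lemma test_function_C1_compact:
  assumes "\<eta> \<in> test_functions \<Omega>"
  shows "C1_compact \<eta>"
proof -
  obtain K where "compact K" "\<And>x. x \<notin> K \<Longrightarrow> \<eta> x = 0"
    using test_function_support[OF assms] by metis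
  moreover have "Ck 1 \<eta>" "Ck 0 \<eta>"
    using assms unfolding test_functions_def by blast+
  ultimately show ?thesis
    unfolding C1_compact_def compactly_supported_def by auto
qed

lemma test_function_compactly_supported:
  assumes "\<eta> \<in> test_functions \<Omega>"
  shows "compactly_supported \<eta>" "b \<in> Basis \<Longrightarrow> compactly_supported (partial_deriv b \<eta>)"
  using test_function_C1_compact[OF assms] C1_compactD(2) by (auto simp: C1_compact_def)

lemma test_functionI:
  assumes "\<And>k. Ck k \<eta>" "compact K" "K \<subseteq> \<Omega>" "\<And>x. x \<notin> K \<Longrightarrow> \<eta> x = 0"
  shows "\<eta> \<in> test_functions \<Omega>"
proof -
  have "closure {x. \<eta> x \<noteq> 0} \<subseteq> K"
    by (rule closure_minimal[OF _ compact_imp_closed[OF assms(2)]]) (use assms(4) in blast)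
  moreover from this have "compact (closure {x. \<eta> x \<noteq> 0})"
    by (metis assms(2) closed_closure compact_Int_closed inf.absorb_iff2)
  ultimately show ?thesis
    using assms(1,3) unfolding test_functions_def by blast
qed

lemma test_functions_linear:
  assumes "\<eta> \<in> test_functions \<Omega>" "\<psi> \<in> test_functions \<Omega>"
  shows "(\<lambda>x. c * \<eta> x + d * \<psi> x) \<in> test_functions \<Omega>"
proof -
  obtain K where K: "compact K" "K \<subseteq> \<Omega>" "\<And>x. x \<notin> K \<Longrightarrow> \<eta> x = 0"
    using test_function_support[OF assms(1)] by metis
  obtain L where L: "compact L" "L \<subseteq> \<Omega>" "\<And>x. x \<notin> L \<Longrightarrow> \<psi> x = 0"
    using test_function_support[OF assms(2)] by metis
  show ?thesis
  proof (rule test_functionI)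
    show "Ck k (\<lambda>x. c * \<eta> x + d * \<psi> x)" for k
    proof (intro Ck_add Ck_cmult)
      show "Ck k \<eta>" "Ck k \<psi>"
        using assms unfolding test_functions_def by blast+
    qed
    show "compact (K \<union> L)" "K \<union> L \<subseteq> \<Omega>"
      using K L by auto
  qed (use K L in auto)
qed

section \<open>Square-integrable functions and weak gradients\<close>

lemma inner_l2_eq: "u \<bullet> v = (LINT x|lebesgue. l2_fun u x * l2_fun v x)"
  by (simp add: inner_l2_def)

lemma l2_eqI: "(AE x in lebesgue. l2_fun u x = l2_fun v x) \<Longrightarrow> u = v"
proof -
  assume "AE x in lebesgue. l2_fun u x = l2_fun v x"
  then have "l2_rel (l2_fun u) (l2_fun v)"
    by (simp add: l2_rel_def square_integrable_l2_fun)
  then have "l2_abs (l2_fun u) = l2_abs (l2_fun v)"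
    by (rule Quotient3_rel_abs[OF Quotient3_l2])
  then show "u = v"
    by (simp add: l2_abs_l2_fun)
qed

lemma l2_fun_l2_of: "square_integrable f \<Longrightarrow> AE x in lebesgue. l2_fun (l2_of f) x = f x"
  by (simp add: l2_of_def l2_fun_l2_abs)

lemma l2_fun_add: "AE x in lebesgue. l2_fun (u + v) x = l2_fun u x + l2_fun v x"
  unfolding plus_l2_def using square_integrable_l2_fun
  by (auto intro!: l2_fun_l2_abs square_integrable_add)

lemma l2_fun_diff: "AE x in lebesgue. l2_fun (u - v) x = l2_fun u x - l2_fun v x"
  unfolding minus_l2_def using square_integrable_l2_fun
  by (auto intro!: l2_fun_l2_abs square_integrable_diff)

lemma l2_fun_scaleR: "AE x in lebesgue. l2_fun (c *\<^sub>R u) x = c * l2_fun u x"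
  unfolding scaleR_l2_def using square_integrable_l2_fun
  by (auto intro!: l2_fun_l2_abs square_integrable_cmult)

lemma l2_fun_zero: "AE x in lebesgue. l2_fun 0 x = 0"
  unfolding zero_l2_def by (intro l2_fun_l2_abs square_integrable_zero)

lemma l2_fun_measurable [measurable]: "l2_fun u \<in> borel_measurable lebesgue"
  using square_integrable_l2_fun[of u] by (simp add: square_integrable_def)

lemma l2_of_add:
  assumes "square_integrable f" "square_integrable g"
  shows "l2_of (\<lambda>x. f x + g x) = l2_of f + l2_of g"
  by (rule l2_eqI)
    (use l2_fun_add[of "l2_of f" "l2_of g"] l2_fun_l2_of[OF assms(1)] l2_fun_l2_of[OF assms(2)]
      l2_fun_l2_of[OF square_integrable_add[OF assms]] in eventually_elim, simp)

lemma l2_of_cmult: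
  assumes "square_integrable f"
  shows "l2_of (\<lambda>x. c * f x) = c *\<^sub>R l2_of f"
  by (rule l2_eqI)
    (use l2_fun_scaleR[of c "l2_of f"] l2_fun_l2_of[OF assms]
      l2_fun_l2_of[OF square_integrable_cmult[OF assms]] in eventually_elim, simp)

lemma inner_l2_of:
  assumes "square_integrable f"
  shows "u \<bullet> l2_of f = (LINT x|lebesgue. l2_fun u x * f x)"
  unfolding inner_l2_eq
proof (rule integral_cong_AE)
  show "(\<lambda>x. l2_fun u x * f x) \<in> borel_measurable lebesgue"
    using assms by (auto simp: square_integrable_def)
  show "AE x in lebesgue. l2_fun u x * l2_fun (l2_of f) x = l2_fun u x * f x"
    using l2_fun_l2_of[OF assms] by eventually_elim simp
qed simp

lemma norm_l2_sq: "(norm u)\<^sup>2 = (LINT x|lebesgue. (l2_fun u x)\<^sup>2)"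
  by (simp only: power2_norm_eq_inner inner_l2_eq) (simp only: power2_eq_square)

lemma nn_integral_l2_sq: "(\<integral>\<^sup>+x. ennreal ((l2_fun u x)\<^sup>2) \<partial>lebesgue) = ennreal ((norm u)\<^sup>2)"
  unfolding norm_l2_sq using square_integrable_l2_fun[of u]
  by (intro nn_integral_eq_integral) (auto simp: square_integrable_def)

lemma nn_integral_l2_diff_sq:
  "(\<integral>\<^sup>+x. ennreal ((l2_fun u x - l2_fun v x)\<^sup>2) \<partial>lebesgue) = ennreal ((norm (u - v))\<^sup>2)"
  unfolding nn_integral_l2_sq[symmetric]
  by (rule nn_integral_cong_AE) (use l2_fun_diff[of u v] in eventually_elim, simp)

text \<open>A sequence with rapidly decreasing increments converges almost everywhere: if
  \<open>2 ^ n * d n \<^sup>2\<close> is bounded in \<open>n\<close> at a point, then \<open>d n\<close> is summable there.\<close>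

lemma l2_fast_Cauchy_AE_convergent:
  fixes X :: "nat \<Rightarrow> 'a::euclidean_space l2"
  assumes "\<And>n. norm (X (Suc n) - X n) \<le> (1 / 2) ^ n"
  shows "AE x in lebesgue. convergent (\<lambda>n. l2_fun (X n) x)"
proof -
  define d where "d n x = l2_fun (X (Suc n)) x - l2_fun (X n) x" for n x
  have d_meas [measurable]: "d n \<in> borel_measurable lebesgue" for n
    unfolding d_def by measurable
  have "(\<integral>\<^sup>+x. (\<Sum>n. ennreal (2 ^ n * (d n x)\<^sup>2)) \<partial>lebesgue) = (\<Sum>n. \<integral>\<^sup>+x. ennreal (2 ^ n * (d n x)\<^sup>2) \<partial>lebesgue)"
    by (rule nn_integral_suminf) measurable
  also have "\<dots> \<le> (\<Sum>n. ennreal ((1 / 2) ^ n))"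
  proof (rule suminf_le)
    fix n
    have "(\<integral>\<^sup>+x. ennreal (2 ^ n * (d n x)\<^sup>2) \<partial>lebesgue) = ennreal (2 ^ n) * (\<integral>\<^sup>+x. ennreal ((d n x)\<^sup>2) \<partial>lebesgue)"
      by (subst nn_integral_cmult[symmetric]) (auto simp: ennreal_mult)
    also have "\<dots> = ennreal (2 ^ n * (norm (X (Suc n) - X n))\<^sup>2)"
      unfolding d_def nn_integral_l2_diff_sq by (simp add: ennreal_mult)
    also have "\<dots> \<le> ennreal (2 ^ n * ((1 / 2) ^ n)\<^sup>2)"
      using power_mono[OF assms[of n] norm_ge_zero, of 2] by (intro ennreal_leI mult_left_mono) auto
    also have "2 ^ n * ((1 / 2) ^ n)\<^sup>2 = ((1 / 2) ^ n :: real)"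
      by (simp add: power2_eq_square power_divide)
    finally show "(\<integral>\<^sup>+x. ennreal (2 ^ n * (d n x)\<^sup>2) \<partial>lebesgue) \<le> ennreal ((1 / 2) ^ n)" .
  qed auto
  also have "\<dots> < \<infinity>"
    using summable_geometric[of "1 / 2 :: real"] by (subst suminf_ennreal2) auto
  finally have "AE x in lebesgue. (\<Sum>n. ennreal (2 ^ n * (d n x)\<^sup>2)) \<noteq> \<infinity>"
    by (intro nn_integral_PInf_AE) auto
  then show ?thesis
  proof eventually_elim
    fix x assume "(\<Sum>n. ennreal (2 ^ n * (d n x)\<^sup>2)) \<noteq> \<infinity>"
    then have "(\<Sum>n. ennreal (2 ^ n * (d n x)\<^sup>2)) < top"
      by (simp only: infinity_ennreal_def less_top)
    from ennreal_enn2real[OF this] obtain B where B: "0 \<le> B" "(\<Sum>n. ennreal (2 ^ n * (d n x)\<^sup>2)) = ennreal B"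
      using enn2real_nonneg by metis
    have "\<bar>d n x\<bar> \<le> sqrt B * sqrt (1 / 2) ^ n" for n
    proof -
      have "ennreal (2 ^ n * (d n x)\<^sup>2) \<le> ennreal B"
      proof -
        have "(\<Sum>k\<in>{n}. ennreal (2 ^ k * (d k x)\<^sup>2)) \<le> (\<Sum>k. ennreal (2 ^ k * (d k x)\<^sup>2))"
          by (rule sum_le_suminf) auto
        then show ?thesis
          unfolding B(2) by simp
      qed
      then have "2 ^ n * (d n x)\<^sup>2 \<le> B"
        by (subst (asm) ennreal_le_iff[OF B(1)])
      then have "(d n x)\<^sup>2 \<le> B * (1 / 2) ^ n"
        by (simp add: power_divide field_simps)
      then have "sqrt ((d n x)\<^sup>2) \<le> sqrt (B * (1 / 2) ^ n)"
        by (rule real_sqrt_le_mono)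
      also have "sqrt (B * (1 / 2) ^ n) = sqrt B * sqrt (1 / 2) ^ n"
        by (simp only: real_sqrt_mult real_sqrt_power)
      finally show ?thesis
        by (simp only: real_sqrt_abs)
    qed
    moreover have "summable (\<lambda>n. sqrt B * sqrt (1 / 2) ^ n)"
      by (intro summable_mult summable_geometric) simp
    ultimately have "summable (\<lambda>n. d n x)"
      by (intro summable_comparison_test'[where f="\<lambda>n. d n x" and N=0]) (simp_all only: real_norm_def)
    then have "convergent (\<lambda>n. \<Sum>k<n. d k x)"
      by (simp add: summable_iff_convergent)
    moreover have "(\<Sum>k<n. d k x) = l2_fun (X n) x - l2_fun (X 0) x" for n
      unfolding d_def by (rule sum_lessThan_telescope)
    ultimately have "convergent (\<lambda>n. l2_fun (X n) x - l2_fun (X 0) x)"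
      by simp
    from convergent_add[OF this convergent_const[of "l2_fun (X 0) x"]]
    show "convergent (\<lambda>n. l2_fun (X n) x)"
      by simp
  qed
qed

text \<open>Fatou's lemma passes the bound on \<open>norm (X m - X n)\<close> to the almost
  everywhere limit \<open>f\<close>. This gives first that \<open>f\<close> is square-integrable and
  then that the convergence holds in norm.\<close>

lemma l2_fast_Cauchy_convergent:
  fixes X :: "nat \<Rightarrow> 'a::euclidean_space l2"
  assumes fast: "\<And>n. norm (X (Suc n) - X n) \<le> (1 / 2) ^ n" and "Cauchy X"
  shows "convergent X"
proof -
  define f where "f x = lim (\<lambda>n. l2_fun (X n) x)" for x
  have f_meas [measurable]: "f \<in> borel_measurable lebesgue"
    unfolding f_def by measurable
  have lim: "AE x in lebesgue. (\<lambda>n. l2_fun (X n) x) \<longlonglongrightarrow> f x"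
    using l2_fast_Cauchy_AE_convergent[OF fast]
    by eventually_elim (simp add: f_def convergent_LIMSEQ_iff)
  have fatou: "(\<integral>\<^sup>+x. ennreal ((f x - l2_fun (X n) x)\<^sup>2) \<partial>lebesgue) \<le> ennreal (e\<^sup>2)"
    if e: "\<And>m. n \<le> m \<Longrightarrow> norm (X m - X n) \<le> e" for n e
  proof -
    have "(\<integral>\<^sup>+x. ennreal ((f x - l2_fun (X n) x)\<^sup>2) \<partial>lebesgue) =
        (\<integral>\<^sup>+x. liminf (\<lambda>m. ennreal ((l2_fun (X m) x - l2_fun (X n) x)\<^sup>2)) \<partial>lebesgue)"
    proof (rule nn_integral_cong_AE)
      show "AE x in lebesgue. ennreal ((f x - l2_fun (X n) x)\<^sup>2) =
          liminf (\<lambda>m. ennreal ((l2_fun (X m) x - l2_fun (X n) x)\<^sup>2))"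
        using lim
      proof eventually_elim
        fix x assume "(\<lambda>m. l2_fun (X m) x) \<longlonglongrightarrow> f x"
        then have "(\<lambda>m. ennreal ((l2_fun (X m) x - l2_fun (X n) x)\<^sup>2)) \<longlonglongrightarrow> ennreal ((f x - l2_fun (X n) x)\<^sup>2)"
          by (intro tendsto_ennrealI tendsto_power tendsto_diff tendsto_const)
        then show "ennreal ((f x - l2_fun (X n) x)\<^sup>2) = liminf (\<lambda>m. ennreal ((l2_fun (X m) x - l2_fun (X n) x)\<^sup>2))"
          using lim_imp_Liminf[OF trivial_limit_sequentially] by metis
      qed
    qed
    also have "\<dots> \<le> liminf (\<lambda>m. \<integral>\<^sup>+x. ennreal ((l2_fun (X m) x - l2_fun (X n) x)\<^sup>2) \<partial>lebesgue)"
      by (rule nn_integral_liminf) measurable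
    also have "\<dots> = liminf (\<lambda>m. ennreal ((norm (X m - X n))\<^sup>2))"
      by (simp add: nn_integral_l2_diff_sq)
    also have "\<dots> \<le> liminf (\<lambda>m. ennreal (e\<^sup>2))"
      by (intro Liminf_mono eventually_sequentiallyI[of n] ennreal_leI power_mono e) auto
    also have "\<dots> = ennreal (e\<^sup>2)"
      by (simp add: Liminf_const)
    finally show ?thesis .
  qed
  have sq_diff: "square_integrable (\<lambda>x. f x - l2_fun (X n) x)" for n
  proof -
    have "bounded (range X)"
      using \<open>Cauchy X\<close> by (rule cauchy_imp_bounded)
    then obtain M where M: "\<And>m. norm (X m) \<le> M"
      by (auto simp: bounded_iff)
    have "norm (X m - X n) \<le> 2 * M" for m
      using norm_triangle_ineq4[of "X m" "X n"] M[of m] M[of n] by linarith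
    then have "(\<integral>\<^sup>+x. ennreal ((f x - l2_fun (X n) x)\<^sup>2) \<partial>lebesgue) < \<infinity>"
      by (intro le_less_trans[OF fatou[of n "2 * M"]]) auto
    then show ?thesis
      by (auto simp: square_integrable_def intro!: integrableI_bounded)
  qed
  have sq: "square_integrable f"
    using square_integrable_add[OF sq_diff[of 0] square_integrable_l2_fun[of "X 0"]] by simp
  have norm_le: "norm (l2_of f - X n) \<le> e" if "0 \<le> e" "\<And>m. n \<le> m \<Longrightarrow> norm (X m - X n) \<le> e" for n e
  proof -
    have "ennreal ((norm (l2_of f - X n))\<^sup>2) = (\<integral>\<^sup>+x. ennreal ((f x - l2_fun (X n) x)\<^sup>2) \<partial>lebesgue)"
      unfolding nn_integral_l2_diff_sq[symmetric]
      by (rule nn_integral_cong_AE) (use l2_fun_l2_of[OF sq] in eventually_elim, simp)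
    also have "\<dots> \<le> ennreal (e\<^sup>2)"
      by (rule fatou[OF that(2)])
    finally show ?thesis
      using that(1) by (simp add: power2_le_iff_abs_le abs_le_iff)
  qed
  have "X \<longlonglongrightarrow> l2_of f"
  proof (rule metric_LIMSEQ_I)
    fix e :: real assume "0 < e"
    then obtain N where N: "\<And>m n. N \<le> m \<Longrightarrow> N \<le> n \<Longrightarrow> dist (X m) (X n) < e / 2"
      using \<open>Cauchy X\<close> unfolding Cauchy_def by (meson half_gt_zero)
    have "norm (l2_of f - X n) \<le> e / 2" if "N \<le> n" for n
      using N[of _ n] that \<open>0 < e\<close> by (intro norm_le) (auto simp: dist_norm intro: less_imp_le)
    then show "\<exists>N. \<forall>n\<ge>N. dist (X n) (l2_of f) < e"
      using \<open>0 < e\<close> by (intro exI[of _ N]) (force simp: dist_norm norm_minus_commute)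
  qed
  then show ?thesis
    by (auto simp: convergent_def)
qed

instance l2 :: (euclidean_space) complete_space
proof
  fix X :: "nat \<Rightarrow> 'a l2"
  assume X: "Cauchy X"
  have "\<forall>n. \<exists>N. \<forall>p\<ge>N. \<forall>q\<ge>N. norm (X p - X q) < (1 / 2) ^ n"
    using X unfolding Cauchy_def dist_norm by (simp add: power_divide)
  then obtain N where N: "\<And>n p q. N n \<le> p \<Longrightarrow> N n \<le> q \<Longrightarrow> norm (X p - X q) < (1 / 2) ^ n"
    by metis
  \<comment> \<open>The summand \<open>n\<close> makes \<open>r\<close> strictly increasing, and the
    sum keeps \<open>r n\<close> at least \<open>N n\<close>.\<close>
  define r where "r n = n + (\<Sum>k\<le>n. N k)" for n
  have r: "strict_mono r" "N n \<le> r n" for n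
  proof -
    show "strict_mono r"
      by (rule strict_monoI_Suc) (simp add: r_def)
    show "N n \<le> r n"
      using member_le_sum[of n "{..n}" N] by (simp add: r_def)
  qed
  have fast: "norm (X (r (Suc n)) - X (r n)) \<le> (1 / 2) ^ n" for n
    using r(2)[of n] strict_mono_less_eq[OF r(1), of n "Suc n"] by (intro less_imp_le[OF N]) auto
  have "Cauchy (X \<circ> r)"
    using Cauchy_subseq_Cauchy[OF X r(1)] .
  then have "convergent (\<lambda>n. X (r n))"
    by (intro l2_fast_Cauchy_convergent fast) (simp add: o_def)
  then obtain L where "(X \<circ> r) \<longlonglongrightarrow> L"
    by (auto simp: convergent_def o_def)
  then show "convergent X"
    using Cauchy_converges_subseq[OF X r(1)] by (auto simp: convergent_def o_def)
qed

text \<open>Elements of nearly minimal norm in the convex hulls of the tails form a Cauchy sequence,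
  by the parallelogram identity.\<close>

lemma convex_hull_tail_Cauchy:
  fixes Z :: "nat \<Rightarrow> 'h::real_normed_vector \<times> 'k::{real_inner, complete_space}"
  assumes lim: "(\<lambda>n. fst (Z n)) \<longlonglongrightarrow> u" and R: "\<And>n. norm (snd (Z n)) \<le> R"
  obtains z p where "\<And>n. z n \<in> convex hull (range Z)" "(\<lambda>n. fst (z n)) \<longlonglongrightarrow> u"
    "(\<lambda>n. snd (z n)) \<longlonglongrightarrow> p" "norm p \<le> R"
proof -
  define C where "C n = convex hull (Z ` {n..})" for n
  have C_anti: "C m \<subseteq> C n" if "n \<le> m" for m n
    unfolding C_def using that by (intro hull_mono) auto
  have Z_C: "Z n \<in> C n" for n
    unfolding C_def by (intro hull_inc) auto
  have C_norm: "norm (snd w) \<le> R" if "w \<in> C n" for w n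
  proof -
    have "convex (snd -` cball (0::'k) R :: ('h \<times> 'k) set)"
      by (intro convex_linear_vimage linear_snd convex_cball)
    then have "C n \<subseteq> snd -` cball 0 R"
      unfolding C_def using R by (intro hull_minimal) auto
    then show ?thesis
      using that by auto
  qed
  \<comment> \<open>The distance of the second components of the n-th tail hull from the origin. It
    increases as the hulls shrink and is bounded by \<open>R\<close>, so the norms of
    near-minimizers converge.\<close>
  define m where "m n = Inf ((\<lambda>w. norm (snd w)) ` C n)" for n
  have bdd: "bdd_below ((\<lambda>w. norm (snd w)) ` C n)" for n
    by (rule bdd_belowI2[of _ 0]) simp
  have ne: "C n \<noteq> {}" for n
    using Z_C by auto
  have m_le: "m n \<le> norm (snd w)" if "w \<in> C n" for w n
    unfolding m_def using that bdd by (intro cInf_lower) auto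
  have m_nonneg: "0 \<le> m n" for n
    unfolding m_def using ne by (intro cInf_greatest) auto
  have "incseq m"
    unfolding incseq_def m_def using C_anti ne bdd by (intro allI impI cInf_superset_mono) auto
  moreover have "m n \<le> R" for n
    using m_le[OF Z_C] R by (rule order_trans)
  ultimately obtain M where M: "m \<longlonglongrightarrow> M"
    using incseq_convergent by blast
  have "\<exists>w\<in>C n. norm (snd w) < m n + inverse (Suc n)" for n
    using cInf_lessD[of "(\<lambda>w. norm (snd w)) ` C n" "m n + inverse (Suc n)"] ne unfolding m_def by auto
  then obtain z where z: "\<And>n. z n \<in> C n" "\<And>n. norm (snd (z n)) < m n + inverse (Suc n)"
    by metis
  define a where "a n = (m n + inverse (real (Suc n)))\<^sup>2" for n
  have a_lim: "a \<longlonglongrightarrow> (M + 0)\<^sup>2"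
    unfolding a_def[abs_def] by (intro tendsto_power tendsto_add M LIMSEQ_inverse_real_of_nat)
  have m_lim: "(\<lambda>n. (m n)\<^sup>2) \<longlonglongrightarrow> M\<^sup>2"
    by (intro tendsto_power M)
  have par: "(norm (snd (z i) - snd (z j)))\<^sup>2 \<le> 2 * a i + 2 * a j - 4 * (m n)\<^sup>2" if "n \<le> i" "n \<le> j" for i j n
  proof -
    have "(1 / 2) *\<^sub>R z i + (1 / 2) *\<^sub>R z j \<in> C n"
    proof (rule convexD)
      show "convex (C n)"
        unfolding C_def by (rule convex_convex_hull)
    qed (use z(1) C_anti that in auto)
    from m_le[OF this] have "m n \<le> norm (snd (z i) + snd (z j)) / 2"
      by (simp add: scaleR_add_right[symmetric])
    then have "(2 * m n)\<^sup>2 \<le> (norm (snd (z i) + snd (z j)))\<^sup>2"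
      using m_nonneg[of n] by (intro power_mono) auto
    moreover have "(norm (snd (z i) + snd (z j)))\<^sup>2 + (norm (snd (z i) - snd (z j)))\<^sup>2 =
        2 * (norm (snd (z i)))\<^sup>2 + 2 * (norm (snd (z j)))\<^sup>2"
      by (simp add: power2_norm_eq_inner inner_add_left inner_add_right inner_diff_left inner_diff_right)
    moreover have "(2 * m n)\<^sup>2 = 4 * (m n)\<^sup>2"
      by (simp add: power_mult_distrib)
    moreover have "(norm (snd (z k)))\<^sup>2 \<le> a k" for k
      unfolding a_def using z(2)[of k] by (intro power_mono) auto
    moreover note this[of i] this[of j]
    ultimately show ?thesis
      by linarith
  qed
  have "Cauchy (\<lambda>n. snd (z n))"
  proof (rule metric_CauchyI)
    fix e :: real assume "0 < e"
    then have e: "0 < e\<^sup>2 / 16"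
      by simp
    have "\<forall>\<^sub>F n in sequentially. \<bar>a n - M\<^sup>2\<bar> < e\<^sup>2 / 16 \<and> \<bar>(m n)\<^sup>2 - M\<^sup>2\<bar> < e\<^sup>2 / 16"
      using tendstoD[OF a_lim e] tendstoD[OF m_lim e] by eventually_elim (simp add: dist_real_def)
    then obtain n where n: "\<And>k. n \<le> k \<Longrightarrow> \<bar>a k - M\<^sup>2\<bar> < e\<^sup>2 / 16 \<and> \<bar>(m k)\<^sup>2 - M\<^sup>2\<bar> < e\<^sup>2 / 16"
      by (auto simp: eventually_sequentially)
    have "dist (snd (z i)) (snd (z j)) < e" if "n \<le> i" "n \<le> j" for i j
    proof -
      have "(norm (snd (z i) - snd (z j)))\<^sup>2 < e\<^sup>2"
        using par[OF that] n[OF that(1)] n[OF that(2)] n[OF order_refl] e by linarith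
      then show ?thesis
        using \<open>0 < e\<close> by (simp add: dist_norm power_less_imp_less_base)
    qed
    then show "\<exists>n. \<forall>i\<ge>n. \<forall>j\<ge>n. dist (snd (z i)) (snd (z j)) < e"
      by blast
  qed
  then obtain p where p: "(\<lambda>n. snd (z n)) \<longlonglongrightarrow> p"
    by (auto simp: Cauchy_convergent_iff convergent_def)
  have "(\<lambda>n. fst (z n)) \<longlonglongrightarrow> u"
  proof (rule metric_LIMSEQ_I)
    fix e :: real assume "0 < e"
    then obtain N where N: "\<And>n. N \<le> n \<Longrightarrow> dist (fst (Z n)) u < e"
      using metric_LIMSEQ_D[OF lim] by metis
    \<comment> \<open>A ball around \<open>u\<close> is convex, so once the tail of \<open>Z\<close>
      lies over it, the tail hull does as well: taking convex combinations keeps the convergence of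
      the first component.\<close>
    have "convex (fst -` ball u e :: ('h \<times> 'k) set)"
      by (intro convex_linear_vimage linear_fst convex_ball)
    then have "C N \<subseteq> fst -` ball u e"
      unfolding C_def using N by (intro hull_minimal) (auto simp: dist_commute)
    then show "\<exists>N. \<forall>n\<ge>N. dist (fst (z n)) u < e"
      using z(1) C_anti by (intro exI[of _ N]) (force simp: dist_commute)
  qed
  moreover have "z n \<in> convex hull (range Z)" for n
    using z(1)[of n] hull_mono[of "Z ` {n..}" "range Z" convex] unfolding C_def by auto
  moreover have "norm p \<le> R"
    by (rule LIMSEQ_le_const2[OF tendsto_norm[OF p]]) (use z(1) C_norm in blast)
  ultimately show ?thesis
    using that p by blast
qed

section \<open>Weak gradients as linear conditions in L2\<close>

lemma square_integrable_indicator_compact: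
  assumes "compact K"
  shows "square_integrable (indicat_real K)"
proof -
  have K: "K \<in> sets lebesgue" "emeasure lebesgue K < \<infinity>"
    using assms compact_imp_closed[OF assms] emeasure_compact_finite[OF assms] by auto
  moreover have "(\<lambda>x. (indicat_real K x)\<^sup>2) = indicat_real K"
    by (auto simp: indicator_def)
  ultimately show ?thesis
    unfolding square_integrable_def by (auto intro!: integrable_real_indicator)
qed

lemma l2_fun_set_integrable:
  assumes "compact K"
  shows "set_integrable lebesgue K (l2_fun u)"
  using square_integrable_mult[OF square_integrable_indicator_compact[OF assms] square_integrable_l2_fun[of u]]
  by (simp add: set_integrable_def)

text \<open>Test functions vanish outside \<Omega>, so the integrals over \<Omega> are inner
  products on the whole space. A weak derivative becomes a family of continuous linear conditions,
  stable under sums and limits in L2.\<close>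

lemma weak_derivative_l2_iff:
  assumes "b \<in> Basis"
  shows "weak_derivative \<Omega> b (l2_fun u) (l2_fun v) \<longleftrightarrow>
    (\<forall>\<eta>\<in>test_functions \<Omega>. u \<bullet> l2_of (partial_deriv b \<eta>) = - (v \<bullet> l2_of \<eta>))"
proof -
  have "(LINT x:\<Omega>|lebesgue. l2_fun u x * partial_deriv b \<eta> x) = u \<bullet> l2_of (partial_deriv b \<eta>)"
    "(LINT x:\<Omega>|lebesgue. l2_fun v x * \<eta> x) = v \<bullet> l2_of \<eta>" if \<eta>: "\<eta> \<in> test_functions \<Omega>" for \<eta>
  proof -
    obtain K where K: "K \<subseteq> \<Omega>" "\<And>x. x \<notin> K \<Longrightarrow> \<eta> x = 0" "\<And>x. x \<notin> K \<Longrightarrow> partial_deriv b \<eta> x = 0"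
      using test_function_support[OF \<eta>] by metis
    have eq: "(\<lambda>x. indicator \<Omega> x *\<^sub>R (l2_fun u x * partial_deriv b \<eta> x)) = (\<lambda>x. l2_fun u x * partial_deriv b \<eta> x)"
      "(\<lambda>x. indicator \<Omega> x *\<^sub>R (l2_fun v x * \<eta> x)) = (\<lambda>x. l2_fun v x * \<eta> x)"
    proof -
      have "indicator \<Omega> x *\<^sub>R (l2_fun u x * partial_deriv b \<eta> x) = l2_fun u x * partial_deriv b \<eta> x"
        "indicator \<Omega> x *\<^sub>R (l2_fun v x * \<eta> x) = l2_fun v x * \<eta> x" for x
        using K(1) K(2)[of x] K(3)[of x] by (cases "x \<in> \<Omega>"; auto)+
      note eq = this
      show "(\<lambda>x. indicator \<Omega> x *\<^sub>R (l2_fun u x * partial_deriv b \<eta> x)) = (\<lambda>x. l2_fun u x * partial_deriv b \<eta> x)"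
        by (rule ext) (rule eq)
      show "(\<lambda>x. indicator \<Omega> x *\<^sub>R (l2_fun v x * \<eta> x)) = (\<lambda>x. l2_fun v x * \<eta> x)"
        by (rule ext) (rule eq)
    qed
    then show "(LINT x:\<Omega>|lebesgue. l2_fun u x * partial_deriv b \<eta> x) = u \<bullet> l2_of (partial_deriv b \<eta>)"
      "(LINT x:\<Omega>|lebesgue. l2_fun v x * \<eta> x) = v \<bullet> l2_of \<eta>"
      unfolding set_lebesgue_integral_def eq
      using test_function_compactly_supported[OF \<eta>] assms
      by (simp_all add: inner_l2_of compactly_supported_square_integrable)
  qed
  then show ?thesis
    unfolding weak_derivative_def locally_integrable_on_def using l2_fun_set_integrable by auto
qed

lemma cbox_shift_subset_cball: "0 \<le> h \<Longrightarrow> cbox x (x + h *\<^sub>R One) \<subseteq> cball x (h * DIM('a))"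
  for x :: "'a::euclidean_space"
proof
  fix y assume "0 \<le> h" and y: "y \<in> cbox x (x + h *\<^sub>R One)"
  have "norm (y - x) \<le> (\<Sum>i\<in>Basis. \<bar>(y - x) \<bullet> i\<bar>)"
    by (rule norm_le_l1)
  also have "\<dots> \<le> (\<Sum>i\<in>(Basis::'a set). h)"
    using y by (intro sum_mono) (auto simp: mem_box inner_diff_left inner_add_left)
  finally show "y \<in> cball x (h * DIM('a))"
    by (simp add: dist_norm norm_minus_commute mult.commute)
qed

text \<open>The fundamental lemma of the calculus of variations, via Lebesgue differentiation.\<close>

lemma l2_eq_zero_on:
  fixes v :: "'a::euclidean_space l2"
  assumes "open \<Omega>" and v: "\<And>\<eta>. \<eta> \<in> test_functions \<Omega> \<Longrightarrow> v \<bullet> l2_of \<eta> = 0"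
  shows "AE x in lebesgue. x \<in> \<Omega> \<longrightarrow> l2_fun v x = 0"
proof -
  have int_cbox: "set_integrable lebesgue (cbox a b) (l2_fun v)" for a b
    by (intro l2_fun_set_integrable compact_cbox)
  \<comment> \<open>Boxes are reached from test functions in the limit:
    \<open>smooth_box n a b\<close> tends to the indicator of the open box and is dominated by that
    of the closed one.\<close>
  have box0: "integral (cbox a b) (l2_fun v) = 0" if ab: "cbox a b \<subseteq> \<Omega>" for a b
  proof -
    have "(\<lambda>n. LINT x|lebesgue. l2_fun v x * smooth_box n a b x) \<longlonglongrightarrow> (LINT x|lebesgue. l2_fun v x * indicator (box a b) x)"
    proof (rule integral_dominated_convergence)
      show "integrable lebesgue (\<lambda>x. \<bar>indicator (cbox a b) x *\<^sub>R l2_fun v x\<bar>)"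
        using int_cbox[of a b] unfolding set_integrable_def by (rule integrable_abs)
      show "AE x in lebesgue. (\<lambda>n. l2_fun v x * smooth_box n a b x) \<longlonglongrightarrow> l2_fun v x * indicator (box a b) x"
        by (intro AE_I2 tendsto_mult_left smooth_box_tendsto)
      show "(\<lambda>x. l2_fun v x * smooth_box n a b x) \<in> borel_measurable lebesgue" for n
        using compactly_supported_lebesgue(1)[OF test_function_compactly_supported(1)[OF smooth_box_test_function[OF ab, of n]]]
        by simp
      show "AE x in lebesgue. norm (l2_fun v x * smooth_box n a b x) \<le> \<bar>indicator (cbox a b) x *\<^sub>R l2_fun v x\<bar>" for n
      proof (rule AE_I2)
        show "norm (l2_fun v x * smooth_box n a b x) \<le> \<bar>indicator (cbox a b) x *\<^sub>R l2_fun v x\<bar>" for x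
          using smooth_box_outside[of x a b n] smooth_box_range[of n a b x] box_subset_cbox[of a b]
          by (cases "x \<in> box a b") (auto simp: abs_mult mult_left_le subset_iff)
      qed
    qed (intro borel_measurable_times l2_fun_measurable borel_measurable_indicator, simp)
    moreover have "(LINT x|lebesgue. l2_fun v x * smooth_box n a b x) = 0" for n
    proof -
      have "square_integrable (smooth_box n a b)"
        using test_function_compactly_supported(1)[OF smooth_box_test_function[OF ab]]
        by (rule compactly_supported_square_integrable)
      then show ?thesis
        using v[OF smooth_box_test_function[OF ab, of n]] by (simp add: inner_l2_of)
    qed
    ultimately have "0 = (LINT x|lebesgue. l2_fun v x * indicator (box a b) x)"
      by (simp only: LIMSEQ_const_iff)
    then have "(LINT x:box a b|lebesgue. l2_fun v x) = 0"
      by (simp add: set_lebesgue_integral_def mult.commute[of "indicator _ _"])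
    moreover have "set_integrable lebesgue (box a b) (l2_fun v)"
      by (rule set_integrable_subset[OF int_cbox[of a b]]) (auto simp: box_subset_cbox)
    ultimately show ?thesis
      using set_lebesgue_integral_eq_integral(2)[of "box a b" "l2_fun v"] by (simp add: integral_open_interval)
  qed
  have "l2_fun v integrable_on cbox a b" for a b
    using set_lebesgue_integral_eq_integral(1)[OF int_cbox] .
  then obtain N where N: "negligible N" "\<And>x e. x \<notin> N \<Longrightarrow> 0 < e \<Longrightarrow> \<exists>d>0. \<forall>h. 0 < h \<and> h < d \<longrightarrow>
      norm (integral (cbox x (x + h *\<^sub>R One)) (l2_fun v) /\<^sub>R h ^ DIM('a) - l2_fun v x) < e"
    using integrable_ccontinuous_explicit[of "l2_fun v"] by metis
  have "l2_fun v x = 0" if x: "x \<in> \<Omega>" "x \<notin> N" for x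
  proof (rule ccontr)
    assume "l2_fun v x \<noteq> 0"
    then obtain d where d: "d > 0" "\<And>h. 0 < h \<Longrightarrow> h < d \<Longrightarrow>
        norm (integral (cbox x (x + h *\<^sub>R One)) (l2_fun v) /\<^sub>R h ^ DIM('a) - l2_fun v x) < \<bar>l2_fun v x\<bar>"
      using N(2)[OF x(2), of "\<bar>l2_fun v x\<bar>"] by auto
    obtain r where r: "r > 0" "cball x r \<subseteq> \<Omega>"
      using \<open>open \<Omega>\<close> x(1) by (auto simp: open_contains_cball)
    \<comment> \<open>A cube of side \<open>h\<close> lies within distance
      \<open>h * DIM('a)\<close> of its corner, so the averaging cube stays in \<Omega>, where its
      integral is zero.\<close>
    define h where "h = min (d / 2) (r / DIM('a))"
    have h: "0 < h" "h < d" "h * DIM('a) \<le> r"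
      using d(1) r(1) DIM_positive[where 'a='a] by (auto simp: h_def min_def field_simps)
    have "cbox x (x + h *\<^sub>R One) \<subseteq> \<Omega>"
      using cbox_shift_subset_cball[of h x] h r(2) subset_cball[OF h(3), of x] by auto
    from box0[OF this] d(2)[OF h(1,2)] show False
      by simp
  qed
  then show ?thesis
    using N(1) unfolding eventually_ae_filter_negligible by blast
qed

lemma L2_on_diff:
  assumes "u \<in> L2_on \<Omega>" "v \<in> L2_on \<Omega>"
  shows "u - v \<in> L2_on \<Omega>"
  using assms l2_fun_diff[of u v] unfolding L2_on_def mem_Collect_eq by eventually_elim auto

lemma L2_on_add:
  assumes "u \<in> L2_on \<Omega>" "v \<in> L2_on \<Omega>"
  shows "u + v \<in> L2_on \<Omega>"
  using assms l2_fun_add[of u v] unfolding L2_on_def mem_Collect_eq by eventually_elim auto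

lemma L2_on_scaleR:
  assumes "u \<in> L2_on \<Omega>"
  shows "c *\<^sub>R u \<in> L2_on \<Omega>"
  using assms l2_fun_scaleR[of c u] unfolding L2_on_def mem_Collect_eq by eventually_elim auto

lemma L2_on_zero: "0 \<in> L2_on \<Omega>"
  unfolding L2_on_def mem_Collect_eq using l2_fun_zero by eventually_elim auto

lemma subspace_L2_on: "subspace (L2_on \<Omega>)"
  by (simp add: subspace_def L2_on_zero L2_on_add L2_on_scaleR)

text \<open>The limit is tested against \<open>g\<close>, its own part outside \<Omega>.
  Orthogonality to \<open>g\<close> survives the limit, and the inner product of \<open>u\<close>
  with \<open>g\<close> is the squared norm of \<open>g\<close>.\<close>

lemma L2_on_closed:
  assumes \<Omega>: "\<Omega> \<in> sets lebesgue" and v: "\<And>n. v n \<in> L2_on \<Omega>" and lim: "v \<longlonglongrightarrow> u"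
  shows "u \<in> L2_on \<Omega>"
proof -
  define g where "g x = indicator (- \<Omega>) x * l2_fun u x" for x
  have g_meas: "g \<in> borel_measurable lebesgue"
    unfolding g_def using sets.compl_sets[OF \<Omega>]
    by (intro borel_measurable_times borel_measurable_indicator) (auto simp: Compl_eq_Diff_UNIV)
  have "integrable lebesgue (\<lambda>x. (g x)\<^sup>2)"
  proof (rule Bochner_Integration.integrable_bound)
    show "integrable lebesgue (\<lambda>x. (l2_fun u x)\<^sup>2)"
      using square_integrable_l2_fun[of u] by (simp add: square_integrable_def)
    show "AE x in lebesgue. norm ((g x)\<^sup>2) \<le> norm ((l2_fun u x)\<^sup>2)"
      by (intro AE_I2) (auto simp: g_def indicator_def)
  qed (use g_meas in simp)
  with g_meas have g: "square_integrable g"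
    by (simp add: square_integrable_def)
  have "v n \<bullet> l2_of g = 0" for n
  proof -
    have "AE x in lebesgue. l2_fun (v n) x * g x = 0"
      using v[of n] unfolding L2_on_def mem_Collect_eq by eventually_elim (auto simp: g_def)
    then show ?thesis
      unfolding inner_l2_of[OF g] by (rule integral_eq_zero_AE)
  qed
  moreover have "(\<lambda>n. v n \<bullet> l2_of g) \<longlonglongrightarrow> u \<bullet> l2_of g"
    by (intro tendsto_inner lim tendsto_const)
  ultimately have "0 = u \<bullet> l2_of g"
    by (simp only: LIMSEQ_const_iff)
  moreover have "u \<bullet> l2_of g = (LINT x|lebesgue. (g x)\<^sup>2)"
    unfolding inner_l2_of[OF g]
    by (intro Bochner_Integration.integral_cong) (auto simp: g_def indicator_def power2_eq_square)
  ultimately have "(LINT x|lebesgue. (g x)\<^sup>2) = 0"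
    by simp
  then have "AE x in lebesgue. (g x)\<^sup>2 = 0"
    using g by (subst (asm) integral_nonneg_eq_0_iff_AE) (auto simp: square_integrable_def)
  then show ?thesis
    unfolding L2_on_def mem_Collect_eq by eventually_elim (auto simp: g_def)
qed

lemma is_weak_gradient_iff:
  "is_weak_gradient \<Omega> u G \<longleftrightarrow> (\<forall>i. G $ i \<in> L2_on \<Omega> \<and>
     (\<forall>\<eta>\<in>test_functions \<Omega>. u \<bullet> l2_of (partial_deriv (axis i 1) \<eta>) = - (G $ i \<bullet> l2_of \<eta>)))"
  unfolding is_weak_gradient_def by (simp add: weak_derivative_l2_iff axis_in_Basis_iff)

text \<open>On \<Omega> the fundamental lemma applies to the difference of the components; off
  \<Omega> both vanish because gradients are required to lie in
  \<open>L2_on \<Omega>\<close>.\<close>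

lemma is_weak_gradient_unique:
  assumes "open \<Omega>" "is_weak_gradient \<Omega> u G" "is_weak_gradient \<Omega> u G'"
  shows "G = G'"
proof -
  have "G $ i - G' $ i = 0" for i
  proof (rule l2_eqI)
    have "AE x in lebesgue. x \<in> \<Omega> \<longrightarrow> l2_fun (G $ i - G' $ i) x = 0"
      using assms by (intro l2_eq_zero_on) (auto simp: is_weak_gradient_iff inner_diff_left)
    moreover have "G $ i - G' $ i \<in> L2_on \<Omega>"
      using assms by (intro L2_on_diff) (auto simp: is_weak_gradient_iff)
    then have "AE x in lebesgue. x \<notin> \<Omega> \<longrightarrow> l2_fun (G $ i - G' $ i) x = 0"
      by (simp add: L2_on_def)
    ultimately show "AE x in lebesgue. l2_fun (G $ i - G' $ i) x = l2_fun 0 x"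
      using l2_fun_zero by eventually_elim auto
  qed
  then show ?thesis
    by (simp add: vec_eq_iff)
qed

lemma grad_eqI:
  assumes "open \<Omega>" "u \<in> L2_on \<Omega>" "is_weak_gradient \<Omega> u G"
  shows "u \<in> H1 \<Omega>" "grad \<Omega> u = G"
proof -
  show "u \<in> H1 \<Omega>"
    using assms by (auto simp: H1_def)
  then show "grad \<Omega> u = G"
    unfolding grad_def using is_weak_gradient_unique[OF assms(1)] assms(3) by (auto intro!: the_equality)
qed

lemma grad_is_weak_gradient:
  assumes "open \<Omega>" "u \<in> H1 \<Omega>"
  shows "is_weak_gradient \<Omega> u (grad \<Omega> u)" "u \<in> L2_on \<Omega>"
proof -
  obtain G where "is_weak_gradient \<Omega> u G" "u \<in> L2_on \<Omega>"
    using assms(2) by (auto simp: H1_def)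
  then show "is_weak_gradient \<Omega> u (grad \<Omega> u)" "u \<in> L2_on \<Omega>"
    using grad_eqI[OF assms(1)] by auto
qed

lemma H1_add:
  assumes "open \<Omega>" "u \<in> H1 \<Omega>" "v \<in> H1 \<Omega>"
  shows "u + v \<in> H1 \<Omega>" "grad \<Omega> (u + v) = grad \<Omega> u + grad \<Omega> v"
proof -
  have "u + v \<in> L2_on \<Omega>"
    using assms grad_is_weak_gradient(2) by (blast intro: L2_on_add)
  moreover have "is_weak_gradient \<Omega> (u + v) (grad \<Omega> u + grad \<Omega> v)"
    using grad_is_weak_gradient(1)[OF assms(1,2)] grad_is_weak_gradient(1)[OF assms(1,3)]
    by (auto simp: is_weak_gradient_iff inner_add_left intro: L2_on_add)
  ultimately show "u + v \<in> H1 \<Omega>" "grad \<Omega> (u + v) = grad \<Omega> u + grad \<Omega> v"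
    using grad_eqI[OF assms(1)] by auto
qed

lemma H1_scaleR:
  assumes "open \<Omega>" "u \<in> H1 \<Omega>"
  shows "c *\<^sub>R u \<in> H1 \<Omega>" "grad \<Omega> (c *\<^sub>R u) = c *\<^sub>R grad \<Omega> u"
proof -
  have "c *\<^sub>R u \<in> L2_on \<Omega>"
    using assms grad_is_weak_gradient(2) by (blast intro: L2_on_scaleR)
  moreover have "is_weak_gradient \<Omega> (c *\<^sub>R u) (c *\<^sub>R grad \<Omega> u)"
    using grad_is_weak_gradient(1)[OF assms] by (auto simp: is_weak_gradient_iff intro: L2_on_scaleR)
  ultimately show "c *\<^sub>R u \<in> H1 \<Omega>" "grad \<Omega> (c *\<^sub>R u) = c *\<^sub>R grad \<Omega> u"
    using grad_eqI[OF assms(1)] by auto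
qed

lemma H1_diff:
  assumes "open \<Omega>" "u \<in> H1 \<Omega>" "v \<in> H1 \<Omega>"
  shows "u - v \<in> H1 \<Omega>" "grad \<Omega> (u - v) = grad \<Omega> u - grad \<Omega> v"
  using H1_add[OF assms(1,2) H1_scaleR(1)[OF assms(1,3), of "-1"]] H1_scaleR(2)[OF assms(1,3), of "-1"] by auto

lemma test_function_H1:
  fixes \<Omega> :: "(real^'n) set"
  assumes "open \<Omega>" "\<eta> \<in> test_functions \<Omega>"
  shows "l2_of \<eta> \<in> H1 \<Omega>" "grad \<Omega> (l2_of \<eta>) = (\<chi> i. l2_of (partial_deriv (axis i 1) \<eta>))"
proof -
  obtain K where K: "K \<subseteq> \<Omega>" "\<And>x. x \<notin> K \<Longrightarrow> \<eta> x = 0"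
    using test_function_support[OF assms(2)] by metis
  have pd0: "partial_deriv b \<eta> x = 0" if "x \<notin> \<Omega>" for b x
    using test_function_support[OF assms(2), of b] that by (metis subsetD)
  note cs = test_function_compactly_supported[OF assms(2)]
  note sq = compactly_supported_square_integrable[OF cs(1)]
  have sq': "square_integrable (partial_deriv (axis i 1) \<eta>)" for i
    by (intro compactly_supported_square_integrable cs(2)) (simp add: axis_in_Basis_iff)
  have L2: "l2_of \<eta> \<in> L2_on \<Omega>"
    unfolding L2_on_def mem_Collect_eq using l2_fun_l2_of[OF sq] by eventually_elim (use K in auto)
  have "is_weak_gradient \<Omega> (l2_of \<eta>) (\<chi> i. l2_of (partial_deriv (axis i 1) \<eta>))"
    unfolding is_weak_gradient_iff
  proof (intro allI conjI ballI)
    fix i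
    have "AE x in lebesgue. x \<notin> \<Omega> \<longrightarrow> l2_fun (l2_of (partial_deriv (axis i 1) \<eta>)) x = 0"
      using l2_fun_l2_of[OF sq'[of i]] by eventually_elim (simp add: pd0)
    then show "(\<chi> i. l2_of (partial_deriv (axis i 1) \<eta>)) $ i \<in> L2_on \<Omega>"
      by (simp add: L2_on_def)
    fix \<psi> assume \<psi>: "\<psi> \<in> test_functions \<Omega>"
    let ?b = "axis i 1 :: real^'n"
    have b: "?b \<in> Basis"
      by (simp add: axis_in_Basis_iff)
    note cs' = test_function_compactly_supported[OF \<psi>]
    have inner_cs: "l2_of f \<bullet> l2_of g = (LINT x|lborel. f x * g x)"
      if f: "compactly_supported f" and g: "compactly_supported g" for f g :: "real^'n \<Rightarrow> real"
    proof -
      have "l2_of f \<bullet> l2_of g = (LINT x|lebesgue. f x * g x)"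
        unfolding inner_l2_of[OF compactly_supported_square_integrable[OF g]]
        using l2_fun_l2_of[OF compactly_supported_square_integrable[OF f]]
          compactly_supported_lebesgue(1)[OF f] compactly_supported_lebesgue(1)[OF g]
        by (intro integral_cong_AE) (auto elim: eventually_mono)
      also have "\<dots> = (LINT x|lborel. f x * g x)"
        using g by (intro compactly_supported_lebesgue(3) compactly_supported_mult f) (simp add: compactly_supported_def)
      finally show ?thesis .
    qed
    show "l2_of \<eta> \<bullet> l2_of (partial_deriv ?b \<psi>) = - ((\<chi> i. l2_of (partial_deriv (axis i 1) \<eta>)) $ i \<bullet> l2_of \<psi>)"
      using integral_by_parts_compact[OF test_function_C1_compact[OF assms(2)] test_function_C1_compact[OF \<psi>] b]
      by (simp add: inner_cs cs cs' b)
  qed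
  from grad_eqI[OF assms(1) L2 this]
  show "l2_of \<eta> \<in> H1 \<Omega>" "grad \<Omega> (l2_of \<eta>) = (\<chi> i. l2_of (partial_deriv (axis i 1) \<eta>))" .
qed

section \<open>The space \<open>H01\<close> as a closed subspace\<close>

lemma H01_subset_H1: "H01 \<Omega> \<subseteq> H1 \<Omega>"
  by (auto simp: H01_def)

lemma H1_norm_bounds:
  "norm u \<le> H1_norm \<Omega> u" "norm (grad \<Omega> u) \<le> H1_norm \<Omega> u" "H1_norm \<Omega> u \<le> norm u + norm (grad \<Omega> u)"
  unfolding H1_norm_def by (auto intro: real_le_rsqrt sqrt_sum_squares_le_sum)

text \<open>Sequences of test functions are easier to combine linearly and to pass to subsequences
  of than the closure in \<open>H1_norm\<close>.\<close>

lemma H01_iff: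
  assumes "open \<Omega>"
  shows "u \<in> H01 \<Omega> \<longleftrightarrow> u \<in> H1 \<Omega> \<and> (\<exists>\<eta>. (\<forall>k. \<eta> k \<in> test_functions \<Omega>) \<and>
     (\<lambda>k. l2_of (\<eta> k)) \<longlonglongrightarrow> u \<and> (\<lambda>k. grad \<Omega> (l2_of (\<eta> k))) \<longlonglongrightarrow> grad \<Omega> u)"
proof (intro iffI conjI)
  assume u: "u \<in> H01 \<Omega>"
  then have "\<exists>\<eta>\<in>test_functions \<Omega>. H1_norm \<Omega> (u - l2_of \<eta>) < inverse (Suc k)" for k
    by (auto simp: H01_def)
  then obtain \<eta> where \<eta>: "\<And>k. \<eta> k \<in> test_functions \<Omega>" "\<And>k. H1_norm \<Omega> (u - l2_of (\<eta> k)) < inverse (Suc k)"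
    by metis
  show H1: "u \<in> H1 \<Omega>"
    using u H01_subset_H1 by blast
  have "norm (l2_of (\<eta> k) - u) \<le> inverse (real (Suc k))" for k
    using H1_norm_bounds(1)[of "u - l2_of (\<eta> k)" \<Omega>] \<eta>(2)[of k] by (simp add: norm_minus_commute)
  then have "(\<lambda>k. l2_of (\<eta> k) - u) \<longlonglongrightarrow> 0"
    by (rule Lim_null_comparison[OF always_eventually[OF allI] LIMSEQ_inverse_real_of_nat])
  moreover have "norm (grad \<Omega> (l2_of (\<eta> k)) - grad \<Omega> u) \<le> inverse (real (Suc k))" for k
    using H1_norm_bounds(2)[of \<Omega> "u - l2_of (\<eta> k)"] \<eta>(2)[of k]
    by (simp add: norm_minus_commute H1_diff(2)[OF assms H1 test_function_H1(1)[OF assms \<eta>(1)]])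
  then have "(\<lambda>k. grad \<Omega> (l2_of (\<eta> k)) - grad \<Omega> u) \<longlonglongrightarrow> 0"
    by (rule Lim_null_comparison[OF always_eventually[OF allI] LIMSEQ_inverse_real_of_nat])
  ultimately show "\<exists>\<eta>. (\<forall>k. \<eta> k \<in> test_functions \<Omega>) \<and>
     (\<lambda>k. l2_of (\<eta> k)) \<longlonglongrightarrow> u \<and> (\<lambda>k. grad \<Omega> (l2_of (\<eta> k))) \<longlonglongrightarrow> grad \<Omega> u"
    using \<eta>(1) by (auto simp: LIM_zero_iff)
next
  assume "u \<in> H1 \<Omega> \<and> (\<exists>\<eta>. (\<forall>k. \<eta> k \<in> test_functions \<Omega>) \<and>
     (\<lambda>k. l2_of (\<eta> k)) \<longlonglongrightarrow> u \<and> (\<lambda>k. grad \<Omega> (l2_of (\<eta> k))) \<longlonglongrightarrow> grad \<Omega> u)"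
  then obtain \<eta> where u: "u \<in> H1 \<Omega>" and \<eta>: "\<And>k. \<eta> k \<in> test_functions \<Omega>"
    and lim: "(\<lambda>k. l2_of (\<eta> k)) \<longlonglongrightarrow> u" "(\<lambda>k. grad \<Omega> (l2_of (\<eta> k))) \<longlonglongrightarrow> grad \<Omega> u"
    by blast
  have "\<exists>\<eta>\<in>test_functions \<Omega>. H1_norm \<Omega> (u - l2_of \<eta>) < e" if "e > 0" for e
  proof -
    have "\<forall>\<^sub>F k in sequentially. dist (l2_of (\<eta> k)) u < e / 2 \<and> dist (grad \<Omega> (l2_of (\<eta> k))) (grad \<Omega> u) < e / 2"
      using tendstoD[OF lim(1), of "e / 2"] tendstoD[OF lim(2), of "e / 2"] that by (auto simp: eventually_conj)
    then obtain k where k: "dist (l2_of (\<eta> k)) u < e / 2" "dist (grad \<Omega> (l2_of (\<eta> k))) (grad \<Omega> u) < e / 2"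
      by (auto simp: eventually_sequentially)
    have "H1_norm \<Omega> (u - l2_of (\<eta> k)) \<le> norm (u - l2_of (\<eta> k)) + norm (grad \<Omega> u - grad \<Omega> (l2_of (\<eta> k)))"
      using H1_norm_bounds(3)[of \<Omega> "u - l2_of (\<eta> k)"] H1_diff(2)[OF assms u test_function_H1(1)[OF assms \<eta>]] by simp
    then show ?thesis
      using k \<eta>[of k] by (intro bexI[of _ "\<eta> k"]) (auto simp: dist_norm norm_minus_commute)
  qed
  then show "u \<in> H01 \<Omega>"
    using u by (simp add: H01_def)
qed

lemma H01_linear:
  assumes "open \<Omega>" "u \<in> H01 \<Omega>" "v \<in> H01 \<Omega>"
  shows "c *\<^sub>R u + d *\<^sub>R v \<in> H01 \<Omega>"
proof -
  note iff = H01_iff[OF assms(1)]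
  from assms(2) obtain \<eta> where u: "u \<in> H1 \<Omega>" and \<eta>: "\<And>k. \<eta> k \<in> test_functions \<Omega>"
    "(\<lambda>k. l2_of (\<eta> k)) \<longlonglongrightarrow> u" "(\<lambda>k. grad \<Omega> (l2_of (\<eta> k))) \<longlonglongrightarrow> grad \<Omega> u"
    unfolding iff by blast
  from assms(3) obtain \<psi> where v: "v \<in> H1 \<Omega>" and \<psi>: "\<And>k. \<psi> k \<in> test_functions \<Omega>"
    "(\<lambda>k. l2_of (\<psi> k)) \<longlonglongrightarrow> v" "(\<lambda>k. grad \<Omega> (l2_of (\<psi> k))) \<longlonglongrightarrow> grad \<Omega> v"
    unfolding iff by blast
  have lin: "l2_of (\<lambda>x. c * \<eta> k x + d * \<psi> k x) = c *\<^sub>R l2_of (\<eta> k) + d *\<^sub>R l2_of (\<psi> k)" for k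
    using compactly_supported_square_integrable[OF test_function_compactly_supported(1)[OF \<eta>(1)]]
      compactly_supported_square_integrable[OF test_function_compactly_supported(1)[OF \<psi>(1)]]
    by (simp add: l2_of_add l2_of_cmult square_integrable_cmult)
  have grad_lin: "grad \<Omega> (c *\<^sub>R p + d *\<^sub>R q) = c *\<^sub>R grad \<Omega> p + d *\<^sub>R grad \<Omega> q" "c *\<^sub>R p + d *\<^sub>R q \<in> H1 \<Omega>"
    if "p \<in> H1 \<Omega>" "q \<in> H1 \<Omega>" for p q
    using that H1_add[OF assms(1)] H1_scaleR[OF assms(1)] by auto
  show ?thesis
    unfolding iff
  proof (intro conjI exI[of _ "\<lambda>k x. c * \<eta> k x + d * \<psi> k x"] allI)
    show "(\<lambda>k. l2_of (\<lambda>x. c * \<eta> k x + d * \<psi> k x)) \<longlonglongrightarrow> c *\<^sub>R u + d *\<^sub>R v"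
      unfolding lin by (intro tendsto_add tendsto_scaleR tendsto_const \<eta> \<psi>)
    show "(\<lambda>k. grad \<Omega> (l2_of (\<lambda>x. c * \<eta> k x + d * \<psi> k x))) \<longlonglongrightarrow> grad \<Omega> (c *\<^sub>R u + d *\<^sub>R v)"
      unfolding lin grad_lin(1)[OF test_function_H1(1)[OF assms(1) \<eta>(1)] test_function_H1(1)[OF assms(1) \<psi>(1)]]
        grad_lin(1)[OF u v]
      by (intro tendsto_add tendsto_scaleR tendsto_const \<eta> \<psi>)
    show "(\<lambda>x. c * \<eta> k x + d * \<psi> k x) \<in> test_functions \<Omega>" for k
      by (rule test_functions_linear[OF \<eta>(1) \<psi>(1)])
  qed (rule grad_lin(2)[OF u v])
qed

lemma H01_zero:
  fixes \<Omega> :: "(real^'n) set"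
  assumes \<Omega>: "open \<Omega>"
  shows "0 \<in> H01 \<Omega>"
  unfolding H01_iff[OF \<Omega>]
proof (intro conjI exI[of _ "\<lambda>k x. 0"] allI)
  have 0: "(\<lambda>x. 0) \<in> test_functions \<Omega>"
    by (rule test_functionI[of _ "{}"]) (auto intro: Ck_const)
  have "l2_of (\<lambda>x. 0) = (0 :: (real^'n) l2)"
    using l2_of_cmult[OF square_integrable_zero, of 0] by simp
  then show "0 \<in> H1 \<Omega>" "(\<lambda>k. l2_of (\<lambda>x::real^'n. 0)) \<longlonglongrightarrow> 0"
    "(\<lambda>k. grad \<Omega> (l2_of (\<lambda>x. 0))) \<longlonglongrightarrow> grad \<Omega> 0"
    using test_function_H1(1)[OF \<Omega> 0] by auto
  show "(\<lambda>x. 0) \<in> test_functions \<Omega>"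
    by (rule 0)
qed

lemma subspace_H01: "open \<Omega> \<Longrightarrow> subspace (H01 \<Omega>)"
  unfolding subspace_def
  using H01_zero H01_linear[of \<Omega> _ _ 1 1] H01_linear[of \<Omega> _ _ _ 0] by fastforce

text \<open>The conditions of \<open>is_weak_gradient_iff\<close> pass to the limit and identify the
  gradient of \<open>u\<close>. For membership, a test function close to \<open>v n\<close> is close
  to \<open>u\<close> as well; the four errors of \<open>e / 4\<close> come from two distances, each
  in value and in gradient.\<close>

lemma H01_closed:
  assumes "open \<Omega>" and v: "\<And>n. v n \<in> H01 \<Omega>" and lim: "v \<longlonglongrightarrow> u" "(\<lambda>n. grad \<Omega> (v n)) \<longlonglongrightarrow> G"
  shows "u \<in> H01 \<Omega>" "grad \<Omega> u = G"
proof -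
  have \<Omega>: "\<Omega> \<in> sets lebesgue"
    using assms(1) by (simp add: borel_open sets_completionI_sets)
  have vH: "v n \<in> H1 \<Omega>" for n
    using v H01_subset_H1 by blast
  note wg = grad_is_weak_gradient[OF assms(1) vH]
  have uL: "u \<in> L2_on \<Omega>"
    by (rule L2_on_closed[OF \<Omega> wg(2) lim(1)])
  have G_lim: "(\<lambda>n. grad \<Omega> (v n) $ i) \<longlonglongrightarrow> G $ i" for i
    by (intro tendsto_vec_nth lim)
  have "is_weak_gradient \<Omega> u G"
    unfolding is_weak_gradient_iff
  proof (intro allI conjI ballI)
    show "G $ i \<in> L2_on \<Omega>" for i
      by (rule L2_on_closed[OF \<Omega> _ G_lim]) (use wg(1) in \<open>simp add: is_weak_gradient_iff\<close>)
    fix i \<eta> assume \<eta>: "\<eta> \<in> test_functions \<Omega>"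
    have "(\<lambda>n. v n \<bullet> l2_of (partial_deriv (axis i 1) \<eta>)) \<longlonglongrightarrow> u \<bullet> l2_of (partial_deriv (axis i 1) \<eta>)"
      by (intro tendsto_inner lim tendsto_const)
    moreover have "v n \<bullet> l2_of (partial_deriv (axis i 1) \<eta>) = - (grad \<Omega> (v n) $ i \<bullet> l2_of \<eta>)" for n
      using wg(1)[of n] \<eta> by (simp add: is_weak_gradient_iff)
    moreover have "(\<lambda>n. - (grad \<Omega> (v n) $ i \<bullet> l2_of \<eta>)) \<longlonglongrightarrow> - (G $ i \<bullet> l2_of \<eta>)"
      by (intro tendsto_minus tendsto_inner G_lim tendsto_const)
    ultimately show "u \<bullet> l2_of (partial_deriv (axis i 1) \<eta>) = - (G $ i \<bullet> l2_of \<eta>)"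
      using LIMSEQ_unique by simp
  qed
  note u = grad_eqI[OF assms(1) uL this]
  then show "grad \<Omega> u = G"
    by simp
  have "\<exists>\<eta>\<in>test_functions \<Omega>. H1_norm \<Omega> (u - l2_of \<eta>) < e" if e: "e > 0" for e
  proof -
    have "\<forall>\<^sub>F n in sequentially. dist (v n) u < e / 4 \<and> dist (grad \<Omega> (v n)) G < e / 4"
      using tendstoD[OF lim(1), of "e / 4"] tendstoD[OF lim(2), of "e / 4"] e by (auto simp: eventually_conj)
    then obtain n where n: "dist (v n) u < e / 4" "dist (grad \<Omega> (v n)) G < e / 4"
      by (auto simp: eventually_sequentially)
    obtain \<eta> where \<eta>: "\<eta> \<in> test_functions \<Omega>" "H1_norm \<Omega> (v n - l2_of \<eta>) < e / 4"
      using v[of n] e unfolding H01_def mem_Collect_eq by (metis divide_pos_pos zero_less_numeral)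
    have \<eta>H: "l2_of \<eta> \<in> H1 \<Omega>"
      by (rule test_function_H1(1)[OF assms(1) \<eta>(1)])
    have "norm (u - l2_of \<eta>) \<le> norm (v n - l2_of \<eta>) + dist (v n) u"
      using norm_triangle_ineq[of "v n - l2_of \<eta>" "u - v n"] by (simp add: dist_norm norm_minus_commute)
    moreover have "norm (grad \<Omega> u - grad \<Omega> (l2_of \<eta>)) \<le> norm (grad \<Omega> (v n) - grad \<Omega> (l2_of \<eta>)) + dist (grad \<Omega> (v n)) G"
      using norm_triangle_ineq[of "grad \<Omega> (v n) - grad \<Omega> (l2_of \<eta>)" "G - grad \<Omega> (v n)"] u(2)
      by (simp add: dist_norm norm_minus_commute)
    moreover have "norm (v n - l2_of \<eta>) < e / 4" "norm (grad \<Omega> (v n) - grad \<Omega> (l2_of \<eta>)) < e / 4"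
      using H1_norm_bounds(1)[of "v n - l2_of \<eta>" \<Omega>] H1_norm_bounds(2)[of \<Omega> "v n - l2_of \<eta>"] \<eta>(2)
        H1_diff(2)[OF assms(1) vH \<eta>H] by (metis order_le_less_trans)+
    moreover have "H1_norm \<Omega> (u - l2_of \<eta>) \<le> norm (u - l2_of \<eta>) + norm (grad \<Omega> u - grad \<Omega> (l2_of \<eta>))"
      using H1_norm_bounds(3)[of \<Omega> "u - l2_of \<eta>"] H1_diff(2)[OF assms(1) u(1) \<eta>H] by simp
    ultimately have "H1_norm \<Omega> (u - l2_of \<eta>) < e"
      using n by linarith
    then show ?thesis
      using \<eta>(1) by blast
  qed
  then show "u \<in> H01 \<Omega>"
    using u by (simp add: H01_def)
qed

section \<open>The Ladyzhenskaya inequality\<close>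

lemma ennreal_le_of_power2_le:
  assumes "a\<^sup>2 \<le> (b::ennreal)\<^sup>2"
  shows "a \<le> b"
proof (cases "b = top")
  case False
  then have "b\<^sup>2 < top"
    by (simp add: less_top power2_eq_square ennreal_mult_less_top)
  with assms have "a\<^sup>2 < top"
    by (rule order.strict_trans1)
  then have "a < top"
    by (cases "a = top") (auto simp: less_top power2_eq_square)
  then obtain r s where "0 \<le> r" "0 \<le> s" "a = ennreal r" "b = ennreal s"
    using False by (metis ennreal_cases less_top infinity_ennreal_def)
  then show ?thesis
    using assms by (simp add: ennreal_power power2_le_iff_abs_le)
qed simp

text \<open>A square root valid up to infinity, so that Cauchy-Schwarz can be used on
  extended-valued factors before any integral is known to be finite.\<close>

definition ennsqrt :: "ennreal \<Rightarrow> ennreal" where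
  "ennsqrt x = (if x = top then top else ennreal (sqrt (enn2real x)))"

lemma ennsqrt_sq: "(ennsqrt x)\<^sup>2 = x"
proof (cases "x = top")
  case False
  then have "(ennreal (sqrt (enn2real x)))\<^sup>2 = ennreal (enn2real x)"
    by (simp add: ennreal_power)
  then show ?thesis
    using False by (simp add: ennsqrt_def less_top)
qed (simp add: ennsqrt_def power2_eq_square)

lemma ennsqrt_measurable [measurable]: "ennsqrt \<in> borel_measurable borel"
  unfolding ennsqrt_def by measurable

text \<open>The hypothesis says that \<open>A\<close> is at most the geometric mean of
  \<open>p\<close> and \<open>q\<close>, in a form free of roots.\<close>

lemma Cauchy_Schwarz_nn_integral_le:
  assumes [measurable]: "p \<in> borel_measurable M" "q \<in> borel_measurable M"
    and le: "\<And>x. x \<in> space M \<Longrightarrow> (A x)\<^sup>2 \<le> p x * q x"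
  shows "(\<integral>\<^sup>+x. A x \<partial>M)\<^sup>2 \<le> (\<integral>\<^sup>+x. p x \<partial>M) * (\<integral>\<^sup>+x. q x \<partial>M)"
proof -
  have "(\<integral>\<^sup>+x. A x \<partial>M) \<le> (\<integral>\<^sup>+x. ennsqrt (p x) * ennsqrt (q x) \<partial>M)"
  proof (rule nn_integral_mono)
    fix x assume "x \<in> space M"
    then show "A x \<le> ennsqrt (p x) * ennsqrt (q x)"
      using le[of x] by (rule_tac ennreal_le_of_power2_le)
        (simp add: power_mult_distrib ennsqrt_sq)
  qed
  then have "(\<integral>\<^sup>+x. A x \<partial>M)\<^sup>2 \<le> (\<integral>\<^sup>+x. ennsqrt (p x) * ennsqrt (q x) \<partial>M)\<^sup>2"
    by (rule power_mono) simp
  also have "\<dots> \<le> (\<integral>\<^sup>+x. (ennsqrt (p x))\<^sup>2 \<partial>M) * (\<integral>\<^sup>+x. (ennsqrt (q x))\<^sup>2 \<partial>M)"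
    by (rule Cauchy_Schwarz_nn_integral) measurable
  finally show ?thesis
    by (simp add: ennsqrt_sq)
qed

text \<open>Isolates what the argument takes from calculus, an estimate along coordinate lines, with
  \<open>G i\<close> in the role of the absolute partial derivative. In contrast to smoothness on a
  fixed space, this property passes directly to the function obtained by freezing a coordinate, so
  the dimension can be built up.\<close>

definition sliceable :: "'i set \<Rightarrow> (('i \<Rightarrow> real) \<Rightarrow> ennreal) \<Rightarrow> ('i \<Rightarrow> ('i \<Rightarrow> real) \<Rightarrow> ennreal) \<Rightarrow> bool" where
  "sliceable I U G \<longleftrightarrow> U \<in> borel_measurable (Pi\<^sub>M I (\<lambda>_. lborel)) \<and>
     (\<forall>i\<in>I. G i \<in> borel_measurable (Pi\<^sub>M I (\<lambda>_. lborel))) \<and>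
     (\<forall>i\<in>I. \<forall>x\<in>space (Pi\<^sub>M I (\<lambda>_. lborel)). (U x)\<^sup>2 \<le> 2 * (\<integral>\<^sup>+z. U (x(i := z)) * G i (x(i := z)) \<partial>lborel))"

interpretation lborel_product: product_sigma_finite "\<lambda>_. lborel :: real measure"
  by standard

abbreviation (input) "PiL I \<equiv> Pi\<^sub>M I (\<lambda>_. lborel :: real measure)"

lemma measurable_fun_upd_slice:
  assumes "U \<in> borel_measurable (PiL (insert i I))"
  shows "(\<lambda>(z, x). U (x(i := z))) \<in> borel_measurable (lborel \<Otimes>\<^sub>M PiL I)"
    "(\<lambda>x. U (x(i := z))) \<in> borel_measurable (PiL I)"
proof -
  have "(\<lambda>(x, z). x(i := z)) \<in> PiL I \<Otimes>\<^sub>M lborel \<rightarrow>\<^sub>M PiL (insert i I)"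
    by (rule measurable_add_dim)
  then have "(\<lambda>(x, z). U (x(i := z))) \<in> borel_measurable (PiL I \<Otimes>\<^sub>M lborel)"
    using assms by (simp add: case_prod_unfold measurable_compose)
  then show *: "(\<lambda>(z, x). U (x(i := z))) \<in> borel_measurable (lborel \<Otimes>\<^sub>M PiL I)"
    by (drule_tac measurable_pair_swap) (simp add: case_prod_unfold)
  have "(\<lambda>x. (z, x)) \<in> PiL I \<rightarrow>\<^sub>M lborel \<Otimes>\<^sub>M PiL I"
    by (rule measurable_Pair1') simp
  from measurable_comp[OF this *] show "(\<lambda>x. U (x(i := z))) \<in> borel_measurable (PiL I)"
    by (simp add: comp_def)
qed

lemma measurable_slice_integral:
  assumes "finite I" "U \<in> borel_measurable (PiL (insert i I))"
  shows "(\<lambda>z. \<integral>\<^sup>+x. U (x(i := z)) \<partial>PiL I) \<in> borel_measurable lborel"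
proof -
  interpret I: finite_product_sigma_finite "\<lambda>_. lborel :: real measure" I
    by standard (rule assms(1))
  show ?thesis
    using measurable_fun_upd_slice(1)[OF assms(2)] by (rule I.borel_measurable_nn_integral)
qed

lemma space_PiL_upd: "x \<in> space (PiL I) \<Longrightarrow> x(i := z) \<in> space (PiL (insert i I))"
  by (auto simp: space_PiM PiE_iff extensional_def)

text \<open>Here \<open>U\<close> is a function on \<open>\<real>\<^sup>I\<^sup>+\<^sup>1\<close>; its slices satisfy the hypothesis, and the factor
  \<open>\<integral> U\<^sup>2\<close> over a slice is bounded uniformly in the slice.\<close>

lemma slice_step:
  assumes I: "finite I" "i \<notin> I" and U: "sliceable (insert i I) U G"
    and meas: "p \<in> borel_measurable lborel" "q \<in> borel_measurable lborel"
    and IH: "\<And>z. (\<integral>\<^sup>+x. (U (x(i := z)))^4 \<partial>PiL I)\<^sup>2 \<le> c * (\<integral>\<^sup>+x. (U (x(i := z)))\<^sup>2 \<partial>PiL I)\<^sup>2 * (p z * q z)"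
  shows "(\<integral>\<^sup>+x. (U x)^4 \<partial>PiL (insert i I))\<^sup>2 \<le> 4 * c * ((\<integral>\<^sup>+x. (U x)\<^sup>2 \<partial>PiL (insert i I)) *
     (\<integral>\<^sup>+x. (G i x)\<^sup>2 \<partial>PiL (insert i I))) * ((\<integral>\<^sup>+z. p z \<partial>lborel) * (\<integral>\<^sup>+z. q z \<partial>lborel))"
proof -
  have [measurable]: "U \<in> borel_measurable (PiL (insert i I))" "G i \<in> borel_measurable (PiL (insert i I))"
    and Ui: "\<And>x. x \<in> space (PiL (insert i I)) \<Longrightarrow> (U x)\<^sup>2 \<le> 2 * (\<integral>\<^sup>+z. U (x(i := z)) * G i (x(i := z)) \<partial>lborel)"
    using U by (auto simp: sliceable_def)
  note [measurable] = meas
  define W where "W = (\<integral>\<^sup>+x. U x * G i x \<partial>PiL (insert i I))"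
  have W: "W\<^sup>2 \<le> (\<integral>\<^sup>+x. (U x)\<^sup>2 \<partial>PiL (insert i I)) * (\<integral>\<^sup>+x. (G i x)\<^sup>2 \<partial>PiL (insert i I))"
    unfolding W_def by (rule Cauchy_Schwarz_nn_integral) measurable
  have slice: "(\<integral>\<^sup>+x. (U (x(i := z)))\<^sup>2 \<partial>PiL I) \<le> 2 * W" for z
  proof -
    have "(\<integral>\<^sup>+x. (U (x(i := z)))\<^sup>2 \<partial>PiL I) \<le> (\<integral>\<^sup>+x. 2 * (\<integral>\<^sup>+w. U (x(i := w)) * G i (x(i := w)) \<partial>lborel) \<partial>PiL I)"
    proof (rule nn_integral_mono)
      fix x assume "x \<in> space (PiL I)"
      from Ui[OF space_PiL_upd[OF this], of z]
      show "(U (x(i := z)))\<^sup>2 \<le> 2 * (\<integral>\<^sup>+w. U (x(i := w)) * G i (x(i := w)) \<partial>lborel)"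
        by simp
    qed
    also have "\<dots> = 2 * (\<integral>\<^sup>+x. (\<integral>\<^sup>+w. U (x(i := w)) * G i (x(i := w)) \<partial>lborel) \<partial>PiL I)"
    proof (rule nn_integral_cmult)
      have "(\<lambda>x. U x * G i x) \<in> borel_measurable (PiL (insert i I))"
        by measurable
      from measurable_comp[OF measurable_add_dim this]
      have "(\<lambda>(x, w). U (x(i := w)) * G i (x(i := w))) \<in> borel_measurable (PiL I \<Otimes>\<^sub>M lborel)"
        by (simp add: case_prod_unfold comp_def)
      then show "(\<lambda>x. \<integral>\<^sup>+w. U (x(i := w)) * G i (x(i := w)) \<partial>lborel) \<in> borel_measurable (PiL I)"
        by (rule lborel.borel_measurable_nn_integral)
    qed
    also have "(\<integral>\<^sup>+x. (\<integral>\<^sup>+w. U (x(i := w)) * G i (x(i := w)) \<partial>lborel) \<partial>PiL I) = W"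
      unfolding W_def by (rule lborel_product.product_nn_integral_insert[symmetric, OF I]) measurable
    finally show ?thesis .
  qed
  \<comment> \<open>Cauchy-Schwarz in \<open>z\<close> splits \<open>p z * q z\<close>. The two
    powers of the slice integral have become the constant \<open>(2 * W)\<^sup>2\<close>, and
    \<open>W\<^sup>2\<close> is again estimated by Cauchy-Schwarz.\<close>
  have "(\<integral>\<^sup>+z. (\<integral>\<^sup>+x. (U (x(i := z)))^4 \<partial>PiL I) \<partial>lborel)\<^sup>2 \<le>
     (\<integral>\<^sup>+z. (c * (2 * W)\<^sup>2) * p z \<partial>lborel) * (\<integral>\<^sup>+z. q z \<partial>lborel)"
  proof (rule Cauchy_Schwarz_nn_integral_le)
    fix z :: real
    have "(\<integral>\<^sup>+x. (U (x(i := z)))^4 \<partial>PiL I)\<^sup>2 \<le> c * (\<integral>\<^sup>+x. (U (x(i := z)))\<^sup>2 \<partial>PiL I)\<^sup>2 * (p z * q z)"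
      by (rule IH)
    also have "\<dots> \<le> c * (2 * W)\<^sup>2 * (p z * q z)"
      by (intro mult_right_mono mult_left_mono power_mono slice) auto
    finally show "(\<integral>\<^sup>+x. (U (x(i := z)))^4 \<partial>PiL I)\<^sup>2 \<le> c * (2 * W)\<^sup>2 * p z * q z"
      by (simp add: mult.assoc)
  qed measurable
  also have "(\<integral>\<^sup>+z. (c * (2 * W)\<^sup>2) * p z \<partial>lborel) = (c * (2 * W)\<^sup>2) * (\<integral>\<^sup>+z. p z \<partial>lborel)"
    by (rule nn_integral_cmult) measurable
  also have "(c * (2 * W)\<^sup>2) * (\<integral>\<^sup>+z. p z \<partial>lborel) * (\<integral>\<^sup>+z. q z \<partial>lborel) =
      4 * c * W\<^sup>2 * ((\<integral>\<^sup>+z. p z \<partial>lborel) * (\<integral>\<^sup>+z. q z \<partial>lborel))"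
    by (simp add: power_mult_distrib mult_ac)
  also have "\<dots> \<le> 4 * c * ((\<integral>\<^sup>+x. (U x)\<^sup>2 \<partial>PiL (insert i I)) * (\<integral>\<^sup>+x. (G i x)\<^sup>2 \<partial>PiL (insert i I)))
      * ((\<integral>\<^sup>+z. p z \<partial>lborel) * (\<integral>\<^sup>+z. q z \<partial>lborel))"
    by (intro mult_right_mono mult_left_mono W) auto
  also have "(\<integral>\<^sup>+z. (\<integral>\<^sup>+x. (U (x(i := z)))^4 \<partial>PiL I) \<partial>lborel) = (\<integral>\<^sup>+x. (U x)^4 \<partial>PiL (insert i I))"
    by (rule lborel_product.product_nn_integral_insert_rev[symmetric, OF I]) measurable
  finally show ?thesis .
qed

lemma sliceable_slice:
  assumes "i \<notin> I" "sliceable (insert i I) U G"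
  shows "sliceable I (\<lambda>x. U (x(i := z))) (\<lambda>j x. G j (x(i := z)))"
  unfolding sliceable_def
proof (intro conjI ballI)
  show "(\<lambda>x. U (x(i := z))) \<in> borel_measurable (PiL I)"
    using assms by (intro measurable_fun_upd_slice) (auto simp: sliceable_def)
  fix j assume j: "j \<in> I"
  then show "(\<lambda>x. G j (x(i := z))) \<in> borel_measurable (PiL I)"
    using assms by (intro measurable_fun_upd_slice) (auto simp: sliceable_def)
  fix x assume "x \<in> space (PiL I)"
  then have "(U (x(i := z)))\<^sup>2 \<le> 2 * (\<integral>\<^sup>+w. U (x(i := z, j := w)) * G j (x(i := z, j := w)) \<partial>lborel)"
    using assms j space_PiL_upd[of x I i z] by (auto simp: sliceable_def)
  moreover have "x(i := z, j := w) = x(j := w, i := z)" for w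
    using assms(1) j by (intro fun_upd_twist) auto
  ultimately show "(U (x(i := z)))\<^sup>2 \<le> 2 * (\<integral>\<^sup>+w. U (x(j := w, i := z)) * G j (x(j := w, i := z)) \<partial>lborel)"
    by simp
qed

lemma slice_integral_sq:
  assumes "finite I" "i \<notin> I" "H \<in> borel_measurable (PiL (insert i I))"
  shows "(\<lambda>z. \<integral>\<^sup>+x. (H (x(i := z)))\<^sup>2 \<partial>PiL I) \<in> borel_measurable lborel"
    "(\<integral>\<^sup>+z. (\<integral>\<^sup>+x. (H (x(i := z)))\<^sup>2 \<partial>PiL I) \<partial>lborel) = (\<integral>\<^sup>+x. (H x)\<^sup>2 \<partial>PiL (insert i I))"
proof -
  have m: "(\<lambda>x. (H x)\<^sup>2) \<in> borel_measurable (PiL (insert i I))"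
    using assms(3) by measurable
  show "(\<lambda>z. \<integral>\<^sup>+x. (H (x(i := z)))\<^sup>2 \<partial>PiL I) \<in> borel_measurable lborel"
    using measurable_slice_integral[OF assms(1) m] .
  show "(\<integral>\<^sup>+z. (\<integral>\<^sup>+x. (H (x(i := z)))\<^sup>2 \<partial>PiL I) \<partial>lborel) = (\<integral>\<^sup>+x. (H x)\<^sup>2 \<partial>PiL (insert i I))"
    using lborel_product.product_nn_integral_insert_rev[OF assms(1,2) m] by simp
qed

text \<open>The step starts from the empty index set, where integrals are evaluations and the eighth
  power of \<open>U\<close> is \<open>(U\<^sup>2)\<^sup>2 * (U\<^sup>2 * U\<^sup>2)\<close>: so
  \<open>c = 1\<close>, and \<open>p\<close> and \<open>q\<close> are both the slice of
  \<open>U\<^sup>2\<close>.\<close>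

lemma ladyzhenskaya_1:
  assumes U: "sliceable {i} U G"
  shows "(\<integral>\<^sup>+x. (U x)^4 \<partial>PiL {i})\<^sup>2 \<le> 4 * (\<integral>\<^sup>+x. (U x)\<^sup>2 \<partial>PiL {i})^3 * (\<integral>\<^sup>+x. (G i x)\<^sup>2 \<partial>PiL {i})"
proof -
  have m: "U \<in> borel_measurable (PiL {i})"
    using U by (simp add: sliceable_def)
  note N = slice_integral_sq[OF finite.emptyI empty_iff[THEN iffD1, THEN notI] m, simplified]
  have "(\<integral>\<^sup>+x. (U x)^4 \<partial>PiL {i})\<^sup>2 \<le> 4 * 1 * ((\<integral>\<^sup>+x. (U x)\<^sup>2 \<partial>PiL {i}) * (\<integral>\<^sup>+x. (G i x)\<^sup>2 \<partial>PiL {i})) *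
    ((\<integral>\<^sup>+z. (\<integral>\<^sup>+x. (U (x(i := z)))\<^sup>2 \<partial>PiL {}) \<partial>lborel) * (\<integral>\<^sup>+z. (\<integral>\<^sup>+x. (U (x(i := z)))\<^sup>2 \<partial>PiL {}) \<partial>lborel))"
  proof (rule slice_step[OF finite.emptyI _ U])
    show "(\<integral>\<^sup>+x. (U (x(i := z)))^4 \<partial>PiL {})\<^sup>2 \<le> 1 * (\<integral>\<^sup>+x. (U (x(i := z)))\<^sup>2 \<partial>PiL {})\<^sup>2 *
        ((\<integral>\<^sup>+x. (U (x(i := z)))\<^sup>2 \<partial>PiL {}) * (\<integral>\<^sup>+x. (U (x(i := z)))\<^sup>2 \<partial>PiL {}))" for z
      by (simp add: PiM_empty nn_integral_count_space_finite power4_eq_xxxx power2_eq_square mult_ac)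
  qed (use N(1) in auto)
  also have "(\<integral>\<^sup>+z. (\<integral>\<^sup>+x. (U (x(i := z)))\<^sup>2 \<partial>PiL {}) \<partial>lborel) = (\<integral>\<^sup>+x. (U x)\<^sup>2 \<partial>PiL {i})"
    using slice_integral_sq(2)[of "{}" i U] m by simp
  finally show ?thesis
    by (simp add: power3_eq_cube mult_ac)
qed

text \<open>Of the three powers of the integral of \<open>U\<^sup>2\<close> in dimension one, two
  are bounded uniformly over the slices and the third becomes \<open>p\<close>. Each added dimension
  exchanges one such power for the integral of another \<open>(G i)\<^sup>2\<close>.\<close>

lemma ladyzhenskaya_2:
  assumes "i \<noteq> j" and U: "sliceable {i, j} U G"
  shows "(\<integral>\<^sup>+x. (U x)^4 \<partial>PiL {i, j})\<^sup>2 \<le> 16 * (\<integral>\<^sup>+x. (U x)\<^sup>2 \<partial>PiL {i, j})\<^sup>2 *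
     ((\<integral>\<^sup>+x. (G i x)\<^sup>2 \<partial>PiL {i, j}) * (\<integral>\<^sup>+x. (G j x)\<^sup>2 \<partial>PiL {i, j}))"
proof -
  have i: "i \<notin> {j}"
    using assms by simp
  have m: "U \<in> borel_measurable (PiL {i, j})" "G j \<in> borel_measurable (PiL {i, j})"
    using U by (auto simp: sliceable_def)
  have fin: "finite {j}"
    by simp
  note N = slice_integral_sq[OF fin i m(1)] and H = slice_integral_sq[OF fin i m(2)]
  have "(\<integral>\<^sup>+x. (U x)^4 \<partial>PiL {i, j})\<^sup>2 \<le> 4 * 4 * ((\<integral>\<^sup>+x. (U x)\<^sup>2 \<partial>PiL {i, j}) * (\<integral>\<^sup>+x. (G i x)\<^sup>2 \<partial>PiL {i, j})) *
    ((\<integral>\<^sup>+z. (\<integral>\<^sup>+x. (U (x(i := z)))\<^sup>2 \<partial>PiL {j}) \<partial>lborel) * (\<integral>\<^sup>+z. (\<integral>\<^sup>+x. (G j (x(i := z)))\<^sup>2 \<partial>PiL {j}) \<partial>lborel))"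
  proof (rule slice_step[OF fin i U N(1) H(1)])
    show "(\<integral>\<^sup>+x. (U (x(i := z)))^4 \<partial>PiL {j})\<^sup>2 \<le> 4 * (\<integral>\<^sup>+x. (U (x(i := z)))\<^sup>2 \<partial>PiL {j})\<^sup>2 *
        ((\<integral>\<^sup>+x. (U (x(i := z)))\<^sup>2 \<partial>PiL {j}) * (\<integral>\<^sup>+x. (G j (x(i := z)))\<^sup>2 \<partial>PiL {j}))" for z
      using ladyzhenskaya_1[OF sliceable_slice[OF i U], of z]
      by (simp add: power2_eq_square power3_eq_cube mult_ac)
  qed
  then show ?thesis
    unfolding N(2) H(2) by (simp add: power2_eq_square mult_ac)
qed

text \<open>\<open>slice_step\<close> takes two powers of the slice integral of
  \<open>U\<^sup>2\<close>, which is what dimension two supplies. The result retains one, so three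
  is the last dimension reached in this way.\<close>

lemma ladyzhenskaya_3:
  assumes "i \<noteq> j" "i \<noteq> k" "j \<noteq> k" and U: "sliceable {i, j, k} U G"
  shows "(\<integral>\<^sup>+x. (U x)^4 \<partial>PiL {i, j, k})\<^sup>2 \<le> 64 * (\<integral>\<^sup>+x. (U x)\<^sup>2 \<partial>PiL {i, j, k}) *
     ((\<integral>\<^sup>+x. (G i x)\<^sup>2 \<partial>PiL {i, j, k}) * (\<integral>\<^sup>+x. (G j x)\<^sup>2 \<partial>PiL {i, j, k}) * (\<integral>\<^sup>+x. (G k x)\<^sup>2 \<partial>PiL {i, j, k}))"
proof -
  have i: "i \<notin> {j, k}"
    using assms by simp
  have m: "G j \<in> borel_measurable (PiL {i, j, k})" "G k \<in> borel_measurable (PiL {i, j, k})"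
    using U by (auto simp: sliceable_def)
  have fin: "finite {j, k}"
    by simp
  note J = slice_integral_sq[OF fin i m(1)] and H = slice_integral_sq[OF fin i m(2)]
  have "(\<integral>\<^sup>+x. (U x)^4 \<partial>PiL {i, j, k})\<^sup>2 \<le> 4 * 16 * ((\<integral>\<^sup>+x. (U x)\<^sup>2 \<partial>PiL {i, j, k}) * (\<integral>\<^sup>+x. (G i x)\<^sup>2 \<partial>PiL {i, j, k})) *
    ((\<integral>\<^sup>+z. (\<integral>\<^sup>+x. (G j (x(i := z)))\<^sup>2 \<partial>PiL {j, k}) \<partial>lborel) * (\<integral>\<^sup>+z. (\<integral>\<^sup>+x. (G k (x(i := z)))\<^sup>2 \<partial>PiL {j, k}) \<partial>lborel))"
    using ladyzhenskaya_2[OF assms(3) sliceable_slice[OF i U]]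
    by (intro slice_step[OF fin i U J(1) H(1)]) auto
  then show ?thesis
    unfolding J(2) H(2) by (simp add: mult_ac)
qed

text \<open>On the line through \<open>X\<close> in direction \<open>b\<close>, the squared value is
  the integral of \<open>2 * \<phi> t * \<phi>' t\<close> from a point below the support. The
  parameter is shifted so that \<open>X\<close> sits at \<open>c\<close>, which will be the
  coordinate replaced by \<open>z\<close>.\<close>

lemma C1_compact_slice:
  fixes \<eta> :: "'a::euclidean_space \<Rightarrow> real"
  assumes \<eta>: "C1_compact \<eta>" and b: "b \<in> Basis"
  shows "(ennreal \<bar>\<eta> X\<bar>)\<^sup>2 \<le> 2 * (\<integral>\<^sup>+z. ennreal \<bar>\<eta> (X + (z - c) *\<^sub>R b)\<bar> * ennreal \<bar>partial_deriv b \<eta> (X + (z - c) *\<^sub>R b)\<bar> \<partial>lborel)"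
proof -
  define Y where "Y = X - c *\<^sub>R b"
  define \<phi> where "\<phi> t = \<eta> (Y + t *\<^sub>R b)" for t
  define \<phi>' where "\<phi>' t = partial_deriv b \<eta> (Y + t *\<^sub>R b)" for t
  have shift: "X + (z - c) *\<^sub>R b = Y + z *\<^sub>R b" for z
    by (simp add: Y_def algebra_simps)
  have deriv: "(\<phi> has_real_derivative \<phi>' t) (at t)" for t
    unfolding \<phi>_def \<phi>'_def by (rule C1_compact_line_derivative[OF \<eta>])
  obtain K where K: "compact K" "\<And>x. x \<notin> K \<Longrightarrow> \<eta> x = 0" and cs: "compactly_supported \<eta>"
    using \<eta> by (auto simp: C1_compact_def compactly_supported_def)
  obtain R where R: "\<And>x. x \<in> K \<Longrightarrow> norm x \<le> R"
    using compact_imp_bounded[OF K(1)] by (auto simp: bounded_iff)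
  have \<phi>0: "\<phi> t = 0" if "\<bar>t\<bar> > R + norm Y" for t
  proof -
    have "norm (t *\<^sub>R b) \<le> norm (Y + t *\<^sub>R b) + norm Y"
      using norm_triangle_ineq4[of "Y + t *\<^sub>R b" Y] by simp
    then have "R < norm (Y + t *\<^sub>R b)"
      using that b by simp
    then have "Y + t *\<^sub>R b \<notin> K"
      using R by (meson not_le)
    then show ?thesis
      unfolding \<phi>_def by (rule K(2))
  qed
  have cont: "continuous_on UNIV \<phi>" "continuous_on UNIV \<phi>'"
  proof -
    have \<eta>_cont: "continuous_on UNIV \<eta>" "continuous_on UNIV (partial_deriv b \<eta>)"
      using cs C1_compactD(2)[OF \<eta> b] by (simp_all add: compactly_supported_def)
    have line: "continuous_on UNIV (\<lambda>t. Y + t *\<^sub>R b)"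
      by (intro continuous_intros)
    show "continuous_on UNIV \<phi>" "continuous_on UNIV \<phi>'"
      unfolding \<phi>_def \<phi>'_def
      by (rule continuous_on_compose2[OF \<eta>_cont(1) line], simp) (rule continuous_on_compose2[OF \<eta>_cont(2) line], simp)
  qed
  define g where "g t = \<bar>\<phi> t\<bar> * \<bar>\<phi>' t\<bar>" for t
  have g_cs: "compactly_supported g"
    unfolding compactly_supported_def
  proof (intro conjI exI[of _ "cball 0 (R + norm Y)"] allI impI)
    show "continuous_on UNIV g"
      unfolding g_def by (intro continuous_intros cont)
    show "g t = 0" if "t \<notin> cball 0 (R + norm Y)" for t
      using \<phi>0[of t] that by (simp add: g_def)
  qed simp
  \<comment> \<open>Outside the support, so that the lower boundary term vanishes, and not above
    \<open>c\<close>; the absolute value covers a negative \<open>R + norm Y\<close>.\<close>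
  define L where "L = min c (- \<bar>R + norm Y\<bar> - 1)"
  have L: "L \<le> c" "\<phi> L = 0"
    using \<phi>0[of L] by (auto simp: L_def)
  have "has_bochner_integral lborel (\<lambda>t. (2 * \<phi> t * \<phi>' t) * indicator {L..c} t) ((\<phi> c)\<^sup>2 - (\<phi> L)\<^sup>2)"
  proof (rule has_bochner_integral_FTC_Icc_real)
    show "((\<lambda>t. (\<phi> t)\<^sup>2) has_real_derivative 2 * \<phi> t * \<phi>' t) (at t)" for t
      using deriv[of t] by (auto intro!: derivative_eq_intros)
    show "isCont (\<lambda>t. 2 * \<phi> t * \<phi>' t) t" for t
      using cont by (intro continuous_intros) (auto simp: continuous_on_eq_continuous_at)
  qed (rule L(1))
  then have int: "integrable lborel (\<lambda>t. (2 * \<phi> t * \<phi>' t) * indicator {L..c} t)"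
    and eq: "(\<phi> c)\<^sup>2 = (LINT t|lborel. (2 * \<phi> t * \<phi>' t) * indicator {L..c} t)"
    using L(2) by (auto simp: has_bochner_integral_iff)
  have g_int: "integrable lborel g"
    by (rule compactly_supported_integrable[OF g_cs])
  have "(LINT t|lborel. (2 * \<phi> t * \<phi>' t) * indicator {L..c} t) \<le> (LINT t|lborel. 2 * g t)"
  proof (rule integral_mono[OF int])
    show "(2 * \<phi> t * \<phi>' t) * indicator {L..c} t \<le> 2 * g t" for t
      using abs_ge_self[of "\<phi> t * \<phi>' t"] by (auto simp: g_def indicator_def abs_mult)
  qed (use g_int in simp)
  then have "(\<phi> c)\<^sup>2 \<le> 2 * (LINT t|lborel. g t)"
    using eq by simp
  then have "ennreal ((\<phi> c)\<^sup>2) \<le> 2 * ennreal (LINT t|lborel. g t)"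
    by (metis ennreal_leI ennreal_mult' ennreal_numeral zero_le_numeral)
  also have "ennreal (LINT t|lborel. g t) = (\<integral>\<^sup>+t. ennreal (g t) \<partial>lborel)"
    by (rule nn_integral_eq_integral[symmetric, OF g_int]) (simp add: g_def)
  finally show ?thesis
    unfolding shift by (simp add: ennreal_power g_def ennreal_mult \<phi>_def \<phi>'_def Y_def)
qed

lemma C1_compact_ladyzhenskaya:
  fixes \<eta> :: "'a::euclidean_space \<Rightarrow> real"
  assumes \<eta>: "C1_compact \<eta>" and dim: "DIM('a) \<le> 3"
    and d: "\<And>b. b \<in> Basis \<Longrightarrow> (\<integral>\<^sup>+x. ennreal ((partial_deriv b \<eta> x)\<^sup>2) \<partial>lborel) \<le> d"
  shows "(\<integral>\<^sup>+x. ennreal ((\<eta> x)^4) \<partial>lborel)\<^sup>2 \<le>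
    4 ^ DIM('a) * (\<integral>\<^sup>+x. ennreal ((\<eta> x)\<^sup>2) \<partial>lborel) ^ (4 - DIM('a)) * d ^ DIM('a)"
proof -
  let ?B = "Basis :: 'a set"
  \<comment> \<open>Identifies coordinate families with points and the product measure with
    \<open>lborel\<close>; updating the coordinate \<open>b\<close> is then motion along
    \<open>b\<close>.\<close>
  let ?s = "\<lambda>x. \<Sum>b\<in>?B. x b *\<^sub>R b"
  define U where "U x = ennreal \<bar>\<eta> (?s x)\<bar>" for x
  define G where "G b x = ennreal \<bar>partial_deriv b \<eta> (?s x)\<bar>" for b x
  have transfer: "(\<integral>\<^sup>+x. h x \<partial>lborel) = (\<integral>\<^sup>+x. h (?s x) \<partial>PiL ?B)" if "h \<in> borel_measurable borel" for h :: "'a \<Rightarrow> ennreal"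
    using that by (subst lborel_eq, subst nn_integral_distr) auto
  have \<eta>m: "\<eta> \<in> borel_measurable borel"
    using \<eta> by (auto simp: C1_compact_def compactly_supported_borel)
  have \<eta>m': "partial_deriv b \<eta> \<in> borel_measurable borel" if "b \<in> ?B" for b
    using C1_compactD(2)[OF \<eta> that] by (rule compactly_supported_borel)
  have [measurable]: "?s \<in> PiL ?B \<rightarrow>\<^sub>M borel"
    by measurable
  have U4: "(\<integral>\<^sup>+x. ennreal ((\<eta> x)^4) \<partial>lborel) = (\<integral>\<^sup>+x. (U x)^4 \<partial>PiL ?B)"
    using \<eta>m by (subst transfer) (auto simp: U_def ennreal_power)
  have U2: "(\<integral>\<^sup>+x. ennreal ((\<eta> x)\<^sup>2) \<partial>lborel) = (\<integral>\<^sup>+x. (U x)\<^sup>2 \<partial>PiL ?B)"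
    using \<eta>m by (subst transfer) (auto simp: U_def ennreal_power)
  have G2: "(\<integral>\<^sup>+x. (G b x)\<^sup>2 \<partial>PiL ?B) \<le> d" if "b \<in> ?B" for b
  proof -
    have "(\<integral>\<^sup>+x. ennreal ((partial_deriv b \<eta> x)\<^sup>2) \<partial>lborel) = (\<integral>\<^sup>+x. (G b x)\<^sup>2 \<partial>PiL ?B)"
      using \<eta>m'[OF that] by (subst transfer) (auto simp: G_def ennreal_power)
    then show ?thesis
      using d[OF that] by simp
  qed
  have sl: "sliceable ?B U G"
    unfolding sliceable_def
  proof (intro conjI ballI)
    show "U \<in> borel_measurable (PiL ?B)"
      unfolding U_def using \<eta>m by measurable
    fix b assume b: "b \<in> ?B"
    show "G b \<in> borel_measurable (PiL ?B)"
      unfolding G_def using \<eta>m'[OF b] by measurable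
    fix x :: "'a \<Rightarrow> real"
    have "?s (x(b := z)) = ?s x + (z - x b) *\<^sub>R b" for z
      using b by (simp add: sum.remove[of ?B b] algebra_simps)
    then show "(U x)\<^sup>2 \<le> 2 * (\<integral>\<^sup>+z. U (x(b := z)) * G b (x(b := z)) \<partial>lborel)"
      using C1_compact_slice[OF \<eta> b, of "?s x" "x b"] unfolding U_def G_def by simp
  qed
  have "0 < card ?B" "card ?B \<le> 3"
    using dim DIM_positive[where 'a='a] by auto
  then consider "card ?B = 1" | "card ?B = 2" | "card ?B = 3"
    by linarith
  then show ?thesis
  proof cases
    case 1
    then obtain i where B: "?B = {i}"
      by (rule card_1_singletonE)
    have "(\<integral>\<^sup>+x. (U x)^4 \<partial>PiL ?B)\<^sup>2 \<le> 4 * (\<integral>\<^sup>+x. (U x)\<^sup>2 \<partial>PiL ?B)^3 * (\<integral>\<^sup>+x. (G i x)\<^sup>2 \<partial>PiL ?B)"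
      using ladyzhenskaya_1[of i U G] sl unfolding B by simp
    also have "\<dots> \<le> 4 * (\<integral>\<^sup>+x. (U x)\<^sup>2 \<partial>PiL ?B)^3 * d"
      using G2[of i] by (intro mult_left_mono) (auto simp: B)
    finally show ?thesis
      unfolding U4 U2 using 1 by simp
  next
    case 2
    then obtain i j where B: "?B = {i, j}" "i \<noteq> j"
      by (auto simp: card_2_iff)
    have "(\<integral>\<^sup>+x. (U x)^4 \<partial>PiL ?B)\<^sup>2 \<le> 16 * (\<integral>\<^sup>+x. (U x)\<^sup>2 \<partial>PiL ?B)\<^sup>2 *
        ((\<integral>\<^sup>+x. (G i x)\<^sup>2 \<partial>PiL ?B) * (\<integral>\<^sup>+x. (G j x)\<^sup>2 \<partial>PiL ?B))"
      using ladyzhenskaya_2[of i j U G] sl B(2) unfolding B(1) by simp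
    also have "\<dots> \<le> 16 * (\<integral>\<^sup>+x. (U x)\<^sup>2 \<partial>PiL ?B)\<^sup>2 * (d * d)"
      using G2[of i] G2[of j] by (intro mult_left_mono mult_mono) (auto simp: B)
    finally show ?thesis
      unfolding U4 U2 using 2 by (simp add: power2_eq_square)
  next
    case 3
    then obtain i j k where B: "?B = {i, j, k}" "i \<noteq> j" "i \<noteq> k" "j \<noteq> k"
      by (auto simp: card_3_iff)
    have "(\<integral>\<^sup>+x. (U x)^4 \<partial>PiL ?B)\<^sup>2 \<le> 64 * (\<integral>\<^sup>+x. (U x)\<^sup>2 \<partial>PiL ?B) *
        ((\<integral>\<^sup>+x. (G i x)\<^sup>2 \<partial>PiL ?B) * (\<integral>\<^sup>+x. (G j x)\<^sup>2 \<partial>PiL ?B) * (\<integral>\<^sup>+x. (G k x)\<^sup>2 \<partial>PiL ?B))"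
      using ladyzhenskaya_3[of i j k U G] sl B(2-4) unfolding B(1) by simp
    also have "\<dots> \<le> 64 * (\<integral>\<^sup>+x. (U x)\<^sup>2 \<partial>PiL ?B) * (d * d * d)"
      using G2[of i] G2[of j] G2[of k] by (intro mult_left_mono mult_mono) (auto simp: B)
    finally show ?thesis
      unfolding U4 U2 using 3 by (simp add: power3_eq_cube)
  qed
qed

section \<open>The L4 bound carried from test functions to \<open>H01\<close>\<close>

lemma l2_convergent_AE_subseq:
  assumes "v \<longlonglongrightarrow> u"
  obtains r where "strict_mono r" "AE x in lebesgue. (\<lambda>k. l2_fun (v (r k)) x) \<longlonglongrightarrow> l2_fun u x"
proof -
  have eq: "(LINT x|lebesgue. norm ((l2_fun (v k - u) x)\<^sup>2)) = (norm (v k - u))\<^sup>2" for k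
    by (simp add: norm_l2_sq)
  have "(\<lambda>k. (norm (v k - u))\<^sup>2) \<longlonglongrightarrow> 0\<^sup>2"
    using assms by (intro tendsto_power) (simp add: LIM_zero tendsto_norm_zero)
  then have "(\<lambda>k. LINT x|lebesgue. norm ((l2_fun (v k - u) x)\<^sup>2)) \<longlonglongrightarrow> 0"
    unfolding eq by simp
  moreover have "integrable lebesgue (\<lambda>x. (l2_fun (v k - u) x)\<^sup>2)" for k
    using square_integrable_l2_fun by (auto simp: square_integrable_def)
  ultimately obtain r where r: "strict_mono r" "AE x in lebesgue. (\<lambda>k. (l2_fun (v (r k) - u) x)\<^sup>2) \<longlonglongrightarrow> 0"
    using tendsto_L1_AE_subseq[of lebesgue "\<lambda>k x. (l2_fun (v k - u) x)\<^sup>2"] by auto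
  have "AE x in lebesgue. \<forall>k. l2_fun (v (r k) - u) x = l2_fun (v (r k)) x - l2_fun u x"
    unfolding AE_all_countable using l2_fun_diff by blast
  with r(2) have "AE x in lebesgue. (\<lambda>k. l2_fun (v (r k)) x) \<longlonglongrightarrow> l2_fun u x"
  proof eventually_elim
    fix x assume sq: "(\<lambda>k. (l2_fun (v (r k) - u) x)\<^sup>2) \<longlonglongrightarrow> 0"
      and eq: "\<forall>k. l2_fun (v (r k) - u) x = l2_fun (v (r k)) x - l2_fun u x"
    have "(\<lambda>k. sqrt ((l2_fun (v (r k)) x - l2_fun u x)\<^sup>2)) \<longlonglongrightarrow> sqrt 0"
      using tendsto_real_sqrt[OF sq] by (simp only: eq)
    then have "(\<lambda>k. l2_fun (v (r k)) x - l2_fun u x) \<longlonglongrightarrow> 0"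
      by (simp only: real_sqrt_abs real_sqrt_zero tendsto_rabs_zero_iff)
    then show "(\<lambda>k. l2_fun (v (r k)) x) \<longlonglongrightarrow> l2_fun u x"
      by (rule LIM_zero_cancel)
  qed
  with r(1) show ?thesis
    using that by blast
qed

lemma ennreal_square_product:
  assumes "0 \<le> x" "0 \<le> y"
  shows "4 ^ k * ennreal (x\<^sup>2) ^ m * ennreal (y\<^sup>2) ^ k = (ennreal (2 ^ k * x ^ m * y ^ k))\<^sup>2"
proof -
  have "ennreal (2 ^ k * x ^ m * y ^ k) = 2 ^ k * ennreal x ^ m * ennreal y ^ k"
    using assms by (simp add: ennreal_mult ennreal_power[symmetric])
  moreover have "ennreal (x\<^sup>2) = (ennreal x)\<^sup>2" "ennreal (y\<^sup>2) = (ennreal y)\<^sup>2"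
    using assms by (simp_all add: ennreal_power)
  moreover have "(4::ennreal) = 2\<^sup>2"
    by simp
  ultimately show ?thesis
    by (simp only: power_mult_distrib power_mult[symmetric] mult.commute[of 2])
qed

lemma test_function_L4:
  fixes \<Omega> :: "(real^'n) set"
  assumes \<Omega>: "open \<Omega>" and n: "CARD('n) \<le> 3" and \<eta>: "\<eta> \<in> test_functions \<Omega>"
  shows "(\<integral>\<^sup>+x. ennreal ((l2_fun (l2_of \<eta>) x)^4) \<partial>lebesgue) \<le>
    ennreal (2 ^ CARD('n) * norm (l2_of \<eta>) ^ (4 - CARD('n)) * norm (grad \<Omega> (l2_of \<eta>)) ^ CARD('n))"
proof -
  note cs = test_function_compactly_supported[OF \<eta>]
  have sq: "square_integrable \<eta>"
    by (rule compactly_supported_square_integrable[OF cs(1)])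
  have lborel: "(\<integral>\<^sup>+x. ennreal ((l2_fun (l2_of f) x)^k) \<partial>lebesgue) = (\<integral>\<^sup>+x. ennreal ((f x)^k) \<partial>lborel)"
    if f: "compactly_supported f" for f :: "real^'n \<Rightarrow> real" and k
  proof -
    have "(\<integral>\<^sup>+x. ennreal ((l2_fun (l2_of f) x)^k) \<partial>lebesgue) = (\<integral>\<^sup>+x. ennreal ((f x)^k) \<partial>lebesgue)"
      by (rule nn_integral_cong_AE)
        (use l2_fun_l2_of[OF compactly_supported_square_integrable[OF f]] in eventually_elim, simp)
    also have "\<dots> = (\<integral>\<^sup>+x. ennreal ((f x)^k) \<partial>lborel)"
      by (rule nn_integral_completion)
    finally show ?thesis .
  qed
  have "(\<integral>\<^sup>+x. ennreal ((\<eta> x)^4) \<partial>lborel)\<^sup>2 \<le>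
    4 ^ DIM(real^'n) * (\<integral>\<^sup>+x. ennreal ((\<eta> x)\<^sup>2) \<partial>lborel) ^ (4 - DIM(real^'n)) *
      (ennreal ((norm (grad \<Omega> (l2_of \<eta>)))\<^sup>2)) ^ DIM(real^'n)"
  proof (rule C1_compact_ladyzhenskaya[OF test_function_C1_compact[OF \<eta>]])
    fix b :: "real^'n" assume b: "b \<in> Basis"
    then obtain i where i: "b = axis i 1"
      by (auto simp: Basis_vec_def)
    have "(\<integral>\<^sup>+x. ennreal ((partial_deriv b \<eta> x)\<^sup>2) \<partial>lborel) = ennreal ((norm (l2_of (partial_deriv b \<eta>)))\<^sup>2)"
      by (simp only: lborel[OF cs(2)[OF b], symmetric] nn_integral_l2_sq)
    also have "l2_of (partial_deriv b \<eta>) = grad \<Omega> (l2_of \<eta>) $ i"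
      by (simp add: test_function_H1(2)[OF \<Omega> \<eta>] i)
    finally show "(\<integral>\<^sup>+x. ennreal ((partial_deriv b \<eta> x)\<^sup>2) \<partial>lborel) \<le> ennreal ((norm (grad \<Omega> (l2_of \<eta>)))\<^sup>2)"
      using Finite_Cartesian_Product.norm_nth_le[of "grad \<Omega> (l2_of \<eta>)" i] by (simp add: ennreal_leI power_mono)
  qed (use n in simp)
  then have "(\<integral>\<^sup>+x. ennreal ((l2_fun (l2_of \<eta>) x)^4) \<partial>lebesgue)\<^sup>2 \<le>
    4 ^ CARD('n) * ennreal ((norm (l2_of \<eta>))\<^sup>2) ^ (4 - CARD('n)) * ennreal ((norm (grad \<Omega> (l2_of \<eta>)))\<^sup>2) ^ CARD('n)"
    by (simp only: lborel[OF cs(1), symmetric] nn_integral_l2_sq DIM_cart DIM_real mult_1_right)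
  also have "\<dots> = (ennreal (2 ^ CARD('n) * norm (l2_of \<eta>) ^ (4 - CARD('n)) * norm (grad \<Omega> (l2_of \<eta>)) ^ CARD('n)))\<^sup>2"
    by (rule ennreal_square_product) auto
  finally show ?thesis
    by (rule ennreal_le_of_power2_le)
qed

text \<open>Test functions converge to \<open>u\<close> together with their gradients. Along an
  almost everywhere convergent subsequence Fatou's lemma handles the fourth power, while the
  right-hand side is continuous in the two norms.\<close>

lemma H01_L4:
  fixes \<Omega> :: "(real^'n) set"
  assumes \<Omega>: "open \<Omega>" and n: "CARD('n) \<le> 3" and u: "u \<in> H01 \<Omega>"
  shows "(\<integral>\<^sup>+x. ennreal ((l2_fun u x)^4) \<partial>lebesgue) \<le>
    ennreal (2 ^ CARD('n) * norm u ^ (4 - CARD('n)) * norm (grad \<Omega> u) ^ CARD('n))"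
proof -
  obtain \<eta> where \<eta>: "\<And>k. \<eta> k \<in> test_functions \<Omega>" "(\<lambda>k. l2_of (\<eta> k)) \<longlonglongrightarrow> u"
    "(\<lambda>k. grad \<Omega> (l2_of (\<eta> k))) \<longlonglongrightarrow> grad \<Omega> u"
    using u unfolding H01_iff[OF \<Omega>] by blast
  obtain r where r: "strict_mono r" "AE x in lebesgue. (\<lambda>k. l2_fun (l2_of (\<eta> (r k))) x) \<longlonglongrightarrow> l2_fun u x"
    using l2_convergent_AE_subseq[OF \<eta>(2)] by blast
  define v where "v k = l2_of (\<eta> (r k))" for k
  have v: "v \<longlonglongrightarrow> u" "(\<lambda>k. grad \<Omega> (v k)) \<longlonglongrightarrow> grad \<Omega> u"
    using LIMSEQ_subseq_LIMSEQ[OF \<eta>(2) r(1)] LIMSEQ_subseq_LIMSEQ[OF \<eta>(3) r(1)]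
    by (simp_all add: v_def[abs_def] o_def)
  let ?B = "\<lambda>w. 2 ^ CARD('n) * norm w ^ (4 - CARD('n)) * norm (grad \<Omega> w) ^ CARD('n)"
  have "(\<integral>\<^sup>+x. ennreal ((l2_fun u x)^4) \<partial>lebesgue) = (\<integral>\<^sup>+x. liminf (\<lambda>k. ennreal ((l2_fun (v k) x)^4)) \<partial>lebesgue)"
  proof (rule nn_integral_cong_AE)
    show "AE x in lebesgue. ennreal ((l2_fun u x)^4) = liminf (\<lambda>k. ennreal ((l2_fun (v k) x)^4))"
      using r(2)
    proof eventually_elim
      fix x assume "(\<lambda>k. l2_fun (l2_of (\<eta> (r k))) x) \<longlonglongrightarrow> l2_fun u x"
      then have "(\<lambda>k. ennreal ((l2_fun (v k) x)^4)) \<longlonglongrightarrow> ennreal ((l2_fun u x)^4)"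
        unfolding v_def by (intro tendsto_ennrealI tendsto_power)
      from lim_imp_Liminf[OF trivial_limit_sequentially this]
      show "ennreal ((l2_fun u x)^4) = liminf (\<lambda>k. ennreal ((l2_fun (v k) x)^4))"
        by simp
    qed
  qed
  also have "\<dots> \<le> liminf (\<lambda>k. \<integral>\<^sup>+x. ennreal ((l2_fun (v k) x)^4) \<partial>lebesgue)"
    by (rule nn_integral_liminf) measurable
  also have "\<dots> \<le> liminf (\<lambda>k. ennreal (?B (v k)))"
    unfolding v_def by (intro Liminf_mono always_eventually allI test_function_L4[OF \<Omega> n \<eta>(1)])
  also have "\<dots> = ennreal (?B u)"
  proof (rule lim_imp_Liminf[OF trivial_limit_sequentially])
    show "(\<lambda>k. ennreal (?B (v k))) \<longlonglongrightarrow> ennreal (?B u)"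
      by (intro tendsto_ennrealI tendsto_mult tendsto_power tendsto_norm tendsto_const v)
  qed
  finally show ?thesis .
qed

section \<open>Products of \<open>H01\<close> functions and interpolation of the L4-norm\<close>

lemma l2_mult_commute: "l2_mult u v = l2_mult v u"
  by (simp add: l2_mult_def mult.commute)

context
  fixes \<Omega> :: "(real^'n) set"
  assumes \<Omega>: "open \<Omega>" and n: "CARD('n) \<le> 3"
begin

lemma H01_L4_integrable:
  assumes "u \<in> H01 \<Omega>"
  shows "integrable lebesgue (\<lambda>x. (l2_fun u x)^4)"
proof (rule integrableI_bounded)
  have "(\<integral>\<^sup>+x. ennreal ((l2_fun u x)^4) \<partial>lebesgue) < \<infinity>"
    using H01_L4[OF \<Omega> n assms] by (rule order.strict_trans1) simp
  then show "(\<integral>\<^sup>+x. ennreal (norm ((l2_fun u x)^4)) \<partial>lebesgue) < \<infinity>"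
    by simp
qed measurable

lemma H01_mult_square_integrable:
  assumes "u \<in> H01 \<Omega>" "v \<in> H01 \<Omega>"
  shows "square_integrable (\<lambda>x. l2_fun u x * l2_fun v x)"
proof -
  have "integrable lebesgue (\<lambda>x. (l2_fun u x * l2_fun v x)\<^sup>2)"
  proof (rule Bochner_Integration.integrable_bound)
    show "integrable lebesgue (\<lambda>x. (l2_fun u x)^4 + (l2_fun v x)^4)"
      using H01_L4_integrable assms by (intro Bochner_Integration.integrable_add)
    show "AE x in lebesgue. norm ((l2_fun u x * l2_fun v x)\<^sup>2) \<le> norm ((l2_fun u x)^4 + (l2_fun v x)^4)"
    proof (rule AE_I2)
      fix x
      have "2 * (l2_fun u x)\<^sup>2 * (l2_fun v x)\<^sup>2 \<le> ((l2_fun u x)\<^sup>2)\<^sup>2 + ((l2_fun v x)\<^sup>2)\<^sup>2"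
        by (rule sum_squares_bound)
      moreover have "0 \<le> (l2_fun u x)\<^sup>2 * (l2_fun v x)\<^sup>2"
        by simp
      ultimately have "(l2_fun u x)\<^sup>2 * (l2_fun v x)\<^sup>2 \<le> (l2_fun u x)^4 + (l2_fun v x)^4"
        unfolding power_mult[symmetric] mult.assoc by (simp only: mult_2_right numeral_times_numeral semiring_norm)
      then show "norm ((l2_fun u x * l2_fun v x)\<^sup>2) \<le> norm ((l2_fun u x)^4 + (l2_fun v x)^4)"
        by (simp add: power_mult_distrib)
    qed
  qed measurable
  then show ?thesis
    unfolding square_integrable_def by simp
qed

lemma l2_fun_mult:
  assumes "u \<in> H01 \<Omega>" "v \<in> H01 \<Omega>"
  shows "AE x in lebesgue. l2_fun (l2_mult u v) x = l2_fun u x * l2_fun v x"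
  unfolding l2_mult_def by (rule l2_fun_l2_of[OF H01_mult_square_integrable[OF assms]])

lemma l2_mult_diff_left:
  assumes "u \<in> H01 \<Omega>" "u' \<in> H01 \<Omega>" "v \<in> H01 \<Omega>"
  shows "l2_mult (u - u') v = l2_mult u v - l2_mult u' v"
proof (rule l2_eqI)
  have "u - u' \<in> H01 \<Omega>"
    using subspace_H01[OF \<Omega>] assms by (intro subspace_diff)
  from l2_fun_mult[OF this assms(3)] l2_fun_mult[OF assms(1,3)] l2_fun_mult[OF assms(2,3)]
    l2_fun_diff[of u u'] l2_fun_diff[of "l2_mult u v" "l2_mult u' v"]
  show "AE x in lebesgue. l2_fun (l2_mult (u - u') v) x = l2_fun (l2_mult u v - l2_mult u' v) x"
    by eventually_elim (simp add: algebra_simps)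
qed

lemma l2_mult_inner:
  assumes "u \<in> H01 \<Omega>" "v \<in> H01 \<Omega>" "\<phi> \<in> H01 \<Omega>"
  shows "l2_mult u v \<bullet> \<phi> = u \<bullet> l2_mult v \<phi>"
  unfolding inner_l2_eq
  by (rule integral_cong_AE, measurable)
    (use l2_fun_mult[OF assms(1,2)] l2_fun_mult[OF assms(2,3)] in eventually_elim, simp)

lemma norm_l2_mult_le:
  assumes "v \<in> H01 \<Omega>" "\<phi> \<in> H01 \<Omega>"
  shows "norm (l2_mult v \<phi>) \<le> sqrt (norm (l2_mult v v)) * sqrt (norm (l2_mult \<phi> \<phi>))"
proof -
  have "(norm (l2_mult v \<phi>))\<^sup>2 = l2_mult v v \<bullet> l2_mult \<phi> \<phi>"
    unfolding power2_norm_eq_inner inner_l2_eq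
    by (rule integral_cong_AE, measurable)
      (use l2_fun_mult[OF assms] l2_fun_mult[OF assms(1,1)] l2_fun_mult[OF assms(2,2)] in eventually_elim, simp)
  also have "\<dots> \<le> norm (l2_mult v v) * norm (l2_mult \<phi> \<phi>)"
    by (rule norm_cauchy_schwarz)
  finally have "norm (l2_mult v \<phi>) \<le> sqrt (norm (l2_mult v v) * norm (l2_mult \<phi> \<phi>))"
    by (rule real_le_rsqrt)
  then show ?thesis
    by (simp add: real_sqrt_mult)
qed

text \<open>The integral of the triple product is symmetric, so the factor that should enter only
  through its L2-norm is paired with the product of the other two. Here
  \<open>sqrt (norm (l2_mult v v))\<close> is the L4-norm of \<open>v\<close>.\<close>

lemma trilinear_bound:
  assumes "u \<in> H01 \<Omega>" "v \<in> H01 \<Omega>" "\<phi> \<in> H01 \<Omega>"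
  shows "\<bar>l2_mult u v \<bullet> \<phi>\<bar> \<le> norm u * (sqrt (norm (l2_mult v v)) * sqrt (norm (l2_mult \<phi> \<phi>)))"
proof -
  have "\<bar>u \<bullet> l2_mult v \<phi>\<bar> \<le> norm u * norm (l2_mult v \<phi>)"
    by (rule Cauchy_Schwarz_ineq2)
  also have "\<dots> \<le> norm u * (sqrt (norm (l2_mult v v)) * sqrt (norm (l2_mult \<phi> \<phi>)))"
    by (intro mult_left_mono norm_l2_mult_le assms) simp
  finally show ?thesis
    by (simp add: l2_mult_inner[OF assms])
qed

lemma norm_l2_square:
  assumes "u \<in> H01 \<Omega>"
  shows "(norm (l2_mult u u))\<^sup>2 \<le> 2 ^ CARD('n) * norm u ^ (4 - CARD('n)) * norm (grad \<Omega> u) ^ CARD('n)"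
proof -
  have "ennreal ((norm (l2_mult u u))\<^sup>2) = (\<integral>\<^sup>+x. ennreal ((l2_fun u x)^4) \<partial>lebesgue)"
    unfolding nn_integral_l2_sq[symmetric]
    by (rule nn_integral_cong_AE)
      (use l2_fun_mult[OF assms assms] in eventually_elim, simp add: power2_eq_square power4_eq_xxxx mult.assoc)
  also have "\<dots> \<le> ennreal (2 ^ CARD('n) * norm u ^ (4 - CARD('n)) * norm (grad \<Omega> u) ^ CARD('n))"
    by (rule H01_L4[OF \<Omega> n assms])
  finally show ?thesis
    by (subst (asm) ennreal_le_iff) auto
qed

text \<open>The gradient enters the L4 bound with a positive power, so the square of
  \<open>u\<close> vanishes.\<close>

lemma H01_grad_zero:
  assumes u: "u \<in> H01 \<Omega>" and "grad \<Omega> u = 0"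
  shows "u = 0"
proof -
  have "(norm (l2_mult u u))\<^sup>2 \<le> 0"
    using norm_l2_square[OF u] assms(2) by (simp add: zero_power)
  then have "l2_mult u u = 0"
    by simp
  then have "AE x in lebesgue. l2_fun u x = l2_fun 0 x"
    using l2_fun_mult[OF u u] l2_fun_zero by (auto elim!: eventually_elim2)
  then show ?thesis
    by (rule l2_eqI)
qed

text \<open>With \<open>M = \<delta> * b + a / \<delta>^3\<close> one has
  \<open>a \<le> M * \<delta>^3\<close> and \<open>b \<le> M / \<delta>\<close>. In dimension n the
  powers of \<delta> combine to the exponent 3 (4 - n) - n, which is nonnegative for n at most 3, so
  one choice of \<open>M\<close> serves all dimensions. The 6 in \<delta> is 3, the root of 8
  rounded up to that of 9, times the 2 from squaring the sum \<open>M\<close>.\<close>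

lemma interpolation:
  assumes "0 < \<epsilon>"
  shows "\<exists>C\<ge>0. \<forall>u\<in>H01 \<Omega>. norm (l2_mult u u) \<le> \<epsilon> * (norm (grad \<Omega> u))\<^sup>2 + C * (norm u)\<^sup>2"
proof -
  define \<delta> where "\<delta> = min 1 (\<epsilon> / 6)"
  have \<delta>: "0 < \<delta>" "\<delta> \<le> 1" "6 * \<delta>\<^sup>2 \<le> \<epsilon>"
  proof -
    show "0 < \<delta>" "\<delta> \<le> 1"
      using assms by (auto simp: \<delta>_def)
    then have "\<delta>\<^sup>2 \<le> \<delta>"
      by (simp add: power2_eq_square mult_left_le)
    also have "\<delta> \<le> \<epsilon> / 6"
      by (simp add: \<delta>_def)
    finally show "6 * \<delta>\<^sup>2 \<le> \<epsilon>"
      by simp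
  qed
  show ?thesis
  proof (intro exI[of _ "6 * (1 / \<delta>^3)\<^sup>2"] conjI ballI)
    fix u assume u: "u \<in> H01 \<Omega>"
    define a where "a = norm u"
    define b where "b = norm (grad \<Omega> u)"
    define M where "M = \<delta> * b + a / \<delta>^3"
    have ab: "0 \<le> a" "0 \<le> b"
      by (auto simp: a_def b_def)
    have M: "0 \<le> M" "a \<le> M * \<delta>^3" "b \<le> M / \<delta>"
      using ab \<delta>(1) by (auto simp: M_def field_simps)
    have "a ^ (4 - CARD('n)) * b ^ CARD('n) \<le> (M * \<delta>^3) ^ (4 - CARD('n)) * (M / \<delta>) ^ CARD('n)"
      using ab M by (intro mult_mono power_mono) auto
    also have "\<dots> = M^4 * (\<delta> ^ (3 * (4 - CARD('n))) / \<delta> ^ CARD('n))"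
    proof -
      have "M^4 = M ^ (4 - CARD('n)) * M ^ CARD('n)"
        using n by (simp add: power_add[symmetric])
      then show ?thesis
        by (simp add: power_mult_distrib power_divide power_mult)
    qed
    also have "\<dots> \<le> M^4 * 1"
    proof (rule mult_left_mono)
      have "\<delta> ^ (3 * (4 - CARD('n))) \<le> \<delta> ^ CARD('n)"
        using \<delta> n by (intro power_decreasing) auto
      then show "\<delta> ^ (3 * (4 - CARD('n))) / \<delta> ^ CARD('n) \<le> 1"
        using \<delta>(1) by simp
    qed simp
    finally have "a ^ (4 - CARD('n)) * b ^ CARD('n) \<le> (M\<^sup>2)\<^sup>2"
      by (simp add: power_mult[symmetric])
    moreover have "(2::real) ^ CARD('n) \<le> 2 ^ 3"
      using n by (intro power_increasing) auto
    ultimately have "2 ^ CARD('n) * (a ^ (4 - CARD('n)) * b ^ CARD('n)) \<le> 8 * (M\<^sup>2)\<^sup>2"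
      using ab by (intro mult_mono) auto
    then have "(norm (l2_mult u u))\<^sup>2 \<le> 8 * (M\<^sup>2)\<^sup>2"
      using norm_l2_square[OF u] unfolding a_def[symmetric] b_def[symmetric] mult.assoc by linarith
    also have "\<dots> \<le> 9 * (M\<^sup>2)\<^sup>2"
      by (rule mult_right_mono) simp_all
    also have "\<dots> = (3 * M\<^sup>2)\<^sup>2"
      by (simp add: power_mult_distrib)
    finally have "(norm (l2_mult u u))\<^sup>2 \<le> (3 * M\<^sup>2)\<^sup>2" .
    then have "norm (l2_mult u u) \<le> 3 * M\<^sup>2"
      by (rule power2_le_imp_le) simp
    also have "M\<^sup>2 \<le> 2 * (\<delta> * b)\<^sup>2 + 2 * (a / \<delta>^3)\<^sup>2"
      using sum_squares_bound[of "\<delta> * b" "a / \<delta>^3"] by (simp add: M_def power2_sum)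
    then have "3 * M\<^sup>2 \<le> (6 * \<delta>\<^sup>2) * b\<^sup>2 + 6 * (1 / \<delta>^3)\<^sup>2 * a\<^sup>2"
      by (simp add: power_mult_distrib power_divide)
    also have "\<dots> \<le> \<epsilon> * b\<^sup>2 + 6 * (1 / \<delta>^3)\<^sup>2 * a\<^sup>2"
      using \<delta>(3) by (intro add_right_mono mult_right_mono) auto
    finally show "norm (l2_mult u u) \<le> \<epsilon> * (norm (grad \<Omega> u))\<^sup>2 + 6 * (1 / \<delta>^3)\<^sup>2 * (norm u)\<^sup>2"
      by (simp add: a_def b_def)
  qed simp
qed

end

section \<open>The Oregonator system\<close>

text \<open>The square roots turn the diffusion form into minus an inner product; this is the
  operator \<open>D\<close> of the abstract problem.\<close>

definition scaled_grad :: "(real^'n) set \<Rightarrow> real^3 \<Rightarrow> 'n state \<Rightarrow> ((real^'n) l2 ^ 'n) ^ 3" where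
  "scaled_grad \<Omega> d g = (\<chi> i. sqrt (d $ i) *\<^sub>R grad \<Omega> (g $ i))"

text \<open>The L2-norm of the square of a component is its squared L4-norm. The H-norm is added so
  that the same quantity controls the linear reaction terms.\<close>

definition L4_norm :: "'n::finite state \<Rightarrow> real" where
  "L4_norm g = sqrt ((\<Sum>i\<in>UNIV. norm (l2_mult (g $ i) (g $ i))) + (norm g)\<^sup>2)"

lemma norm_vec_sq: "(norm (g :: 'a::real_normed_vector ^ 'm))\<^sup>2 = (\<Sum>i\<in>UNIV. (norm (g $ i))\<^sup>2)"
  by (simp add: norm_vec_def L2_set_def sum_nonneg)

lemma inner_vec_components: "(x :: 'a::real_inner ^ 'm) \<bullet> y = (\<Sum>i\<in>UNIV. x $ i \<bullet> y $ i)"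
  by (simp add: inner_vec_def)

lemma diffusion_eq:
  assumes "\<And>i. 0 < d $ i"
  shows "diffusion \<Omega> d g \<phi> = - (scaled_grad \<Omega> d g \<bullet> scaled_grad \<Omega> d \<phi>)"
  unfolding diffusion_def
  by (subst inner_vec_components) (use assms in \<open>simp add: scaled_grad_def less_imp_le mult.assoc[symmetric]\<close>)

lemma L4_norm_bounds:
  "0 \<le> L4_norm g" "norm g \<le> L4_norm g" "sqrt (norm (l2_mult (g $ i) (g $ i))) \<le> L4_norm g"
proof -
  have s: "0 \<le> (\<Sum>i\<in>UNIV. norm (l2_mult (g $ i) (g $ i)))"
    by (simp add: sum_nonneg)
  then show "0 \<le> L4_norm g"
    unfolding L4_norm_def by simp
  show "norm g \<le> L4_norm g"
    unfolding L4_norm_def using s by (intro real_le_rsqrt) simp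
  have "norm (l2_mult (g $ i) (g $ i)) \<le> (\<Sum>i\<in>UNIV. norm (l2_mult (g $ i) (g $ i)))"
    by (rule member_le_sum) auto
  also have "\<dots> \<le> (\<Sum>i\<in>UNIV. norm (l2_mult (g $ i) (g $ i))) + (norm g)\<^sup>2"
    by simp
  finally show "sqrt (norm (l2_mult (g $ i) (g $ i))) \<le> L4_norm g"
    unfolding L4_norm_def by (rule real_sqrt_le_mono)
qed

lemma subspace_H_space: "subspace (H_space \<Omega>)"
  using subspace_L2_on[of \<Omega>] unfolding H_space_def subspace_def by auto

context
  fixes \<Omega> :: "(real^'n) set" and d :: "real^3"
  assumes \<Omega>: "open \<Omega>" and n: "CARD('n) \<le> 3" and d: "\<And>i. 0 < d $ i"
begin

lemma subspace_E_space: "subspace (E_space \<Omega>)"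
  using subspace_H01[OF \<Omega>] unfolding E_space_def subspace_def by auto

lemma E_space_subset_H_space: "E_space \<Omega> \<subseteq> H_space \<Omega>"
  using H01_subset_H1 by (fastforce simp: E_space_def H_space_def H1_def)

lemma E_space_H1: "g \<in> E_space \<Omega> \<Longrightarrow> g $ i \<in> H1 \<Omega>"
  using H01_subset_H1 by (auto simp: E_space_def)

lemma scaled_grad_linear:
  assumes "x \<in> E_space \<Omega>"
  shows "y \<in> E_space \<Omega> \<Longrightarrow> scaled_grad \<Omega> d (x + y) = scaled_grad \<Omega> d x + scaled_grad \<Omega> d y"
    "scaled_grad \<Omega> d (c *\<^sub>R x) = c *\<^sub>R scaled_grad \<Omega> d x"
  using assms E_space_H1
  by (simp_all add: scaled_grad_def vec_eq_iff H1_add[OF \<Omega>] H1_scaleR[OF \<Omega>] scaleR_add_right)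

lemma scaled_grad_norm:
  shows "(norm (scaled_grad \<Omega> d g))\<^sup>2 = (\<Sum>i\<in>UNIV. d $ i * (norm (grad \<Omega> (g $ i)))\<^sup>2)"
  by (subst norm_vec_sq) (use d in \<open>simp add: scaled_grad_def power_mult_distrib less_imp_le\<close>)

lemma E_norm_sq: "(E_norm \<Omega> g)\<^sup>2 = (\<Sum>i\<in>UNIV. (norm (grad \<Omega> (g $ i)))\<^sup>2)"
  unfolding E_norm_def norm_vec_sq by simp

lemma scaled_grad_E_norm:
  obtains m where "0 < m" "\<And>g. m * (E_norm \<Omega> g)\<^sup>2 \<le> (norm (scaled_grad \<Omega> d g))\<^sup>2"
proof -
  define m where "m = Min (range (($) d))"
  have "0 < m"
    using d unfolding m_def by (subst Min_gr_iff) auto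
  have m_le: "m \<le> d $ i" for i
    unfolding m_def by (intro Min_le) auto
  show ?thesis
  proof (rule that[OF \<open>0 < m\<close>])
    show "m * (E_norm \<Omega> g)\<^sup>2 \<le> (norm (scaled_grad \<Omega> d g))\<^sup>2" for g
      unfolding E_norm_sq scaled_grad_norm sum_distrib_left
      using m_le by (intro sum_mono mult_right_mono) auto
  qed
qed

lemma scaled_grad_E_norm_upper:
  obtains M where "0 < M" "\<And>g. (norm (scaled_grad \<Omega> d g))\<^sup>2 \<le> M * (E_norm \<Omega> g)\<^sup>2"
proof -
  define M where "M = Max (range (($) d))"
  have M_ge: "d $ i \<le> M" for i
    unfolding M_def by (intro Max_ge) auto
  show ?thesis
  proof (rule that[of M])
    show "0 < M"
      using M_ge d order_less_le_trans by blast
    show "(norm (scaled_grad \<Omega> d g))\<^sup>2 \<le> M * (E_norm \<Omega> g)\<^sup>2" for g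
      unfolding E_norm_sq scaled_grad_norm sum_distrib_left
      using M_ge by (intro sum_mono mult_right_mono) auto
  qed
qed

lemma L4_norm_interpolation:
  assumes "0 < \<epsilon>"
  shows "\<exists>C\<ge>0. \<forall>x\<in>E_space \<Omega>. (L4_norm x)\<^sup>2 \<le> \<epsilon> * (norm (scaled_grad \<Omega> d x))\<^sup>2 + C * (norm x)\<^sup>2"
proof -
  obtain m where m: "0 < m" "\<And>g. m * (E_norm \<Omega> g)\<^sup>2 \<le> (norm (scaled_grad \<Omega> d g))\<^sup>2"
    using scaled_grad_E_norm by blast
  have "0 < \<epsilon> * m"
    using assms m(1) by simp
  from interpolation[OF \<Omega> n this] obtain C where C: "0 \<le> C"
    "\<And>u. u \<in> H01 \<Omega> \<Longrightarrow> norm (l2_mult u u) \<le> \<epsilon> * m * (norm (grad \<Omega> u))\<^sup>2 + C * (norm u)\<^sup>2"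
    by blast
  show ?thesis
  proof (intro exI[of _ "C + 1"] conjI ballI)
    fix x assume x: "x \<in> E_space \<Omega>"
    have "(\<Sum>i\<in>UNIV. norm (l2_mult (x $ i) (x $ i))) \<le>
        (\<Sum>i\<in>UNIV. \<epsilon> * m * (norm (grad \<Omega> (x $ i)))\<^sup>2 + C * (norm (x $ i))\<^sup>2)"
      using x by (intro sum_mono C) (auto simp: E_space_def)
    also have "\<dots> = \<epsilon> * (m * (E_norm \<Omega> x)\<^sup>2) + C * (norm x)\<^sup>2"
      unfolding E_norm_sq norm_vec_sq[of x] by (simp add: sum.distrib sum_distrib_left mult.assoc)
    also have "\<dots> \<le> \<epsilon> * (norm (scaled_grad \<Omega> d x))\<^sup>2 + C * (norm x)\<^sup>2"
      using m(2) assms by (intro add_right_mono mult_left_mono) auto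
    moreover have "(L4_norm x)\<^sup>2 = (\<Sum>i\<in>UNIV. norm (l2_mult (x $ i) (x $ i))) + (norm x)\<^sup>2"
      unfolding L4_norm_def by (intro real_sqrt_pow2 add_nonneg_nonneg sum_nonneg) auto
    ultimately show "(L4_norm x)\<^sup>2 \<le> \<epsilon> * (norm (scaled_grad \<Omega> d x))\<^sup>2 + (C + 1) * (norm x)\<^sup>2"
      by (simp add: algebra_simps)
  qed (use C(1) in simp)
qed

text \<open>Bounded gradients need not converge strongly, but suitable convex combinations of the
  pairs do in both components. They remain in the graph of \<open>scaled_grad\<close>, which is
  linear, and \<open>H01_closed\<close> identifies the limit.\<close>

lemma E_space_closed:
  assumes x: "\<And>k. xs k \<in> E_space \<Omega>" "xs \<longlonglongrightarrow> z" and R: "\<And>k. norm (scaled_grad \<Omega> d (xs k)) \<le> R"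
  shows "z \<in> E_space \<Omega> \<and> norm (scaled_grad \<Omega> d z) \<le> R"
proof -
  let ?Z = "\<lambda>k. (xs k, scaled_grad \<Omega> d (xs k))"
  have "(\<lambda>k. fst (?Z k)) \<longlonglongrightarrow> z" "\<And>k. norm (snd (?Z k)) \<le> R"
    using x R by simp_all
  note lim = this
  obtain w p where w: "\<And>k. w k \<in> convex hull (range ?Z)" "(\<lambda>k. fst (w k)) \<longlonglongrightarrow> z"
    "(\<lambda>k. snd (w k)) \<longlonglongrightarrow> p" "norm p \<le> R"
    by (rule convex_hull_tail_Cauchy[OF lim]) (rule that)
  define \<Gamma> where "\<Gamma> = {(g, scaled_grad \<Omega> d g) |g. g \<in> E_space \<Omega>}"
  have "convex \<Gamma>"
  proof (rule convexI)
    fix p q and a b :: real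
    assume "p \<in> \<Gamma>" "q \<in> \<Gamma>"
    then obtain g h where gh: "p = (g, scaled_grad \<Omega> d g)" "q = (h, scaled_grad \<Omega> d h)" "g \<in> E_space \<Omega>" "h \<in> E_space \<Omega>"
      by (auto simp: \<Gamma>_def)
    have "a *\<^sub>R g \<in> E_space \<Omega>" "b *\<^sub>R h \<in> E_space \<Omega>" "a *\<^sub>R g + b *\<^sub>R h \<in> E_space \<Omega>"
      using gh subspace_E_space by (auto intro: subspace_add subspace_scale)
    then show "a *\<^sub>R p + b *\<^sub>R q \<in> \<Gamma>"
      unfolding \<Gamma>_def gh using gh(3,4) by (auto simp: scaled_grad_linear)
  qed
  then have "convex hull (range ?Z) \<subseteq> \<Gamma>"
    using x(1) by (intro hull_minimal) (auto simp: \<Gamma>_def)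
  then have "w k \<in> \<Gamma>" for k
    using w(1) by blast
  then have w\<Gamma>: "fst (w k) \<in> E_space \<Omega>" "snd (w k) = scaled_grad \<Omega> d (fst (w k))" for k
    by (auto simp: \<Gamma>_def) (metis fst_conv snd_conv)+
  have "z $ i \<in> H01 \<Omega> \<and> grad \<Omega> (z $ i) = p $ i /\<^sub>R sqrt (d $ i)" for i
  proof -
    have "(\<lambda>k. snd (w k) $ i /\<^sub>R sqrt (d $ i)) \<longlonglongrightarrow> p $ i /\<^sub>R sqrt (d $ i)"
      by (intro tendsto_scaleR tendsto_const tendsto_vec_nth w)
    moreover have "snd (w k) $ i /\<^sub>R sqrt (d $ i) = grad \<Omega> (fst (w k) $ i)" for k
      unfolding w\<Gamma>(2) scaled_grad_def using d[of i] by simp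
    ultimately have G: "(\<lambda>k. grad \<Omega> (fst (w k) $ i)) \<longlonglongrightarrow> p $ i /\<^sub>R sqrt (d $ i)"
      by simp
    have "fst (w k) $ i \<in> H01 \<Omega>" for k
      using w\<Gamma>(1)[of k] by (simp add: E_space_def)
    moreover have "(\<lambda>k. fst (w k) $ i) \<longlonglongrightarrow> z $ i"
      by (intro tendsto_vec_nth w)
    ultimately show ?thesis
      using H01_closed[OF \<Omega> _ _ G] by simp
  qed
  then have "z \<in> E_space \<Omega>" "scaled_grad \<Omega> d z = p"
    using d by (auto simp: E_space_def scaled_grad_def vec_eq_iff less_imp_neq[symmetric])
  then show ?thesis
    using w(4) by simp
qed

text \<open>In components the difference of products is x_j (x - y)_i + y_i (x - y)_j. In each term
  the full state is measured by its H-bound \<open>K\<close>, while the difference and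
  \<open>\<phi>\<close> take the L4-norm.\<close>

lemma mult_diff_bound:
  assumes x: "x \<in> E_space \<Omega>" "norm x \<le> K" and y: "y \<in> E_space \<Omega>" "norm y \<le> K" and \<phi>: "\<phi> \<in> E_space \<Omega>"
  shows "\<bar>(l2_mult (x $ i) (x $ j) - l2_mult (y $ i) (y $ j)) \<bullet> (\<phi> $ k)\<bar> \<le> 2 * K * (L4_norm (x - y) * L4_norm \<phi>)"
proof -
  have H: "x $ i \<in> H01 \<Omega>" "x $ j \<in> H01 \<Omega>" "y $ i \<in> H01 \<Omega>" "y $ j \<in> H01 \<Omega>" "\<phi> $ k \<in> H01 \<Omega>"
    and H': "(x - y) $ i \<in> H01 \<Omega>" "(x - y) $ j \<in> H01 \<Omega>"
    using x y \<phi> subspace_diff[OF subspace_E_space x(1) y(1)] by (auto simp: E_space_def)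
  have one: "\<bar>l2_mult u ((x - y) $ a) \<bullet> (\<phi> $ k)\<bar> \<le> K * (L4_norm (x - y) * L4_norm \<phi>)"
    if u: "u \<in> H01 \<Omega>" "norm u \<le> K" and a: "(x - y) $ a \<in> H01 \<Omega>" for u a
  proof -
    have "\<bar>l2_mult u ((x - y) $ a) \<bullet> (\<phi> $ k)\<bar> \<le> norm u *
        (sqrt (norm (l2_mult ((x - y) $ a) ((x - y) $ a))) * sqrt (norm (l2_mult (\<phi> $ k) (\<phi> $ k))))"
      by (rule trilinear_bound[OF \<Omega> n u(1) a H(5)])
    also have "\<dots> \<le> K * (L4_norm (x - y) * L4_norm \<phi>)"
      using u(2) order_trans[OF norm_ge_zero u(2)]
      by (intro mult_mono L4_norm_bounds) (auto intro: L4_norm_bounds mult_nonneg_nonneg)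
    finally show ?thesis .
  qed
  have "l2_mult (x $ i) (x $ j) - l2_mult (y $ i) (y $ j) =
      l2_mult (x $ j) ((x - y) $ i) + l2_mult (y $ i) ((x - y) $ j)"
  proof -
    have "l2_mult (x $ j) ((x - y) $ i) = l2_mult (x $ i) (x $ j) - l2_mult (y $ i) (x $ j)"
      using l2_mult_diff_left[OF \<Omega> n H(1,3,2)] l2_mult_commute[of "x $ j" "(x - y) $ i"] by simp
    moreover have "l2_mult (y $ i) ((x - y) $ j) = l2_mult (x $ j) (y $ i) - l2_mult (y $ j) (y $ i)"
      using l2_mult_diff_left[OF \<Omega> n H(2,4,3)] l2_mult_commute[of "y $ i" "(x - y) $ j"] by simp
    ultimately show ?thesis
      using l2_mult_commute[of "x $ j" "y $ i"] l2_mult_commute[of "y $ j" "y $ i"] by simp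
  qed
  then have "\<bar>(l2_mult (x $ i) (x $ j) - l2_mult (y $ i) (y $ j)) \<bullet> (\<phi> $ k)\<bar> \<le>
      \<bar>l2_mult (x $ j) ((x - y) $ i) \<bullet> (\<phi> $ k)\<bar> + \<bar>l2_mult (y $ i) ((x - y) $ j) \<bullet> (\<phi> $ k)\<bar>"
    by (simp add: inner_add_left)
  also have "\<dots> \<le> K * (L4_norm (x - y) * L4_norm \<phi>) + K * (L4_norm (x - y) * L4_norm \<phi>)"
    using x(2) y(2) Finite_Cartesian_Product.norm_nth_le[of x j] Finite_Cartesian_Product.norm_nth_le[of y i]
    by (intro add_mono one H H') auto
  finally show ?thesis
    by (simp only: mult_2 distrib_right)
qed

lemma linear_diff_bound: "\<bar>(x $ i - y $ i) \<bullet> (\<phi> $ k)\<bar> \<le> L4_norm (x - y) * L4_norm \<phi>"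
proof -
  have "\<bar>(x $ i - y $ i) \<bullet> (\<phi> $ k)\<bar> \<le> norm (x $ i - y $ i) * norm (\<phi> $ k)"
    by (rule Cauchy_Schwarz_ineq2)
  also have "\<dots> \<le> norm (x - y) * norm \<phi>"
    using Finite_Cartesian_Product.norm_nth_le[of "x - y" i] Finite_Cartesian_Product.norm_nth_le[of \<phi> k]
    by (intro mult_mono) auto
  also have "\<dots> \<le> L4_norm (x - y) * L4_norm \<phi>"
    by (intro mult_mono L4_norm_bounds) auto
  finally show ?thesis .
qed

lemma oregonator_difference:
  fixes a1 a3 b1 b2 c2 c3 F G1 G2 :: real
  assumes pos: "a1 > 0" "a3 > 0" "b1 > 0" "b2 > 0" "c2 > 0" "c3 > 0" "F > 0" "G1 > 0" "G2 > 0"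
  defines "f \<equiv> oregonator_reaction a1 a3 b1 b2 c2 c3 F G1 G2"
  shows "\<exists>C\<ge>0. \<forall>x\<in>E_space \<Omega>. \<forall>y\<in>E_space \<Omega>. \<forall>\<phi>\<in>E_space \<Omega>. norm x \<le> K \<longrightarrow> norm y \<le> K \<longrightarrow>
     \<bar>(f x - f y) \<bullet> \<phi>\<bar> \<le> C * (L4_norm (x - y) * L4_norm \<phi>)"
proof (cases "0 \<le> K")
  case False
  then have "\<not> norm x \<le> K" for x :: "'n state"
    by (meson norm_ge_zero order_trans)
  then show ?thesis
    by (intro exI[of _ 0]) simp
next
  case True
  \<comment> \<open>The sum of the rate constants, where each quadratic one carries the
    \<open>2 * K\<close> of \<open>mult_diff_bound\<close>.\<close>
  let ?C = "a1 + b1 + F * (2 * K) + G1 * (2 * K) + b2 + c2 + G2 * (2 * K) + a3 + c3"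
  show ?thesis
  proof (intro exI[of _ ?C] conjI ballI impI)
    show "0 \<le> ?C"
      using pos True by simp
    fix x y \<phi> assume E: "x \<in> E_space \<Omega>" "y \<in> E_space \<Omega>" "\<phi> \<in> E_space \<Omega>" and K: "norm x \<le> K" "norm y \<le> K"
    define L where "L i k = (x $ i - y $ i) \<bullet> (\<phi> $ k)" for i k :: 3
    define Q where "Q i j k = (l2_mult (x $ i) (x $ j) - l2_mult (y $ i) (y $ j)) \<bullet> (\<phi> $ k)" for i j k :: 3
    define V where "V = L4_norm (x - y) * L4_norm \<phi>"
    have L: "\<bar>L i k\<bar> \<le> V" for i k
      unfolding L_def V_def by (rule linear_diff_bound)
    have Q: "\<bar>Q i j k\<bar> \<le> 2 * K * V" for i j k
      unfolding Q_def V_def by (rule mult_diff_bound[OF E(1) K(1) E(2) K(2) E(3)])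
    have eq: "(f x - f y) \<bullet> \<phi> = a1 * L 1 1 + b1 * L 2 1 - F * Q 1 1 1 - G1 * Q 1 2 1
        - b2 * L 2 2 + c2 * L 3 2 - G2 * Q 1 2 2 + a3 * L 1 3 - c3 * L 3 3"
      unfolding f_def oregonator_reaction_def Let_def L_def Q_def
      by (simp add: inner_vec_def sum_3 inner_diff_left inner_add_left algebra_simps)
    have cL: "c * L i k \<le> c * V" "- (c * V) \<le> c * L i k" if "0 < c" for c i k
      using mult_left_mono[OF abs_le_D1[OF L[of i k]], of c] mult_left_mono[OF abs_le_D2[OF L[of i k]], of c] that
      by linarith+
    have cQ: "c * Q i j k \<le> c * (2 * K) * V" "- (c * (2 * K) * V) \<le> c * Q i j k" if "0 < c" for c i j k
      using mult_left_mono[OF abs_le_D1[OF Q[of i j k]], of c] mult_left_mono[OF abs_le_D2[OF Q[of i j k]], of c] that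
      unfolding mult.assoc by linarith+
    note bounds = cL[OF pos(1), of 1 1] cL[OF pos(3), of 2 1] cQ[OF pos(7), of 1 1 1] cQ[OF pos(8), of 1 2 1]
      cL[OF pos(4), of 2 2] cL[OF pos(5), of 3 2] cQ[OF pos(9), of 1 2 2] cL[OF pos(2), of 1 3]
      cL[OF pos(6), of 3 3]
    have "\<bar>(f x - f y) \<bullet> \<phi>\<bar> \<le> a1 * V + b1 * V + F * (2 * K) * V + G1 * (2 * K) * V + b2 * V + c2 * V
        + G2 * (2 * K) * V + a3 * V + c3 * V"
      unfolding eq by (rule abs_leI) (use bounds in linarith)+
    then show "\<bar>(f x - f y) \<bullet> \<phi>\<bar> \<le> ?C * (L4_norm (x - y) * L4_norm \<phi>)"
      unfolding V_def[symmetric] by (simp add: algebra_simps)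
  qed
qed

lemma oregonator_zero: "oregonator_reaction a1 a3 b1 b2 c2 c3 F G1 G2 (0 :: 'n state) = 0"
proof -
  have "l2_mult 0 (0 :: (real^'n) l2) = 0"
    using l2_mult_diff_left[OF \<Omega> n H01_zero[OF \<Omega>] H01_zero[OF \<Omega>] H01_zero[OF \<Omega>]] by simp
  then show ?thesis
    unfolding oregonator_reaction_def by (simp add: Let_def vec_eq_iff forall_3)
qed

end

section \<open>From the distributional time derivative to an integral equation\<close>

definition smooth_ramp :: "nat \<Rightarrow> real \<Rightarrow> real \<Rightarrow> real" where
  "smooth_ramp n a x = smooth_step (real n * (x - a))"

definition ramp_density :: "nat \<Rightarrow> real \<Rightarrow> real \<Rightarrow> real" where
  "ramp_density n a x = real n * (bump (real n * (x - a)) / integral {0..1} bump)"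

lemma smooth_ramp_derivative: "(smooth_ramp n a has_real_derivative ramp_density n a x) (at x)"
proof -
  have "((\<lambda>x. real n * (x - a)) has_real_derivative real n) (at x)"
    by (auto intro!: derivative_eq_intros)
  from DERIV_chain2[OF smooth_step_derivative this] show ?thesis
    by (simp add: smooth_ramp_def[abs_def] ramp_density_def mult.commute)
qed

lemma ramp_density_nonneg: "0 \<le> ramp_density n a x"
  using bump_nonneg bump_integral_pos by (simp add: ramp_density_def less_imp_le)

lemma ramp_density_outside: "0 < n \<Longrightarrow> x \<notin> {a..a + 1 / real n} \<Longrightarrow> ramp_density n a x = 0"
  unfolding ramp_density_def by (subst bump_zero) (auto simp: not_le mult_le_0_iff field_simps)

lemma continuous_on_ramp_density: "continuous_on A (ramp_density n a)"
  unfolding ramp_density_def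
  by (intro continuous_on_mult continuous_on_divide continuous_on_const continuous_on_compose2[OF continuous_on_bump[of UNIV]])
    (use bump_integral_pos in \<open>auto intro!: continuous_intros\<close>)

lemma ramp_density_integral: "0 < n \<Longrightarrow> (ramp_density n a has_integral 1) {a..a + 1 / real n}"
proof -
  assume "0 < n"
  then have "(ramp_density n a has_integral (smooth_ramp n a (a + 1 / real n) - smooth_ramp n a a)) {a..a + 1 / real n}"
    using smooth_ramp_derivative
    by (intro fundamental_theorem_of_calculus)
      (auto simp: has_real_derivative_iff_has_vector_derivative[symmetric] intro: has_field_derivative_at_within)
  then show ?thesis
    using \<open>0 < n\<close> by (simp add: smooth_ramp_def smooth_step_0 smooth_step_1)
qed

lemma Ck_smooth_ramp: "Ck k (smooth_ramp n a)"
proof -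
  have "Ck k (\<lambda>x::real. smooth_step (x \<bullet> real n + - real n * a))"
    by (intro Ck_affine Ck_smooth_step)
  then show ?thesis
    unfolding smooth_ramp_def[abs_def] by (simp add: algebra_simps)
qed

lemma smooth_ramp_eq: "x \<le> a \<Longrightarrow> smooth_ramp n a x = 0" "0 < n \<Longrightarrow> a + 1 / real n \<le> x \<Longrightarrow> smooth_ramp n a x = 1"
  unfolding smooth_ramp_def
   apply (rule smooth_step_0, rule mult_nonneg_nonpos, simp, simp)
  apply (rule smooth_step_1, simp add: field_simps)
  done

text \<open>The densities have mass one on \<open>[a, a + 1 / n]\<close>, so they are an approximate
  identity that looks only to the right of \<open>a\<close>.\<close>

lemma ramp_density_tendsto:
  assumes cont: "continuous_on {a..b} h" and ab: "a < b" and \<Omega>: "{a..b} \<subseteq> \<Omega>"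
  shows "(\<lambda>n. LINT x:\<Omega>|lebesgue. h x * ramp_density n a x) \<longlonglongrightarrow> h a"
    "\<forall>\<^sub>F n in sequentially. set_integrable lebesgue \<Omega> (\<lambda>x. h x * ramp_density n a x)"
proof -
  obtain N :: nat where N: "0 < N" "1 / real N < b - a"
    using ab by (metis diff_gt_0_iff_gt inverse_eq_divide reals_Archimedean zero_less_Suc)
  have n_large: "0 < n" "a + 1 / real n \<le> b" if "N \<le> n" for n
  proof -
    show "0 < n"
      using N(1) that by simp
    have "1 / real n \<le> 1 / real N"
      using N(1) that by (simp add: divide_left_mono)
    then show "a + 1 / real n \<le> b"
      using N(2) by simp
  qed
  let ?I = "\<lambda>n. {a..a + 1 / real n}"
  have cont_I: "continuous_on (?I n) (\<lambda>x. h x * ramp_density n a x)" if "N \<le> n" for n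
    using n_large[OF that] by (intro continuous_on_mult continuous_on_ramp_density continuous_on_subset[OF cont]) auto
  have ind: "(\<lambda>x. indicator \<Omega> x *\<^sub>R (h x * ramp_density n a x)) = (\<lambda>x. indicator (?I n) x *\<^sub>R (h x * ramp_density n a x))"
    if "N \<le> n" for n
  proof (rule ext)
    fix x
    show "indicator \<Omega> x *\<^sub>R (h x * ramp_density n a x) = indicator (?I n) x *\<^sub>R (h x * ramp_density n a x)"
    proof (cases "x \<in> ?I n")
      case True
      then have "x \<in> \<Omega>"
        using \<Omega> n_large(2)[OF that] by auto
      then show ?thesis
        using True by simp
    qed (simp add: ramp_density_outside[OF n_large(1)[OF that]])
  qed
  have abs_int: "set_integrable lebesgue (?I n) (\<lambda>x. h x * ramp_density n a x)" if "N \<le> n" for n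
    using cont_I[OF that] by (rule absolutely_integrable_continuous_real)
  have eq: "(LINT x:\<Omega>|lebesgue. h x * ramp_density n a x) = integral (?I n) (\<lambda>x. h x * ramp_density n a x)" if "N \<le> n" for n
    using set_lebesgue_integral_eq_integral(2)[OF abs_int[OF that]]
    unfolding set_lebesgue_integral_def ind[OF that] .
  show "\<forall>\<^sub>F n in sequentially. set_integrable lebesgue \<Omega> (\<lambda>x. h x * ramp_density n a x)"
    unfolding set_integrable_def
    using abs_int ind unfolding set_integrable_def by (intro eventually_sequentiallyI[of N]) simp
  show "(\<lambda>n. LINT x:\<Omega>|lebesgue. h x * ramp_density n a x) \<longlonglongrightarrow> h a"
  proof (rule metric_LIMSEQ_I)
    fix \<epsilon> :: real assume "0 < \<epsilon>"
    then obtain d where d: "0 < d" "\<And>x. x \<in> {a..b} \<Longrightarrow> dist x a < d \<Longrightarrow> dist (h x) (h a) < \<epsilon> / 2"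
      using cont ab unfolding continuous_on_iff by (metis atLeastAtMost_iff half_gt_zero less_imp_le order_refl)
    obtain N' :: nat where N': "0 < N'" "1 / real N' < d"
      using d(1) by (metis inverse_eq_divide reals_Archimedean zero_less_Suc)
    have "dist (LINT x:\<Omega>|lebesgue. h x * ramp_density n a x) (h a) < \<epsilon>" if n: "max N N' \<le> n" for n
    proof -
      have nN: "N \<le> n"
        using n by simp
      have "1 / real n \<le> 1 / real N'"
        using N'(1) n by (simp add: divide_left_mono)
      then have small: "1 / real n < d"
        using N'(2) by simp
      have close: "h a - \<epsilon> / 2 \<le> h x \<and> h x \<le> h a + \<epsilon> / 2" if "x \<in> ?I n" for x
      proof -
        have "x \<in> {a..b}" "dist x a < d"
          using that small n_large(2)[OF nN] by (auto simp: dist_real_def)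
        from d(2)[OF this] show ?thesis
          unfolding dist_real_def by linarith
      qed
      note one = ramp_density_integral[OF n_large(1)[OF nN], of a]
      have int: "(\<lambda>x. h x * ramp_density n a x) integrable_on ?I n"
        by (rule integrable_continuous_interval[OF cont_I[OF nN]])
      have "integral (?I n) (\<lambda>x. h x * ramp_density n a x) \<le> integral (?I n) (\<lambda>x. (h a + \<epsilon> / 2) * ramp_density n a x)"
        using close one by (intro integral_le int integrable_on_mult_right mult_right_mono ramp_density_nonneg) auto
      moreover have "integral (?I n) (\<lambda>x. (h a - \<epsilon> / 2) * ramp_density n a x) \<le> integral (?I n) (\<lambda>x. h x * ramp_density n a x)"
        using close one by (intro integral_le int integrable_on_mult_right mult_right_mono ramp_density_nonneg) auto
      ultimately show ?thesis
        using integral_unique[OF one] \<open>0 < \<epsilon>\<close> unfolding eq[OF nN] by (simp add: dist_real_def abs_less_iff)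
    qed
    then show "\<exists>N. \<forall>n\<ge>N. dist (LINT x:\<Omega>|lebesgue. h x * ramp_density n a x) (h a) < \<epsilon>"
      by blast
  qed
qed

lemma frechet_derivative_real: "(f has_real_derivative D) (at x) \<Longrightarrow> frechet_derivative f (at x) 1 = D"
  using frechet_derivative_eq[of f "(*) D" x] by (simp add: has_field_derivative_def)

text \<open>Testing with the difference of two ramps of width \<open>1 / n\<close> starting at \<open>s\<close> and \<open>t\<close>.\<close>

lemma weak_derivative_imp_integral:
  fixes h h' :: "real \<Rightarrow> real"
  assumes wd: "weak_derivative {0<..<\<tau>} 1 h h'" and cont: "continuous_on {0<..<\<tau>} h"
    and st: "0 < s" "s < t" "t < \<tau>"
  shows "(h' has_integral (h t - h s)) {s..t}"
proof -
  let ?\<Omega> = "{0<..<\<tau>}"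
  \<comment> \<open>Leaves room to the right of \<open>t\<close>: for large \<open>n\<close> the
    ramp that starts at \<open>t\<close> ends before \<open>b\<close>.\<close>
  define b where "b = (t + \<tau>) / 2"
  have b: "t < b" "b < \<tau>"
    using st by (auto simp: b_def field_simps)
  have h'_int: "set_integrable lebesgue {s..b} h'"
  proof -
    have "{s..b} \<subseteq> ?\<Omega>"
      using st b by auto
    then show ?thesis
      using wd compact_Icc unfolding weak_derivative_def locally_integrable_on_def by blast
  qed
  define \<eta> where "\<eta> n x = 1 * smooth_ramp n s x + (-1) * smooth_ramp n t x" for n x
  obtain N :: nat where N: "0 < N" "1 / real N < b - t"
    using b by (metis diff_gt_0_iff_gt inverse_eq_divide reals_Archimedean zero_less_Suc)
  have n_large: "0 < n" "t + 1 / real n \<le> b" if "N \<le> n" for n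
  proof -
    show "0 < n"
      using N(1) that by simp
    have "1 / real n \<le> 1 / real N"
      using N(1) that by (simp add: divide_left_mono)
    then show "t + 1 / real n \<le> b"
      using N(2) by simp
  qed
  have \<eta>_out: "\<eta> n x = 0" if "N \<le> n" "x \<notin> {s..b}" for n x
    using that n_large[OF that(1)] st smooth_ramp_eq(1)[of x s n] smooth_ramp_eq(1)[of x t n] smooth_ramp_eq(2)[of n t x]
      smooth_ramp_eq(2)[of n s x] by (auto simp: \<eta>_def not_le)
  have \<eta>_test: "\<eta> n \<in> test_functions ?\<Omega>" if "N \<le> n" for n
  proof (rule test_functionI)
    show "Ck k (\<eta> n)" for k
      unfolding \<eta>_def[abs_def] by (intro Ck_add Ck_cmult Ck_smooth_ramp)
    show "{s..b} \<subseteq> ?\<Omega>"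
      using st b by auto
  qed (use \<eta>_out[OF that] in auto)
  have \<eta>_deriv: "frechet_derivative (\<eta> n) (at x) 1 = ramp_density n s x - ramp_density n t x" for n x
    unfolding \<eta>_def[abs_def]
    by (rule frechet_derivative_real) (auto intro!: derivative_eq_intros smooth_ramp_derivative)
  have sub: "{s..b} \<subseteq> ?\<Omega>" "{t..b} \<subseteq> ?\<Omega>"
    using st b by auto
  note cs = continuous_on_subset[OF cont sub(1)] and ct = continuous_on_subset[OF cont sub(2)]
  have sb: "s < b"
    using st b by simp
  note S = ramp_density_tendsto[OF cs sb sub(1)] and T = ramp_density_tendsto[OF ct b(1) sub(2)]
  have "(\<lambda>n. LINT x:?\<Omega>|lebesgue. h x * frechet_derivative (\<eta> n) (at x) 1) \<longlonglongrightarrow> h s - h t"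
  proof (rule Lim_transform_eventually[OF tendsto_diff[OF S(1) T(1)]])
    show "\<forall>\<^sub>F n in sequentially. (LINT x:?\<Omega>|lebesgue. h x * ramp_density n s x) - (LINT x:?\<Omega>|lebesgue. h x * ramp_density n t x)
        = (LINT x:?\<Omega>|lebesgue. h x * frechet_derivative (\<eta> n) (at x) 1)"
      using S(2) T(2)
    proof eventually_elim
      fix n assume "set_integrable lebesgue ?\<Omega> (\<lambda>x. h x * ramp_density n s x)"
        "set_integrable lebesgue ?\<Omega> (\<lambda>x. h x * ramp_density n t x)"
      from set_integral_diff(2)[OF this]
      show "(LINT x:?\<Omega>|lebesgue. h x * ramp_density n s x) - (LINT x:?\<Omega>|lebesgue. h x * ramp_density n t x)
        = (LINT x:?\<Omega>|lebesgue. h x * frechet_derivative (\<eta> n) (at x) 1)"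
        by (simp add: \<eta>_deriv right_diff_distrib)
    qed
  qed
  moreover have "(\<lambda>n. - (LINT x:?\<Omega>|lebesgue. h' x * \<eta> n x)) \<longlonglongrightarrow> - (LINT x:{s<..t}|lebesgue. h' x)"
  proof (rule tendsto_minus)
    have "(\<lambda>n. LINT x|lebesgue. indicator {s..b} x *\<^sub>R h' x * \<eta> n x) \<longlonglongrightarrow>
        (LINT x|lebesgue. indicator {s<..t} x *\<^sub>R h' x)"
    proof (rule integral_dominated_convergence)
      have hm: "(\<lambda>x. indicator {s..b} x *\<^sub>R h' x) \<in> borel_measurable lebesgue"
        using h'_int unfolding set_integrable_def by (rule borel_measurable_integrable)
      show "integrable lebesgue (\<lambda>x. \<bar>indicator {s..b} x *\<^sub>R h' x\<bar>)"
        using h'_int unfolding set_integrable_def by (rule integrable_abs)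
      have "\<eta> n \<in> borel_measurable lebesgue" for n
      proof -
        have "Ck 0 (\<eta> n)"
          unfolding \<eta>_def[abs_def] by (intro Ck_add Ck_cmult Ck_smooth_ramp)
        then have "\<eta> n \<in> borel_measurable borel"
          by (simp add: borel_measurable_continuous_onI)
        then show ?thesis
          by (simp add: measurable_completion)
      qed
      then show "(\<lambda>x. indicator {s..b} x *\<^sub>R h' x * \<eta> n x) \<in> borel_measurable lebesgue" for n
        by (intro borel_measurable_times hm)
      have "set_integrable lebesgue {s<..t} h'"
        by (rule set_integrable_subset[OF h'_int]) (use b in auto)
      then show "(\<lambda>x. indicator {s<..t} x *\<^sub>R h' x) \<in> borel_measurable lebesgue"
        unfolding set_integrable_def by (rule borel_measurable_integrable)
      show "AE x in lebesgue. norm (indicator {s..b} x *\<^sub>R h' x * \<eta> n x) \<le> \<bar>indicator {s..b} x *\<^sub>R h' x\<bar>" for n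
      proof (rule AE_I2)
        fix x
        have "\<bar>\<eta> n x\<bar> \<le> 1"
          using smooth_step_range[of "real n * (x - s)"] smooth_step_range[of "real n * (x - t)"]
          by (simp add: \<eta>_def smooth_ramp_def)
        then show "norm (indicator {s..b} x *\<^sub>R h' x * \<eta> n x) \<le> \<bar>indicator {s..b} x *\<^sub>R h' x\<bar>"
          by (simp add: abs_mult mult_left_le)
      qed
      show "AE x in lebesgue. (\<lambda>n. indicator {s..b} x *\<^sub>R h' x * \<eta> n x) \<longlonglongrightarrow> indicator {s<..t} x *\<^sub>R h' x"
      proof (rule AE_I2)
        fix x
        \<comment> \<open>A ramp tends to the indicator of the open half-line beyond its start, so
          the test functions tend to that of \<open>{s<..t}\<close>; the missing point
          \<open>s\<close> does not affect the integral.\<close>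
        have ramp: "(\<lambda>n. smooth_ramp n a x) \<longlonglongrightarrow> (if a < x then 1 else 0)" for a
          using smooth_step_scaled_tendsto[of "x - a"] by (simp add: smooth_ramp_def smooth_ramp_eq(1)[unfolded smooth_ramp_def])
        have "(\<lambda>n. indicator {s..b} x *\<^sub>R h' x * \<eta> n x) \<longlonglongrightarrow>
          indicator {s..b} x *\<^sub>R h' x * (1 * (if s < x then 1 else 0) + (-1) * (if t < x then 1 else 0))"
          unfolding \<eta>_def by (intro tendsto_mult tendsto_add tendsto_const ramp)
        moreover have "indicator {s..b} x *\<^sub>R h' x * (1 * (if s < x then 1 else 0) + (-1) * (if t < x then 1 else 0))
          = indicator {s<..t} x *\<^sub>R h' x"
          using st b by (auto simp: indicator_def)
        ultimately show "(\<lambda>n. indicator {s..b} x *\<^sub>R h' x * \<eta> n x) \<longlonglongrightarrow> indicator {s<..t} x *\<^sub>R h' x"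
          by (simp only:)
      qed
    qed
    moreover have "\<forall>\<^sub>F n in sequentially. (LINT x|lebesgue. indicator {s..b} x *\<^sub>R h' x * \<eta> n x) =
        (LINT x:?\<Omega>|lebesgue. h' x * \<eta> n x)"
    proof (rule eventually_sequentiallyI[of N])
      fix n assume n: "N \<le> n"
      have "(\<lambda>x. indicator {s..b} x *\<^sub>R h' x * \<eta> n x) = (\<lambda>x. indicator ?\<Omega> x *\<^sub>R (h' x * \<eta> n x))"
      proof (rule ext)
        fix x show "indicator {s..b} x *\<^sub>R h' x * \<eta> n x = indicator ?\<Omega> x *\<^sub>R (h' x * \<eta> n x)"
          using \<eta>_out[OF n, of x] sub(1) by (cases "x \<in> {s..b}") auto
      qed
      then show "(LINT x|lebesgue. indicator {s..b} x *\<^sub>R h' x * \<eta> n x) = (LINT x:?\<Omega>|lebesgue. h' x * \<eta> n x)"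
        by (simp only: set_lebesgue_integral_def)
    qed
    ultimately show "(\<lambda>n. LINT x:?\<Omega>|lebesgue. h' x * \<eta> n x) \<longlonglongrightarrow> (LINT x:{s<..t}|lebesgue. h' x)"
      unfolding set_lebesgue_integral_def[of lebesgue "{s<..t}"] by (rule Lim_transform_eventually)
  qed
  moreover have "\<forall>\<^sub>F n in sequentially. - (LINT x:?\<Omega>|lebesgue. h' x * \<eta> n x) =
      (LINT x:?\<Omega>|lebesgue. h x * frechet_derivative (\<eta> n) (at x) 1)"
  proof (rule eventually_sequentiallyI[of N])
    show "- (LINT x:?\<Omega>|lebesgue. h' x * \<eta> n x) = (LINT x:?\<Omega>|lebesgue. h x * frechet_derivative (\<eta> n) (at x) 1)"
      if "N \<le> n" for n
      using wd \<eta>_test[OF that] unfolding weak_derivative_def by simp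
  qed
  ultimately have "h s - h t = - (LINT x:{s<..t}|lebesgue. h' x)"
    by (rule LIMSEQ_unique[OF _ Lim_transform_eventually])
  moreover have int: "set_integrable lebesgue {s<..t} h'" "set_integrable lebesgue {s..t} h'"
    using b by (auto intro: set_integrable_subset[OF h'_int])
  moreover have "integral {s<..t} h' = integral {s..t} h'"
    by (rule integral_spike_set) (auto intro: negligible_subset[of "{s}"])
  ultimately have "integral {s..t} h' = h t - h s"
    using set_lebesgue_integral_eq_integral(2)[OF int(1)] by simp
  then show ?thesis
    using set_lebesgue_integral_eq_integral(1)[OF int(2)] by (simp add: has_integral_iff)
qed

context parabolic
begin

text \<open>Weak solutions are given on intervals of positive length, whereas
  \<open>solution\<close> asks for every real \<open>T\<close>.\<close>

lemma approx_mono: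
  assumes "approx T' g" "T \<le> T'"
  shows "approx T g"
  unfolding approx_def
proof (intro allI impI)
  fix \<eta> :: real assume "0 < \<eta>"
  from approxE[OF assms(1) this] obtain c e N where c: "\<And>t. c t \<in> E" "continuous_on {0..T'} (\<lambda>t. D (c t))"
    "\<And>t. 0 \<le> (e t :: real)" "e integrable_on {0..T'}" "integral {0..T'} e \<le> \<eta>" "negligible N"
    "\<And>t. t \<in> {0..T'} \<Longrightarrow> t \<notin> N \<Longrightarrow> g t \<in> E"
    "\<And>t. t \<in> {0..T'} \<Longrightarrow> t \<notin> N \<Longrightarrow> (norm (D (g t - c t)))\<^sup>2 \<le> e t"
    by metis
  have sub: "{0..T} \<subseteq> {0..T'}"
    using assms(2) by simp
  have int: "e integrable_on {0..T}"
    by (rule integrable_on_subinterval[OF c(4) sub])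
  have "integral {0..T} e \<le> integral {0..T'} e"
    by (rule integral_subset_le[OF sub int c(4)]) (simp add: c(3))
  then have "integral {0..T} e \<le> \<eta>"
    using c(5) by (rule order_trans)
  moreover have "g t \<in> E \<and> (norm (D (g t - c t)))\<^sup>2 \<le> e t" if "t \<in> {0..T} - N" for t
    using c(7)[of t] c(8)[of t] that sub by auto
  ultimately show "\<exists>c e N. (\<forall>t. c t \<in> E) \<and> continuous_on {0..T} (\<lambda>t. D (c t)) \<and>
     (\<forall>t. 0 \<le> e t) \<and> e integrable_on {0..T} \<and> integral {0..T} e \<le> \<eta> \<and>
     negligible N \<and> (\<forall>t\<in>{0..T} - N. g t \<in> E \<and> (norm (D (g t - c t)))\<^sup>2 \<le> e t)"
    by (intro exI[of _ c] exI[of _ e] exI[of _ N] conjI allI ballI c(1) c(3) c(6) int continuous_on_subset[OF c(2) sub]) blast+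
qed

end

text \<open>Stated for arbitrary \<open>f\<close> because it is applied to the squared E-norm of a
  trajectory without a measurability proof; the factor is pulled out of each simple
  minorant.\<close>

lemma nn_integral_cmult_le:
  assumes "0 < c"
  shows "(\<integral>\<^sup>+x. ennreal c * f x \<partial>M) \<le> ennreal c * (\<integral>\<^sup>+x. f x \<partial>M)"
proof -
  have "integral\<^sup>S M g \<le> ennreal c * (\<integral>\<^sup>+x. f x \<partial>M)" if g: "simple_function M g" "g \<le> (\<lambda>x. ennreal c * f x)" for g
  proof -
    have c1: "ennreal c * (ennreal (1 / c) * a) = a" "ennreal (1 / c) * (ennreal c * a) = a" for a
      using assms by (simp_all add: mult.assoc[symmetric] ennreal_mult[symmetric])
    have "integral\<^sup>S M g = (\<integral>\<^sup>+x. ennreal c * (ennreal (1 / c) * g x) \<partial>M)"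
      using g(1) by (simp add: c1 nn_integral_eq_simple_integral)
    also have "\<dots> = ennreal c * (\<integral>\<^sup>+x. ennreal (1 / c) * g x \<partial>M)"
      using borel_measurable_simple_function[OF g(1)] by (intro nn_integral_cmult) measurable
    also have "\<dots> \<le> ennreal c * (\<integral>\<^sup>+x. f x \<partial>M)"
    proof (intro mult_left_mono nn_integral_mono)
      fix x
      have "ennreal (1 / c) * g x \<le> ennreal (1 / c) * (ennreal c * f x)"
        using g(2) by (intro mult_left_mono) (auto simp: le_fun_def)
      then show "ennreal (1 / c) * g x \<le> f x"
        by (simp only: c1)
    qed simp
    finally show ?thesis .
  qed
  then show ?thesis
    unfolding nn_integral_def[of M "\<lambda>x. ennreal c * f x"] by (intro SUP_least) simp
qed

section \<open>Absorption, the E-metric and compactness in it\<close>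

lemma semidist_lessD:
  assumes "semidist \<delta> X Y < ennreal \<epsilon>" "x \<in> X" "\<And>y. 0 \<le> \<delta> x y"
  obtains y where "y \<in> Y" "\<delta> x y < \<epsilon>"
proof -
  have "(INF y\<in>Y. ennreal (\<delta> x y)) \<le> semidist \<delta> X Y"
    unfolding semidist_def by (rule SUP_upper[OF assms(2)])
  then have "(INF y\<in>Y. ennreal (\<delta> x y)) < ennreal \<epsilon>"
    using assms(1) by (rule le_less_trans)
  then obtain y where "y \<in> Y" "ennreal (\<delta> x y) < ennreal \<epsilon>"
    unfolding INF_less_iff by (elim bexE)
  then show thesis
    using that assms(3) by (simp add: ennreal_less_iff)
qed

lemma semidist_leI:
  assumes "\<And>x. x \<in> X \<Longrightarrow> \<exists>y\<in>Y. \<delta> x y \<le> \<epsilon>"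
  shows "semidist \<delta> X Y \<le> ennreal \<epsilon>"
  unfolding semidist_def
proof (rule SUP_least)
  fix x assume "x \<in> X"
  from assms[OF this] obtain y where "y \<in> Y" "\<delta> x y \<le> \<epsilon>" ..
  then show "(INF y\<in>Y. ennreal (\<delta> x y)) \<le> ennreal \<epsilon>"
    by (intro INF_lower2[of y]) (auto intro: ennreal_leI)
qed

text \<open>The attractor is bounded because it is compact, and trajectories from \<open>B\<close>
  eventually stay within distance 1 of it. The time \<open>h\<close> is positive so that
  trajectories can be shifted to interior times.\<close>

lemma attractor_absorbs:
  assumes A: "global_attractor \<Omega> S \<A>" and B: "B \<subseteq> H_plus \<Omega>" "bounded B"
  obtains h K where "0 < h" "\<And>t x. h \<le> t \<Longrightarrow> x \<in> B \<Longrightarrow> norm (S t x) \<le> K"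
proof -
  have "bounded \<A>"
    using A by (intro compact_imp_bounded) (simp add: global_attractor_def)
  then obtain R where R: "\<And>y. y \<in> \<A> \<Longrightarrow> norm y \<le> R"
    unfolding bounded_iff by - (elim exE, rule that, erule (1) bspec)
  have "((\<lambda>t. semidist dist (S t ` B) \<A>) \<longlongrightarrow> 0) at_top"
    using A B by (simp add: global_attractor_def)
  then have "\<forall>\<^sub>F t in at_top. semidist dist (S t ` B) \<A> < ennreal 1"
    by (rule order_tendstoD(2)) simp
  then obtain h where h: "\<And>t. h \<le> t \<Longrightarrow> semidist dist (S t ` B) \<A> < ennreal 1"
    by (auto simp: eventually_at_top_linorder)
  show thesis
  proof (rule that[of "max h 1" "R + 1"])
    fix t x assume t: "max h 1 \<le> t" and "x \<in> B"
    then have "S t x \<in> S t ` B"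
      by simp
    from semidist_lessD[OF h this] t obtain y where y: "y \<in> \<A>" "dist (S t x) y < 1"
      by auto
    show "norm (S t x) \<le> R + 1"
      using R[OF y(1)] y(2) norm_triangle_sub[of "S t x" y] by (simp add: dist_norm)
  qed simp
qed

text \<open>With unit coefficients the weighted gradient is the gradient, so linearity of
  \<open>scaled_grad\<close> serves the E-norm as well.\<close>

lemma E_norm_eq: "E_norm \<Omega> g = norm (scaled_grad \<Omega> 1 g)"
  by (simp add: E_norm_def scaled_grad_def)

context
  fixes \<Omega> :: "(real^'n) set"
  assumes \<Omega>: "open \<Omega>" and n: "CARD('n) \<le> 3"
begin

lemma scaled_grad_diff:
  assumes "x \<in> E_space \<Omega>" "y \<in> E_space \<Omega>"
  shows "scaled_grad \<Omega> 1 (x - y) = scaled_grad \<Omega> 1 x - scaled_grad \<Omega> 1 y"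
proof -
  have 1: "0 < (1 :: real^3) $ i" for i
    by simp
  have "(-1) *\<^sub>R y \<in> E_space \<Omega>"
    by (intro subspace_scale[OF subspace_E_space[OF \<Omega> n 1]] assms)
  then show ?thesis
    using scaled_grad_linear(1)[OF \<Omega> n 1 assms(1), of "(-1) *\<^sub>R y"]
      scaled_grad_linear(2)[OF \<Omega> n 1 assms(2), of "-1"] by simp
qed

lemma Metric_space_E_plus: "Metric_space (E_plus \<Omega>) (E_dist \<Omega>)"
proof
  fix x y z :: "'n state"
  show "0 \<le> E_dist \<Omega> x y"
    by (simp add: E_dist_def E_norm_def)
  \<comment> \<open>Symmetry of the metric is demanded on the whole type; outside
    \<open>H1 \<Omega>\<close> both sides are the default 0.\<close>
  have minus: "grad \<Omega> (- u) = - grad \<Omega> u" for u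
    using H1_scaleR[OF \<Omega>, of u "-1"] H1_scaleR[OF \<Omega>, of "- u" "-1"]
    by (cases "u \<in> H1 \<Omega>") (auto simp: grad_def)
  have "(\<chi> i. grad \<Omega> ((y - x) $ i)) = - (\<chi> i. grad \<Omega> ((x - y) $ i))"
    using minus[of "x $ _ - y $ _"] by (simp add: vec_eq_iff)
  then show "E_dist \<Omega> x y = E_dist \<Omega> y x"
    unfolding E_dist_def E_norm_def by (simp only: norm_minus_cancel)
  assume x: "x \<in> E_plus \<Omega>" and y: "y \<in> E_plus \<Omega>"
  then have E: "x \<in> E_space \<Omega>" "y \<in> E_space \<Omega>"
    by (auto simp: E_plus_def)
  show "E_dist \<Omega> x y = 0 \<longleftrightarrow> x = y"
  proof
    assume "E_dist \<Omega> x y = 0"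
    then have "grad \<Omega> (x $ i - y $ i) = 0" for i
      by (simp add: E_dist_def E_norm_def vec_eq_iff)
    moreover have "x $ i - y $ i \<in> H01 \<Omega>" for i
      using E subspace_diff[OF subspace_H01[OF \<Omega>]] by (auto simp: E_space_def)
    ultimately have "x $ i - y $ i = 0" for i
      using H01_grad_zero[OF \<Omega> n] by blast
    then show "x = y"
      by (simp add: vec_eq_iff)
  next
    assume "x = y"
    then show "E_dist \<Omega> x y = 0"
      using scaled_grad_diff[OF E(2) E(2)] by (simp add: E_dist_def E_norm_eq)
  qed
  assume "z \<in> E_plus \<Omega>"
  then have z: "z \<in> E_space \<Omega>"
    by (simp add: E_plus_def)
  show "E_dist \<Omega> x z \<le> E_dist \<Omega> x y + E_dist \<Omega> y z"
    using norm_triangle_ineq[of "scaled_grad \<Omega> 1 x - scaled_grad \<Omega> 1 y" "scaled_grad \<Omega> 1 y - scaled_grad \<Omega> 1 z"]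
    by (simp add: E_dist_def E_norm_eq scaled_grad_diff E z)
qed

text \<open>By the hypothesis the identity on the set is continuous from the H-metric to the
  E-metric, and continuous images of compact sets are compact.\<close>

lemma compactin_E_plus:
  assumes A: "compact \<A>" "\<A> \<subseteq> E_plus \<Omega>"
    and cont: "\<And>\<epsilon>. 0 < \<epsilon> \<Longrightarrow> \<exists>\<eta>>0. \<forall>p\<in>\<A>. \<forall>q\<in>\<A>. norm (p - q) < \<eta> \<longrightarrow> E_dist \<Omega> p q < \<epsilon>"
  shows "compactin (Metric_space.mtopology (E_plus \<Omega>) (E_dist \<Omega>)) \<A>"
proof -
  interpret M: Metric_space "E_plus \<Omega>" "E_dist \<Omega>"
    by (rule Metric_space_E_plus)
  have "continuous_map (top_of_set \<A>) M.mtopology (\<lambda>x. x)"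
    unfolding M.continuous_map_to_metric
  proof (intro ballI allI impI)
    fix p \<epsilon> assume p: "p \<in> topspace (top_of_set \<A>)" and "(0 :: real) < \<epsilon>"
    from cont[OF this(2)] obtain \<eta> where \<eta>: "0 < \<eta>" "\<And>q. q \<in> \<A> \<Longrightarrow> norm (p - q) < \<eta> \<Longrightarrow> E_dist \<Omega> p q < \<epsilon>"
      using p by auto
    have "openin (top_of_set \<A>) (\<A> \<inter> ball p \<eta>)"
      by (rule openin_open_Int) simp
    moreover have "\<forall>q\<in>\<A> \<inter> ball p \<eta>. q \<in> M.mball p \<epsilon>"
      using \<eta>(2) p A(2) by (auto simp: dist_norm)
    ultimately show "\<exists>U. openin (top_of_set \<A>) U \<and> p \<in> U \<and> (\<forall>y\<in>U. y \<in> M.mball p \<epsilon>)"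
      using p \<eta>(1) by (intro exI[of _ "\<A> \<inter> ball p \<eta>"]) auto
  qed
  moreover have "compactin (top_of_set \<A>) \<A>"
    using A(1) by (simp add: compactin_subtopology)
  ultimately have "compactin M.mtopology ((\<lambda>x. x) ` \<A>)"
    by (rule image_compactin[rotated])
  then show ?thesis
    by simp
qed

end

section \<open>The Oregonator as an instance of the abstract problem\<close>

lemma parabolic_oregonator:
  fixes \<Omega> :: "(real^'n) set" and d :: "real^3" and a1 a3 b1 b2 c2 c3 F G1 G2 :: real
  assumes \<Omega>: "open \<Omega>" and n: "CARD('n) \<le> 3" and d: "\<And>i. 0 < d $ i"
    and pos: "a1 > 0" "a3 > 0" "b1 > 0" "b2 > 0" "c2 > 0" "c3 > 0" "F > 0" "G1 > 0" "G2 > 0"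
  shows "parabolic (H_space \<Omega>) (E_space \<Omega>) (scaled_grad \<Omega> d)
    (oregonator_reaction a1 a3 b1 b2 c2 c3 F G1 G2) L4_norm"
proof
  note E = \<Omega> n d
  show "subspace (H_space \<Omega>)"
    by (rule subspace_H_space)
  show "subspace (E_space \<Omega>)" "E_space \<Omega> \<subseteq> H_space \<Omega>"
    by (rule subspace_E_space[OF E] E_space_subset_H_space[OF E])+
  show "scaled_grad \<Omega> d (x + y) = scaled_grad \<Omega> d x + scaled_grad \<Omega> d y" if "x \<in> E_space \<Omega>" "y \<in> E_space \<Omega>" for x y
    by (rule scaled_grad_linear(1)[OF E that])
  show "scaled_grad \<Omega> d (c *\<^sub>R x) = c *\<^sub>R scaled_grad \<Omega> d x" if "x \<in> E_space \<Omega>" for c x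
    by (rule scaled_grad_linear(2)[OF E that])
  show "0 \<le> L4_norm x" for x :: "'n state"
    by (rule L4_norm_bounds(1))
  show "\<exists>C\<ge>0. \<forall>x\<in>E_space \<Omega>. (L4_norm x)\<^sup>2 \<le> \<epsilon> * (norm (scaled_grad \<Omega> d x))\<^sup>2 + C * (norm x)\<^sup>2"
    if "0 < \<epsilon>" for \<epsilon>
    by (rule L4_norm_interpolation[OF E that])
  show "z \<in> E_space \<Omega> \<and> norm (scaled_grad \<Omega> d z) \<le> R"
    if "\<And>k. xs k \<in> E_space \<Omega>" "xs \<longlonglongrightarrow> z" "\<And>k. norm (scaled_grad \<Omega> d (xs k)) \<le> R" for xs :: "nat \<Rightarrow> _" and z R
    by (rule E_space_closed[OF E that])
qed (rule oregonator_difference[OF \<Omega> n d pos] oregonator_zero[OF \<Omega> n d])+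

text \<open>The distributional equation on \<open>{0<..<\<tau>}\<close> integrates between positive
  times. Shifting by \<open>h\<close> makes every nonnegative time of the shifted trajectory
  interior.\<close>

lemma weak_solution_imp_solution:
  fixes \<Omega> :: "(real^'n) set" and d :: "real^3"
  assumes \<Omega>: "open \<Omega>" and n: "CARD('n) \<le> 3" and d: "\<And>i. 0 < d $ i"
    and par: "parabolic (H_space \<Omega>) (E_space \<Omega>) (scaled_grad \<Omega> d) f V"
    and g: "global_weak_solution \<Omega> d f g0 g" and h: "0 < h"
  shows "parabolic.solution (H_space \<Omega>) (E_space \<Omega>) (scaled_grad \<Omega> d) f (\<lambda>t. g (t + h))"
proof -
  interpret parabolic "H_space \<Omega>" "E_space \<Omega>" "scaled_grad \<Omega> d" f V
    by (rule par)
  have w: "weak_solution \<Omega> d f g0 \<tau> g" if "0 < \<tau>" for \<tau>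
    using g that by (simp add: global_weak_solution_def)
  obtain M where M: "0 < M" "\<And>g. (norm (scaled_grad \<Omega> d g))\<^sup>2 \<le> M * (E_norm \<Omega> g)\<^sup>2"
    using scaled_grad_E_norm_upper[OF \<Omega> n d] by blast
  have M_norm: "norm (scaled_grad \<Omega> d g) \<le> sqrt M * E_norm \<Omega> g" for g
  proof (rule power2_le_imp_le)
    show "0 \<le> sqrt M * E_norm \<Omega> g"
      using M(1) by (simp add: E_norm_def)
    show "(norm (scaled_grad \<Omega> d g))\<^sup>2 \<le> (sqrt M * E_norm \<Omega> g)\<^sup>2"
      using M(1) M(2)[of g] by (simp add: power_mult_distrib)
  qed
  have approx_pos: "approx \<tau> g" if "0 < \<tau>" for \<tau>
  proof -
    have b: "bochner_L2_E \<Omega> \<tau> g"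
      using w[OF that] by (simp add: weak_solution_def)
    then obtain s where s: "\<And>k::nat. simple_function (lebesgue_on {0..\<tau>}) (s k)" "\<And>k. s k ` {0..\<tau>} \<subseteq> E_space \<Omega>"
      "AE t in lebesgue. t \<in> {0..\<tau>} \<longrightarrow> (\<lambda>k. E_norm \<Omega> (s k t - g t)) \<longlonglongrightarrow> 0"
      unfolding bochner_L2_E_def by blast
    show ?thesis
    proof (rule approx_if_simple_limit[OF _ s(1,2)])
      show "AE t in lebesgue. t \<in> {0..\<tau>} \<longrightarrow> g t \<in> E_space \<Omega>"
        using b by (simp add: bochner_L2_E_def)
      show "AE t in lebesgue. t \<in> {0..\<tau>} \<longrightarrow> (\<lambda>k. norm (scaled_grad \<Omega> d (s k t - g t))) \<longlonglongrightarrow> 0"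
        using s(3)
      proof eventually_elim
        fix t assume t: "t \<in> {0..\<tau>} \<longrightarrow> (\<lambda>k. E_norm \<Omega> (s k t - g t)) \<longlonglongrightarrow> 0"
        show "t \<in> {0..\<tau>} \<longrightarrow> (\<lambda>k. norm (scaled_grad \<Omega> d (s k t - g t))) \<longlonglongrightarrow> 0"
        proof
          assume "t \<in> {0..\<tau>}"
          with t have "(\<lambda>k. sqrt M * E_norm \<Omega> (s k t - g t)) \<longlonglongrightarrow> sqrt M * 0"
            by (intro tendsto_mult_left) simp
          then have "(\<lambda>k. sqrt M * E_norm \<Omega> (s k t - g t)) \<longlonglongrightarrow> 0"
            by simp
          then show "(\<lambda>k. norm (scaled_grad \<Omega> d (s k t - g t))) \<longlonglongrightarrow> 0"
            by (rule Lim_null_comparison[OF always_eventually[OF allI], rotated]) (simp add: M_norm)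
        qed
      qed
      have "(\<integral>\<^sup>+t\<in>{0..\<tau>}. ennreal ((norm (scaled_grad \<Omega> d (g t)))\<^sup>2) \<partial>lebesgue)
        \<le> (\<integral>\<^sup>+t. ennreal M * (ennreal ((E_norm \<Omega> (g t))\<^sup>2) * indicator {0..\<tau>} t) \<partial>lebesgue)"
      proof (rule nn_integral_mono)
        fix t
        show "ennreal ((norm (scaled_grad \<Omega> d (g t)))\<^sup>2) * indicator {0..\<tau>} t
          \<le> ennreal M * (ennreal ((E_norm \<Omega> (g t))\<^sup>2) * indicator {0..\<tau>} t)"
          using M(1) ennreal_leI[OF M(2)[of "g t"]] by (auto simp: indicator_def ennreal_mult)
      qed
      also have "\<dots> \<le> ennreal M * (\<integral>\<^sup>+t\<in>{0..\<tau>}. ennreal ((E_norm \<Omega> (g t))\<^sup>2) \<partial>lebesgue)"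
        using M(1) by (rule nn_integral_cmult_le)
      also have "\<dots> < \<infinity>"
        using b by (simp add: bochner_L2_E_def ennreal_mult_less_top)
      finally show "(\<integral>\<^sup>+t\<in>{0..\<tau>}. ennreal ((norm (scaled_grad \<Omega> d (g t)))\<^sup>2) \<partial>lebesgue) < \<infinity>" .
    qed
  qed
  have weak: "g t \<in> H_space \<Omega>" if "0 \<le> t" for t
    using w[of "t + 1"] that by (simp add: weak_solution_def weakly_continuous_H_def)
  have cont: "continuous_on {0..\<tau>} (\<lambda>t. g t \<bullet> \<phi>)" if "\<phi> \<in> H_space \<Omega>" for \<phi> \<tau>
  proof (cases "0 < \<tau>")
    case True
    then show ?thesis
      using w[OF True] that by (simp add: weak_solution_def weakly_continuous_H_def)
  next
    case False
    then have "{0..\<tau>} = {} \<or> {0..\<tau>} = {0}"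
      by auto
    then show ?thesis
      by (elim disjE) simp_all
  qed
  show ?thesis
    unfolding solution_def
  proof (intro conjI allI ballI impI)
    show "approx T (\<lambda>t. g (t + h))" for T
    proof (rule approx_shift)
      have "0 < max 1 (T + h)"
        by simp
      from approx_mono[OF approx_pos[OF this]] show "approx (T + h) g"
        by simp
    qed (use h in simp)
    show "weakly_continuous (\<lambda>t. g (t + h))"
      unfolding weakly_continuous_def
    proof (intro conjI allI ballI impI)
      show "g (t + h) \<in> H_space \<Omega>" if "0 \<le> t" for t
        using weak h that by simp
      fix \<phi> assume \<phi>: "\<phi> \<in> H_space \<Omega>"
      have "continuous (at t within {0..}) (\<lambda>t. g (t + h) \<bullet> \<phi>)" if "t \<in> {0..}" for t
      proof -
        have "continuous_on {-h<..<t + 1} (\<lambda>t. g (t + h) \<bullet> \<phi>)"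
          by (rule continuous_on_compose2[OF cont[OF \<phi>, of "t + 1 + h"]]) (auto intro!: continuous_intros)
        then have "isCont (\<lambda>t. g (t + h) \<bullet> \<phi>) t"
          using that h by (subst (asm) continuous_on_eq_continuous_at) auto
        then show ?thesis
          by (rule continuous_at_imp_continuous_at_within)
      qed
      then show "continuous_on {0..} (\<lambda>t. g (t + h) \<bullet> \<phi>)"
        unfolding continuous_on_eq_continuous_within by blast
    qed
    fix \<phi> s t assume \<phi>: "\<phi> \<in> E_space \<Omega>" and st: "0 \<le> s" "s \<le> (t::real)"
    show "((\<lambda>r. f (g (r + h)) \<bullet> \<phi> - scaled_grad \<Omega> d (g (r + h)) \<bullet> scaled_grad \<Omega> d \<phi>) has_integral
      (g (t + h) - g (s + h)) \<bullet> \<phi>) {s..t}"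
    proof (cases "s = t")
      case True
      then show ?thesis
        by (simp add: has_integral_refl)
    next
      case False
      let ?\<tau> = "t + h + 1"
      have "weak_derivative {0<..<?\<tau>} 1 (\<lambda>t. g t \<bullet> \<phi>) (\<lambda>t. diffusion \<Omega> d (g t) \<phi> + f (g t) \<bullet> \<phi>)"
        using w[of ?\<tau>] st h \<phi> by (simp add: weak_solution_def)
      moreover have "\<phi> \<in> H_space \<Omega>"
        using \<phi> E_subset by blast
      then have "continuous_on {0<..<?\<tau>} (\<lambda>t. g t \<bullet> \<phi>)"
        by (rule continuous_on_subset[OF cont[of _ ?\<tau>]]) auto
      ultimately have "((\<lambda>t. diffusion \<Omega> d (g t) \<phi> + f (g t) \<bullet> \<phi>) has_integral g (t + h) \<bullet> \<phi> - g (s + h) \<bullet> \<phi>) {s + h..t + h}"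
        by (rule weak_derivative_imp_integral) (use st h False in auto)
      then have "((\<lambda>r. f (g r) \<bullet> \<phi> - scaled_grad \<Omega> d (g r) \<bullet> scaled_grad \<Omega> d \<phi>) has_integral (g (t + h) - g (s + h)) \<bullet> \<phi>) {s + h..t + h}"
        by (simp add: diffusion_eq[OF d] inner_diff_left)
      from has_integral_shift_real_ivl[OF this, of h] show ?thesis
        by simp
    qed
  qed
qed

theorem theorem3:
  fixes \<Omega> :: "(real^'n) set"
    and d1 d2 d3 a1 a3 b1 b2 c2 c3 F G1 G2 :: real
    and S :: "real \<Rightarrow> 'n state \<Rightarrow> 'n state"
    and \<A> :: "'n state set"
  assumes "CARD('n) \<le> 3"
    and "lipschitz_domain \<Omega>" and "bounded \<Omega>"
    and "d1 > 0" "d2 > 0" "d3 > 0"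
    and "a1 > 0" "a3 > 0" "b1 > 0" "b2 > 0" "c2 > 0" "c3 > 0"
    and "F > 0" "G1 > 0" "G2 > 0"
    and "is_semiflow_of \<Omega> (vector [d1, d2, d3])
           (oregonator_reaction a1 a3 b1 b2 c2 c3 F G1 G2) S"
    and "global_attractor \<Omega> S \<A>"
  shows "HE_global_attractor \<Omega> S \<A>"
proof -
  define d :: "real^3" where "d = vector [d1, d2, d3]"
  define f where "f = (oregonator_reaction a1 a3 b1 b2 c2 c3 F G1 G2 :: 'n state \<Rightarrow> _)"
  have \<Omega>: "open \<Omega>"
    using assms(2) by (simp add: lipschitz_domain_def)
  have d: "0 < d $ i" for i
    using assms(4-6) exhaust_3[of i] by (auto simp: d_def vector_3)
  note n = assms(1)
  have par: "parabolic (H_space \<Omega>) (E_space \<Omega>) (scaled_grad \<Omega> d) f L4_norm"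
    unfolding f_def by (rule parabolic_oregonator[OF \<Omega> n d assms(7-15)])
  interpret parabolic "H_space \<Omega>" "E_space \<Omega>" "scaled_grad \<Omega> d" f L4_norm
    by (rule par)
  note A = assms(17)
  have A_sub: "\<A> \<subseteq> H_plus \<Omega>" and A_ne: "\<A> \<noteq> {}" and A_compact: "compact \<A>"
    and A_inv: "\<And>t. 0 \<le> t \<Longrightarrow> S t ` \<A> = \<A>"
    and A_attr: "\<And>B. B \<subseteq> H_plus \<Omega> \<Longrightarrow> bounded B \<Longrightarrow> ((\<lambda>t. semidist dist (S t ` B) \<A>) \<longlongrightarrow> 0) at_top"
    using A by (auto simp: global_attractor_def)
  have semiflow: "global_weak_solution \<Omega> d f x (\<lambda>t. S t x)" "\<And>t. 0 \<le> t \<Longrightarrow> S t x \<in> H_plus \<Omega>" if "x \<in> H_plus \<Omega>" for x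
    using assms(16) that by (auto simp: is_semiflow_of_def d_def f_def)
  have trajectory: "bounded_solution K (\<lambda>t. S (t + h) x)"
    if "x \<in> H_plus \<Omega>" "0 < h" "\<And>t. h \<le> t \<Longrightarrow> norm (S t x) \<le> K" for x h K
    unfolding bounded_solution_def
    using weak_solution_imp_solution[OF \<Omega> n d par semiflow(1)[OF that(1)] that(2)] that(3) by simp
  have A_bounded: "bounded \<A>"
    using A_compact by (rule compact_imp_bounded)
  obtain m where m: "0 < m" "\<And>g. m * (E_norm \<Omega> g)\<^sup>2 \<le> (norm (scaled_grad \<Omega> d g))\<^sup>2"
    using scaled_grad_E_norm[OF \<Omega> n d] by blast
  have E_less: "E_dist \<Omega> p q < \<epsilon>" if "norm (scaled_grad \<Omega> d (p - q)) < sqrt m * \<epsilon>" "0 < \<epsilon>" for p q \<epsilon>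
  proof -
    have "(norm (scaled_grad \<Omega> d (p - q)))\<^sup>2 < (sqrt m * \<epsilon>)\<^sup>2"
      using that by (intro power_strict_mono) auto
    then have "m * (E_norm \<Omega> (p - q))\<^sup>2 < m * \<epsilon>\<^sup>2"
      using m by (intro le_less_trans[OF m(2)]) (simp add: power_mult_distrib)
    then have "(E_norm \<Omega> (p - q))\<^sup>2 < \<epsilon>\<^sup>2"
      using m(1) by simp
    then show ?thesis
      unfolding E_dist_def using that(2) by (intro power2_less_imp_less[of _ \<epsilon>]) auto
  qed
  \<comment> \<open>Both trajectories in the comparison need one common H-bound, so the estimate is
    stated for a single bounded set, to be applied to the attractor and to its union with
    \<open>B\<close>.\<close>
  have key: "\<exists>\<tau>\<ge>0. (\<forall>t>\<tau>. S t ` B \<subseteq> E_plus \<Omega>) \<and>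
      (\<forall>\<epsilon>>0. \<exists>\<eta>>0. \<forall>t>\<tau>. \<forall>x\<in>B. \<forall>y\<in>B. norm (S t x - S t y) < \<eta> \<longrightarrow> E_dist \<Omega> (S t x) (S t y) < \<epsilon>)"
    if B: "B \<subseteq> H_plus \<Omega>" "bounded B" for B
  proof -
    obtain h K where hK: "0 < h" "\<And>t x. h \<le> t \<Longrightarrow> x \<in> B \<Longrightarrow> norm (S t x) \<le> K"
      using attractor_absorbs[OF A B] by blast
    \<comment> \<open>If \<open>B\<close> is empty nothing forces \<open>K\<close> to be
      nonnegative, as \<open>smoothing\<close> requires.\<close>
    define K' where "K' = max K 0"
    have traj: "bounded_solution K' (\<lambda>t. S (t + h) x)" if "x \<in> B" for x
    proof (rule trajectory)
      show "norm (S t x) \<le> K'" if "h \<le> t" for t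
        using hK(2)[OF that \<open>x \<in> B\<close>] by (simp add: K'_def)
    qed (use B(1) that hK(1) in auto)
    have "0 \<le> K'"
      by (simp add: K'_def)
    from smoothing[OF this] obtain \<sigma> where \<sigma>: "0 \<le> \<sigma>"
      "\<And>g t. bounded_solution K' g \<Longrightarrow> \<sigma> \<le> t \<Longrightarrow> g t \<in> E_space \<Omega>"
      "\<And>\<epsilon>. 0 < \<epsilon> \<Longrightarrow> \<exists>\<eta>>0. \<forall>g1 g2 t. bounded_solution K' g1 \<longrightarrow> bounded_solution K' g2 \<longrightarrow> \<sigma> \<le> t \<longrightarrow>
         norm (g1 t - g2 t) < \<eta> \<longrightarrow> norm (scaled_grad \<Omega> d (g1 t - g2 t)) < \<epsilon>"
      by - (elim exE conjE, rule that, assumption, blast+)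
    show ?thesis
    proof (rule exI[of _ "\<sigma> + h"], intro conjI allI impI)
      show "0 \<le> \<sigma> + h"
        using \<sigma>(1) hK(1) by simp
      show "S t ` B \<subseteq> E_plus \<Omega>" if t: "\<sigma> + h < t" for t
      proof (rule image_subsetI)
        fix x assume x: "x \<in> B"
        have "S t x \<in> E_space \<Omega>"
          using \<sigma>(2)[OF traj[OF x], of "t - h"] t by simp
        moreover have "S t x \<in> H_plus \<Omega>"
          using x B(1) t \<sigma>(1) hK(1) by (intro semiflow(2)) auto
        ultimately show "S t x \<in> E_plus \<Omega>"
          by (simp add: E_plus_def H_plus_def)
      qed
      fix \<epsilon> :: real assume "0 < \<epsilon>"
      then have "0 < sqrt m * \<epsilon>"
        using m(1) by simp
      from \<sigma>(3)[OF this] obtain \<eta> where \<eta>: "0 < \<eta>"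
        "\<And>g1 g2 t. bounded_solution K' g1 \<Longrightarrow> bounded_solution K' g2 \<Longrightarrow> \<sigma> \<le> t \<Longrightarrow>
         norm (g1 t - g2 t) < \<eta> \<Longrightarrow> norm (scaled_grad \<Omega> d (g1 t - g2 t)) < sqrt m * \<epsilon>"
        by - (elim exE conjE, rule that, assumption, blast+)
      show "\<exists>\<eta>>0. \<forall>t>\<sigma> + h. \<forall>x\<in>B. \<forall>y\<in>B. norm (S t x - S t y) < \<eta> \<longrightarrow> E_dist \<Omega> (S t x) (S t y) < \<epsilon>"
      proof (intro exI[of _ \<eta>] conjI allI ballI impI \<eta>(1))
        fix t x y assume t: "\<sigma> + h < t" and xy: "x \<in> B" "y \<in> B" "norm (S t x - S t y) < \<eta>"
        have "norm (scaled_grad \<Omega> d (S t x - S t y)) < sqrt m * \<epsilon>"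
          using \<eta>(2)[OF traj[OF xy(1)] traj[OF xy(2)], of "t - h"] t xy(3) by simp
        then show "E_dist \<Omega> (S t x) (S t y) < \<epsilon>"
          using \<open>0 < \<epsilon>\<close> by (rule E_less)
      qed
    qed
  qed
  obtain \<sigma> where \<sigma>: "0 \<le> \<sigma>" "\<And>t. \<sigma> < t \<Longrightarrow> S t ` \<A> \<subseteq> E_plus \<Omega>"
    "\<And>\<epsilon>. 0 < \<epsilon> \<Longrightarrow> \<exists>\<eta>>0. \<forall>t>\<sigma>. \<forall>x\<in>\<A>. \<forall>y\<in>\<A>. norm (S t x - S t y) < \<eta> \<longrightarrow> E_dist \<Omega> (S t x) (S t y) < \<epsilon>"
    using key[OF A_sub A_bounded] by - (elim exE conjE, rule that, assumption, blast+)
  \<comment> \<open>By invariance the attractor equals its image at a time beyond the smoothing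
    threshold.\<close>
  have A_E: "\<A> \<subseteq> E_plus \<Omega>"
    using \<sigma>(2)[of "\<sigma> + 1"] A_inv[of "\<sigma> + 1"] \<sigma>(1) by simp
  have "compactin (Metric_space.mtopology (E_plus \<Omega>) (E_dist \<Omega>)) \<A>"
  proof (rule compactin_E_plus[OF \<Omega> n A_compact A_E])
    fix \<epsilon> :: real assume "0 < \<epsilon>"
    from \<sigma>(3)[OF this] obtain \<eta> where \<eta>: "0 < \<eta>"
      "\<And>t x y. \<sigma> < t \<Longrightarrow> x \<in> \<A> \<Longrightarrow> y \<in> \<A> \<Longrightarrow> norm (S t x - S t y) < \<eta> \<Longrightarrow> E_dist \<Omega> (S t x) (S t y) < \<epsilon>"
      by - (elim exE conjE, rule that, assumption, blast+)
    show "\<exists>\<eta>>0. \<forall>p\<in>\<A>. \<forall>q\<in>\<A>. norm (p - q) < \<eta> \<longrightarrow> E_dist \<Omega> p q < \<epsilon>"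
    proof (intro exI[of _ \<eta>] conjI ballI impI \<eta>(1))
      fix p q assume "p \<in> \<A>" "q \<in> \<A>" and pq: "norm (p - q) < \<eta>"
      \<comment> \<open>Points of the attractor are values at time \<open>\<sigma> + 1\<close> of
        trajectories inside it, so the uniform estimate compares them directly.\<close>
      then have "p \<in> S (\<sigma> + 1) ` \<A>" "q \<in> S (\<sigma> + 1) ` \<A>"
        using A_inv[of "\<sigma> + 1"] \<sigma>(1) by simp_all
      then obtain x y where xy: "x \<in> \<A>" "p = S (\<sigma> + 1) x" "y \<in> \<A>" "q = S (\<sigma> + 1) y"
        by (elim imageE)
      show "E_dist \<Omega> p q < \<epsilon>"
        using \<eta>(2)[of "\<sigma> + 1", OF _ xy(1,3)] pq unfolding xy(2,4) by simp
    qed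
  qed
  moreover have "(\<exists>\<tau>\<ge>0. \<forall>t>\<tau>. S t ` B \<subseteq> E_plus \<Omega>) \<and>
    ((\<lambda>t. semidist (E_dist \<Omega>) (S t ` B) \<A>) \<longlongrightarrow> 0) at_top" if B: "B \<subseteq> H_plus \<Omega>" "bounded B" for B
  proof -
    \<comment> \<open>Enlarging \<open>B\<close> by the attractor gives one threshold and one
      modulus for a trajectory from \<open>B\<close> and the points it approaches.\<close>
    have BA: "B \<union> \<A> \<subseteq> H_plus \<Omega>" "bounded (B \<union> \<A>)"
      using B A_sub A_bounded by auto
    obtain \<tau> where \<tau>: "0 \<le> \<tau>" "\<And>t. \<tau> < t \<Longrightarrow> S t ` (B \<union> \<A>) \<subseteq> E_plus \<Omega>"
      "\<And>\<epsilon>. 0 < \<epsilon> \<Longrightarrow> \<exists>\<eta>>0. \<forall>t>\<tau>. \<forall>x\<in>B \<union> \<A>. \<forall>y\<in>B \<union> \<A>. norm (S t x - S t y) < \<eta> \<longrightarrow> E_dist \<Omega> (S t x) (S t y) < \<epsilon>"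
      using key[OF BA] by - (elim exE conjE, rule that, assumption, blast+)
    have "\<forall>t>\<tau>. S t ` B \<subseteq> E_plus \<Omega>"
      using \<tau>(2) by (simp add: image_Un)
    moreover have "((\<lambda>t. semidist (E_dist \<Omega>) (S t ` B) \<A>) \<longlongrightarrow> 0) at_top"
    proof (rule order_tendstoI)
      fix a :: ennreal assume "0 < a"
      \<comment> \<open>The intermediate value is finite even if \<open>a\<close> is infinite, and a
        non-strict bound by it is strict for \<open>a\<close>.\<close>
      then obtain z where z: "0 < z" "z < a"
        using dense by blast
      then obtain \<epsilon> where \<epsilon>: "z = ennreal \<epsilon>" "0 < \<epsilon>"
        by (cases z) auto
      from \<tau>(3)[OF \<epsilon>(2)] obtain \<eta> where \<eta>: "0 < \<eta>"
        "\<And>t x y. \<tau> < t \<Longrightarrow> x \<in> B \<union> \<A> \<Longrightarrow> y \<in> B \<union> \<A> \<Longrightarrow> norm (S t x - S t y) < \<eta> \<Longrightarrow> E_dist \<Omega> (S t x) (S t y) < \<epsilon>"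
        by - (elim exE conjE, rule that, assumption, blast+)
      have "\<forall>\<^sub>F t in at_top. semidist dist (S t ` B) \<A> < ennreal \<eta>"
        using A_attr[OF B] by (rule order_tendstoD(2)) (use \<eta>(1) in simp)
      then show "\<forall>\<^sub>F t in at_top. semidist (E_dist \<Omega>) (S t ` B) \<A> < a"
        using eventually_gt_at_top[of \<tau>]
      proof eventually_elim
        fix t assume close: "semidist dist (S t ` B) \<A> < ennreal \<eta>" and t: "\<tau> < t"
        have "semidist (E_dist \<Omega>) (S t ` B) \<A> \<le> ennreal \<epsilon>"
        proof (rule semidist_leI)
          fix p assume p: "p \<in> S t ` B"
          then obtain x where x: "x \<in> B" "p = S t x" ..
          obtain q where q: "q \<in> \<A>" "dist p q < \<eta>"
            by (rule semidist_lessD[OF close p]) auto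
          \<comment> \<open>Invariance rewrites the nearby point as a value at the same time
            \<open>t\<close>, so that both points have had the same time to smooth.\<close>
          then have "q \<in> S t ` \<A>"
            using A_inv[of t] t \<tau>(1) by simp
          then obtain y where y: "y \<in> \<A>" "q = S t y" ..
          have "E_dist \<Omega> p q < \<epsilon>"
            using \<eta>(2)[OF t, of x y] x(1) y(1) q(2) unfolding x(2) y(2) dist_norm by simp
          then show "\<exists>q\<in>\<A>. E_dist \<Omega> p q \<le> \<epsilon>"
            using q(1) by (intro bexI[of _ q]) simp_all
        qed
        then show "semidist (E_dist \<Omega>) (S t ` B) \<A> < a"
          using z(2) unfolding \<epsilon>(1) by (rule le_less_trans)
      qed
    qed simp
    ultimately show ?thesis
      using \<tau>(1) by auto
  qed
  ultimately show ?thesis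
    unfolding HE_global_attractor_def using A_E A_ne A_inv by simp
qed

end
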